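(* Let $k$ be a field of characteristic different from $2$ and $3$. For an $\mathrm{A}_1$-graded Lie algebra $L$ over $k$, the following two conditions are equivalent: (i) $H_2(L)=0$; (ii) $H^2(L,M)=0$ for every trivial $L$-module $M$. Moreover, the category of unital Jordan algebras over $k$ is equivalent to the category whose objects are the $\mathrm{A}_1$-graded Lie algebras over $k$ satisfying one of the equivalent conditions (i), (ii), and whose morphisms are the $\mathrm{A}_1$-graded morphisms.
   Context: All modules and algebras are over $k$. A (linear) Jordan algebra is a $k$-module $J$ with a bilinear product satisfying $ab=ba$ and $(a^2b)a=a^2(ba)$. In the category of unital Jordan algebras, both algebras and homomorphisms are unital. An $\mathfrak{sl}_2$-triple in a Lie algebra is an ordered triple $\mathfrak s=\langle h,e,f\rangle$ of elements with $[e,f]=h$, $[h,e]=2e$, $[h,f]=-2f$. An $\mathrm{A}_1$-graded Lie algebra is a pair $(L,\mathfrak s)$ consisting of a Lie algebra $L$ and an $\mathfrak{sl}_2$-triple $\mathfrak s=\langle h,e,f\rangle$ in $L$ such that $L=L_{-1}\oplus L_0\oplus L_1$, where $L_i=\{x\in L:[h,x]=2ix\}$, and $L_0=[L_{-1},L_1]$ (span of commutators). An $\mathrm{A}_1$-graded morphism $(L,\mathfrak s)\to(L',\mathfrak s')$ is a Lie algebra homomorphism sending $\mathfrak s$ to $\mathfrak s'$ elementwise. $H_*(L)=H_*(L,k)$ and $H^*(L,M)$ ($M$ a trivial $L$-module) are the usual (ungraded) Chevalley–Eilenberg homology with coefficients in the one-dimensional trivial module and cohomology with coefficients in $M$. 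*)

theory Defs
  imports "HOL-Algebra.Module" "HOL-Algebra.Multiplicative_Group"
begin

section \<open>Linear algebra over a commutative ring\<close>

text \<open>
  All structures are carrier-based, as in HOL-Algebra.  The record type \<open>module\<close> carries, besides
  the module operations, the fields \<open>mult\<close> and \<open>one\<close>.  They play no role for plain modules; for
  Jordan algebras \<open>mult\<close> is the product and \<open>one\<close> the unit, for Lie algebras \<open>mult\<close> is the bracket
  and \<open>one\<close> is ignored.
\<close>

text \<open>The additive order of the unit; \<^const>\<open>group.ord\<close> is 0 for elements of infinite order.\<close>

definition ring_char :: "('k, 'z) ring_scheme \<Rightarrow> nat" where
  "ring_char R = group.ord (add_monoid R) \<one>\<^bsub>R\<^esub>"

definition lin_span :: "('k, 'z) ring_scheme \<Rightarrow> ('k, 'a, 'y) module_scheme \<Rightarrow> 'a set \<Rightarrow> 'a set" where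
  "lin_span R M S = \<Inter>{N. submodule N R M \<and> S \<subseteq> N}"

definition zero_module :: "('k, 'a, 'y) module_scheme \<Rightarrow> bool" where
  "zero_module M \<longleftrightarrow> carrier M = {\<zero>\<^bsub>M\<^esub>}"

definition quot_module :: "('k, 'a) module \<Rightarrow> 'a set \<Rightarrow> ('k, 'a set) module" where
  "quot_module M N =
     \<lparr>carrier = a_rcosets\<^bsub>M\<^esub> N, mult = (\<lambda>_ _. N), one = N, zero = N, add = set_add M,
      smult = (\<lambda>a K. N <+>\<^bsub>M\<^esub> (\<lambda>x. a \<odot>\<^bsub>M\<^esub> x) ` K)\<rparr>"

text \<open>Maps are extensional (\<open>undefined\<close> off the carrier), so equality of morphisms is equality on the
  carrier.\<close>

definition module_homs ::
  "('k, 'z) ring_scheme \<Rightarrow> ('k, 'a, 'x) module_scheme \<Rightarrow> ('k, 'b, 'y) module_scheme \<Rightarrow> ('a \<Rightarrow> 'b) set"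
  where
  "module_homs R M N = {\<phi> \<in> carrier M \<rightarrow>\<^sub>E carrier N.
     (\<forall>x\<in>carrier M. \<forall>y\<in>carrier M. \<phi> (x \<oplus>\<^bsub>M\<^esub> y) = \<phi> x \<oplus>\<^bsub>N\<^esub> \<phi> y) \<and>
     (\<forall>a\<in>carrier R. \<forall>x\<in>carrier M. \<phi> (a \<odot>\<^bsub>M\<^esub> x) = a \<odot>\<^bsub>N\<^esub> \<phi> x)}"

definition free_module :: "('k, 'z) ring_scheme \<Rightarrow> 'x set \<Rightarrow> ('k, 'x \<Rightarrow> 'k) module" where
  "free_module R S =
     \<lparr>carrier = {c. (\<forall>x. c x \<in> carrier R) \<and> (\<forall>x. x \<notin> S \<longrightarrow> c x = \<zero>\<^bsub>R\<^esub>) \<and> finite {x. c x \<noteq> \<zero>\<^bsub>R\<^esub>}},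
      mult = (\<lambda>_ _ _. \<zero>\<^bsub>R\<^esub>), one = (\<lambda>_. \<zero>\<^bsub>R\<^esub>), zero = (\<lambda>_. \<zero>\<^bsub>R\<^esub>),
      add = (\<lambda>c d x. c x \<oplus>\<^bsub>R\<^esub> d x), smult = (\<lambda>a c x. a \<otimes>\<^bsub>R\<^esub> c x)\<rparr>"

definition free_gen :: "('k, 'z) ring_scheme \<Rightarrow> 'x \<Rightarrow> 'x \<Rightarrow> 'k" where
  "free_gen R x = (\<lambda>y. if y = x then \<one>\<^bsub>R\<^esub> else \<zero>\<^bsub>R\<^esub>)"


section \<open>Jordan algebras and Lie algebras\<close>

locale nonassoc_algebra = module R A for R (structure) and A (structure) +
  assumes mult_closed: "\<lbrakk>x \<in> carrier A; y \<in> carrier A\<rbrakk> \<Longrightarrow> x \<otimes>\<^bsub>A\<^esub> y \<in> carrier A"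
    and mult_add_left: "\<lbrakk>x \<in> carrier A; y \<in> carrier A; z \<in> carrier A\<rbrakk>
      \<Longrightarrow> (x \<oplus>\<^bsub>A\<^esub> y) \<otimes>\<^bsub>A\<^esub> z = x \<otimes>\<^bsub>A\<^esub> z \<oplus>\<^bsub>A\<^esub> y \<otimes>\<^bsub>A\<^esub> z"
    and mult_add_right: "\<lbrakk>x \<in> carrier A; y \<in> carrier A; z \<in> carrier A\<rbrakk>
      \<Longrightarrow> x \<otimes>\<^bsub>A\<^esub> (y \<oplus>\<^bsub>A\<^esub> z) = x \<otimes>\<^bsub>A\<^esub> y \<oplus>\<^bsub>A\<^esub> x \<otimes>\<^bsub>A\<^esub> z"
    and mult_smult_left: "\<lbrakk>a \<in> carrier R; x \<in> carrier A; y \<in> carrier A\<rbrakk>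
      \<Longrightarrow> (a \<odot>\<^bsub>A\<^esub> x) \<otimes>\<^bsub>A\<^esub> y = a \<odot>\<^bsub>A\<^esub> (x \<otimes>\<^bsub>A\<^esub> y)"
    and mult_smult_right: "\<lbrakk>a \<in> carrier R; x \<in> carrier A; y \<in> carrier A\<rbrakk>
      \<Longrightarrow> x \<otimes>\<^bsub>A\<^esub> (a \<odot>\<^bsub>A\<^esub> y) = a \<odot>\<^bsub>A\<^esub> (x \<otimes>\<^bsub>A\<^esub> y)"

locale unital_jordan_algebra = nonassoc_algebra R J for R (structure) and J (structure) +
  assumes mult_commute: "\<lbrakk>a \<in> carrier J; b \<in> carrier J\<rbrakk> \<Longrightarrow> a \<otimes>\<^bsub>J\<^esub> b = b \<otimes>\<^bsub>J\<^esub> a"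
    and jordan_identity: "\<lbrakk>a \<in> carrier J; b \<in> carrier J\<rbrakk>
      \<Longrightarrow> ((a \<otimes>\<^bsub>J\<^esub> a) \<otimes>\<^bsub>J\<^esub> b) \<otimes>\<^bsub>J\<^esub> a = (a \<otimes>\<^bsub>J\<^esub> a) \<otimes>\<^bsub>J\<^esub> (b \<otimes>\<^bsub>J\<^esub> a)"
    and unit_closed: "\<one>\<^bsub>J\<^esub> \<in> carrier J"
    and unit_left: "a \<in> carrier J \<Longrightarrow> \<one>\<^bsub>J\<^esub> \<otimes>\<^bsub>J\<^esub> a = a"

locale lie_algebra = nonassoc_algebra R L for R (structure) and L (structure) +
  assumes bracket_self: "x \<in> carrier L \<Longrightarrow> x \<otimes>\<^bsub>L\<^esub> x = \<zero>\<^bsub>L\<^esub>"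
    and jacobi: "\<lbrakk>x \<in> carrier L; y \<in> carrier L; z \<in> carrier L\<rbrakk>
      \<Longrightarrow> x \<otimes>\<^bsub>L\<^esub> (y \<otimes>\<^bsub>L\<^esub> z) \<oplus>\<^bsub>L\<^esub> y \<otimes>\<^bsub>L\<^esub> (z \<otimes>\<^bsub>L\<^esub> x) \<oplus>\<^bsub>L\<^esub> z \<otimes>\<^bsub>L\<^esub> (x \<otimes>\<^bsub>L\<^esub> y) = \<zero>\<^bsub>L\<^esub>"

definition algebra_homs ::
  "('k, 'z) ring_scheme \<Rightarrow> ('k, 'a, 'x) module_scheme \<Rightarrow> ('k, 'b, 'y) module_scheme \<Rightarrow> ('a \<Rightarrow> 'b) set"
  where
  "algebra_homs R A B = {\<phi> \<in> module_homs R A B.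
     \<forall>x\<in>carrier A. \<forall>y\<in>carrier A. \<phi> (x \<otimes>\<^bsub>A\<^esub> y) = \<phi> x \<otimes>\<^bsub>B\<^esub> \<phi> y}"


section \<open>A1-graded Lie algebras\<close>

definition sl2_triple :: "('k, 'a, 'y) module_scheme \<Rightarrow> 'a \<times> 'a \<times> 'a \<Rightarrow> bool" where
  "sl2_triple L = (\<lambda>(h, e, f).
     h \<in> carrier L \<and> e \<in> carrier L \<and> f \<in> carrier L \<and>
     e \<otimes>\<^bsub>L\<^esub> f = h \<and>
     h \<otimes>\<^bsub>L\<^esub> e = [(2::int)] \<cdot>\<^bsub>L\<^esub> e \<and>
     h \<otimes>\<^bsub>L\<^esub> f = [(-2::int)] \<cdot>\<^bsub>L\<^esub> f)"

definition weight_space :: "('k, 'a, 'y) module_scheme \<Rightarrow> 'a \<Rightarrow> int \<Rightarrow> 'a set" where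
  "weight_space L h i = {x \<in> carrier L. h \<otimes>\<^bsub>L\<^esub> x = [(2 * i)] \<cdot>\<^bsub>L\<^esub> x}"

definition A1_graded ::
  "('k, 'z) ring_scheme \<Rightarrow> ('k, 'a, 'y) module_scheme \<Rightarrow> 'a \<times> 'a \<times> 'a \<Rightarrow> bool" where
  "A1_graded R L = (\<lambda>(h, e, f).
     lie_algebra R L \<and> sl2_triple L (h, e, f) \<and>
     bij_betw (\<lambda>(x, y, z). x \<oplus>\<^bsub>L\<^esub> y \<oplus>\<^bsub>L\<^esub> z)
       (weight_space L h (-1) \<times> weight_space L h 0 \<times> weight_space L h 1) (carrier L) \<and>
     weight_space L h 0 =
       lin_span R L {x \<otimes>\<^bsub>L\<^esub> y | x y. x \<in> weight_space L h (-1) \<and> y \<in> weight_space L h 1})"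


section \<open>Chevalley--Eilenberg homology and cohomology with trivial coefficients\<close>

subsection \<open>Exterior powers\<close>

definition tuples :: "('k, 'a, 'y) module_scheme \<Rightarrow> nat \<Rightarrow> 'a list set" where
  "tuples M n = {xs. length xs = n \<and> set xs \<subseteq> carrier M}"

definition ext_relators ::
  "('k, 'z) ring_scheme \<Rightarrow> ('k, 'a, 'y) module_scheme \<Rightarrow> nat \<Rightarrow> ('a list \<Rightarrow> 'k) set" where
  "ext_relators R M n =
     (let F = free_module R (tuples M n); g = free_gen R in
       {g (xs[i := x \<oplus>\<^bsub>M\<^esub> y]) \<ominus>\<^bsub>F\<^esub> (g (xs[i := x]) \<oplus>\<^bsub>F\<^esub> g (xs[i := y])) | xs i x y.
          xs \<in> tuples M n \<and> i < n \<and> x \<in> carrier M \<and> y \<in> carrier M} \<union>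
       {g (xs[i := a \<odot>\<^bsub>M\<^esub> x]) \<ominus>\<^bsub>F\<^esub> (a \<odot>\<^bsub>F\<^esub> g (xs[i := x])) | xs i a x.
          xs \<in> tuples M n \<and> i < n \<and> a \<in> carrier R \<and> x \<in> carrier M} \<union>
       {g xs | xs. xs \<in> tuples M n \<and> \<not> distinct xs})"

definition ext_rel_module ::
  "('k, 'z) ring_scheme \<Rightarrow> ('k, 'a, 'y) module_scheme \<Rightarrow> nat \<Rightarrow> ('a list \<Rightarrow> 'k) set" where
  "ext_rel_module R M n = lin_span R (free_module R (tuples M n)) (ext_relators R M n)"

definition ext_power ::
  "('k, 'z) ring_scheme \<Rightarrow> ('k, 'a, 'y) module_scheme \<Rightarrow> nat \<Rightarrow> ('k, ('a list \<Rightarrow> 'k) set) module" where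
  "ext_power R M n = quot_module (free_module R (tuples M n)) (ext_rel_module R M n)"

definition wedge ::
  "('k, 'z) ring_scheme \<Rightarrow> ('k, 'a, 'y) module_scheme \<Rightarrow> 'a list \<Rightarrow> ('a list \<Rightarrow> 'k) set" where
  "wedge R M xs =
     ext_rel_module R M (length xs) +>\<^bsub>free_module R (tuples M (length xs))\<^esub> free_gen R xs"

subsection \<open>Homology\<close>

text \<open>
  \<open>merge_pair L xs i j\<close> is the tuple \<open>[x\<^sub>i, x\<^sub>j], x\<^sub>0, \<dots>\<close> with the entries \<open>x\<^sub>i\<close> and \<open>x\<^sub>j\<close> omitted from
  the tail.  The differential is
  \<open>d (x\<^sub>0 \<and> \<dots> \<and> x\<^bsub>n-1\<^esub>) = \<Sum>i<j. (-1)^(i+j) [x\<^sub>i, x\<^sub>j] \<and> x\<^sub>0 \<and> \<dots>\<close>, first defined on the free module on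
  \<open>n\<close>-tuples and then induced on the quotient.
\<close>

definition merge_pair :: "('k, 'a, 'y) module_scheme \<Rightarrow> 'a list \<Rightarrow> nat \<Rightarrow> nat \<Rightarrow> 'a list" where
  "merge_pair L xs i j = (xs ! i \<otimes>\<^bsub>L\<^esub> xs ! j) # nths xs (- {i, j})"

definition ce_boundary_gen ::
  "('k, 'z) ring_scheme \<Rightarrow> ('k, 'a, 'y) module_scheme \<Rightarrow> 'a list \<Rightarrow> ('a list \<Rightarrow> 'k) set" where
  "ce_boundary_gen R L xs =
     (let E = ext_power R L (length xs - 1) in
      (\<Oplus>\<^bsub>E\<^esub>p \<in> {(i, j). i < j \<and> j < length xs}.
         [((-1::int) ^ (fst p + snd p))] \<cdot>\<^bsub>E\<^esub> wedge R L (merge_pair L xs (fst p) (snd p))))"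

definition ce_boundary_free ::
  "('k, 'z) ring_scheme \<Rightarrow> ('k, 'a, 'y) module_scheme \<Rightarrow> nat \<Rightarrow> ('a list \<Rightarrow> 'k) \<Rightarrow> ('a list \<Rightarrow> 'k) set"
  where
  "ce_boundary_free R L n c =
     (let E = ext_power R L (n - 1) in
      (\<Oplus>\<^bsub>E\<^esub>xs \<in> {xs. c xs \<noteq> \<zero>\<^bsub>R\<^esub>}. c xs \<odot>\<^bsub>E\<^esub> ce_boundary_gen R L xs))"

text \<open>For \<open>n = 0\<close> the sum over pairs is empty, so this is the zero map, as it should be.\<close>

definition ce_boundary ::
  "('k, 'z) ring_scheme \<Rightarrow> ('k, 'a, 'y) module_scheme \<Rightarrow> nat \<Rightarrow>
    ('a list \<Rightarrow> 'k) set \<Rightarrow> ('a list \<Rightarrow> 'k) set" where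
  "ce_boundary R L n =
     (\<lambda>K\<in>carrier (ext_power R L n). the_elem (ce_boundary_free R L n ` K))"

definition ce_homology ::
  "('k, 'z) ring_scheme \<Rightarrow> ('k, 'a, 'y) module_scheme \<Rightarrow> nat \<Rightarrow>
    ('k, ('a list \<Rightarrow> 'k) set set) module" where
  "ce_homology R L n =
     quot_module
       ((ext_power R L n)
          \<lparr>carrier := a_kernel (ext_power R L n) (ext_power R L (n - 1)) (ce_boundary R L n)\<rparr>)
       (ce_boundary R L (Suc n) ` carrier (ext_power R L (Suc n)))"

subsection \<open>Cohomology\<close>

text \<open>
  A trivial \<open>L\<close>-module is just an \<open>R\<close>-module \<open>M\<close> (with \<open>L\<close> acting by zero).  Accordingly the terms
  of the Chevalley--Eilenberg differential involving the action on \<open>M\<close> are absent.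
\<close>

definition ce_cochains ::
  "('k, 'z) ring_scheme \<Rightarrow> ('k, 'a, 'x) module_scheme \<Rightarrow> ('k, 'm, 'y) module_scheme \<Rightarrow> nat \<Rightarrow>
    ('k, 'a list \<Rightarrow> 'm) module" where
  "ce_cochains R L M n =
     \<lparr>carrier = {\<omega> \<in> tuples L n \<rightarrow>\<^sub>E carrier M.
        (\<forall>xs\<in>tuples L n. \<forall>i<n. \<forall>x\<in>carrier L. \<forall>y\<in>carrier L.
           \<omega> (xs[i := x \<oplus>\<^bsub>L\<^esub> y]) = \<omega> (xs[i := x]) \<oplus>\<^bsub>M\<^esub> \<omega> (xs[i := y])) \<and>
        (\<forall>xs\<in>tuples L n. \<forall>i<n. \<forall>a\<in>carrier R. \<forall>x\<in>carrier L.
           \<omega> (xs[i := a \<odot>\<^bsub>L\<^esub> x]) = a \<odot>\<^bsub>M\<^esub> \<omega> (xs[i := x])) \<and>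
        (\<forall>xs\<in>tuples L n. \<not> distinct xs \<longrightarrow> \<omega> xs = \<zero>\<^bsub>M\<^esub>)},
      mult = (\<lambda>_ _. \<lambda>xs\<in>tuples L n. \<zero>\<^bsub>M\<^esub>),
      one = (\<lambda>xs\<in>tuples L n. \<zero>\<^bsub>M\<^esub>),
      zero = (\<lambda>xs\<in>tuples L n. \<zero>\<^bsub>M\<^esub>),
      add = (\<lambda>\<omega> \<eta>. \<lambda>xs\<in>tuples L n. \<omega> xs \<oplus>\<^bsub>M\<^esub> \<eta> xs),
      smult = (\<lambda>a \<omega>. \<lambda>xs\<in>tuples L n. a \<odot>\<^bsub>M\<^esub> \<omega> xs)\<rparr>"

definition ce_coboundary ::
  "('k, 'a, 'x) module_scheme \<Rightarrow> ('k, 'm, 'y) module_scheme \<Rightarrow> nat \<Rightarrow>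
    ('a list \<Rightarrow> 'm) \<Rightarrow> ('a list \<Rightarrow> 'm)" where
  "ce_coboundary L M n \<omega> =
     (\<lambda>xs\<in>tuples L (Suc n).
        \<Oplus>\<^bsub>M\<^esub>p \<in> {(i, j). i < j \<and> j < Suc n}.
          [((-1::int) ^ (fst p + snd p))] \<cdot>\<^bsub>M\<^esub> \<omega> (merge_pair L xs (fst p) (snd p)))"

definition ce_coboundaries ::
  "('k, 'z) ring_scheme \<Rightarrow> ('k, 'a, 'x) module_scheme \<Rightarrow> ('k, 'm, 'y) module_scheme \<Rightarrow> nat \<Rightarrow>
    ('a list \<Rightarrow> 'm) set" where
  "ce_coboundaries R L M n =
     (case n of 0 \<Rightarrow> {\<zero>\<^bsub>ce_cochains R L M 0\<^esub>}
      | Suc m \<Rightarrow> ce_coboundary L M m ` carrier (ce_cochains R L M m))"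

definition ce_cohomology ::
  "('k, 'z) ring_scheme \<Rightarrow> ('k, 'a, 'x) module_scheme \<Rightarrow> ('k, 'm, 'y) module_scheme \<Rightarrow> nat \<Rightarrow>
    ('k, ('a list \<Rightarrow> 'm) set) module" where
  "ce_cohomology R L M n =
     quot_module
       ((ce_cochains R L M n)
          \<lparr>carrier := a_kernel (ce_cochains R L M n) (ce_cochains R L M (Suc n)) (ce_coboundary L M n)\<rparr>)
       (ce_coboundaries R L M n)"


section \<open>Categories and equivalences\<close>

text \<open>\<open>Comp C a b c g f\<close> is the composite of \<open>f : a \<rightarrow> b\<close> and \<open>g : b \<rightarrow> c\<close>.  The hom-sets need not be
  disjoint.\<close>

record ('o, 'm) cat =
  Ob :: "'o set"
  Hom :: "'o \<Rightarrow> 'o \<Rightarrow> 'm set"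
  Ident :: "'o \<Rightarrow> 'm"
  Comp :: "'o \<Rightarrow> 'o \<Rightarrow> 'o \<Rightarrow> 'm \<Rightarrow> 'm \<Rightarrow> 'm"

definition is_category :: "('o, 'm) cat \<Rightarrow> bool" where
  "is_category C \<longleftrightarrow>
     (\<forall>a\<in>Ob C. Ident C a \<in> Hom C a a) \<and>
     (\<forall>a\<in>Ob C. \<forall>b\<in>Ob C. \<forall>c\<in>Ob C. \<forall>f\<in>Hom C a b. \<forall>g\<in>Hom C b c. Comp C a b c g f \<in> Hom C a c) \<and>
     (\<forall>a\<in>Ob C. \<forall>b\<in>Ob C. \<forall>f\<in>Hom C a b.
        Comp C a a b f (Ident C a) = f \<and> Comp C a b b (Ident C b) f = f) \<and>
     (\<forall>a\<in>Ob C. \<forall>b\<in>Ob C. \<forall>c\<in>Ob C. \<forall>d\<in>Ob C. \<forall>f\<in>Hom C a b. \<forall>g\<in>Hom C b c. \<forall>h\<in>Hom C c d.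
        Comp C a b d (Comp C b c d h g) f = Comp C a c d h (Comp C a b c g f))"

text \<open>A functor is given by its action on objects and its action on each hom-set.\<close>

definition is_functor ::
  "('o, 'm) cat \<Rightarrow> ('p, 'n) cat \<Rightarrow> ('o \<Rightarrow> 'p) \<Rightarrow> ('o \<Rightarrow> 'o \<Rightarrow> 'm \<Rightarrow> 'n) \<Rightarrow> bool" where
  "is_functor C D F F' \<longleftrightarrow>
     (\<forall>a\<in>Ob C. F a \<in> Ob D) \<and>
     (\<forall>a\<in>Ob C. \<forall>b\<in>Ob C. \<forall>f\<in>Hom C a b. F' a b f \<in> Hom D (F a) (F b)) \<and>
     (\<forall>a\<in>Ob C. F' a a (Ident C a) = Ident D (F a)) \<and>
     (\<forall>a\<in>Ob C. \<forall>b\<in>Ob C. \<forall>c\<in>Ob C. \<forall>f\<in>Hom C a b. \<forall>g\<in>Hom C b c.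
        F' a c (Comp C a b c g f) = Comp D (F a) (F b) (F c) (F' b c g) (F' a b f))"

definition is_iso :: "('o, 'm) cat \<Rightarrow> 'o \<Rightarrow> 'o \<Rightarrow> 'm \<Rightarrow> bool" where
  "is_iso C a b f \<longleftrightarrow> f \<in> Hom C a b \<and>
     (\<exists>g\<in>Hom C b a. Comp C a b a g f = Ident C a \<and> Comp C b a b f g = Ident C b)"

definition nat_isomorphic ::
  "('o, 'm) cat \<Rightarrow> ('p, 'n) cat \<Rightarrow> ('o \<Rightarrow> 'p) \<Rightarrow> ('o \<Rightarrow> 'o \<Rightarrow> 'm \<Rightarrow> 'n) \<Rightarrow>
    ('o \<Rightarrow> 'p) \<Rightarrow> ('o \<Rightarrow> 'o \<Rightarrow> 'm \<Rightarrow> 'n) \<Rightarrow> bool" where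
  "nat_isomorphic C D F F' G G' \<longleftrightarrow>
     (\<exists>\<eta>. (\<forall>a\<in>Ob C. is_iso D (F a) (G a) (\<eta> a)) \<and>
          (\<forall>a\<in>Ob C. \<forall>b\<in>Ob C. \<forall>f\<in>Hom C a b.
             Comp D (F a) (F b) (G b) (\<eta> b) (F' a b f) = Comp D (F a) (G a) (G b) (G' a b f) (\<eta> a)))"

definition equivalent_categories :: "('o, 'm) cat \<Rightarrow> ('p, 'n) cat \<Rightarrow> bool" where
  "equivalent_categories C D \<longleftrightarrow> is_category C \<and> is_category D \<and>
     (\<exists>F F' G G'. is_functor C D F F' \<and> is_functor D C G G' \<and>
        nat_isomorphic C C (\<lambda>a. G (F a)) (\<lambda>a b f. G' (F a) (F b) (F' a b f)) (\<lambda>a. a) (\<lambda>a b f. f) \<and>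
        nat_isomorphic D D (\<lambda>x. F (G x)) (\<lambda>x y g. F' (G x) (G y) (G' x y g)) (\<lambda>x. x) (\<lambda>x y g. g))"

text \<open>
  The objects of the following categories are the algebras whose carrier is a subset of a type \<open>'u\<close>,
  which plays the role of a universe.  Any infinite \<open>'u\<close> will do: an algebra presented by finitary
  expressions in the elements of a set \<open>J \<subseteq> UNIV :: 'u set\<close> has at most as many elements as \<open>'u\<close> has.
  The unused record fields (\<open>one\<close> of a Lie algebra, values off the carrier) only produce isomorphic copies.
\<close>

definition jordan_category :: "('k, 'z) ring_scheme \<Rightarrow> (('k, 'u) module, 'u \<Rightarrow> 'u) cat" where
  "jordan_category R =
     \<lparr>Ob = {J. unital_jordan_algebra R J},
      Hom = (\<lambda>J J'. {\<phi> \<in> algebra_homs R J J'. \<phi> \<one>\<^bsub>J\<^esub> = \<one>\<^bsub>J'\<^esub>}),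
      Ident = (\<lambda>J. \<lambda>x\<in>carrier J. x),
      Comp = (\<lambda>J _ _ \<psi> \<phi>. compose (carrier J) \<psi> \<phi>)\<rparr>"

definition A1_category ::
  "('k, 'z) ring_scheme \<Rightarrow> (('k, 'u) module \<Rightarrow> bool) \<Rightarrow>
    (('k, 'u) module \<times> ('u \<times> 'u \<times> 'u), 'u \<Rightarrow> 'u) cat" where
  "A1_category R P =
     \<lparr>Ob = {(L, s). A1_graded R L s \<and> P L},
      Hom = (\<lambda>(L, h, e, f) (L', h', e', f').
        {\<phi> \<in> algebra_homs R L L'. \<phi> h = h' \<and> \<phi> e = e' \<and> \<phi> f = f'}),
      Ident = (\<lambda>(L, s). \<lambda>x\<in>carrier L. x),
      Comp = (\<lambda>(L, s) _ _ \<psi> \<phi>. compose (carrier L) \<psi> \<phi>)\<rparr>"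

end

theory Submission
  imports Defs
begin

text \<open>
  Write \<open>{a b c} = (ab)c + a(bc) - b(ac)\<close> for the triple product of a unital Jordan algebra \<open>J\<close>.  The
  bridge between the two categories is a Lie algebra with two linear images \<open>p J\<close> and \<open>q J\<close> of \<open>J\<close>, in
  each of which all brackets vanish, such that \<open>[[p a, q b], p c] = 2 p {a b c}\<close> and
  \<open>[[p a, q b], q c] = - 2 q {b a c}\<close> (locale \<open>jordan_datum\<close>).  These relations alone turn
  \<open>q J + [q J, p J] + p J\<close> into an A1-graded Lie algebra with the triple \<open>([p 1, q 1], p 1, q 1)\<close> and with
  \<open>p J\<close> as its part of weight one (\<open>core_A1_graded\<close>).  Conversely, every A1-graded Lie algebra \<open>L\<close> is
  obtained in this way from \<open>J = L_1\<close>, a Jordan algebra under \<open>ab = 1/2 [[a, f], b]\<close>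
  (\<open>jordan_of_jordan\<close>, \<open>jordan_of_datum\<close>, \<open>jordan_of_core\<close>); this uses that \<open>2\<close> and \<open>3\<close> are invertible.

  Among the Lie algebras that belong to a given \<open>J\<close> in this sense there is a universal one, \<open>U(J)\<close>
  (\<open>universal_datum_exists\<close>).  Its map \<open>p\<close> is injective because \<open>p\<close> is injective in one example, the
  Tits--Kantor--Koecher algebra (\<open>tkk_datum\<close>, \<open>universal_datum_inj\<close>), so that \<open>U(J)_1\<close> is \<open>J\<close> again.  In
  a central extension of \<open>U(J)\<close> the generators have canonical lifts, the eigenvectors of a lift of
  \<open>[p 1, q 1]\<close>; these satisfy the defining relations, so the extension splits, which means
  \<open>H_2(U(J)) = 0\<close> (\<open>universal_datum_homology\<close>).

  Therefore the functor that takes \<open>L\<close> to \<open>L_1\<close> is essentially surjective on the A1-graded Lie algebras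
  with \<open>H_2(L) = 0\<close>.  It is faithful because \<open>L_1\<close> and \<open>f\<close> generate \<open>L\<close> (\<open>hom_unique\<close>).  It is full: the
  universal property gives a surjection from \<open>U(L_1)\<close> to \<open>L\<close>, its kernel is central, and a perfect
  central extension of \<open>L\<close> is an isomorphism when \<open>H_2(L) = 0\<close> (\<open>core_map_injective\<close>).
  So \<open>L\<close> is \<open>U(L_1)\<close>, and a homomorphism from \<open>L_1\<close> to \<open>L'_1\<close> induces one from \<open>L\<close> to \<open>L'\<close>
  (\<open>A1_hom_extends\<close>).

  Finally, an A1-graded Lie algebra is perfect, and for a perfect \<open>L\<close> the space \<open>H^2(L, M)\<close> consists of
  the linear maps from \<open>H_2(L)\<close> to \<open>M\<close>.  It vanishes if \<open>H_2(L)\<close> does, and a linear functional that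
  does not vanish on a given homology class shows the converse
  (\<open>homology2_zero_iff_cohomology2_zero\<close>).
\<close>

section \<open>Abelian groups, fields and linear maps\<close>

context abelian_group begin

text \<open>
  Rewriting with these rules moves every subtraction outwards and then to the other side of an
  equation, so that an identity of a free abelian group becomes an equality of sums, up to order.
\<close>

lemma minus_outwards:
  shows "\<lbrakk>x \<in> carrier G; y \<in> carrier G; z \<in> carrier G\<rbrakk> \<Longrightarrow> (x \<ominus> y) \<oplus> z = (x \<oplus> z) \<ominus> y"
    and "\<lbrakk>x \<in> carrier G; y \<in> carrier G; z \<in> carrier G\<rbrakk> \<Longrightarrow> z \<oplus> (x \<ominus> y) = (z \<oplus> x) \<ominus> y"
    and "\<lbrakk>x \<in> carrier G; y \<in> carrier G; z \<in> carrier G\<rbrakk> \<Longrightarrow> (x \<ominus> y) \<ominus> z = x \<ominus> (y \<oplus> z)"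
    and "\<lbrakk>x \<in> carrier G; y \<in> carrier G; z \<in> carrier G\<rbrakk> \<Longrightarrow> x \<ominus> (y \<ominus> z) = (x \<oplus> z) \<ominus> y"
    and "\<lbrakk>x \<in> carrier G; y \<in> carrier G\<rbrakk> \<Longrightarrow> (\<ominus> x) \<oplus> y = y \<ominus> x"
    and "\<lbrakk>x \<in> carrier G; y \<in> carrier G\<rbrakk> \<Longrightarrow> y \<oplus> (\<ominus> x) = y \<ominus> x"
    and "\<lbrakk>x \<in> carrier G; y \<in> carrier G\<rbrakk> \<Longrightarrow> y \<ominus> (\<ominus> x) = y \<oplus> x"
    and "\<lbrakk>x \<in> carrier G; y \<in> carrier G\<rbrakk> \<Longrightarrow> (\<ominus> x) \<ominus> y = \<ominus> (x \<oplus> y)"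
    and "\<lbrakk>x \<in> carrier G; y \<in> carrier G\<rbrakk> \<Longrightarrow> \<ominus> (x \<ominus> y) = y \<ominus> x"
  by (simp_all add: a_minus_def minus_add a_ac)

lemma minus_across:
  shows "\<lbrakk>x \<in> carrier G; y \<in> carrier G; z \<in> carrier G\<rbrakk> \<Longrightarrow> x \<ominus> y = z \<longleftrightarrow> x = z \<oplus> y"
    and "\<lbrakk>x \<in> carrier G; y \<in> carrier G; z \<in> carrier G\<rbrakk> \<Longrightarrow> z = x \<ominus> y \<longleftrightarrow> z \<oplus> y = x"
    and "\<lbrakk>x \<in> carrier G; z \<in> carrier G\<rbrakk> \<Longrightarrow> \<ominus> x = z \<longleftrightarrow> z \<oplus> x = \<zero>"
    and "\<lbrakk>x \<in> carrier G; z \<in> carrier G\<rbrakk> \<Longrightarrow> z = \<ominus> x \<longleftrightarrow> z \<oplus> x = \<zero>"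
proof -
  show 1: "x \<ominus> y = z \<longleftrightarrow> x = z \<oplus> y"
    if "x \<in> carrier G" "y \<in> carrier G" "z \<in> carrier G" for x y z
    using that by (auto simp: a_minus_def a_assoc l_neg r_neg)
  show "z = x \<ominus> y \<longleftrightarrow> z \<oplus> y = x"
    if "x \<in> carrier G" "y \<in> carrier G" "z \<in> carrier G" for x y z
    using 1[OF that] by auto
  show 2: "\<ominus> x = z \<longleftrightarrow> z \<oplus> x = \<zero>" if "x \<in> carrier G" "z \<in> carrier G" for x z
    using that by (metis l_neg minus_equality)
  show "z = \<ominus> x \<longleftrightarrow> z \<oplus> x = \<zero>" if "x \<in> carrier G" "z \<in> carrier G" for x z
    using 2[OF that] by auto
qed

lemmas ab_simps = minus_outwards minus_across a_ac

lemma diff_eq_zero_iff: "\<lbrakk>x \<in> carrier G; y \<in> carrier G\<rbrakk> \<Longrightarrow> x \<ominus> y = \<zero> \<longleftrightarrow> x = y"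
  by (simp add: minus_across)

lemma diff_self: "x \<in> carrier G \<Longrightarrow> x \<ominus> x = \<zero>"
  by (simp add: minus_across)

lemma diff_zero: "x \<in> carrier G \<Longrightarrow> x \<ominus> \<zero> = x" "x \<in> carrier G \<Longrightarrow> \<zero> \<ominus> x = \<ominus> x"
  by (simp_all add: a_minus_def)

lemma int_mult_simps:
  assumes "x \<in> carrier G"
  shows "[(2::int)] \<cdot> x = x \<oplus> x" "[(-2::int)] \<cdot> x = \<ominus> (x \<oplus> x)"
    "[(1::int)] \<cdot> x = x" "[(-1::int)] \<cdot> x = \<ominus> x" "[(0::int)] \<cdot> x = \<zero>"
proof -
  show 1: "[(1::int)] \<cdot> x = x" and "[(0::int)] \<cdot> x = \<zero>"
    using assms by (auto simp: add_pow_def int_pow_def2)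
  have "[(1 + 1::int)] \<cdot> x = [(1::int)] \<cdot> x \<oplus> [(1::int)] \<cdot> x"
    using assms by (rule add.int_pow_mult)
  then show 2: "[(2::int)] \<cdot> x = x \<oplus> x" using 1 by simp
  show "[(-2::int)] \<cdot> x = \<ominus> (x \<oplus> x)" "[(-1::int)] \<cdot> x = \<ominus> x"
    using add.int_pow_neg[OF assms, of 2] add.int_pow_neg[OF assms, of 1] 1 2 by simp_all
qed

end

locale field_char_not_2_3 = field R for R (structure) +
  assumes two_nonzero: "\<one> \<oplus> \<one> \<noteq> \<zero>" and three_nonzero: "\<one> \<oplus> \<one> \<oplus> \<one> \<noteq> \<zero>"

lemma field_char_not_2_3I:
  fixes R (structure)
  assumes "field R" "ring_char R \<noteq> 2" "ring_char R \<noteq> 3"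
  shows "field_char_not_2_3 R"
proof -
  interpret field R by fact
  have ord1: "group.ord (add_monoid R) \<one> \<noteq> 1"
    using add.ord_eq_1[of \<one>] by simp
  have *: "group.ord (add_monoid R) \<one> dvd n" if "[n] \<cdot> \<one> = \<zero>" for n
    using add.pow_eq_id[of \<one> n] that by simp
  have two: "[(2::nat)] \<cdot> \<one> = \<one> \<oplus> \<one>" and three: "[(3::nat)] \<cdot> \<one> = \<one> \<oplus> \<one> \<oplus> \<one>"
    by (simp_all add: numeral_2_eq_2 numeral_3_eq_3)
  have "\<one> \<oplus> \<one> \<noteq> \<zero>"
  proof
    assume "\<one> \<oplus> \<one> = \<zero>"
    with * two have "group.ord (add_monoid R) \<one> dvd 2" by metis
    moreover have "d \<in> {1, 2}" if "d dvd 2" for d :: nat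
      using that dvd_imp_le[OF that] by (auto simp: le_Suc_eq numeral_2_eq_2)
    ultimately have "group.ord (add_monoid R) \<one> \<in> {1, 2}" by blast
    then show False using ord1 assms(2) by (simp add: ring_char_def)
  qed
  moreover have "\<one> \<oplus> \<one> \<oplus> \<one> \<noteq> \<zero>"
  proof
    assume "\<one> \<oplus> \<one> \<oplus> \<one> = \<zero>"
    with * three have "group.ord (add_monoid R) \<one> dvd 3" by metis
    moreover have "d \<in> {1, 3}" if "d dvd 3" for d :: nat
    proof -
      have "d \<le> 3" "d \<noteq> 0" "d \<noteq> 2" using that dvd_imp_le[OF that] by (auto intro: gr0I)
      then show ?thesis by auto
    qed
    ultimately have "group.ord (add_monoid R) \<one> \<in> {1, 3}" by blast
    then show False using ord1 assms(3) by (simp add: ring_char_def)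
  qed
  ultimately show ?thesis
    by (intro field_char_not_2_3.intro field_char_not_2_3_axioms.intro assms(1))
qed

definition half :: "('k, 'z) ring_scheme \<Rightarrow> 'k" where
  "half R = inv\<^bsub>R\<^esub> (\<one>\<^bsub>R\<^esub> \<oplus>\<^bsub>R\<^esub> \<one>\<^bsub>R\<^esub>)"

context field_char_not_2_3 begin

lemma two_unit: "\<one> \<oplus> \<one> \<in> Units R" and three_unit: "\<one> \<oplus> \<one> \<oplus> \<one> \<in> Units R"
  using two_nonzero three_nonzero by (simp_all add: field_Units)

lemma half_closed [simp]: "half R \<in> carrier R"
  using two_unit by (simp add: half_def)

end

locale vector_space_char_not_2_3 = field_char_not_2_3 R + module R M for R (structure) and M (structure)
begin

lemma smult_two: "x \<in> carrier M \<Longrightarrow> (\<one> \<oplus> \<one>) \<odot>\<^bsub>M\<^esub> x = x \<oplus>\<^bsub>M\<^esub> x"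
  and smult_three: "x \<in> carrier M \<Longrightarrow> (\<one> \<oplus> \<one> \<oplus> \<one>) \<odot>\<^bsub>M\<^esub> x = x \<oplus>\<^bsub>M\<^esub> x \<oplus>\<^bsub>M\<^esub> x"
  by (simp_all add: smult_l_distr)

lemma half_add_half: "x \<in> carrier M \<Longrightarrow> half R \<odot>\<^bsub>M\<^esub> x \<oplus>\<^bsub>M\<^esub> half R \<odot>\<^bsub>M\<^esub> x = x"
  using smult_assoc1[of "\<one> \<oplus> \<one>" "half R" x] two_unit by (simp add: smult_two half_def)

lemma smult_half_double: "x \<in> carrier M \<Longrightarrow> half R \<odot>\<^bsub>M\<^esub> (x \<oplus>\<^bsub>M\<^esub> x) = x"
  by (simp add: smult_r_distr half_add_half)

lemma double_cancel: "\<lbrakk>x \<oplus>\<^bsub>M\<^esub> x = y \<oplus>\<^bsub>M\<^esub> y; x \<in> carrier M; y \<in> carrier M\<rbrakk> \<Longrightarrow> x = y"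
  by (metis smult_half_double)

lemma double_eq_zero: "\<lbrakk>x \<oplus>\<^bsub>M\<^esub> x = \<zero>\<^bsub>M\<^esub>; x \<in> carrier M\<rbrakk> \<Longrightarrow> x = \<zero>\<^bsub>M\<^esub>"
  by (rule double_cancel) simp_all

lemma double_eq_zero_iff: "x \<in> carrier M \<Longrightarrow> x \<oplus>\<^bsub>M\<^esub> x = \<zero>\<^bsub>M\<^esub> \<longleftrightarrow> x = \<zero>\<^bsub>M\<^esub>"
  by (auto dest: double_eq_zero)

lemma triple_eq_zero:
  assumes "x \<oplus>\<^bsub>M\<^esub> x \<oplus>\<^bsub>M\<^esub> x = \<zero>\<^bsub>M\<^esub>" "x \<in> carrier M" shows "x = \<zero>\<^bsub>M\<^esub>"
proof -
  have "x = (inv (\<one> \<oplus> \<one> \<oplus> \<one>) \<otimes> (\<one> \<oplus> \<one> \<oplus> \<one>)) \<odot>\<^bsub>M\<^esub> x"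
    using three_unit assms(2) by simp
  also have "\<dots> = inv (\<one> \<oplus> \<one> \<oplus> \<one>) \<odot>\<^bsub>M\<^esub> (x \<oplus>\<^bsub>M\<^esub> x \<oplus>\<^bsub>M\<^esub> x)"
    using three_unit assms(2) by (subst smult_assoc1) (simp_all add: smult_three)
  finally show ?thesis using three_unit assms(1) by simp
qed

end

text \<open>
  Unlike the members of \<open>module_homs\<close>, these maps are not required to be extensional, so that plain
  composites and inclusions are maps again.
\<close>

definition linear_map ::
  "('k, 'z) ring_scheme \<Rightarrow> ('k, 'a, 'x) module_scheme \<Rightarrow> ('k, 'b, 'y) module_scheme \<Rightarrow> ('a \<Rightarrow> 'b) \<Rightarrow> bool"
  where
  "linear_map R M N \<phi> \<longleftrightarrow> \<phi> \<in> carrier M \<rightarrow> carrier N \<and>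
     (\<forall>x\<in>carrier M. \<forall>y\<in>carrier M. \<phi> (x \<oplus>\<^bsub>M\<^esub> y) = \<phi> x \<oplus>\<^bsub>N\<^esub> \<phi> y) \<and>
     (\<forall>a\<in>carrier R. \<forall>x\<in>carrier M. \<phi> (a \<odot>\<^bsub>M\<^esub> x) = a \<odot>\<^bsub>N\<^esub> \<phi> x)"

definition algebra_map ::
  "('k, 'z) ring_scheme \<Rightarrow> ('k, 'a, 'x) module_scheme \<Rightarrow> ('k, 'b, 'y) module_scheme \<Rightarrow> ('a \<Rightarrow> 'b) \<Rightarrow> bool"
  where
  "algebra_map R A B \<phi> \<longleftrightarrow> linear_map R A B \<phi> \<and>
     (\<forall>x\<in>carrier A. \<forall>y\<in>carrier A. \<phi> (x \<otimes>\<^bsub>A\<^esub> y) = \<phi> x \<otimes>\<^bsub>B\<^esub> \<phi> y)"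

lemma linear_mapI:
  assumes "\<And>x. x \<in> carrier M \<Longrightarrow> \<phi> x \<in> carrier N"
    and "\<And>x y. \<lbrakk>x \<in> carrier M; y \<in> carrier M\<rbrakk> \<Longrightarrow> \<phi> (x \<oplus>\<^bsub>M\<^esub> y) = \<phi> x \<oplus>\<^bsub>N\<^esub> \<phi> y"
    and "\<And>a x. \<lbrakk>a \<in> carrier R; x \<in> carrier M\<rbrakk> \<Longrightarrow> \<phi> (a \<odot>\<^bsub>M\<^esub> x) = a \<odot>\<^bsub>N\<^esub> \<phi> x"
  shows "linear_map R M N \<phi>"
  using assms by (auto simp: linear_map_def)

lemma linear_map_simps:
  assumes "linear_map R M N \<phi>"
  shows "x \<in> carrier M \<Longrightarrow> \<phi> x \<in> carrier N"
    and "\<lbrakk>x \<in> carrier M; y \<in> carrier M\<rbrakk> \<Longrightarrow> \<phi> (x \<oplus>\<^bsub>M\<^esub> y) = \<phi> x \<oplus>\<^bsub>N\<^esub> \<phi> y"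
    and "\<lbrakk>a \<in> carrier R; x \<in> carrier M\<rbrakk> \<Longrightarrow> \<phi> (a \<odot>\<^bsub>M\<^esub> x) = a \<odot>\<^bsub>N\<^esub> \<phi> x"
  using assms by (auto simp: linear_map_def)

lemma algebra_mapD: "algebra_map R A B \<phi> \<Longrightarrow> linear_map R A B \<phi>"
  "\<lbrakk>algebra_map R A B \<phi>; x \<in> carrier A; y \<in> carrier A\<rbrakk> \<Longrightarrow> \<phi> (x \<otimes>\<^bsub>A\<^esub> y) = \<phi> x \<otimes>\<^bsub>B\<^esub> \<phi> y"
  by (auto simp: algebra_map_def)

lemma algebra_homs_iff:
  "\<phi> \<in> algebra_homs R A B \<longleftrightarrow> algebra_map R A B \<phi> \<and> \<phi> \<in> extensional (carrier A)"
  by (auto simp: algebra_homs_def module_homs_def algebra_map_def linear_map_def PiE_def)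

lemma linear_map_minus:
  assumes "module R M" "module R N" "linear_map R M N \<phi>"
  shows "\<phi> \<zero>\<^bsub>M\<^esub> = \<zero>\<^bsub>N\<^esub>"
    and "x \<in> carrier M \<Longrightarrow> \<phi> (\<ominus>\<^bsub>M\<^esub> x) = \<ominus>\<^bsub>N\<^esub> \<phi> x"
    and "\<lbrakk>x \<in> carrier M; y \<in> carrier M\<rbrakk> \<Longrightarrow> \<phi> (x \<ominus>\<^bsub>M\<^esub> y) = \<phi> x \<ominus>\<^bsub>N\<^esub> \<phi> y"
proof -
  interpret M: module R M by fact
  interpret N: module R N by fact
  note lin = linear_map_simps[OF assms(3)]
  have "\<phi> (\<zero>\<^bsub>R\<^esub> \<odot>\<^bsub>M\<^esub> \<zero>\<^bsub>M\<^esub>) = \<zero>\<^bsub>R\<^esub> \<odot>\<^bsub>N\<^esub> \<phi> \<zero>\<^bsub>M\<^esub>"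
    by (rule lin) simp_all
  then show 0: "\<phi> \<zero>\<^bsub>M\<^esub> = \<zero>\<^bsub>N\<^esub>" by (simp add: lin)
  show minus: "\<phi> (\<ominus>\<^bsub>M\<^esub> x) = \<ominus>\<^bsub>N\<^esub> \<phi> x" if "x \<in> carrier M" for x
    using that lin(2)[of "\<ominus>\<^bsub>M\<^esub> x" x] 0 by (simp add: M.M.l_neg N.M.minus_equality lin)
  show "\<phi> (x \<ominus>\<^bsub>M\<^esub> y) = \<phi> x \<ominus>\<^bsub>N\<^esub> \<phi> y" if "x \<in> carrier M" "y \<in> carrier M"
    using that by (simp add: a_minus_def lin minus)
qed

lemma linear_map_compose:
  "\<lbrakk>linear_map R M N \<phi>; linear_map R N K \<psi>\<rbrakk> \<Longrightarrow> linear_map R M K (\<lambda>x. \<psi> (\<phi> x))"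
  by (auto simp: linear_map_def Pi_iff)

lemma algebra_map_compose:
  "\<lbrakk>algebra_map R M N \<phi>; algebra_map R N K \<psi>\<rbrakk> \<Longrightarrow> algebra_map R M K (\<lambda>x. \<psi> (\<phi> x))"
  by (auto simp: algebra_map_def linear_map_def Pi_iff)

lemma inv_into_linear_map:
  assumes "module R M" "linear_map R M N \<phi>" "inj_on \<phi> (carrier M)" "\<phi> ` carrier M = carrier N"
  shows "linear_map R N M (inv_into (carrier M) \<phi>)"
proof -
  interpret M: module R M by fact
  note lin = linear_map_simps[OF assms(2)]
  let ?g = "inv_into (carrier M) \<phi>"
  have g: "?g y \<in> carrier M" "\<phi> (?g y) = y" if "y \<in> carrier N" for y
    using that assms(4) by (auto intro: inv_into_into f_inv_into_f)
  show ?thesis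
    by (rule linear_mapI) (auto intro!: inv_into_f_eq assms(3) simp: g lin)
qed

lemma inv_into_algebra_map:
  assumes "nonassoc_algebra R M" "algebra_map R M N \<phi>" "inj_on \<phi> (carrier M)" "\<phi> ` carrier M = carrier N"
  shows "algebra_map R N M (inv_into (carrier M) \<phi>)"
proof -
  interpret M: nonassoc_algebra R M by fact
  let ?g = "inv_into (carrier M) \<phi>"
  have g: "?g y \<in> carrier M" "\<phi> (?g y) = y" if "y \<in> carrier N" for y
    using that assms(4) by (auto intro: inv_into_into f_inv_into_f)
  show ?thesis unfolding algebra_map_def
    using inv_into_linear_map[OF M.module_axioms algebra_mapD(1)[OF assms(2)] assms(3,4)]
    by (auto intro!: inv_into_f_eq assms(3) simp: g algebra_mapD(2)[OF assms(2)] M.mult_closed)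
qed

section \<open>Submodules and spans\<close>

context module begin

lemma submodule_preimage:
  assumes "module R N" "linear_map R M N \<phi>" "submodule K R N"
  shows "submodule {x \<in> carrier M. \<phi> x \<in> K} R M"
proof -
  interpret N: module R N by fact
  note K = N.submoduleE[OF assms(3)]
  have 0: "\<zero>\<^bsub>N\<^esub> \<in> K" using K(2,3,5) K(1) N.M.r_neg by (metis ex_in_conv subsetD)
  show ?thesis
    by (rule submoduleI) (auto simp: linear_map_simps[OF assms(2)] K 0
        linear_map_minus[OF module_axioms assms(1,2)])
qed

lemma submodule_image:
  assumes "module R N" "linear_map R M N \<phi>" "submodule K R M"
  shows "submodule (\<phi> ` K) R N"
proof -
  interpret N: module R N by fact
  note K = submoduleE[OF assms(3)]
  have 0: "\<zero>\<^bsub>M\<^esub> \<in> K" using K(2,3,5) K(1) M.r_neg by (metis ex_in_conv subsetD)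
  note lin = linear_map_simps[OF assms(2)] linear_map_minus[OF module_axioms assms(1,2)]
  have K': "x \<in> carrier M" if "x \<in> K" for x using that K(1) by auto
  show ?thesis
  proof (rule N.submoduleI)
    show "\<phi> ` K \<subseteq> carrier N" using K' by (auto simp: lin)
    show "\<zero>\<^bsub>N\<^esub> \<in> \<phi> ` K" using 0 by (metis imageI lin(4))
    show "\<ominus>\<^bsub>N\<^esub> a \<in> \<phi> ` K" if "a \<in> \<phi> ` K" for a
      using that K' by (auto simp flip: lin(5) intro: K)
    show "a \<oplus>\<^bsub>N\<^esub> b \<in> \<phi> ` K" if "a \<in> \<phi> ` K" "b \<in> \<phi> ` K" for a b
      using that K' by (auto simp flip: lin(2) intro: K)
    show "a \<odot>\<^bsub>N\<^esub> x \<in> \<phi> ` K" if "a \<in> carrier R" "x \<in> \<phi> ` K" for a x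
      using that K' by (auto simp flip: lin(3) intro: K)
  qed
qed

lemma submodule_zero: "submodule K R M \<Longrightarrow> \<zero>\<^bsub>M\<^esub> \<in> K"
  using submoduleE[of K] M.r_neg by (metis ex_in_conv subsetD)

lemma submodule_diff: "\<lbrakk>submodule K R M; x \<in> K; y \<in> K\<rbrakk> \<Longrightarrow> x \<ominus>\<^bsub>M\<^esub> y \<in> K"
  using submoduleE[of K] by (simp add: a_minus_def)

lemma zero_submodule: "submodule {\<zero>\<^bsub>M\<^esub>} R M"
  by (rule submoduleI) auto

lemma submodule_equalizer:
  assumes "module R N" "linear_map R M N \<phi>" "linear_map R M N \<psi>"
  shows "submodule {x \<in> carrier M. \<phi> x = \<psi> x} R M"
proof -
  interpret N: module R N by fact
  show ?thesis
    by (rule submoduleI) (auto simp: linear_map_simps[OF assms(2)] linear_map_simps[OF assms(3)]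
        linear_map_minus[OF module_axioms assms(1,2)] linear_map_minus[OF module_axioms assms(1,3)])
qed

lemma lin_span_subset: "S \<subseteq> carrier M \<Longrightarrow> lin_span R M S \<subseteq> carrier M"
  using carrier_is_submodule by (auto simp: lin_span_def)

lemma lin_span_superset: "S \<subseteq> lin_span R M S"
  by (auto simp: lin_span_def)

lemma lin_span_least: "\<lbrakk>submodule N R M; S \<subseteq> N\<rbrakk> \<Longrightarrow> lin_span R M S \<subseteq> N"
  by (auto simp: lin_span_def)

lemma lin_span_submodule:
  assumes "S \<subseteq> carrier M" shows "submodule (lin_span R M S) R M"
proof (rule submoduleI)
  show "lin_span R M S \<subseteq> carrier M" by (rule lin_span_subset[OF assms])
qed (auto simp: lin_span_def submodule_zero submoduleE)

lemma linear_map_eq_on_span: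
  assumes "module R N" "linear_map R M N \<phi>" "linear_map R M N \<psi>" "S \<subseteq> carrier M"
    and "\<And>x. x \<in> S \<Longrightarrow> \<phi> x = \<psi> x" and "x \<in> lin_span R M S"
  shows "\<phi> x = \<psi> x"
  using lin_span_least[OF submodule_equalizer[OF assms(1-3)], of S] assms(4-6) by auto

lemma restrict_module: "submodule N R M \<Longrightarrow> module R (M\<lparr>carrier := N\<rparr>)"
  by (rule submodule.submodule_is_module[OF _ module_axioms])

lemma restrict_minus:
  assumes "submodule N R M" "x \<in> N"
  shows "\<ominus>\<^bsub>M\<lparr>carrier := N\<rparr>\<^esub> x = \<ominus>\<^bsub>M\<^esub> x"
proof -
  interpret N: module R "M\<lparr>carrier := N\<rparr>" by (rule restrict_module[OF assms(1)])
  show ?thesis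
    by (rule N.M.minus_equality) (use submoduleE[OF assms(1)] assms(2) in \<open>auto simp: M.l_neg subset_iff\<close>)
qed

lemma restrict_submodule_iff:
  assumes "submodule N R M" "K \<subseteq> N"
  shows "submodule K R (M\<lparr>carrier := N\<rparr>) \<longleftrightarrow> submodule K R M"
proof -
  interpret N: module R "M\<lparr>carrier := N\<rparr>" by (rule restrict_module[OF assms(1)])
  have KM: "K \<subseteq> carrier M" using assms submoduleE(1) by blast
  have neg: "\<ominus>\<^bsub>M\<lparr>carrier := N\<rparr>\<^esub> x = \<ominus>\<^bsub>M\<^esub> x" if "x \<in> K" for x
    using restrict_minus[OF assms(1)] that assms(2) by auto
  show ?thesis
  proof
    assume K: "submodule K R (M\<lparr>carrier := N\<rparr>)"
    show "submodule K R M"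
      by (rule submoduleI) (use N.submoduleE[OF K] N.submodule_zero[OF K] KM neg in auto)
  next
    assume K: "submodule K R M"
    show "submodule K R (M\<lparr>carrier := N\<rparr>)"
      by (rule N.submoduleI) (use submoduleE[OF K] submodule_zero[OF K] assms(2) neg in auto)
  qed
qed

lemma lin_span_restrict:
  assumes N: "submodule N R M" and S: "S \<subseteq> N"
  shows "lin_span R (M\<lparr>carrier := N\<rparr>) S = lin_span R M S"
proof -
  interpret N: module R "M\<lparr>carrier := N\<rparr>" by (rule restrict_module[OF N])
  have SM: "S \<subseteq> carrier M" using S submoduleE(1)[OF N] by auto
  have sub: "lin_span R M S \<subseteq> N" by (rule lin_span_least[OF N S])
  have "submodule (lin_span R M S) R (M\<lparr>carrier := N\<rparr>)"
    using lin_span_submodule[OF SM] restrict_submodule_iff[OF N sub] by simp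
  then have 1: "lin_span R (M\<lparr>carrier := N\<rparr>) S \<subseteq> lin_span R M S"
    by (rule N.lin_span_least) (rule lin_span_superset)
  have "submodule (lin_span R (M\<lparr>carrier := N\<rparr>) S) R (M\<lparr>carrier := N\<rparr>)"
    using S by (intro N.lin_span_submodule) simp
  moreover have "lin_span R (M\<lparr>carrier := N\<rparr>) S \<subseteq> N" using 1 sub by simp
  ultimately have "submodule (lin_span R (M\<lparr>carrier := N\<rparr>) S) R M"
    using restrict_submodule_iff[OF N] by blast
  then have "lin_span R M S \<subseteq> lin_span R (M\<lparr>carrier := N\<rparr>) S"
    by (rule lin_span_least) (rule N.lin_span_superset)
  with 1 show ?thesis by auto
qed

end

section \<open>Identities in nonassociative algebras\<close>

lemma (in module) smult_r_diff:
  "\<lbrakk>a \<in> carrier R; x \<in> carrier M; y \<in> carrier M\<rbrakk> \<Longrightarrow> a \<odot>\<^bsub>M\<^esub> (x \<ominus>\<^bsub>M\<^esub> y) = a \<odot>\<^bsub>M\<^esub> x \<ominus>\<^bsub>M\<^esub> a \<odot>\<^bsub>M\<^esub> y"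
  by (simp add: a_minus_def smult_r_distr smult_r_minus)

context nonassoc_algebra begin

lemma mult_zero: "x \<in> carrier A \<Longrightarrow> \<zero>\<^bsub>A\<^esub> \<otimes>\<^bsub>A\<^esub> x = \<zero>\<^bsub>A\<^esub>" "x \<in> carrier A \<Longrightarrow> x \<otimes>\<^bsub>A\<^esub> \<zero>\<^bsub>A\<^esub> = \<zero>\<^bsub>A\<^esub>"
  using mult_smult_left[of "\<zero>" "\<zero>\<^bsub>A\<^esub>" x] mult_smult_right[of "\<zero>" x "\<zero>\<^bsub>A\<^esub>"] by (simp_all add: mult_closed)

lemma mult_minus:
  "\<lbrakk>x \<in> carrier A; y \<in> carrier A\<rbrakk> \<Longrightarrow> (\<ominus>\<^bsub>A\<^esub> x) \<otimes>\<^bsub>A\<^esub> y = \<ominus>\<^bsub>A\<^esub> (x \<otimes>\<^bsub>A\<^esub> y)"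
  "\<lbrakk>x \<in> carrier A; y \<in> carrier A\<rbrakk> \<Longrightarrow> x \<otimes>\<^bsub>A\<^esub> (\<ominus>\<^bsub>A\<^esub> y) = \<ominus>\<^bsub>A\<^esub> (x \<otimes>\<^bsub>A\<^esub> y)"
  subgoal by (rule M.minus_equality[symmetric])
      (simp_all add: mult_add_left[symmetric] M.l_neg mult_zero mult_closed)
  subgoal by (rule M.minus_equality[symmetric])
      (simp_all add: mult_add_right[symmetric] M.l_neg mult_zero mult_closed)
  done

lemma mult_diff:
  "\<lbrakk>x \<in> carrier A; y \<in> carrier A; z \<in> carrier A\<rbrakk> \<Longrightarrow> (x \<ominus>\<^bsub>A\<^esub> y) \<otimes>\<^bsub>A\<^esub> z = x \<otimes>\<^bsub>A\<^esub> z \<ominus>\<^bsub>A\<^esub> y \<otimes>\<^bsub>A\<^esub> z"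
  "\<lbrakk>x \<in> carrier A; y \<in> carrier A; z \<in> carrier A\<rbrakk> \<Longrightarrow> z \<otimes>\<^bsub>A\<^esub> (x \<ominus>\<^bsub>A\<^esub> y) = z \<otimes>\<^bsub>A\<^esub> x \<ominus>\<^bsub>A\<^esub> z \<otimes>\<^bsub>A\<^esub> y"
  by (simp_all add: a_minus_def mult_add_left mult_add_right mult_minus)

lemmas mult_distribs = mult_add_left mult_add_right mult_diff mult_minus mult_zero

lemma mult_linear_map:
  "x \<in> carrier A \<Longrightarrow> linear_map R A A (\<lambda>y. x \<otimes>\<^bsub>A\<^esub> y)"
  "x \<in> carrier A \<Longrightarrow> linear_map R A A (\<lambda>y. y \<otimes>\<^bsub>A\<^esub> x)"
  by (auto intro!: linear_mapI simp: mult_closed mult_add_left mult_add_right mult_smult_left mult_smult_right)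

end

context lie_algebra begin

lemma bracket_swap:
  assumes "x \<in> carrier L" "y \<in> carrier L" shows "x \<otimes>\<^bsub>L\<^esub> y = \<ominus>\<^bsub>L\<^esub> (y \<otimes>\<^bsub>L\<^esub> x)"
proof -
  have "(x \<oplus>\<^bsub>L\<^esub> y) \<otimes>\<^bsub>L\<^esub> (x \<oplus>\<^bsub>L\<^esub> y) = x \<otimes>\<^bsub>L\<^esub> x \<oplus>\<^bsub>L\<^esub> y \<otimes>\<^bsub>L\<^esub> y \<oplus>\<^bsub>L\<^esub> (x \<otimes>\<^bsub>L\<^esub> y \<oplus>\<^bsub>L\<^esub> y \<otimes>\<^bsub>L\<^esub> x)"
    using assms by (simp add: mult_distribs mult_closed M.a_ac)
  then have "x \<otimes>\<^bsub>L\<^esub> y \<oplus>\<^bsub>L\<^esub> y \<otimes>\<^bsub>L\<^esub> x = \<zero>\<^bsub>L\<^esub>"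
    using assms by (simp add: mult_closed bracket_self)
  then show ?thesis using assms by (simp add: M.ab_simps mult_closed)
qed

lemma bracket_derivation:
  assumes "x \<in> carrier L" "y \<in> carrier L" "z \<in> carrier L"
  shows "x \<otimes>\<^bsub>L\<^esub> (y \<otimes>\<^bsub>L\<^esub> z) = (x \<otimes>\<^bsub>L\<^esub> y) \<otimes>\<^bsub>L\<^esub> z \<oplus>\<^bsub>L\<^esub> y \<otimes>\<^bsub>L\<^esub> (x \<otimes>\<^bsub>L\<^esub> z)"
proof -
  have 1: "y \<otimes>\<^bsub>L\<^esub> (z \<otimes>\<^bsub>L\<^esub> x) = \<ominus>\<^bsub>L\<^esub> (y \<otimes>\<^bsub>L\<^esub> (x \<otimes>\<^bsub>L\<^esub> z))"
    using assms bracket_swap[of z x] by (simp add: mult_distribs mult_closed)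
  have 2: "z \<otimes>\<^bsub>L\<^esub> (x \<otimes>\<^bsub>L\<^esub> y) = \<ominus>\<^bsub>L\<^esub> ((x \<otimes>\<^bsub>L\<^esub> y) \<otimes>\<^bsub>L\<^esub> z)"
    using assms bracket_swap[of z "x \<otimes>\<^bsub>L\<^esub> y"] by (simp add: mult_distribs mult_closed)
  show ?thesis
    using jacobi[OF assms] assms unfolding 1 2 by (simp add: M.ab_simps mult_closed)
qed

lemma bracket_commutator:
  assumes "x \<in> carrier L" "y \<in> carrier L" "z \<in> carrier L"
  shows "(x \<otimes>\<^bsub>L\<^esub> y) \<otimes>\<^bsub>L\<^esub> z = x \<otimes>\<^bsub>L\<^esub> (y \<otimes>\<^bsub>L\<^esub> z) \<ominus>\<^bsub>L\<^esub> y \<otimes>\<^bsub>L\<^esub> (x \<otimes>\<^bsub>L\<^esub> z)"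
  using bracket_derivation[OF assms] assms by (simp add: M.ab_simps mult_closed)

end

section \<open>The triple product of a Jordan algebra\<close>

locale jordan_char_not_2_3 = field_char_not_2_3 R + unital_jordan_algebra R J for R (structure) and J (structure)

sublocale jordan_char_not_2_3 \<subseteq> J: vector_space_char_not_2_3 R J ..

definition jordan_triple :: "('k, 'a, 'y) module_scheme \<Rightarrow> 'a \<Rightarrow> 'a \<Rightarrow> 'a \<Rightarrow> 'a" where
  "jordan_triple J a b c = (a \<otimes>\<^bsub>J\<^esub> b) \<otimes>\<^bsub>J\<^esub> c \<oplus>\<^bsub>J\<^esub> a \<otimes>\<^bsub>J\<^esub> (b \<otimes>\<^bsub>J\<^esub> c) \<ominus>\<^bsub>J\<^esub> b \<otimes>\<^bsub>J\<^esub> (a \<otimes>\<^bsub>J\<^esub> c)"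

text \<open>Twice the triple product: the integral form in which it occurs as a double bracket.\<close>

definition jordan_triple2 :: "('k, 'a, 'y) module_scheme \<Rightarrow> 'a \<Rightarrow> 'a \<Rightarrow> 'a \<Rightarrow> 'a" where
  "jordan_triple2 J a b c = jordan_triple J a b c \<oplus>\<^bsub>J\<^esub> jordan_triple J a b c"

context jordan_char_not_2_3 begin

text \<open>
  The part of the Jordan identity for \<open>a + c\<close> that is linear in \<open>c\<close>.  Replacing \<open>c\<close> by \<open>-c\<close> separates
  it from the part that is quadratic in \<open>c\<close>.
\<close>

lemma jordan_polarized_once:
  assumes a: "a \<in> carrier J" and c: "c \<in> carrier J" and d: "d \<in> carrier J"
  shows "c \<otimes>\<^bsub>J\<^esub> ((a \<otimes>\<^bsub>J\<^esub> a) \<otimes>\<^bsub>J\<^esub> d) \<oplus>\<^bsub>J\<^esub> (a \<otimes>\<^bsub>J\<^esub> ((a \<otimes>\<^bsub>J\<^esub> c) \<otimes>\<^bsub>J\<^esub> d) \<oplus>\<^bsub>J\<^esub> a \<otimes>\<^bsub>J\<^esub> ((a \<otimes>\<^bsub>J\<^esub> c) \<otimes>\<^bsub>J\<^esub> d)) =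
    (a \<otimes>\<^bsub>J\<^esub> a) \<otimes>\<^bsub>J\<^esub> (c \<otimes>\<^bsub>J\<^esub> d) \<oplus>\<^bsub>J\<^esub> ((a \<otimes>\<^bsub>J\<^esub> c) \<otimes>\<^bsub>J\<^esub> (a \<otimes>\<^bsub>J\<^esub> d) \<oplus>\<^bsub>J\<^esub> (a \<otimes>\<^bsub>J\<^esub> c) \<otimes>\<^bsub>J\<^esub> (a \<otimes>\<^bsub>J\<^esub> d))"
    (is "?Q = ?P")
proof -
  let ?Q' = "a \<otimes>\<^bsub>J\<^esub> ((c \<otimes>\<^bsub>J\<^esub> c) \<otimes>\<^bsub>J\<^esub> d) \<oplus>\<^bsub>J\<^esub> (c \<otimes>\<^bsub>J\<^esub> ((a \<otimes>\<^bsub>J\<^esub> c) \<otimes>\<^bsub>J\<^esub> d) \<oplus>\<^bsub>J\<^esub> c \<otimes>\<^bsub>J\<^esub> ((a \<otimes>\<^bsub>J\<^esub> c) \<otimes>\<^bsub>J\<^esub> d))"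
  let ?P' = "(c \<otimes>\<^bsub>J\<^esub> c) \<otimes>\<^bsub>J\<^esub> (a \<otimes>\<^bsub>J\<^esub> d) \<oplus>\<^bsub>J\<^esub> ((a \<otimes>\<^bsub>J\<^esub> c) \<otimes>\<^bsub>J\<^esub> (c \<otimes>\<^bsub>J\<^esub> d) \<oplus>\<^bsub>J\<^esub> (a \<otimes>\<^bsub>J\<^esub> c) \<otimes>\<^bsub>J\<^esub> (c \<otimes>\<^bsub>J\<^esub> d))"
  note cl = a c d mult_closed
  have G: "x \<otimes>\<^bsub>J\<^esub> ((x \<otimes>\<^bsub>J\<^esub> x) \<otimes>\<^bsub>J\<^esub> d) = (x \<otimes>\<^bsub>J\<^esub> x) \<otimes>\<^bsub>J\<^esub> (x \<otimes>\<^bsub>J\<^esub> d)" if "x \<in> carrier J" for x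
    using jordan_identity[OF that d] mult_commute[of d x] mult_commute[of "(x \<otimes>\<^bsub>J\<^esub> x) \<otimes>\<^bsub>J\<^esub> d" x] that d
    by (simp add: mult_closed)
  have ca: "c \<otimes>\<^bsub>J\<^esub> a = a \<otimes>\<^bsub>J\<^esub> c" by (rule mult_commute[OF c a])
  have "(?Q \<oplus>\<^bsub>J\<^esub> ?Q') \<ominus>\<^bsub>J\<^esub> (?P \<oplus>\<^bsub>J\<^esub> ?P') =
    (a \<oplus>\<^bsub>J\<^esub> c) \<otimes>\<^bsub>J\<^esub> (((a \<oplus>\<^bsub>J\<^esub> c) \<otimes>\<^bsub>J\<^esub> (a \<oplus>\<^bsub>J\<^esub> c)) \<otimes>\<^bsub>J\<^esub> d) \<ominus>\<^bsub>J\<^esub> ((a \<oplus>\<^bsub>J\<^esub> c) \<otimes>\<^bsub>J\<^esub> (a \<oplus>\<^bsub>J\<^esub> c)) \<otimes>\<^bsub>J\<^esub> ((a \<oplus>\<^bsub>J\<^esub> c) \<otimes>\<^bsub>J\<^esub> d)"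
    by (simp add: cl mult_distribs ca G[OF a] G[OF c]) (simp add: cl M.ab_simps)
  then have plus: "?Q \<oplus>\<^bsub>J\<^esub> ?Q' = ?P \<oplus>\<^bsub>J\<^esub> ?P'"
    using G[of "a \<oplus>\<^bsub>J\<^esub> c"] by (simp add: cl M.diff_eq_zero_iff M.diff_self)
  have "(?Q' \<ominus>\<^bsub>J\<^esub> ?Q) \<ominus>\<^bsub>J\<^esub> (?P' \<ominus>\<^bsub>J\<^esub> ?P) =
    (a \<ominus>\<^bsub>J\<^esub> c) \<otimes>\<^bsub>J\<^esub> (((a \<ominus>\<^bsub>J\<^esub> c) \<otimes>\<^bsub>J\<^esub> (a \<ominus>\<^bsub>J\<^esub> c)) \<otimes>\<^bsub>J\<^esub> d) \<ominus>\<^bsub>J\<^esub> ((a \<ominus>\<^bsub>J\<^esub> c) \<otimes>\<^bsub>J\<^esub> (a \<ominus>\<^bsub>J\<^esub> c)) \<otimes>\<^bsub>J\<^esub> ((a \<ominus>\<^bsub>J\<^esub> c) \<otimes>\<^bsub>J\<^esub> d)"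
    by (simp add: cl mult_distribs ca G[OF a] G[OF c]) (simp add: cl M.ab_simps)
  then have minus: "?Q' \<ominus>\<^bsub>J\<^esub> ?Q = ?P' \<ominus>\<^bsub>J\<^esub> ?P"
    using G[of "a \<ominus>\<^bsub>J\<^esub> c"] by (simp add: cl M.diff_eq_zero_iff M.diff_self)
  have double: "x \<oplus>\<^bsub>J\<^esub> x = (x \<oplus>\<^bsub>J\<^esub> y) \<ominus>\<^bsub>J\<^esub> (y \<ominus>\<^bsub>J\<^esub> x)" if "x \<in> carrier J" "y \<in> carrier J" for x y
    using that by (simp add: M.ab_simps)
  have "?Q \<oplus>\<^bsub>J\<^esub> ?Q = ?P \<oplus>\<^bsub>J\<^esub> ?P"
    using double[of ?Q ?Q'] double[of ?P ?P'] plus minus by (simp add: cl)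
  then show ?thesis by (rule J.double_cancel) (simp_all add: cl)
qed

text \<open>
  The complete polarization.  The right-hand side is symmetric in all four variables, although the
  left-hand side singles out \<open>d\<close>; comparing the left-hand sides for different distinguished
  variables is what yields every further identity.
\<close>

lemma jordan_polarized:
  assumes a: "a \<in> carrier J" and b: "b \<in> carrier J" and c: "c \<in> carrier J" and d: "d \<in> carrier J"
  shows "a \<otimes>\<^bsub>J\<^esub> (d \<otimes>\<^bsub>J\<^esub> (b \<otimes>\<^bsub>J\<^esub> c)) \<oplus>\<^bsub>J\<^esub> b \<otimes>\<^bsub>J\<^esub> (d \<otimes>\<^bsub>J\<^esub> (a \<otimes>\<^bsub>J\<^esub> c)) \<oplus>\<^bsub>J\<^esub> c \<otimes>\<^bsub>J\<^esub> (d \<otimes>\<^bsub>J\<^esub> (a \<otimes>\<^bsub>J\<^esub> b)) =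
    (a \<otimes>\<^bsub>J\<^esub> b) \<otimes>\<^bsub>J\<^esub> (c \<otimes>\<^bsub>J\<^esub> d) \<oplus>\<^bsub>J\<^esub> (a \<otimes>\<^bsub>J\<^esub> c) \<otimes>\<^bsub>J\<^esub> (b \<otimes>\<^bsub>J\<^esub> d) \<oplus>\<^bsub>J\<^esub> (b \<otimes>\<^bsub>J\<^esub> c) \<otimes>\<^bsub>J\<^esub> (a \<otimes>\<^bsub>J\<^esub> d)"
    (is "?Q = ?P")
proof -
  note cl = a b c d mult_closed
  have com: "b \<otimes>\<^bsub>J\<^esub> a = a \<otimes>\<^bsub>J\<^esub> b" "d \<otimes>\<^bsub>J\<^esub> (b \<otimes>\<^bsub>J\<^esub> c) = (b \<otimes>\<^bsub>J\<^esub> c) \<otimes>\<^bsub>J\<^esub> d" "d \<otimes>\<^bsub>J\<^esub> (a \<otimes>\<^bsub>J\<^esub> c) = (a \<otimes>\<^bsub>J\<^esub> c) \<otimes>\<^bsub>J\<^esub> d"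
    "d \<otimes>\<^bsub>J\<^esub> (a \<otimes>\<^bsub>J\<^esub> b) = (a \<otimes>\<^bsub>J\<^esub> b) \<otimes>\<^bsub>J\<^esub> d"
    by (rule mult_commute; simp add: cl)+
  define Q1 where "Q1 x = c \<otimes>\<^bsub>J\<^esub> ((x \<otimes>\<^bsub>J\<^esub> x) \<otimes>\<^bsub>J\<^esub> d) \<oplus>\<^bsub>J\<^esub> (x \<otimes>\<^bsub>J\<^esub> ((x \<otimes>\<^bsub>J\<^esub> c) \<otimes>\<^bsub>J\<^esub> d) \<oplus>\<^bsub>J\<^esub> x \<otimes>\<^bsub>J\<^esub> ((x \<otimes>\<^bsub>J\<^esub> c) \<otimes>\<^bsub>J\<^esub> d))" for x
  define P1 where "P1 x = (x \<otimes>\<^bsub>J\<^esub> x) \<otimes>\<^bsub>J\<^esub> (c \<otimes>\<^bsub>J\<^esub> d) \<oplus>\<^bsub>J\<^esub> ((x \<otimes>\<^bsub>J\<^esub> c) \<otimes>\<^bsub>J\<^esub> (x \<otimes>\<^bsub>J\<^esub> d) \<oplus>\<^bsub>J\<^esub> (x \<otimes>\<^bsub>J\<^esub> c) \<otimes>\<^bsub>J\<^esub> (x \<otimes>\<^bsub>J\<^esub> d))" for x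
  have once: "Q1 x \<ominus>\<^bsub>J\<^esub> P1 x = \<zero>\<^bsub>J\<^esub>" if "x \<in> carrier J" for x
    using jordan_polarized_once[OF that c d] that unfolding Q1_def P1_def by (simp add: cl M.diff_self)
  have "(?Q \<oplus>\<^bsub>J\<^esub> ?Q) \<ominus>\<^bsub>J\<^esub> (?P \<oplus>\<^bsub>J\<^esub> ?P) =
      (Q1 (a \<oplus>\<^bsub>J\<^esub> b) \<ominus>\<^bsub>J\<^esub> P1 (a \<oplus>\<^bsub>J\<^esub> b)) \<ominus>\<^bsub>J\<^esub> (Q1 a \<ominus>\<^bsub>J\<^esub> P1 a) \<ominus>\<^bsub>J\<^esub> (Q1 b \<ominus>\<^bsub>J\<^esub> P1 b)"
    unfolding Q1_def P1_def by (simp add: cl mult_distribs com) (simp add: cl M.ab_simps)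
  also have "\<dots> = \<zero>\<^bsub>J\<^esub>" using once[of a] once[of b] once[of "a \<oplus>\<^bsub>J\<^esub> b"] a b by (simp add: M.diff_self)
  finally have "(?Q \<oplus>\<^bsub>J\<^esub> ?Q) \<ominus>\<^bsub>J\<^esub> (?P \<oplus>\<^bsub>J\<^esub> ?P) = \<zero>\<^bsub>J\<^esub>" .
  then have "?Q \<oplus>\<^bsub>J\<^esub> ?Q = ?P \<oplus>\<^bsub>J\<^esub> ?P" by (simp add: cl M.diff_eq_zero_iff)
  then show ?thesis by (rule J.double_cancel) (simp_all add: cl)
qed

text \<open>
  The commutator of the multiplications by \<open>a\<close> and \<open>c\<close> is a derivation: this is the difference of the
  complete polarizations in which \<open>c\<close> and \<open>a\<close> are the distinguished variables.
\<close>

lemma jordan_derivation: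
  assumes a: "a \<in> carrier J" and c: "c \<in> carrier J" and x: "x \<in> carrier J" and y: "y \<in> carrier J"
  shows "a \<otimes>\<^bsub>J\<^esub> (c \<otimes>\<^bsub>J\<^esub> (x \<otimes>\<^bsub>J\<^esub> y)) \<ominus>\<^bsub>J\<^esub> c \<otimes>\<^bsub>J\<^esub> (a \<otimes>\<^bsub>J\<^esub> (x \<otimes>\<^bsub>J\<^esub> y)) =
    (a \<otimes>\<^bsub>J\<^esub> (c \<otimes>\<^bsub>J\<^esub> x) \<ominus>\<^bsub>J\<^esub> c \<otimes>\<^bsub>J\<^esub> (a \<otimes>\<^bsub>J\<^esub> x)) \<otimes>\<^bsub>J\<^esub> y \<oplus>\<^bsub>J\<^esub> x \<otimes>\<^bsub>J\<^esub> (a \<otimes>\<^bsub>J\<^esub> (c \<otimes>\<^bsub>J\<^esub> y) \<ominus>\<^bsub>J\<^esub> c \<otimes>\<^bsub>J\<^esub> (a \<otimes>\<^bsub>J\<^esub> y))"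
proof -
  note cl = a c x y mult_closed
  have com: "y \<otimes>\<^bsub>J\<^esub> (c \<otimes>\<^bsub>J\<^esub> (a \<otimes>\<^bsub>J\<^esub> x)) = (c \<otimes>\<^bsub>J\<^esub> (a \<otimes>\<^bsub>J\<^esub> x)) \<otimes>\<^bsub>J\<^esub> y" "y \<otimes>\<^bsub>J\<^esub> (a \<otimes>\<^bsub>J\<^esub> (c \<otimes>\<^bsub>J\<^esub> x)) = (a \<otimes>\<^bsub>J\<^esub> (c \<otimes>\<^bsub>J\<^esub> x)) \<otimes>\<^bsub>J\<^esub> y"
    "y \<otimes>\<^bsub>J\<^esub> c = c \<otimes>\<^bsub>J\<^esub> y" "y \<otimes>\<^bsub>J\<^esub> a = a \<otimes>\<^bsub>J\<^esub> y" "x \<otimes>\<^bsub>J\<^esub> a = a \<otimes>\<^bsub>J\<^esub> x" "x \<otimes>\<^bsub>J\<^esub> c = c \<otimes>\<^bsub>J\<^esub> x" "c \<otimes>\<^bsub>J\<^esub> a = a \<otimes>\<^bsub>J\<^esub> c"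
    "(x \<otimes>\<^bsub>J\<^esub> y) \<otimes>\<^bsub>J\<^esub> (a \<otimes>\<^bsub>J\<^esub> c) = (a \<otimes>\<^bsub>J\<^esub> c) \<otimes>\<^bsub>J\<^esub> (x \<otimes>\<^bsub>J\<^esub> y)"
    "(c \<otimes>\<^bsub>J\<^esub> y) \<otimes>\<^bsub>J\<^esub> (a \<otimes>\<^bsub>J\<^esub> x) = (a \<otimes>\<^bsub>J\<^esub> x) \<otimes>\<^bsub>J\<^esub> (c \<otimes>\<^bsub>J\<^esub> y)"
    "(c \<otimes>\<^bsub>J\<^esub> x) \<otimes>\<^bsub>J\<^esub> (a \<otimes>\<^bsub>J\<^esub> y) = (a \<otimes>\<^bsub>J\<^esub> y) \<otimes>\<^bsub>J\<^esub> (c \<otimes>\<^bsub>J\<^esub> x)"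
    by (rule mult_commute; simp add: cl)+
  show ?thesis
    using jordan_polarized[OF a x y c] jordan_polarized[OF c x y a]
    by (simp add: cl mult_distribs com) (simp add: cl M.ab_simps)
qed

lemma jordan_triple_closed [simp]:
  "\<lbrakk>a \<in> carrier J; b \<in> carrier J; c \<in> carrier J\<rbrakk> \<Longrightarrow> jordan_triple J a b c \<in> carrier J"
  "\<lbrakk>a \<in> carrier J; b \<in> carrier J; c \<in> carrier J\<rbrakk> \<Longrightarrow> jordan_triple2 J a b c \<in> carrier J"
  by (simp_all add: jordan_triple_def jordan_triple2_def mult_closed)

lemma jordan_triple_sym:
  assumes "a \<in> carrier J" "b \<in> carrier J" "c \<in> carrier J"
  shows "jordan_triple J a b c = jordan_triple J c b a"
proof -
  have "(a \<otimes>\<^bsub>J\<^esub> b) \<otimes>\<^bsub>J\<^esub> c = c \<otimes>\<^bsub>J\<^esub> (b \<otimes>\<^bsub>J\<^esub> a)" "a \<otimes>\<^bsub>J\<^esub> (b \<otimes>\<^bsub>J\<^esub> c) = (c \<otimes>\<^bsub>J\<^esub> b) \<otimes>\<^bsub>J\<^esub> a" "a \<otimes>\<^bsub>J\<^esub> c = c \<otimes>\<^bsub>J\<^esub> a"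
    using assms by (simp_all add: mult_commute mult_closed)
  then show ?thesis using assms by (simp add: jordan_triple_def M.a_ac mult_closed)
qed

lemma jordan_triple_linear:
  assumes "a \<in> carrier J" "b \<in> carrier J"
  shows "linear_map R J J (\<lambda>x. jordan_triple J x a b)"
    and "linear_map R J J (\<lambda>x. jordan_triple J a x b)"
    and "linear_map R J J (\<lambda>x. jordan_triple J a b x)"
  using assms
  by (auto intro!: linear_mapI simp: jordan_triple_def mult_distribs mult_closed mult_smult_left
      mult_smult_right smult_r_distr smult_r_diff) (simp_all add: M.ab_simps mult_closed)

lemma jordan_triple2_linear:
  assumes "a \<in> carrier J" "b \<in> carrier J"
  shows "linear_map R J J (\<lambda>x. jordan_triple2 J x a b)"
    and "linear_map R J J (\<lambda>x. jordan_triple2 J a x b)"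
    and "linear_map R J J (\<lambda>x. jordan_triple2 J a b x)"
  using assms unfolding jordan_triple2_def
  by (auto intro!: linear_mapI simp: linear_map_simps[OF jordan_triple_linear(1)]
      linear_map_simps[OF jordan_triple_linear(2)] linear_map_simps[OF jordan_triple_linear(3)]
      smult_r_distr) (simp_all add: M.a_ac)

lemma jordan_triple2_sym:
  "\<lbrakk>a \<in> carrier J; b \<in> carrier J; c \<in> carrier J\<rbrakk> \<Longrightarrow> jordan_triple2 J a b c = jordan_triple2 J c b a"
  using jordan_triple_sym[of a b c] by (simp add: jordan_triple2_def)

text \<open>
  Up to commutativity the difference of the two sides is a signed sum of the left-hand sides of the
  complete polarization for the distinguished variables \<open>x\<close>, \<open>y\<close>, \<open>z\<close> and of its right-hand side.
  All four are equal, and the signs add up to zero.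
\<close>

lemma mult_jordan_triple:
  assumes a: "a \<in> carrier J" and x: "x \<in> carrier J" and y: "y \<in> carrier J" and z: "z \<in> carrier J"
  shows "a \<otimes>\<^bsub>J\<^esub> jordan_triple J x y z =
    jordan_triple J (a \<otimes>\<^bsub>J\<^esub> x) y z \<ominus>\<^bsub>J\<^esub> jordan_triple J x (a \<otimes>\<^bsub>J\<^esub> y) z \<oplus>\<^bsub>J\<^esub> jordan_triple J x y (a \<otimes>\<^bsub>J\<^esub> z)"
proof -
  note cl = a x y z mult_closed
  have com: "(x \<otimes>\<^bsub>J\<^esub> y) \<otimes>\<^bsub>J\<^esub> z = z \<otimes>\<^bsub>J\<^esub> (x \<otimes>\<^bsub>J\<^esub> y)" "((a \<otimes>\<^bsub>J\<^esub> x) \<otimes>\<^bsub>J\<^esub> y) \<otimes>\<^bsub>J\<^esub> z = z \<otimes>\<^bsub>J\<^esub> (y \<otimes>\<^bsub>J\<^esub> (a \<otimes>\<^bsub>J\<^esub> x))"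
    "(x \<otimes>\<^bsub>J\<^esub> (a \<otimes>\<^bsub>J\<^esub> y)) \<otimes>\<^bsub>J\<^esub> z = z \<otimes>\<^bsub>J\<^esub> (x \<otimes>\<^bsub>J\<^esub> (a \<otimes>\<^bsub>J\<^esub> y))" "(a \<otimes>\<^bsub>J\<^esub> y) \<otimes>\<^bsub>J\<^esub> z = z \<otimes>\<^bsub>J\<^esub> (a \<otimes>\<^bsub>J\<^esub> y)"
    "(a \<otimes>\<^bsub>J\<^esub> x) \<otimes>\<^bsub>J\<^esub> z = z \<otimes>\<^bsub>J\<^esub> (a \<otimes>\<^bsub>J\<^esub> x)" "y \<otimes>\<^bsub>J\<^esub> x = x \<otimes>\<^bsub>J\<^esub> y" "z \<otimes>\<^bsub>J\<^esub> x = x \<otimes>\<^bsub>J\<^esub> z" "z \<otimes>\<^bsub>J\<^esub> y = y \<otimes>\<^bsub>J\<^esub> z"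
    "y \<otimes>\<^bsub>J\<^esub> a = a \<otimes>\<^bsub>J\<^esub> y" "x \<otimes>\<^bsub>J\<^esub> a = a \<otimes>\<^bsub>J\<^esub> x" "z \<otimes>\<^bsub>J\<^esub> a = a \<otimes>\<^bsub>J\<^esub> z"
    "(x \<otimes>\<^bsub>J\<^esub> y) \<otimes>\<^bsub>J\<^esub> (a \<otimes>\<^bsub>J\<^esub> z) = (a \<otimes>\<^bsub>J\<^esub> z) \<otimes>\<^bsub>J\<^esub> (x \<otimes>\<^bsub>J\<^esub> y)"
    "(y \<otimes>\<^bsub>J\<^esub> z) \<otimes>\<^bsub>J\<^esub> (a \<otimes>\<^bsub>J\<^esub> x) = (a \<otimes>\<^bsub>J\<^esub> x) \<otimes>\<^bsub>J\<^esub> (y \<otimes>\<^bsub>J\<^esub> z)"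
    "(x \<otimes>\<^bsub>J\<^esub> z) \<otimes>\<^bsub>J\<^esub> (a \<otimes>\<^bsub>J\<^esub> y) = (a \<otimes>\<^bsub>J\<^esub> y) \<otimes>\<^bsub>J\<^esub> (x \<otimes>\<^bsub>J\<^esub> z)"
    by (simp_all add: mult_commute cl)
  define P where "P = (a \<otimes>\<^bsub>J\<^esub> x) \<otimes>\<^bsub>J\<^esub> (y \<otimes>\<^bsub>J\<^esub> z) \<oplus>\<^bsub>J\<^esub> (a \<otimes>\<^bsub>J\<^esub> y) \<otimes>\<^bsub>J\<^esub> (x \<otimes>\<^bsub>J\<^esub> z) \<oplus>\<^bsub>J\<^esub> (a \<otimes>\<^bsub>J\<^esub> z) \<otimes>\<^bsub>J\<^esub> (x \<otimes>\<^bsub>J\<^esub> y)"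
  define Q1 where "Q1 = a \<otimes>\<^bsub>J\<^esub> (x \<otimes>\<^bsub>J\<^esub> (y \<otimes>\<^bsub>J\<^esub> z)) \<oplus>\<^bsub>J\<^esub> y \<otimes>\<^bsub>J\<^esub> (x \<otimes>\<^bsub>J\<^esub> (a \<otimes>\<^bsub>J\<^esub> z)) \<oplus>\<^bsub>J\<^esub> z \<otimes>\<^bsub>J\<^esub> (x \<otimes>\<^bsub>J\<^esub> (a \<otimes>\<^bsub>J\<^esub> y))"
  define Q2 where "Q2 = a \<otimes>\<^bsub>J\<^esub> (y \<otimes>\<^bsub>J\<^esub> (x \<otimes>\<^bsub>J\<^esub> z)) \<oplus>\<^bsub>J\<^esub> x \<otimes>\<^bsub>J\<^esub> (y \<otimes>\<^bsub>J\<^esub> (a \<otimes>\<^bsub>J\<^esub> z)) \<oplus>\<^bsub>J\<^esub> z \<otimes>\<^bsub>J\<^esub> (y \<otimes>\<^bsub>J\<^esub> (a \<otimes>\<^bsub>J\<^esub> x))"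
  define Q3 where "Q3 = a \<otimes>\<^bsub>J\<^esub> (z \<otimes>\<^bsub>J\<^esub> (x \<otimes>\<^bsub>J\<^esub> y)) \<oplus>\<^bsub>J\<^esub> x \<otimes>\<^bsub>J\<^esub> (z \<otimes>\<^bsub>J\<^esub> (a \<otimes>\<^bsub>J\<^esub> y)) \<oplus>\<^bsub>J\<^esub> y \<otimes>\<^bsub>J\<^esub> (z \<otimes>\<^bsub>J\<^esub> (a \<otimes>\<^bsub>J\<^esub> x))"
  have Q: "Q1 = P" "Q2 = P" "Q3 = P" and "P \<in> carrier J"
    using jordan_polarized[OF a x y z] jordan_polarized[OF a y z x] jordan_polarized[OF a x z y]
    unfolding P_def Q1_def Q2_def Q3_def by (simp_all add: cl com M.a_ac)
  have "a \<otimes>\<^bsub>J\<^esub> jordan_triple J x y z \<ominus>\<^bsub>J\<^esub>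
    (jordan_triple J (a \<otimes>\<^bsub>J\<^esub> x) y z \<ominus>\<^bsub>J\<^esub> jordan_triple J x (a \<otimes>\<^bsub>J\<^esub> y) z \<oplus>\<^bsub>J\<^esub> jordan_triple J x y (a \<otimes>\<^bsub>J\<^esub> z))
    = Q1 \<oplus>\<^bsub>J\<^esub> Q3 \<ominus>\<^bsub>J\<^esub> (Q2 \<oplus>\<^bsub>J\<^esub> P)"
    unfolding jordan_triple_def P_def Q1_def Q2_def Q3_def
    by (simp add: cl mult_distribs com) (simp add: cl M.ab_simps)
  also have "\<dots> = \<zero>\<^bsub>J\<^esub>" using \<open>P \<in> carrier J\<close> by (simp add: Q M.diff_self)
  finally show ?thesis using cl by (simp add: M.diff_eq_zero_iff)
qed

text \<open>
  The operator \<open>jordan_triple J a b\<close> is multiplication by \<open>ab\<close> plus the inner derivation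
  \<open>[a, b]\<close> of multiplications.  The former acts on a triple product with the opposite sign in the
  middle, the latter as a derivation; exchanging \<open>a\<close> and \<open>b\<close> only changes the sign of the latter.
\<close>

lemma jordan_triple_five_linear:
  assumes a: "a \<in> carrier J" and b: "b \<in> carrier J"
    and x: "x \<in> carrier J" and y: "y \<in> carrier J" and z: "z \<in> carrier J"
  shows "jordan_triple J a b (jordan_triple J x y z) = jordan_triple J (jordan_triple J a b x) y z
    \<ominus>\<^bsub>J\<^esub> jordan_triple J x (jordan_triple J b a y) z \<oplus>\<^bsub>J\<^esub> jordan_triple J x y (jordan_triple J a b z)"
proof -
  note cl = a b x y z mult_closed
  let ?T = "jordan_triple J"
  define D where "D w = a \<otimes>\<^bsub>J\<^esub> (b \<otimes>\<^bsub>J\<^esub> w) \<ominus>\<^bsub>J\<^esub> b \<otimes>\<^bsub>J\<^esub> (a \<otimes>\<^bsub>J\<^esub> w)" for w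
  have D_cl: "D w \<in> carrier J" if "w \<in> carrier J" for w using that by (simp add: D_def cl)
  have D_mult: "D (v \<otimes>\<^bsub>J\<^esub> w) = D v \<otimes>\<^bsub>J\<^esub> w \<oplus>\<^bsub>J\<^esub> v \<otimes>\<^bsub>J\<^esub> D w" if "v \<in> carrier J" "w \<in> carrier J" for v w
    using jordan_derivation[OF a b that] by (simp add: D_def)
  have D_add: "D (v \<oplus>\<^bsub>J\<^esub> w) = D v \<oplus>\<^bsub>J\<^esub> D w" "D (v \<ominus>\<^bsub>J\<^esub> w) = D v \<ominus>\<^bsub>J\<^esub> D w"
    if "v \<in> carrier J" "w \<in> carrier J" for v w
    using that unfolding D_def by (simp_all add: cl mult_distribs) (simp_all add: cl M.ab_simps)
  have D_triple: "D (?T x y z) = ?T (D x) y z \<oplus>\<^bsub>J\<^esub> ?T x (D y) z \<oplus>\<^bsub>J\<^esub> ?T x y (D z)"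
    unfolding jordan_triple_def
    by (simp add: cl D_cl D_mult D_add mult_distribs) (simp add: cl D_cl M.ab_simps)
  have ab: "?T a b w = (a \<otimes>\<^bsub>J\<^esub> b) \<otimes>\<^bsub>J\<^esub> w \<oplus>\<^bsub>J\<^esub> D w" "?T b a w = (a \<otimes>\<^bsub>J\<^esub> b) \<otimes>\<^bsub>J\<^esub> w \<ominus>\<^bsub>J\<^esub> D w"
    if "w \<in> carrier J" for w
    using that mult_commute[OF b a] unfolding jordan_triple_def D_def by (simp_all add: cl M.ab_simps)
  note lin1 = linear_map_simps(2)[OF jordan_triple_linear(1)]
    and lin2 = linear_map_minus(3)[OF module_axioms module_axioms jordan_triple_linear(2)]
    and lin3 = linear_map_simps(2)[OF jordan_triple_linear(3)]
  show ?thesis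
    by (simp add: ab cl D_cl D_triple mult_jordan_triple[of "a \<otimes>\<^bsub>J\<^esub> b"] lin1 lin2 lin3)
      (simp add: cl D_cl M.ab_simps)
qed

lemma jordan_triple2_five_linear:
  assumes a: "a \<in> carrier J" and b: "b \<in> carrier J"
    and x: "x \<in> carrier J" and y: "y \<in> carrier J" and z: "z \<in> carrier J"
  shows "jordan_triple2 J a b (jordan_triple2 J x y z) = jordan_triple2 J (jordan_triple2 J a b x) y z
    \<ominus>\<^bsub>J\<^esub> jordan_triple2 J x (jordan_triple2 J b a y) z \<oplus>\<^bsub>J\<^esub> jordan_triple2 J x y (jordan_triple2 J a b z)"
proof -
  note cl = a b x y z
  note lin1 = linear_map_simps(2)[OF jordan_triple_linear(1)]
    and lin2 = linear_map_simps(2)[OF jordan_triple_linear(2)]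
    and lin3 = linear_map_simps(2)[OF jordan_triple_linear(3)]
  show ?thesis unfolding jordan_triple2_def
    by (simp add: cl lin1 lin2 lin3 jordan_triple_five_linear[OF a b x y z]) (simp add: cl M.ab_simps)
qed

end

section \<open>Products and copies of algebras\<close>

lemma lie_algebraI:
  assumes "module R L"
    and "\<And>x y. \<lbrakk>x \<in> carrier L; y \<in> carrier L\<rbrakk> \<Longrightarrow> x \<otimes>\<^bsub>L\<^esub> y \<in> carrier L"
    and "\<And>x y z. \<lbrakk>x \<in> carrier L; y \<in> carrier L; z \<in> carrier L\<rbrakk> \<Longrightarrow> (x \<oplus>\<^bsub>L\<^esub> y) \<otimes>\<^bsub>L\<^esub> z = x \<otimes>\<^bsub>L\<^esub> z \<oplus>\<^bsub>L\<^esub> y \<otimes>\<^bsub>L\<^esub> z"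
    and "\<And>x y z. \<lbrakk>x \<in> carrier L; y \<in> carrier L; z \<in> carrier L\<rbrakk> \<Longrightarrow> x \<otimes>\<^bsub>L\<^esub> (y \<oplus>\<^bsub>L\<^esub> z) = x \<otimes>\<^bsub>L\<^esub> y \<oplus>\<^bsub>L\<^esub> x \<otimes>\<^bsub>L\<^esub> z"
    and "\<And>a x y. \<lbrakk>a \<in> carrier R; x \<in> carrier L; y \<in> carrier L\<rbrakk> \<Longrightarrow> (a \<odot>\<^bsub>L\<^esub> x) \<otimes>\<^bsub>L\<^esub> y = a \<odot>\<^bsub>L\<^esub> (x \<otimes>\<^bsub>L\<^esub> y)"
    and "\<And>a x y. \<lbrakk>a \<in> carrier R; x \<in> carrier L; y \<in> carrier L\<rbrakk> \<Longrightarrow> x \<otimes>\<^bsub>L\<^esub> (a \<odot>\<^bsub>L\<^esub> y) = a \<odot>\<^bsub>L\<^esub> (x \<otimes>\<^bsub>L\<^esub> y)"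
    and "\<And>x. x \<in> carrier L \<Longrightarrow> x \<otimes>\<^bsub>L\<^esub> x = \<zero>\<^bsub>L\<^esub>"
    and "\<And>x y z. \<lbrakk>x \<in> carrier L; y \<in> carrier L; z \<in> carrier L\<rbrakk>
      \<Longrightarrow> x \<otimes>\<^bsub>L\<^esub> (y \<otimes>\<^bsub>L\<^esub> z) \<oplus>\<^bsub>L\<^esub> y \<otimes>\<^bsub>L\<^esub> (z \<otimes>\<^bsub>L\<^esub> x) \<oplus>\<^bsub>L\<^esub> z \<otimes>\<^bsub>L\<^esub> (x \<otimes>\<^bsub>L\<^esub> y) = \<zero>\<^bsub>L\<^esub>"
  shows "lie_algebra R L"
  using assms unfolding lie_algebra_def nonassoc_algebra_def lie_algebra_axioms_def nonassoc_algebra_axioms_def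
  by blast

text \<open>Axioms that are equations pass to images.\<close>

lemma module_image:
  assumes M: "module R M" and onto: "carrier Q = \<pi> ` carrier M"
    and add: "\<And>x y. \<lbrakk>x \<in> carrier M; y \<in> carrier M\<rbrakk> \<Longrightarrow> \<pi> x \<oplus>\<^bsub>Q\<^esub> \<pi> y = \<pi> (x \<oplus>\<^bsub>M\<^esub> y)"
    and smult: "\<And>a x. \<lbrakk>a \<in> carrier R; x \<in> carrier M\<rbrakk> \<Longrightarrow> a \<odot>\<^bsub>Q\<^esub> \<pi> x = \<pi> (a \<odot>\<^bsub>M\<^esub> x)"
    and zero: "\<zero>\<^bsub>Q\<^esub> = \<pi> \<zero>\<^bsub>M\<^esub>"
  shows "module R Q"
proof -
  interpret M: module R M by fact
  show ?thesis
  proof (rule moduleI[OF M.R.is_cring])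
    show "abelian_group Q"
    proof (rule abelian_groupI)
      fix u assume "u \<in> carrier Q"
      then obtain x where x: "x \<in> carrier M" "u = \<pi> x" by (auto simp: onto)
      then have "\<pi> (\<ominus>\<^bsub>M\<^esub> x) \<oplus>\<^bsub>Q\<^esub> u = \<zero>\<^bsub>Q\<^esub>" by (simp add: add zero M.M.l_neg)
      then show "\<exists>v\<in>carrier Q. v \<oplus>\<^bsub>Q\<^esub> u = \<zero>\<^bsub>Q\<^esub>" using x by (auto simp: onto)
    qed (auto simp: onto add zero M.M.a_ac)
  qed (auto simp: onto add smult M.smult_l_distr M.smult_r_distr M.smult_assoc1)
qed

lemma module_update_mult:
  assumes "module R M" shows "module R (M\<lparr>mult := m\<rparr>)" "module R (M\<lparr>mult := m, one := u\<rparr>)"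
  by (rule module_image[OF assms, of _ "\<lambda>x. x"]; simp)+

definition product_algebra :: "'i set \<Rightarrow> ('i \<Rightarrow> ('k, 'a, 'y) module_scheme) \<Rightarrow> ('k, 'i \<Rightarrow> 'a) module" where
  "product_algebra I A =
     \<lparr>carrier = (\<Pi>\<^sub>E i\<in>I. carrier (A i)),
      mult = (\<lambda>u v. \<lambda>i\<in>I. u i \<otimes>\<^bsub>A i\<^esub> v i), one = (\<lambda>i\<in>I. \<one>\<^bsub>A i\<^esub>), zero = (\<lambda>i\<in>I. \<zero>\<^bsub>A i\<^esub>),
      add = (\<lambda>u v. \<lambda>i\<in>I. u i \<oplus>\<^bsub>A i\<^esub> v i), smult = (\<lambda>a u. \<lambda>i\<in>I. a \<odot>\<^bsub>A i\<^esub> u i)\<rparr>"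

lemma product_module:
  assumes R: "cring R" and A: "\<And>i. i \<in> I \<Longrightarrow> module R (A i)"
  shows "module R (product_algebra I A)"
proof -
  have ab: "abelian_group (A i)" if "i \<in> I" for i using A[OF that] by (simp add: module_def)
  note facts = abelian_groupE(1-3,5)[OF ab] module.smult_l_distr[OF A] module.smult_r_distr[OF A]
    module.smult_assoc1[OF A] module.smult_one[OF A] module.smult_closed[OF A]
  show ?thesis
  proof (rule moduleI[OF R])
    show "abelian_group (product_algebra I A)"
    proof (rule abelian_groupI)
      fix u assume u: "u \<in> carrier (product_algebra I A)"
      let ?v = "\<lambda>i\<in>I. \<ominus>\<^bsub>A i\<^esub> u i"
      have "\<ominus>\<^bsub>A i\<^esub> u i \<in> carrier (A i)" "\<ominus>\<^bsub>A i\<^esub> u i \<oplus>\<^bsub>A i\<^esub> u i = \<zero>\<^bsub>A i\<^esub>" if "i \<in> I" for i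
        using u that abelian_group.a_inv_closed[OF ab] abelian_group.l_neg[OF ab]
        by (auto simp: product_algebra_def PiE_iff)
      then have "?v \<in> carrier (product_algebra I A)" "?v \<oplus>\<^bsub>product_algebra I A\<^esub> u = \<zero>\<^bsub>product_algebra I A\<^esub>"
        by (auto simp: product_algebra_def)
      then show "\<exists>v\<in>carrier (product_algebra I A). v \<oplus>\<^bsub>product_algebra I A\<^esub> u = \<zero>\<^bsub>product_algebra I A\<^esub>"
        by blast
    next
      fix u v assume "u \<in> carrier (product_algebra I A)" "v \<in> carrier (product_algebra I A)"
      then show "u \<oplus>\<^bsub>product_algebra I A\<^esub> v = v \<oplus>\<^bsub>product_algebra I A\<^esub> u"
        by (auto simp: product_algebra_def PiE_iff fun_eq_iff intro: abelian_groupE(4)[OF ab])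
    qed (simp_all add: product_algebra_def PiE_iff fun_eq_iff extensional_def facts)
  qed (simp_all add: product_algebra_def PiE_iff fun_eq_iff extensional_def facts)
qed

lemma product_apply:
  assumes "i \<in> I"
  shows "(u \<oplus>\<^bsub>product_algebra I A\<^esub> v) i = u i \<oplus>\<^bsub>A i\<^esub> v i" "(u \<otimes>\<^bsub>product_algebra I A\<^esub> v) i = u i \<otimes>\<^bsub>A i\<^esub> v i"
    "(a \<odot>\<^bsub>product_algebra I A\<^esub> u) i = a \<odot>\<^bsub>A i\<^esub> u i" "\<zero>\<^bsub>product_algebra I A\<^esub> i = \<zero>\<^bsub>A i\<^esub>"
  using assms by (simp_all add: product_algebra_def)

lemma product_ext:
  "\<lbrakk>u \<in> carrier (product_algebra I A); v \<in> carrier (product_algebra I A); \<And>i. i \<in> I \<Longrightarrow> u i = v i\<rbrakk> \<Longrightarrow> u = v"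
  by (auto simp: product_algebra_def intro: PiE_ext)

lemma product_projection: "i \<in> I \<Longrightarrow> linear_map R (product_algebra I A) (A i) (\<lambda>u. u i)"
  "i \<in> I \<Longrightarrow> algebra_map R (product_algebra I A) (A i) (\<lambda>u. u i)"
  by (auto simp: linear_map_def algebra_map_def product_apply) (auto simp: product_algebra_def)

lemma product_minus_apply:
  assumes "cring R" "\<And>i. i \<in> I \<Longrightarrow> module R (A i)" "i \<in> I" "u \<in> carrier (product_algebra I A)"
  shows "(\<ominus>\<^bsub>product_algebra I A\<^esub> u) i = \<ominus>\<^bsub>A i\<^esub> u i"
  using linear_map_minus(2)[of R "product_algebra I A" "A i" "\<lambda>u. u i" u] product_module[of R I A]
    product_projection(1)[OF assms(3), of R A] assms by simp

lemma product_lie_algebra: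
  assumes R: "cring R" and A: "\<And>i. i \<in> I \<Longrightarrow> lie_algebra R (A i)"
  shows "lie_algebra R (product_algebra I A)"
proof -
  have na: "nonassoc_algebra R (A i)" if "i \<in> I" for i using A[OF that] by (simp add: lie_algebra_def)
  have mo: "module R (A i)" if "i \<in> I" for i using na[OF that] by (simp add: nonassoc_algebra_def)
  note facts = nonassoc_algebra.mult_add_left[OF na] nonassoc_algebra.mult_add_right[OF na]
    nonassoc_algebra.mult_smult_left[OF na] nonassoc_algebra.mult_smult_right[OF na]
    nonassoc_algebra.mult_closed[OF na] lie_algebra.bracket_self[OF A] lie_algebra.jacobi[OF A]
  show ?thesis
    by (rule lie_algebraI[OF product_module[OF R mo]])
      (auto simp: product_algebra_def PiE_iff fun_eq_iff extensional_def facts)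
qed

definition transport_algebra :: "('a \<Rightarrow> 'b) \<Rightarrow> ('k, 'a, 'y) module_scheme \<Rightarrow> ('k, 'b) module" where
  "transport_algebra \<iota> A = (let g = inv_into (carrier A) \<iota> in
     \<lparr>carrier = \<iota> ` carrier A,
      mult = (\<lambda>u v. \<iota> (g u \<otimes>\<^bsub>A\<^esub> g v)), one = \<iota> \<one>\<^bsub>A\<^esub>, zero = \<iota> \<zero>\<^bsub>A\<^esub>,
      add = (\<lambda>u v. \<iota> (g u \<oplus>\<^bsub>A\<^esub> g v)), smult = (\<lambda>a u. \<iota> (a \<odot>\<^bsub>A\<^esub> g u))\<rparr>)"

lemma transport_simps:
  assumes "inj_on \<iota> (carrier A)"
  shows "carrier (transport_algebra \<iota> A) = \<iota> ` carrier A"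
    and "\<lbrakk>x \<in> carrier A; y \<in> carrier A\<rbrakk> \<Longrightarrow> \<iota> x \<otimes>\<^bsub>transport_algebra \<iota> A\<^esub> \<iota> y = \<iota> (x \<otimes>\<^bsub>A\<^esub> y)"
    and "\<lbrakk>x \<in> carrier A; y \<in> carrier A\<rbrakk> \<Longrightarrow> \<iota> x \<oplus>\<^bsub>transport_algebra \<iota> A\<^esub> \<iota> y = \<iota> (x \<oplus>\<^bsub>A\<^esub> y)"
    and "x \<in> carrier A \<Longrightarrow> a \<odot>\<^bsub>transport_algebra \<iota> A\<^esub> \<iota> x = \<iota> (a \<odot>\<^bsub>A\<^esub> x)"
    and "\<zero>\<^bsub>transport_algebra \<iota> A\<^esub> = \<iota> \<zero>\<^bsub>A\<^esub>"
  using assms by (simp_all add: transport_algebra_def Let_def)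

lemma transport_algebra_map:
  assumes "inj_on \<iota> (carrier A)"
  shows "algebra_map R A (transport_algebra \<iota> A) \<iota>"
  using assms by (auto simp: algebra_map_def linear_map_def transport_simps)

lemma transport_module:
  assumes "module R A" and \<iota>: "inj_on \<iota> (carrier A)"
  shows "module R (transport_algebra \<iota> A)"
  by (rule module_image[OF assms(1), of _ \<iota>]) (simp_all add: transport_simps[OF \<iota>])

lemma transport_lie_algebra:
  assumes A: "lie_algebra R A" and \<iota>: "inj_on \<iota> (carrier A)"
  shows "lie_algebra R (transport_algebra \<iota> A)"
proof -
  interpret A: lie_algebra R A by fact
  show ?thesis
    by (rule lie_algebraI[OF transport_module[OF A.module_axioms \<iota>]])
      (auto simp: transport_simps[OF \<iota>] A.mult_closed A.mult_add_left A.mult_add_right A.mult_smult_left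
        A.mult_smult_right A.bracket_self A.jacobi)
qed

section \<open>The Tits--Kantor--Koecher algebra\<close>

text \<open>
  An element of the Tits--Kantor--Koecher algebra is a pair of vectors together with a derivation of
  the Jordan pair \<open>(J, J)\<close>, that is, a pair of operators.  The two members of each pair are indexed by
  a sign, so a single function \<open>u\<close> holds the vectors \<open>u (s, None)\<close> and the operators
  \<open>x \<mapsto> u (s, Some x)\<close>; the formulas are then invariant under exchanging the signs.
\<close>

definition tkk_index :: "('k, 'a, 'y) module_scheme \<Rightarrow> (bool \<times> 'a option) set" where
  "tkk_index J = {(s, w). \<forall>x. w = Some x \<longrightarrow> x \<in> carrier J}"

definition tkk_carrier :: "('k, 'z) ring_scheme \<Rightarrow> ('k, 'a, 'y) module_scheme \<Rightarrow> (bool \<times> 'a option \<Rightarrow> 'a) set" where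
  "tkk_carrier R J = {u \<in> tkk_index J \<rightarrow>\<^sub>E carrier J. \<forall>s.
     linear_map R J J (\<lambda>x. u (s, Some x)) \<and>
     (\<forall>x\<in>carrier J. \<forall>y\<in>carrier J. \<forall>z\<in>carrier J. u (s, Some (jordan_triple2 J x y z)) =
        jordan_triple2 J (u (s, Some x)) y z \<oplus>\<^bsub>J\<^esub> jordan_triple2 J x (u (\<not> s, Some y)) z
        \<oplus>\<^bsub>J\<^esub> jordan_triple2 J x y (u (s, Some z)))}"

definition tkk_bracket ::
  "('k, 'a, 'y) module_scheme \<Rightarrow> (bool \<times> 'a option \<Rightarrow> 'a) \<Rightarrow> (bool \<times> 'a option \<Rightarrow> 'a) \<Rightarrow> bool \<times> 'a option \<Rightarrow> 'a" where
  "tkk_bracket J u v = (\<lambda>(s, w)\<in>tkk_index J. case w of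
     None \<Rightarrow> u (s, Some (v (s, None))) \<ominus>\<^bsub>J\<^esub> v (s, Some (u (s, None)))
   | Some x \<Rightarrow> u (s, Some (v (s, Some x))) \<ominus>\<^bsub>J\<^esub> v (s, Some (u (s, Some x)))
       \<oplus>\<^bsub>J\<^esub> (jordan_triple2 J (u (s, None)) (v (\<not> s, None)) x \<ominus>\<^bsub>J\<^esub> jordan_triple2 J (v (s, None)) (u (\<not> s, None)) x))"

definition tkk :: "('k, 'z) ring_scheme \<Rightarrow> ('k, 'a, 'y) module_scheme \<Rightarrow> ('k, bool \<times> 'a option \<Rightarrow> 'a) module" where
  "tkk R J = (product_algebra (tkk_index J) (\<lambda>_. J))\<lparr>carrier := tkk_carrier R J, mult := tkk_bracket J\<rparr>"

context jordan_char_not_2_3 begin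

abbreviation V where "V \<equiv> jordan_triple2 J"

lemmas V_simps =
  linear_map_simps(2,3)[OF jordan_triple2_linear(1)] linear_map_minus[OF module_axioms module_axioms jordan_triple2_linear(1)]
  linear_map_simps(2,3)[OF jordan_triple2_linear(2)] linear_map_minus[OF module_axioms module_axioms jordan_triple2_linear(2)]
  linear_map_simps(2,3)[OF jordan_triple2_linear(3)] linear_map_minus[OF module_axioms module_axioms jordan_triple2_linear(3)]

lemma tkk_index_iff [simp]: "(s, None) \<in> tkk_index J" "(s, Some x) \<in> tkk_index J \<longleftrightarrow> x \<in> carrier J"
  by (auto simp: tkk_index_def)

lemma tkk_indexE:
  assumes "i \<in> tkk_index J" obtains s where "i = (s, None)" | s x where "i = (s, Some x)" "x \<in> carrier J"
  using assms by (cases i; cases "snd i") (auto simp: tkk_index_def)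

lemma tkk_bracket_apply:
  "tkk_bracket J u v (s, None) = u (s, Some (v (s, None))) \<ominus>\<^bsub>J\<^esub> v (s, Some (u (s, None)))"
  "x \<in> carrier J \<Longrightarrow> tkk_bracket J u v (s, Some x) = u (s, Some (v (s, Some x))) \<ominus>\<^bsub>J\<^esub> v (s, Some (u (s, Some x)))
     \<oplus>\<^bsub>J\<^esub> (V (u (s, None)) (v (\<not> s, None)) x \<ominus>\<^bsub>J\<^esub> V (v (s, None)) (u (\<not> s, None)) x)"
  by (simp_all add: tkk_bracket_def)

lemma tkk_carrierD:
  assumes "u \<in> tkk_carrier R J"
  shows "u (s, None) \<in> carrier J" "x \<in> carrier J \<Longrightarrow> u (s, Some x) \<in> carrier J"
    "\<lbrakk>x \<in> carrier J; y \<in> carrier J\<rbrakk> \<Longrightarrow> u (s, Some (x \<oplus>\<^bsub>J\<^esub> y)) = u (s, Some x) \<oplus>\<^bsub>J\<^esub> u (s, Some y)"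
    "\<lbrakk>a \<in> carrier R; x \<in> carrier J\<rbrakk> \<Longrightarrow> u (s, Some (a \<odot>\<^bsub>J\<^esub> x)) = a \<odot>\<^bsub>J\<^esub> u (s, Some x)"
    "\<lbrakk>x \<in> carrier J; y \<in> carrier J\<rbrakk> \<Longrightarrow> u (s, Some (x \<ominus>\<^bsub>J\<^esub> y)) = u (s, Some x) \<ominus>\<^bsub>J\<^esub> u (s, Some y)"
    "u (s, Some \<zero>\<^bsub>J\<^esub>) = \<zero>\<^bsub>J\<^esub>"
    "\<lbrakk>x \<in> carrier J; y \<in> carrier J; z \<in> carrier J\<rbrakk> \<Longrightarrow> u (s, Some (V x y z)) =
        V (u (s, Some x)) y z \<oplus>\<^bsub>J\<^esub> V x (u (\<not> s, Some y)) z \<oplus>\<^bsub>J\<^esub> V x y (u (s, Some z))"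
proof -
  have lin: "linear_map R J J (\<lambda>x. u (s, Some x))" using assms by (simp add: tkk_carrier_def)
  note l = linear_map_simps[OF lin] linear_map_minus[OF module_axioms module_axioms lin]
  have PiE: "u \<in> tkk_index J \<rightarrow>\<^sub>E carrier J" using assms by (simp add: tkk_carrier_def)
  then show "u (s, None) \<in> carrier J" by (rule PiE_mem) simp
  show "\<lbrakk>x \<in> carrier J; y \<in> carrier J; z \<in> carrier J\<rbrakk> \<Longrightarrow> u (s, Some (V x y z)) =
        V (u (s, Some x)) y z \<oplus>\<^bsub>J\<^esub> V x (u (\<not> s, Some y)) z \<oplus>\<^bsub>J\<^esub> V x y (u (s, Some z))"
    using assms by (simp add: tkk_carrier_def)
  show "x \<in> carrier J \<Longrightarrow> u (s, Some x) \<in> carrier J"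
    "\<lbrakk>x \<in> carrier J; y \<in> carrier J\<rbrakk> \<Longrightarrow> u (s, Some (x \<oplus>\<^bsub>J\<^esub> y)) = u (s, Some x) \<oplus>\<^bsub>J\<^esub> u (s, Some y)"
    "\<lbrakk>a \<in> carrier R; x \<in> carrier J\<rbrakk> \<Longrightarrow> u (s, Some (a \<odot>\<^bsub>J\<^esub> x)) = a \<odot>\<^bsub>J\<^esub> u (s, Some x)"
    "\<lbrakk>x \<in> carrier J; y \<in> carrier J\<rbrakk> \<Longrightarrow> u (s, Some (x \<ominus>\<^bsub>J\<^esub> y)) = u (s, Some x) \<ominus>\<^bsub>J\<^esub> u (s, Some y)"
    "u (s, Some \<zero>\<^bsub>J\<^esub>) = \<zero>\<^bsub>J\<^esub>"
    using l by simp_all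
qed

lemma product_tkk_module: "module R (product_algebra (tkk_index J) (\<lambda>_. J))"
  using product_module[of R "tkk_index J" "\<lambda>_. J"] is_cring module_axioms by simp

lemma tkk_carrierI:
  assumes "\<And>s. u (s, None) \<in> carrier J" "u \<in> extensional (tkk_index J)"
    and "\<And>s x. x \<in> carrier J \<Longrightarrow> u (s, Some x) \<in> carrier J"
    and "\<And>s x y. \<lbrakk>x \<in> carrier J; y \<in> carrier J\<rbrakk> \<Longrightarrow> u (s, Some (x \<oplus>\<^bsub>J\<^esub> y)) = u (s, Some x) \<oplus>\<^bsub>J\<^esub> u (s, Some y)"
    and "\<And>s a x. \<lbrakk>a \<in> carrier R; x \<in> carrier J\<rbrakk> \<Longrightarrow> u (s, Some (a \<odot>\<^bsub>J\<^esub> x)) = a \<odot>\<^bsub>J\<^esub> u (s, Some x)"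
    and "\<And>s x y z. \<lbrakk>x \<in> carrier J; y \<in> carrier J; z \<in> carrier J\<rbrakk> \<Longrightarrow> u (s, Some (V x y z)) =
        V (u (s, Some x)) y z \<oplus>\<^bsub>J\<^esub> V x (u (\<not> s, Some y)) z \<oplus>\<^bsub>J\<^esub> V x y (u (s, Some z))"
  shows "u \<in> tkk_carrier R J"
  unfolding tkk_carrier_def using assms
  by (auto simp: PiE_iff intro!: linear_mapI elim!: tkk_indexE)

lemma tkk_bracket_closed:
  assumes u: "u \<in> tkk_carrier R J" and v: "v \<in> tkk_carrier R J"
  shows "tkk_bracket J u v \<in> tkk_carrier R J"
proof (rule tkk_carrierI)
  note U = tkk_carrierD[OF u] and V = tkk_carrierD[OF v]
  show "tkk_bracket J u v \<in> extensional (tkk_index J)" by (simp add: tkk_bracket_def)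
  show "tkk_bracket J u v (s, None) \<in> carrier J" for s by (simp add: tkk_bracket_apply U V)
  show "tkk_bracket J u v (s, Some x) \<in> carrier J" if "x \<in> carrier J" for s x
    using that by (simp add: tkk_bracket_apply U V)
  show "tkk_bracket J u v (s, Some (x \<oplus>\<^bsub>J\<^esub> y)) = tkk_bracket J u v (s, Some x) \<oplus>\<^bsub>J\<^esub> tkk_bracket J u v (s, Some y)"
    if "x \<in> carrier J" "y \<in> carrier J" for s x y
    using that by (simp add: tkk_bracket_apply U V V_simps) (simp add: U V M.ab_simps)
  show "tkk_bracket J u v (s, Some (a \<odot>\<^bsub>J\<^esub> x)) = a \<odot>\<^bsub>J\<^esub> tkk_bracket J u v (s, Some x)"
    if "a \<in> carrier R" "x \<in> carrier J" for s a x
    using that by (simp add: tkk_bracket_apply U V V_simps smult_r_distr smult_r_diff)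
  fix s x y z assume xyz: "x \<in> carrier J" "y \<in> carrier J" "z \<in> carrier J"
  note five = jordan_triple2_five_linear[OF _ _ xyz]
  show "tkk_bracket J u v (s, Some (V x y z)) =
      V (tkk_bracket J u v (s, Some x)) y z \<oplus>\<^bsub>J\<^esub> V x (tkk_bracket J u v (\<not> s, Some y)) z
      \<oplus>\<^bsub>J\<^esub> V x y (tkk_bracket J u v (s, Some z))"
    by (simp add: xyz tkk_bracket_apply U V V_simps five) (simp add: xyz U V M.ab_simps)
qed

lemma tkk_carrier_submodule: "submodule (tkk_carrier R J) R (product_algebra (tkk_index J) (\<lambda>_. J))"
proof -
  let ?P = "product_algebra (tkk_index J) (\<lambda>_. J)"
  interpret P: module R ?P by (rule product_tkk_module)
  have ext: "u \<in> extensional (tkk_index J)" if "u \<in> carrier ?P" for u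
    using that by (simp add: product_algebra_def PiE_iff)
  have sub: "u \<in> carrier ?P" if "u \<in> tkk_carrier R J" for u
    using that by (auto simp: product_algebra_def tkk_carrier_def)
  have minus: "(\<ominus>\<^bsub>?P\<^esub> u) i = \<ominus>\<^bsub>J\<^esub> u i" if "i \<in> tkk_index J" "u \<in> carrier ?P" for u i
    by (rule product_minus_apply[of R "tkk_index J" "\<lambda>_. J" i u, OF is_cring module_axioms that])
  show ?thesis
  proof (rule P.submoduleI)
    show "tkk_carrier R J \<subseteq> carrier ?P" using sub by (rule subsetI)
    show "\<zero>\<^bsub>?P\<^esub> \<in> tkk_carrier R J"
      by (rule tkk_carrierI) (simp_all add: ext product_apply V_simps)
    show "\<ominus>\<^bsub>?P\<^esub> u \<in> tkk_carrier R J" if u: "u \<in> tkk_carrier R J" for u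
      by (rule tkk_carrierI)
        (simp_all add: ext sub[OF u] minus tkk_carrierD[OF u] V_simps M.minus_add smult_r_minus)
    show "u \<oplus>\<^bsub>?P\<^esub> v \<in> tkk_carrier R J" if u: "u \<in> tkk_carrier R J" and v: "v \<in> tkk_carrier R J" for u v
      by (rule tkk_carrierI)
        (simp_all add: ext sub[OF u] sub[OF v] product_apply tkk_carrierD[OF u] tkk_carrierD[OF v]
          V_simps M.a_ac smult_r_distr)
    show "a \<odot>\<^bsub>?P\<^esub> u \<in> tkk_carrier R J" if a: "a \<in> carrier R" and u: "u \<in> tkk_carrier R J" for a u
      by (rule tkk_carrierI)
        (simp_all add: ext a sub[OF u] product_apply tkk_carrierD[OF u] V_simps smult_r_distr
          smult_assoc1[symmetric] m_comm)
  qed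
qed

lemma tkk_ext:
  assumes u: "u \<in> tkk_carrier R J" and v: "v \<in> tkk_carrier R J"
    and vec: "\<And>s. u (s, None) = v (s, None)" and op: "\<And>s x. x \<in> carrier J \<Longrightarrow> u (s, Some x) = v (s, Some x)"
  shows "u = v"
proof (rule PiE_ext)
  show "u \<in> tkk_index J \<rightarrow>\<^sub>E carrier J" "v \<in> tkk_index J \<rightarrow>\<^sub>E carrier J"
    using u v by (simp_all add: tkk_carrier_def)
  show "u i = v i" if "i \<in> tkk_index J" for i
    using that by (rule tkk_indexE) (simp_all add: vec op)
qed

lemma tkk_simps [simp]:
  "carrier (tkk R J) = tkk_carrier R J" "mult (tkk R J) = tkk_bracket J"
  "(u \<oplus>\<^bsub>tkk R J\<^esub> v) (s, None) = u (s, None) \<oplus>\<^bsub>J\<^esub> v (s, None)"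
  "x \<in> carrier J \<Longrightarrow> (u \<oplus>\<^bsub>tkk R J\<^esub> v) (s, Some x) = u (s, Some x) \<oplus>\<^bsub>J\<^esub> v (s, Some x)"
  "(a \<odot>\<^bsub>tkk R J\<^esub> u) (s, None) = a \<odot>\<^bsub>J\<^esub> u (s, None)"
  "x \<in> carrier J \<Longrightarrow> (a \<odot>\<^bsub>tkk R J\<^esub> u) (s, Some x) = a \<odot>\<^bsub>J\<^esub> u (s, Some x)"
  "\<zero>\<^bsub>tkk R J\<^esub> (s, None) = \<zero>\<^bsub>J\<^esub>" "x \<in> carrier J \<Longrightarrow> \<zero>\<^bsub>tkk R J\<^esub> (s, Some x) = \<zero>\<^bsub>J\<^esub>"
  by (simp_all add: tkk_def product_apply)

lemma tkk_module: "module R (tkk R J)"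
  unfolding tkk_def
  using module_update_mult(1)[OF module.restrict_module[OF product_tkk_module tkk_carrier_submodule]] .

text \<open>
  Only the components need to be compared.  On vectors the Jacobi identity is the outer symmetry of
  the triple product; on operators it is the derivation property.
\<close>

lemma tkk_lie_algebra: "lie_algebra R (tkk R J)"
proof -
  interpret T: module R "tkk R J" by (rule tkk_module)
  note cl = T.M.a_closed[simplified] tkk_bracket_closed T.smult_closed[simplified] T.M.zero_closed[simplified]
  show ?thesis
  proof (rule lie_algebraI[OF tkk_module]; simp only: tkk_simps)
    show "tkk_bracket J u v \<in> tkk_carrier R J" if "u \<in> tkk_carrier R J" "v \<in> tkk_carrier R J" for u v
      using that by (rule tkk_bracket_closed)
    fix u assume u: "u \<in> tkk_carrier R J"
    note U = tkk_carrierD[OF u]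
    show "tkk_bracket J u u = \<zero>\<^bsub>tkk R J\<^esub>"
      by (rule tkk_ext) (simp_all add: u cl U tkk_bracket_apply M.diff_self)
    fix v assume v: "v \<in> tkk_carrier R J"
    note V = tkk_carrierD[OF v]
    show "tkk_bracket J (a \<odot>\<^bsub>tkk R J\<^esub> u) v = a \<odot>\<^bsub>tkk R J\<^esub> tkk_bracket J u v" if "a \<in> carrier R" for a
      by (rule tkk_ext)
        (simp_all add: that u v cl U V tkk_bracket_apply smult_r_distr smult_r_diff V_simps)
    show "tkk_bracket J u (a \<odot>\<^bsub>tkk R J\<^esub> v) = a \<odot>\<^bsub>tkk R J\<^esub> tkk_bracket J u v" if "a \<in> carrier R" for a
      by (rule tkk_ext)
        (simp_all add: that u v cl U V tkk_bracket_apply smult_r_distr smult_r_diff V_simps)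
    fix w assume w: "w \<in> tkk_carrier R J"
    note W = tkk_carrierD[OF w]
    show "tkk_bracket J (u \<oplus>\<^bsub>tkk R J\<^esub> v) w = tkk_bracket J u w \<oplus>\<^bsub>tkk R J\<^esub> tkk_bracket J v w"
      by (rule tkk_ext; simp add: u v w cl U V W tkk_bracket_apply V_simps; simp add: U V W M.ab_simps)
    show "tkk_bracket J u (v \<oplus>\<^bsub>tkk R J\<^esub> w) = tkk_bracket J u v \<oplus>\<^bsub>tkk R J\<^esub> tkk_bracket J u w"
      by (rule tkk_ext; simp add: u v w cl U V W tkk_bracket_apply V_simps; simp add: U V W M.ab_simps)
    show "tkk_bracket J u (tkk_bracket J v w) \<oplus>\<^bsub>tkk R J\<^esub> tkk_bracket J v (tkk_bracket J w u)
        \<oplus>\<^bsub>tkk R J\<^esub> tkk_bracket J w (tkk_bracket J u v) = \<zero>\<^bsub>tkk R J\<^esub>"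
    proof (rule tkk_ext)
      fix s
      have sym: "V (v (s, None)) y (u (s, None)) = V (u (s, None)) y (v (s, None))"
        "V (w (s, None)) y (u (s, None)) = V (u (s, None)) y (w (s, None))"
        "V (w (s, None)) y (v (s, None)) = V (v (s, None)) y (w (s, None))" if "y \<in> carrier J" for y
        using that by (auto intro: jordan_triple2_sym simp: U V W)
      show "(tkk_bracket J u (tkk_bracket J v w) \<oplus>\<^bsub>tkk R J\<^esub> tkk_bracket J v (tkk_bracket J w u)
        \<oplus>\<^bsub>tkk R J\<^esub> tkk_bracket J w (tkk_bracket J u v)) (s, None) = \<zero>\<^bsub>tkk R J\<^esub> (s, None)"
        by (simp add: u v w cl U V W tkk_bracket_apply sym) (simp add: U V W M.ab_simps)
      fix x assume x: "x \<in> carrier J"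
      show "(tkk_bracket J u (tkk_bracket J v w) \<oplus>\<^bsub>tkk R J\<^esub> tkk_bracket J v (tkk_bracket J w u)
        \<oplus>\<^bsub>tkk R J\<^esub> tkk_bracket J w (tkk_bracket J u v)) (s, Some x) = \<zero>\<^bsub>tkk R J\<^esub> (s, Some x)"
        by (simp add: u v w x cl U V W tkk_bracket_apply V_simps) (simp add: x U V W M.ab_simps)
    qed (simp_all add: u v w cl)
  qed
qed

end

section \<open>Lie algebras over a Jordan algebra\<close>

text \<open>
  Two copies of \<open>J\<close> that multiply like the parts of degree \<open>1\<close> and \<open>-1\<close> of a three-graded Lie algebra:
  the double brackets are the triple products of the Jordan pair \<open>(J, J)\<close>.
\<close>

locale jordan_datum = jordan_char_not_2_3 R J + L: lie_algebra R L
  for R (structure) and J (structure) and L (structure) +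
  fixes p q
  assumes p_linear: "linear_map R J L p" and q_linear: "linear_map R J L q"
    and p_p: "\<lbrakk>a \<in> carrier J; b \<in> carrier J\<rbrakk> \<Longrightarrow> p a \<otimes>\<^bsub>L\<^esub> p b = \<zero>\<^bsub>L\<^esub>"
    and q_q: "\<lbrakk>a \<in> carrier J; b \<in> carrier J\<rbrakk> \<Longrightarrow> q a \<otimes>\<^bsub>L\<^esub> q b = \<zero>\<^bsub>L\<^esub>"
    and p_q_p: "\<lbrakk>a \<in> carrier J; b \<in> carrier J; c \<in> carrier J\<rbrakk>
      \<Longrightarrow> (p a \<otimes>\<^bsub>L\<^esub> q b) \<otimes>\<^bsub>L\<^esub> p c = p (jordan_triple2 J a b c)"
    and p_q_q: "\<lbrakk>a \<in> carrier J; b \<in> carrier J; c \<in> carrier J\<rbrakk>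
      \<Longrightarrow> (p a \<otimes>\<^bsub>L\<^esub> q b) \<otimes>\<^bsub>L\<^esub> q c = \<ominus>\<^bsub>L\<^esub> q (jordan_triple2 J b a c)"

sublocale jordan_datum \<subseteq> LV: vector_space_char_not_2_3 R L ..

definition datum_zero where
  "datum_zero R J L p q = lin_span R L {q b \<otimes>\<^bsub>L\<^esub> p a | a b. a \<in> carrier J \<and> b \<in> carrier J}"

text \<open>
  The Lie subalgebra generated by the two copies of \<open>J\<close>; \<open>core_bracket\<close> shows that these three summands
  suffice.
\<close>

definition datum_core where
  "datum_core R J L p q =
     {q b \<oplus>\<^bsub>L\<^esub> z \<oplus>\<^bsub>L\<^esub> p a | a b z. a \<in> carrier J \<and> b \<in> carrier J \<and> z \<in> datum_zero R J L p q}"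

lemma lie_subalgebra:
  assumes L: "lie_algebra R L" and N: "submodule N R L"
    and closed: "\<And>x y. \<lbrakk>x \<in> N; y \<in> N\<rbrakk> \<Longrightarrow> x \<otimes>\<^bsub>L\<^esub> y \<in> N"
  shows "lie_algebra R (L\<lparr>carrier := N\<rparr>)"
proof -
  interpret L: lie_algebra R L by fact
  have sub: "x \<in> carrier L" if "x \<in> N" for x using L.submoduleE(1)[OF N] that by auto
  show ?thesis
    by (rule lie_algebraI[OF L.restrict_module[OF N]])
      (simp_all add: closed sub L.mult_add_left L.mult_add_right L.mult_smult_left L.mult_smult_right
        L.bracket_self L.jacobi)
qed

lemma (in jordan_char_not_2_3) jordan_triple2_one:
  assumes "a \<in> carrier J"
  shows "jordan_triple2 J \<one>\<^bsub>J\<^esub> \<one>\<^bsub>J\<^esub> a = a \<oplus>\<^bsub>J\<^esub> a"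
    and "b \<in> carrier J \<Longrightarrow> jordan_triple2 J a \<one>\<^bsub>J\<^esub> b = a \<otimes>\<^bsub>J\<^esub> b \<oplus>\<^bsub>J\<^esub> a \<otimes>\<^bsub>J\<^esub> b"
proof -
  have 1: "a \<otimes>\<^bsub>J\<^esub> \<one>\<^bsub>J\<^esub> = a" using assms mult_commute[OF unit_closed assms] unit_left by simp
  show "jordan_triple2 J \<one>\<^bsub>J\<^esub> \<one>\<^bsub>J\<^esub> a = a \<oplus>\<^bsub>J\<^esub> a"
    using assms by (simp add: jordan_triple2_def jordan_triple_def unit_closed unit_left M.ab_simps)
  show "jordan_triple2 J a \<one>\<^bsub>J\<^esub> b = a \<otimes>\<^bsub>J\<^esub> b \<oplus>\<^bsub>J\<^esub> a \<otimes>\<^bsub>J\<^esub> b" if "b \<in> carrier J"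
    using assms that by (simp add: jordan_triple2_def jordan_triple_def unit_closed unit_left 1 mult_closed M.ab_simps)
qed

context jordan_datum begin

abbreviation "Z \<equiv> datum_zero R J L p q"
abbreviation "C \<equiv> datum_core R J L p q"
abbreviation "h \<equiv> p \<one>\<^bsub>J\<^esub> \<otimes>\<^bsub>L\<^esub> q \<one>\<^bsub>J\<^esub>"

lemmas p_simps = linear_map_simps[OF p_linear] linear_map_minus[OF module_axioms L.module_axioms p_linear]
lemmas q_simps = linear_map_simps[OF q_linear] linear_map_minus[OF module_axioms L.module_axioms q_linear]

lemma generators_closed: "{q b \<otimes>\<^bsub>L\<^esub> p a | a b. a \<in> carrier J \<and> b \<in> carrier J} \<subseteq> carrier L"
  by (auto simp: p_simps q_simps L.mult_closed)

lemma Z_submodule: "submodule Z R L"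
  unfolding datum_zero_def by (rule L.lin_span_submodule[OF generators_closed])

lemma Z_closed: "z \<in> Z \<Longrightarrow> z \<in> carrier L"
  using L.submoduleE(1)[OF Z_submodule] by auto

lemma q_p_in_Z: "\<lbrakk>a \<in> carrier J; b \<in> carrier J\<rbrakk> \<Longrightarrow> q b \<otimes>\<^bsub>L\<^esub> p a \<in> Z"
  unfolding datum_zero_def by (rule subsetD[OF L.lin_span_superset]) auto

lemma p_q_in_Z: "\<lbrakk>a \<in> carrier J; b \<in> carrier J\<rbrakk> \<Longrightarrow> p a \<otimes>\<^bsub>L\<^esub> q b \<in> Z"
  using L.submoduleE(3)[OF Z_submodule q_p_in_Z] L.bracket_swap[of "p a" "q b"]
  by (simp add: p_simps q_simps)

lemma Z_least: "\<lbrakk>submodule N R L; \<And>a b. \<lbrakk>a \<in> carrier J; b \<in> carrier J\<rbrakk> \<Longrightarrow> q b \<otimes>\<^bsub>L\<^esub> p a \<in> N; z \<in> Z\<rbrakk> \<Longrightarrow> z \<in> N"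
  unfolding datum_zero_def by (rule subsetD[OF L.lin_span_least]) auto

lemma q_p_bracket:
  assumes "a \<in> carrier J" "b \<in> carrier J" "x \<in> carrier L"
  shows "(q b \<otimes>\<^bsub>L\<^esub> p a) \<otimes>\<^bsub>L\<^esub> x = \<ominus>\<^bsub>L\<^esub> ((p a \<otimes>\<^bsub>L\<^esub> q b) \<otimes>\<^bsub>L\<^esub> x)"
  using assms L.bracket_swap[of "q b" "p a"] by (simp add: p_simps q_simps L.mult_closed L.mult_minus)

lemma Z_p:
  assumes z: "z \<in> Z" and c: "c \<in> carrier J" shows "z \<otimes>\<^bsub>L\<^esub> p c \<in> p ` carrier J"
proof -
  have sub: "submodule {z \<in> carrier L. z \<otimes>\<^bsub>L\<^esub> p c \<in> p ` carrier J} R L"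
    using L.submodule_preimage[OF L.module_axioms L.mult_linear_map(2)
        submodule_image[OF L.module_axioms p_linear carrier_is_submodule], of "p c"] c
    by (simp add: p_simps)
  have "z \<in> {z \<in> carrier L. z \<otimes>\<^bsub>L\<^esub> p c \<in> p ` carrier J}"
  proof (rule Z_least[OF sub _ z])
    fix a b assume ab: "a \<in> carrier J" "b \<in> carrier J"
    have "(q b \<otimes>\<^bsub>L\<^esub> p a) \<otimes>\<^bsub>L\<^esub> p c = p (\<ominus>\<^bsub>J\<^esub> jordan_triple2 J a b c)"
      using ab c by (simp add: q_p_bracket p_q_p p_simps)
    then have "(q b \<otimes>\<^bsub>L\<^esub> p a) \<otimes>\<^bsub>L\<^esub> p c \<in> p ` carrier J"
      by (rule ssubst) (rule imageI, simp add: ab c)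
    then show "q b \<otimes>\<^bsub>L\<^esub> p a \<in> {z \<in> carrier L. z \<otimes>\<^bsub>L\<^esub> p c \<in> p ` carrier J}"
      using ab by (simp add: p_simps(1) q_simps(1) L.mult_closed)
  qed
  then show ?thesis by simp
qed

lemma Z_q:
  assumes z: "z \<in> Z" and c: "c \<in> carrier J" shows "z \<otimes>\<^bsub>L\<^esub> q c \<in> q ` carrier J"
proof -
  have sub: "submodule {z \<in> carrier L. z \<otimes>\<^bsub>L\<^esub> q c \<in> q ` carrier J} R L"
    using L.submodule_preimage[OF L.module_axioms L.mult_linear_map(2)
        submodule_image[OF L.module_axioms q_linear carrier_is_submodule], of "q c"] c
    by (simp add: q_simps)
  have "z \<in> {z \<in> carrier L. z \<otimes>\<^bsub>L\<^esub> q c \<in> q ` carrier J}"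
  proof (rule Z_least[OF sub _ z])
    fix a b assume ab: "a \<in> carrier J" "b \<in> carrier J"
    have "(q b \<otimes>\<^bsub>L\<^esub> p a) \<otimes>\<^bsub>L\<^esub> q c = q (jordan_triple2 J b a c)"
      using ab c by (simp add: q_p_bracket p_q_q q_simps)
    then have "(q b \<otimes>\<^bsub>L\<^esub> p a) \<otimes>\<^bsub>L\<^esub> q c \<in> q ` carrier J"
      by (rule ssubst) (rule imageI, simp add: ab c)
    then show "q b \<otimes>\<^bsub>L\<^esub> p a \<in> {z \<in> carrier L. z \<otimes>\<^bsub>L\<^esub> q c \<in> q ` carrier J}"
      using ab by (simp add: p_simps(1) q_simps(1) L.mult_closed)
  qed
  then show ?thesis by simp
qed

lemma Z_Z:
  assumes z: "z \<in> Z" and w: "w \<in> Z" shows "z \<otimes>\<^bsub>L\<^esub> w \<in> Z"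
proof -
  have sub: "submodule {w \<in> carrier L. z \<otimes>\<^bsub>L\<^esub> w \<in> Z} R L"
    using L.submodule_preimage[OF L.module_axioms L.mult_linear_map(1) Z_submodule] z Z_closed by auto
  have "w \<in> {w \<in> carrier L. z \<otimes>\<^bsub>L\<^esub> w \<in> Z}"
  proof (rule Z_least[OF sub _ w])
    fix a b assume ab: "a \<in> carrier J" "b \<in> carrier J"
    obtain a' where a': "a' \<in> carrier J" "z \<otimes>\<^bsub>L\<^esub> p a = p a'" using Z_p[OF z ab(1)] by auto
    obtain b' where b': "b' \<in> carrier J" "z \<otimes>\<^bsub>L\<^esub> q b = q b'" using Z_q[OF z ab(2)] by auto
    have "z \<otimes>\<^bsub>L\<^esub> (q b \<otimes>\<^bsub>L\<^esub> p a) = q b' \<otimes>\<^bsub>L\<^esub> p a \<oplus>\<^bsub>L\<^esub> q b \<otimes>\<^bsub>L\<^esub> p a'"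
      using L.bracket_derivation[of z "q b" "p a"] ab z Z_closed a' b' by (simp add: p_simps q_simps)
    then show "q b \<otimes>\<^bsub>L\<^esub> p a \<in> {w \<in> carrier L. z \<otimes>\<^bsub>L\<^esub> w \<in> Z}"
      using ab a' b' q_p_in_Z L.submoduleE(5)[OF Z_submodule] by (simp add: Z_closed)
  qed
  then show ?thesis by simp
qed

lemma coreI: "\<lbrakk>a \<in> carrier J; b \<in> carrier J; z \<in> Z\<rbrakk> \<Longrightarrow> q b \<oplus>\<^bsub>L\<^esub> z \<oplus>\<^bsub>L\<^esub> p a \<in> C"
  unfolding datum_core_def by blast

lemma coreE:
  assumes "x \<in> C" obtains a b z where "a \<in> carrier J" "b \<in> carrier J" "z \<in> Z" "x = q b \<oplus>\<^bsub>L\<^esub> z \<oplus>\<^bsub>L\<^esub> p a"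
  using assms unfolding datum_core_def by blast

lemma Z_zero: "\<zero>\<^bsub>L\<^esub> \<in> Z" by (rule L.submodule_zero[OF Z_submodule])

lemma parts_in_core: "a \<in> carrier J \<Longrightarrow> p a \<in> C" "b \<in> carrier J \<Longrightarrow> q b \<in> C" "z \<in> Z \<Longrightarrow> z \<in> C"
  using coreI[of a "\<zero>\<^bsub>J\<^esub>" "\<zero>\<^bsub>L\<^esub>"] coreI[of "\<zero>\<^bsub>J\<^esub>" b "\<zero>\<^bsub>L\<^esub>"] coreI[of "\<zero>\<^bsub>J\<^esub>" "\<zero>\<^bsub>J\<^esub>" z] Z_zero Z_closed
  by (simp_all add: p_simps q_simps)

lemma core_submodule: "submodule C R L"
proof (rule L.submoduleI)
  note cl = p_simps(1) q_simps(1) Z_closed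
  show "C \<subseteq> carrier L" by (auto elim!: coreE simp: cl)
  show "\<zero>\<^bsub>L\<^esub> \<in> C" by (rule parts_in_core(3)[OF Z_zero])
  show "\<ominus>\<^bsub>L\<^esub> x \<in> C" if "x \<in> C" for x
    using that
  proof (rule coreE)
    fix a b z assume *: "a \<in> carrier J" "b \<in> carrier J" "z \<in> Z" "x = q b \<oplus>\<^bsub>L\<^esub> z \<oplus>\<^bsub>L\<^esub> p a"
    then have "\<ominus>\<^bsub>L\<^esub> x = q (\<ominus>\<^bsub>J\<^esub> b) \<oplus>\<^bsub>L\<^esub> \<ominus>\<^bsub>L\<^esub> z \<oplus>\<^bsub>L\<^esub> p (\<ominus>\<^bsub>J\<^esub> a)"
      by (simp add: cl p_simps q_simps L.M.minus_add)
    then show "\<ominus>\<^bsub>L\<^esub> x \<in> C" using * coreI[of "\<ominus>\<^bsub>J\<^esub> a" "\<ominus>\<^bsub>J\<^esub> b" "\<ominus>\<^bsub>L\<^esub> z"] L.submoduleE(3)[OF Z_submodule] by simp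
  qed
  show "x \<oplus>\<^bsub>L\<^esub> y \<in> C" if x: "x \<in> C" and y: "y \<in> C" for x y
  proof -
    obtain a b z where *: "a \<in> carrier J" "b \<in> carrier J" "z \<in> Z" "x = q b \<oplus>\<^bsub>L\<^esub> z \<oplus>\<^bsub>L\<^esub> p a" using x by (rule coreE)
    obtain a' b' z' where **: "a' \<in> carrier J" "b' \<in> carrier J" "z' \<in> Z" "y = q b' \<oplus>\<^bsub>L\<^esub> z' \<oplus>\<^bsub>L\<^esub> p a'"
      using y by (rule coreE)
    have "x \<oplus>\<^bsub>L\<^esub> y = q (b \<oplus>\<^bsub>J\<^esub> b') \<oplus>\<^bsub>L\<^esub> (z \<oplus>\<^bsub>L\<^esub> z') \<oplus>\<^bsub>L\<^esub> p (a \<oplus>\<^bsub>J\<^esub> a')"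
      using * ** by (simp add: cl p_simps q_simps L.M.a_ac)
    then show ?thesis using coreI[of "a \<oplus>\<^bsub>J\<^esub> a'" "b \<oplus>\<^bsub>J\<^esub> b'" "z \<oplus>\<^bsub>L\<^esub> z'"] * ** L.submoduleE(5)[OF Z_submodule] by simp
  qed
  show "r \<odot>\<^bsub>L\<^esub> x \<in> C" if r: "r \<in> carrier R" and x: "x \<in> C" for r x
  proof -
    obtain a b z where *: "a \<in> carrier J" "b \<in> carrier J" "z \<in> Z" "x = q b \<oplus>\<^bsub>L\<^esub> z \<oplus>\<^bsub>L\<^esub> p a" using x by (rule coreE)
    then have "r \<odot>\<^bsub>L\<^esub> x = q (r \<odot>\<^bsub>J\<^esub> b) \<oplus>\<^bsub>L\<^esub> r \<odot>\<^bsub>L\<^esub> z \<oplus>\<^bsub>L\<^esub> p (r \<odot>\<^bsub>J\<^esub> a)"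
      using r by (simp add: cl p_simps q_simps L.smult_r_distr)
    then show ?thesis using coreI[of "r \<odot>\<^bsub>J\<^esub> a" "r \<odot>\<^bsub>J\<^esub> b" "r \<odot>\<^bsub>L\<^esub> z"] * r L.submoduleE(4)[OF Z_submodule] by simp
  qed
qed

lemma core_closed: "x \<in> C \<Longrightarrow> x \<in> carrier L"
  using L.submoduleE(1)[OF core_submodule] by auto

lemma core_add: "\<lbrakk>x \<in> C; y \<in> C\<rbrakk> \<Longrightarrow> x \<oplus>\<^bsub>L\<^esub> y \<in> C"
  by (rule L.submoduleE(5)[OF core_submodule])

lemma core_bracket:
  assumes x: "x \<in> C" and y: "y \<in> C" shows "x \<otimes>\<^bsub>L\<^esub> y \<in> C"
proof -
  have neg: "u \<otimes>\<^bsub>L\<^esub> v \<in> C" if "v \<otimes>\<^bsub>L\<^esub> u \<in> C" "u \<in> carrier L" "v \<in> carrier L" for u v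
    using L.submoduleE(3)[OF core_submodule that(1)] L.bracket_swap[OF that(2,3)] by simp
  obtain a b z where *: "a \<in> carrier J" "b \<in> carrier J" "z \<in> Z" "x = q b \<oplus>\<^bsub>L\<^esub> z \<oplus>\<^bsub>L\<^esub> p a" using x by (rule coreE)
  obtain a' b' z' where **: "a' \<in> carrier J" "b' \<in> carrier J" "z' \<in> Z" "y = q b' \<oplus>\<^bsub>L\<^esub> z' \<oplus>\<^bsub>L\<^esub> p a'"
    using y by (rule coreE)
  note cl = *(1-3) **(1-3) p_simps(1) q_simps(1) Z_closed L.mult_closed
  have 1: "z \<otimes>\<^bsub>L\<^esub> p a' \<in> C" "z' \<otimes>\<^bsub>L\<^esub> p a \<in> C" 
    using Z_p[of z a'] Z_p[of z' a] parts_in_core(1) * ** by auto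
  have 2: "z \<otimes>\<^bsub>L\<^esub> q b' \<in> C" "z' \<otimes>\<^bsub>L\<^esub> q b \<in> C" 
    using Z_q[of z b'] Z_q[of z' b] parts_in_core(2) * ** by auto
  have 3: "p a \<otimes>\<^bsub>L\<^esub> z' \<in> C" "q b \<otimes>\<^bsub>L\<^esub> z' \<in> C" using neg 1 2 cl by simp_all
  have 4: "z \<otimes>\<^bsub>L\<^esub> z' \<in> C" "q b \<otimes>\<^bsub>L\<^esub> p a' \<in> C" "p a \<otimes>\<^bsub>L\<^esub> q b' \<in> C"
    using parts_in_core(3) Z_Z q_p_in_Z p_q_in_Z * ** by simp_all
  have "x \<otimes>\<^bsub>L\<^esub> y = (z \<otimes>\<^bsub>L\<^esub> q b' \<oplus>\<^bsub>L\<^esub> p a \<otimes>\<^bsub>L\<^esub> q b') \<oplus>\<^bsub>L\<^esub> ((q b \<otimes>\<^bsub>L\<^esub> z' \<oplus>\<^bsub>L\<^esub> z \<otimes>\<^bsub>L\<^esub> z' \<oplus>\<^bsub>L\<^esub> p a \<otimes>\<^bsub>L\<^esub> z')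
      \<oplus>\<^bsub>L\<^esub> (q b \<otimes>\<^bsub>L\<^esub> p a' \<oplus>\<^bsub>L\<^esub> z \<otimes>\<^bsub>L\<^esub> p a'))"
    unfolding *(4) **(4) by (simp add: cl L.mult_distribs p_p q_q L.M.a_ac)
  then show ?thesis using 1 2 3 4 by (simp add: core_add)
qed

lemma core_lie_algebra: "lie_algebra R (L\<lparr>carrier := C\<rparr>)"
  by (rule lie_subalgebra[OF L.lie_algebra_axioms core_submodule core_bracket])

lemma h_closed: "h \<in> carrier L" by (simp add: p_simps q_simps unit_closed L.mult_closed)

text \<open>
  From \<open>{1 1 a} = a\<close> it follows that \<open>h\<close> acts on the two copies of \<open>J\<close> by \<open>2\<close> and \<open>-2\<close>, hence on the
  brackets between them by \<open>0\<close>.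
\<close>

lemma h_p: "a \<in> carrier J \<Longrightarrow> h \<otimes>\<^bsub>L\<^esub> p a = p a \<oplus>\<^bsub>L\<^esub> p a"
  by (simp add: p_q_p unit_closed unit_left jordan_triple2_one p_simps)

lemma h_q: "a \<in> carrier J \<Longrightarrow> h \<otimes>\<^bsub>L\<^esub> q a = \<ominus>\<^bsub>L\<^esub> (q a \<oplus>\<^bsub>L\<^esub> q a)"
  by (simp add: p_q_q unit_closed unit_left jordan_triple2_one q_simps)

lemma h_Z:
  assumes "z \<in> Z" shows "h \<otimes>\<^bsub>L\<^esub> z = \<zero>\<^bsub>L\<^esub>"
proof -
  have sub: "submodule {w \<in> carrier L. h \<otimes>\<^bsub>L\<^esub> w \<in> {\<zero>\<^bsub>L\<^esub>}} R L"
    by (rule L.submodule_preimage[OF L.module_axioms L.mult_linear_map(1)[OF h_closed] L.zero_submodule])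
  have "z \<in> {w \<in> carrier L. h \<otimes>\<^bsub>L\<^esub> w \<in> {\<zero>\<^bsub>L\<^esub>}}"
  proof (rule Z_least[OF sub _ assms])
    fix a b assume ab: "a \<in> carrier J" "b \<in> carrier J"
    have "h \<otimes>\<^bsub>L\<^esub> (q b \<otimes>\<^bsub>L\<^esub> p a) = \<zero>\<^bsub>L\<^esub>"
      using ab L.bracket_derivation[of h "q b" "p a"]
      by (simp add: h_closed h_p h_q p_simps(1) q_simps(1) L.mult_closed L.mult_distribs L.M.ab_simps)
    then show "q b \<otimes>\<^bsub>L\<^esub> p a \<in> {w \<in> carrier L. h \<otimes>\<^bsub>L\<^esub> w \<in> {\<zero>\<^bsub>L\<^esub>}}"
      using ab by (simp add: p_simps q_simps L.mult_closed)
  qed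
  then show ?thesis by simp
qed

lemma h_core:
  assumes "a \<in> carrier J" "b \<in> carrier J" "z \<in> Z"
  shows "h \<otimes>\<^bsub>L\<^esub> (q b \<oplus>\<^bsub>L\<^esub> z \<oplus>\<^bsub>L\<^esub> p a) = p a \<oplus>\<^bsub>L\<^esub> p a \<ominus>\<^bsub>L\<^esub> (q b \<oplus>\<^bsub>L\<^esub> q b)"
  using assms by (simp add: h_closed h_p h_q h_Z L.mult_add_right p_simps(1) q_simps(1) Z_closed L.M.ab_simps)

text \<open>Eigenvectors of \<open>h\<close> for the eigenvalues \<open>-2, 0, 2\<close>, which differ by units, are independent.\<close>

lemma core_direct:
  assumes a: "a \<in> carrier J" and b: "b \<in> carrier J" and z: "z \<in> Z" and 0: "q b \<oplus>\<^bsub>L\<^esub> z \<oplus>\<^bsub>L\<^esub> p a = \<zero>\<^bsub>L\<^esub>"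
  shows "p a = \<zero>\<^bsub>L\<^esub>" "q b = \<zero>\<^bsub>L\<^esub>" "z = \<zero>\<^bsub>L\<^esub>"
proof -
  note cl = a b z p_simps(1) q_simps(1) Z_closed h_closed
  have "p a \<oplus>\<^bsub>L\<^esub> p a \<ominus>\<^bsub>L\<^esub> (q b \<oplus>\<^bsub>L\<^esub> q b) = h \<otimes>\<^bsub>L\<^esub> \<zero>\<^bsub>L\<^esub>" using h_core[OF a b z] 0 by simp
  then have "p a \<oplus>\<^bsub>L\<^esub> p a = q b \<oplus>\<^bsub>L\<^esub> q b" by (simp add: cl L.mult_zero L.M.ab_simps)
  then have pq: "p a = q b" by (rule LV.double_cancel) (simp_all add: cl)
  have "p a \<oplus>\<^bsub>L\<^esub> p a = \<ominus>\<^bsub>L\<^esub> (p a \<oplus>\<^bsub>L\<^esub> p a)" using h_p[OF a] h_q[OF b] pq by simp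
  then have "(p a \<oplus>\<^bsub>L\<^esub> p a) \<oplus>\<^bsub>L\<^esub> (p a \<oplus>\<^bsub>L\<^esub> p a) = \<zero>\<^bsub>L\<^esub>" by (simp add: cl L.M.ab_simps)
  then have "p a \<oplus>\<^bsub>L\<^esub> p a = \<zero>\<^bsub>L\<^esub>" by (rule LV.double_eq_zero) (simp add: cl)
  then show "p a = \<zero>\<^bsub>L\<^esub>" by (rule LV.double_eq_zero) (simp add: cl)
  with pq show "q b = \<zero>\<^bsub>L\<^esub>" by simp
  with \<open>p a = \<zero>\<^bsub>L\<^esub>\<close> 0 show "z = \<zero>\<^bsub>L\<^esub>" by (simp add: cl)
qed

lemma core_weight_spaces:
  shows "weight_space (L\<lparr>carrier := C\<rparr>) h 1 = p ` carrier J"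
    and "weight_space (L\<lparr>carrier := C\<rparr>) h (-1) = q ` carrier J"
    and "weight_space (L\<lparr>carrier := C\<rparr>) h 0 = Z"
proof -
  interpret C: lie_algebra R "L\<lparr>carrier := C\<rparr>" by (rule core_lie_algebra)
  note int = C.M.int_mult_simps[simplified]
  note cl = p_simps(1) q_simps(1) Z_closed h_closed
  have neg: "\<ominus>\<^bsub>L\<lparr>carrier := C\<rparr>\<^esub> x = \<ominus>\<^bsub>L\<^esub> x" if "x \<in> C" for x
    using L.restrict_minus[OF core_submodule that] .
  have w1: "weight_space (L\<lparr>carrier := C\<rparr>) h 1 = {x \<in> C. h \<otimes>\<^bsub>L\<^esub> x = x \<oplus>\<^bsub>L\<^esub> x}"
    by (auto simp: weight_space_def int)
  have w2: "weight_space (L\<lparr>carrier := C\<rparr>) h (-1) = {x \<in> C. h \<otimes>\<^bsub>L\<^esub> x = \<ominus>\<^bsub>L\<^esub> (x \<oplus>\<^bsub>L\<^esub> x)}"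
    by (auto simp: weight_space_def int neg core_add)
  have w0: "weight_space (L\<lparr>carrier := C\<rparr>) h 0 = {x \<in> C. h \<otimes>\<^bsub>L\<^esub> x = \<zero>\<^bsub>L\<^esub>}"
    by (auto simp: weight_space_def int)
  have double: "a \<oplus>\<^bsub>J\<^esub> a \<in> carrier J" "q (a \<oplus>\<^bsub>J\<^esub> a) = q a \<oplus>\<^bsub>L\<^esub> q a" "p (a \<oplus>\<^bsub>J\<^esub> a) = p a \<oplus>\<^bsub>L\<^esub> p a" if "a \<in> carrier J" for a
    using that by (simp_all add: p_simps q_simps)
  have Z_double: "z \<oplus>\<^bsub>L\<^esub> z \<in> Z" if "z \<in> Z" for z using that L.submoduleE(5)[OF Z_submodule] by simp
  show "weight_space (L\<lparr>carrier := C\<rparr>) h 1 = p ` carrier J" unfolding w1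
  proof (intro equalityI subsetI)
    fix x assume "x \<in> {x \<in> C. h \<otimes>\<^bsub>L\<^esub> x = x \<oplus>\<^bsub>L\<^esub> x}"
    then obtain a b z where *: "a \<in> carrier J" "b \<in> carrier J" "z \<in> Z" "x = q b \<oplus>\<^bsub>L\<^esub> z \<oplus>\<^bsub>L\<^esub> p a"
      and h: "h \<otimes>\<^bsub>L\<^esub> x = x \<oplus>\<^bsub>L\<^esub> x" by (auto elim: coreE)
    have "q (b \<oplus>\<^bsub>J\<^esub> b \<oplus>\<^bsub>J\<^esub> (b \<oplus>\<^bsub>J\<^esub> b)) \<oplus>\<^bsub>L\<^esub> (z \<oplus>\<^bsub>L\<^esub> z) \<oplus>\<^bsub>L\<^esub> p \<zero>\<^bsub>J\<^esub> = (x \<oplus>\<^bsub>L\<^esub> x) \<ominus>\<^bsub>L\<^esub> h \<otimes>\<^bsub>L\<^esub> x"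
      unfolding *(4) h_core[OF *(1-3)] using *(1-3) by (simp add: cl p_simps(4) q_simps(2) L.M.ab_simps)
    also have "\<dots> = \<zero>\<^bsub>L\<^esub>" unfolding h using * by (simp add: cl L.M.diff_self)
    finally have 0: "q (b \<oplus>\<^bsub>J\<^esub> b \<oplus>\<^bsub>J\<^esub> (b \<oplus>\<^bsub>J\<^esub> b)) \<oplus>\<^bsub>L\<^esub> (z \<oplus>\<^bsub>L\<^esub> z) \<oplus>\<^bsub>L\<^esub> p \<zero>\<^bsub>J\<^esub> = \<zero>\<^bsub>L\<^esub>" .
    have "q b \<oplus>\<^bsub>L\<^esub> q b \<oplus>\<^bsub>L\<^esub> (q b \<oplus>\<^bsub>L\<^esub> q b) = \<zero>\<^bsub>L\<^esub>" "z \<oplus>\<^bsub>L\<^esub> z = \<zero>\<^bsub>L\<^esub>"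
      using core_direct(2,3)[OF _ _ _ 0] * Z_double by (simp_all add: q_simps)
    then have "q b = \<zero>\<^bsub>L\<^esub>" "z = \<zero>\<^bsub>L\<^esub>" using *(1-3) by (simp_all add: cl LV.double_eq_zero_iff)
    then show "x \<in> p ` carrier J" using * by (simp add: cl)
  qed (auto simp: h_p parts_in_core)
  show "weight_space (L\<lparr>carrier := C\<rparr>) h (-1) = q ` carrier J" unfolding w2
  proof (intro equalityI subsetI)
    fix x assume "x \<in> {x \<in> C. h \<otimes>\<^bsub>L\<^esub> x = \<ominus>\<^bsub>L\<^esub> (x \<oplus>\<^bsub>L\<^esub> x)}"
    then obtain a b z where *: "a \<in> carrier J" "b \<in> carrier J" "z \<in> Z" "x = q b \<oplus>\<^bsub>L\<^esub> z \<oplus>\<^bsub>L\<^esub> p a"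
      and h: "h \<otimes>\<^bsub>L\<^esub> x = \<ominus>\<^bsub>L\<^esub> (x \<oplus>\<^bsub>L\<^esub> x)" by (auto elim: coreE)
    have "q \<zero>\<^bsub>J\<^esub> \<oplus>\<^bsub>L\<^esub> (z \<oplus>\<^bsub>L\<^esub> z) \<oplus>\<^bsub>L\<^esub> p (a \<oplus>\<^bsub>J\<^esub> a \<oplus>\<^bsub>J\<^esub> (a \<oplus>\<^bsub>J\<^esub> a)) = (x \<oplus>\<^bsub>L\<^esub> x) \<oplus>\<^bsub>L\<^esub> h \<otimes>\<^bsub>L\<^esub> x"
      unfolding *(4) h_core[OF *(1-3)] using *(1-3) by (simp add: cl q_simps(4) p_simps(2) L.M.ab_simps)
    also have "\<dots> = \<zero>\<^bsub>L\<^esub>" unfolding h using * by (simp add: cl L.M.r_neg)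
    finally have 0: "q \<zero>\<^bsub>J\<^esub> \<oplus>\<^bsub>L\<^esub> (z \<oplus>\<^bsub>L\<^esub> z) \<oplus>\<^bsub>L\<^esub> p (a \<oplus>\<^bsub>J\<^esub> a \<oplus>\<^bsub>J\<^esub> (a \<oplus>\<^bsub>J\<^esub> a)) = \<zero>\<^bsub>L\<^esub>" .
    have "p a \<oplus>\<^bsub>L\<^esub> p a \<oplus>\<^bsub>L\<^esub> (p a \<oplus>\<^bsub>L\<^esub> p a) = \<zero>\<^bsub>L\<^esub>" "z \<oplus>\<^bsub>L\<^esub> z = \<zero>\<^bsub>L\<^esub>"
      using core_direct(1,3)[OF _ _ _ 0] * Z_double by (simp_all add: p_simps)
    then have "p a = \<zero>\<^bsub>L\<^esub>" "z = \<zero>\<^bsub>L\<^esub>" using *(1-3) by (simp_all add: cl LV.double_eq_zero_iff)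
    then show "x \<in> q ` carrier J" using * by (simp add: cl)
  qed (auto simp: h_q parts_in_core)
  show "weight_space (L\<lparr>carrier := C\<rparr>) h 0 = Z" unfolding w0
  proof (intro equalityI subsetI)
    fix x assume "x \<in> {x \<in> C. h \<otimes>\<^bsub>L\<^esub> x = \<zero>\<^bsub>L\<^esub>}"
    then obtain a b z where *: "a \<in> carrier J" "b \<in> carrier J" "z \<in> Z" "x = q b \<oplus>\<^bsub>L\<^esub> z \<oplus>\<^bsub>L\<^esub> p a"
      and h: "h \<otimes>\<^bsub>L\<^esub> x = \<zero>\<^bsub>L\<^esub>" by (auto elim: coreE)
    have 0: "q (\<ominus>\<^bsub>J\<^esub> (b \<oplus>\<^bsub>J\<^esub> b)) \<oplus>\<^bsub>L\<^esub> \<zero>\<^bsub>L\<^esub> \<oplus>\<^bsub>L\<^esub> p (a \<oplus>\<^bsub>J\<^esub> a) = \<zero>\<^bsub>L\<^esub>"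
      using h h_core[OF *(1-3)] *(1-3) unfolding *(4) by (simp add: cl q_simps(2,5) p_simps(2) L.M.ab_simps)
    have "p a \<oplus>\<^bsub>L\<^esub> p a = \<zero>\<^bsub>L\<^esub>" "\<ominus>\<^bsub>L\<^esub> (q b \<oplus>\<^bsub>L\<^esub> q b) = \<zero>\<^bsub>L\<^esub>"
      using core_direct(1,2)[OF _ _ _ 0] * Z_zero by (simp_all add: p_simps q_simps)
    then have "p a = \<zero>\<^bsub>L\<^esub>" "q b \<oplus>\<^bsub>L\<^esub> q b = \<zero>\<^bsub>L\<^esub>" using *(1-3) by (simp_all add: cl L.M.minus_across LV.double_eq_zero_iff)
    then have "p a = \<zero>\<^bsub>L\<^esub>" "q b = \<zero>\<^bsub>L\<^esub>" using *(1-3) by (simp_all add: cl LV.double_eq_zero_iff)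
    then show "x \<in> Z" using * by (simp add: cl)
  qed (auto simp: h_Z parts_in_core)
qed

text \<open>
  The decomposition is the one into eigenspaces of \<open>h\<close>, and the part of weight zero consists of
  brackets by construction.
\<close>

theorem core_A1_graded: "A1_graded R (L\<lparr>carrier := C\<rparr>) (h, p \<one>\<^bsub>J\<^esub>, q \<one>\<^bsub>J\<^esub>)"
proof -
  interpret C: lie_algebra R "L\<lparr>carrier := C\<rparr>" by (rule core_lie_algebra)
  note cl = p_simps(1) q_simps(1) Z_closed h_closed
  have h_in_core: "h \<in> C" using parts_in_core(3) p_q_in_Z unit_closed by simp
  have "bij_betw (\<lambda>(x, y, z). x \<oplus>\<^bsub>L\<^esub> y \<oplus>\<^bsub>L\<^esub> z) (q ` carrier J \<times> Z \<times> p ` carrier J) C"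
    unfolding bij_betw_def
  proof
    show "inj_on (\<lambda>(x, y, z). x \<oplus>\<^bsub>L\<^esub> y \<oplus>\<^bsub>L\<^esub> z) (q ` carrier J \<times> Z \<times> p ` carrier J)"
    proof (rule inj_onI, clarsimp)
      fix b z a b' z' a'
      assume *: "b \<in> carrier J" "z \<in> Z" "a \<in> carrier J" "b' \<in> carrier J" "z' \<in> Z" "a' \<in> carrier J"
        and eq: "q b \<oplus>\<^bsub>L\<^esub> z \<oplus>\<^bsub>L\<^esub> p a = q b' \<oplus>\<^bsub>L\<^esub> z' \<oplus>\<^bsub>L\<^esub> p a'"
      have "q (b \<ominus>\<^bsub>J\<^esub> b') \<oplus>\<^bsub>L\<^esub> (z \<ominus>\<^bsub>L\<^esub> z') \<oplus>\<^bsub>L\<^esub> p (a \<ominus>\<^bsub>J\<^esub> a') = \<zero>\<^bsub>L\<^esub>"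
        using eq * by (simp add: cl p_simps(6) q_simps(6) L.M.ab_simps)
      from core_direct[OF _ _ _ this] * L.submodule_diff[OF Z_submodule]
      have "q (b \<ominus>\<^bsub>J\<^esub> b') = \<zero>\<^bsub>L\<^esub>" "z \<ominus>\<^bsub>L\<^esub> z' = \<zero>\<^bsub>L\<^esub>" "p (a \<ominus>\<^bsub>J\<^esub> a') = \<zero>\<^bsub>L\<^esub>" by simp_all
      then show "q b = q b' \<and> z = z' \<and> p a = p a'"
        using * by (simp add: cl p_simps(6) q_simps(6) L.M.diff_eq_zero_iff)
    qed
    show "(\<lambda>(x, y, z). x \<oplus>\<^bsub>L\<^esub> y \<oplus>\<^bsub>L\<^esub> z) ` (q ` carrier J \<times> Z \<times> p ` carrier J) = C"
      unfolding datum_core_def by (force simp: image_iff)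
  qed
  moreover have "lin_span R (L\<lparr>carrier := C\<rparr>) {x \<otimes>\<^bsub>L\<^esub> y | x y. x \<in> q ` carrier J \<and> y \<in> p ` carrier J} = Z"
  proof -
    have eq: "{x \<otimes>\<^bsub>L\<^esub> y | x y. x \<in> q ` carrier J \<and> y \<in> p ` carrier J} =
        {q b \<otimes>\<^bsub>L\<^esub> p a | a b. a \<in> carrier J \<and> b \<in> carrier J}" by blast
    show ?thesis unfolding eq datum_zero_def
      by (rule L.lin_span_restrict[OF core_submodule]) (auto intro: parts_in_core(3) q_p_in_Z)
  qed
  moreover have "sl2_triple (L\<lparr>carrier := C\<rparr>) (h, p \<one>\<^bsub>J\<^esub>, q \<one>\<^bsub>J\<^esub>)"
    using h_p[OF unit_closed] h_q[OF unit_closed] parts_in_core unit_closed h_in_core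
    by (simp add: sl2_triple_def C.M.int_mult_simps[simplified] L.restrict_minus[OF core_submodule] core_add)
  ultimately show ?thesis
    using core_lie_algebra unfolding A1_graded_def prod.case core_weight_spaces by simp
qed

end

section \<open>Constructions of such Lie algebras\<close>

lemma (in module) lin_span_image:
  assumes "module R N" "linear_map R M N \<phi>" "S \<subseteq> carrier M"
  shows "\<phi> ` lin_span R M S = lin_span R N (\<phi> ` S)"
proof -
  interpret N: module R N by fact
  have \<phi>S: "\<phi> ` S \<subseteq> carrier N" using assms(3) by (auto simp: linear_map_simps[OF assms(2)])
  have "S \<subseteq> {x \<in> carrier M. \<phi> x \<in> lin_span R N (\<phi> ` S)}"
    using assms(3) N.lin_span_superset[of "\<phi> ` S"] by auto
  then have "lin_span R M S \<subseteq> {x \<in> carrier M. \<phi> x \<in> lin_span R N (\<phi> ` S)}"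
    by (rule lin_span_least[OF submodule_preimage[OF assms(1,2) N.lin_span_submodule[OF \<phi>S]]])
  moreover have "lin_span R N (\<phi> ` S) \<subseteq> \<phi> ` lin_span R M S"
    by (rule N.lin_span_least[OF submodule_image[OF assms(1,2) lin_span_submodule[OF assms(3)]]])
      (use lin_span_superset in auto)
  ultimately show ?thesis by auto
qed

lemma jordan_datumI:
  assumes "jordan_char_not_2_3 R J" "lie_algebra R L" "linear_map R J L p" "linear_map R J L q"
    and "\<And>a b. \<lbrakk>a \<in> carrier J; b \<in> carrier J\<rbrakk> \<Longrightarrow> p a \<otimes>\<^bsub>L\<^esub> p b = \<zero>\<^bsub>L\<^esub>"
    and "\<And>a b. \<lbrakk>a \<in> carrier J; b \<in> carrier J\<rbrakk> \<Longrightarrow> q a \<otimes>\<^bsub>L\<^esub> q b = \<zero>\<^bsub>L\<^esub>"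
    and "\<And>a b c. \<lbrakk>a \<in> carrier J; b \<in> carrier J; c \<in> carrier J\<rbrakk>
      \<Longrightarrow> (p a \<otimes>\<^bsub>L\<^esub> q b) \<otimes>\<^bsub>L\<^esub> p c = p (jordan_triple2 J a b c)"
    and "\<And>a b c. \<lbrakk>a \<in> carrier J; b \<in> carrier J; c \<in> carrier J\<rbrakk>
      \<Longrightarrow> (p a \<otimes>\<^bsub>L\<^esub> q b) \<otimes>\<^bsub>L\<^esub> q c = \<ominus>\<^bsub>L\<^esub> q (jordan_triple2 J b a c)"
  shows "jordan_datum R J L p q"
  using assms by (simp add: jordan_datum_def jordan_datum_axioms_def)

context jordan_datum begin

lemma core_datum: "jordan_datum R J (L\<lparr>carrier := C\<rparr>) p q"
proof (rule jordan_datumI)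
  show "jordan_char_not_2_3 R J" by (rule jordan_char_not_2_3_axioms)
  show "lie_algebra R (L\<lparr>carrier := C\<rparr>)" by (rule core_lie_algebra)
  show "linear_map R J (L\<lparr>carrier := C\<rparr>) p" "linear_map R J (L\<lparr>carrier := C\<rparr>) q"
    by (auto intro!: linear_mapI simp: parts_in_core p_simps q_simps)
qed (simp_all add: p_p q_q p_q_p p_q_q L.restrict_minus[OF core_submodule] parts_in_core)

lemma core_of_core: "datum_core R J (L\<lparr>carrier := C\<rparr>) p q = C"
proof -
  have "datum_zero R J (L\<lparr>carrier := C\<rparr>) p q = Z"
    unfolding datum_zero_def
    by (simp, rule L.lin_span_restrict[OF core_submodule]) (auto intro: parts_in_core(3) q_p_in_Z)
  then show ?thesis by (simp add: datum_core_def)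
qed

lemma map_datum:
  assumes E: "lie_algebra R E" and \<phi>: "algebra_map R L E \<phi>"
  shows "jordan_datum R J E (\<lambda>a. \<phi> (p a)) (\<lambda>a. \<phi> (q a))"
proof -
  interpret E: lie_algebra R E by fact
  note lin = algebra_mapD(1)[OF \<phi>]
  have mult: "\<phi> x \<otimes>\<^bsub>E\<^esub> \<phi> y = \<phi> (x \<otimes>\<^bsub>L\<^esub> y)" if "x \<in> carrier L" "y \<in> carrier L" for x y
    using algebra_mapD(2)[OF \<phi> that] by simp
  show ?thesis
    by (rule jordan_datumI[OF jordan_char_not_2_3_axioms E linear_map_compose[OF p_linear lin]
          linear_map_compose[OF q_linear lin]])
      (simp_all add: mult p_simps(1) q_simps(1) L.mult_closed p_p q_q p_q_p p_q_q
        linear_map_minus[OF L.module_axioms E.module_axioms lin])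
qed

lemma map_core:
  assumes E: "lie_algebra R E" and \<phi>: "algebra_map R L E \<phi>"
  shows "datum_core R J E (\<lambda>a. \<phi> (p a)) (\<lambda>a. \<phi> (q a)) = \<phi> ` C"
proof -
  interpret E: lie_algebra R E by fact
  note lin = algebra_mapD(1)[OF \<phi>]
  note \<phi>_simps = linear_map_simps[OF lin]
  have gens: "{\<phi> (q b) \<otimes>\<^bsub>E\<^esub> \<phi> (p a) | a b. a \<in> carrier J \<and> b \<in> carrier J} =
      \<phi> ` {q b \<otimes>\<^bsub>L\<^esub> p a | a b. a \<in> carrier J \<and> b \<in> carrier J}"
  proof (intro equalityI subsetI)
    have eq: "\<phi> (q b) \<otimes>\<^bsub>E\<^esub> \<phi> (p a) = \<phi> (q b \<otimes>\<^bsub>L\<^esub> p a)" if "a \<in> carrier J" "b \<in> carrier J" for a b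
      using that by (simp add: algebra_mapD(2)[OF \<phi>] p_simps(1) q_simps(1))
    show "y \<in> \<phi> ` {q b \<otimes>\<^bsub>L\<^esub> p a | a b. a \<in> carrier J \<and> b \<in> carrier J}"
      if "y \<in> {\<phi> (q b) \<otimes>\<^bsub>E\<^esub> \<phi> (p a) | a b. a \<in> carrier J \<and> b \<in> carrier J}" for y
      using that eq by blast
    show "y \<in> {\<phi> (q b) \<otimes>\<^bsub>E\<^esub> \<phi> (p a) | a b. a \<in> carrier J \<and> b \<in> carrier J}"
      if "y \<in> \<phi> ` {q b \<otimes>\<^bsub>L\<^esub> p a | a b. a \<in> carrier J \<and> b \<in> carrier J}" for y
      using that eq[symmetric] by blast
  qed
  have zero: "datum_zero R J E (\<lambda>a. \<phi> (p a)) (\<lambda>a. \<phi> (q a)) = \<phi> ` Z"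
    unfolding datum_zero_def gens
    using L.lin_span_image[OF E.module_axioms lin generators_closed] by simp
  have sum: "\<phi> (q b) \<oplus>\<^bsub>E\<^esub> \<phi> z \<oplus>\<^bsub>E\<^esub> \<phi> (p a) = \<phi> (q b \<oplus>\<^bsub>L\<^esub> z \<oplus>\<^bsub>L\<^esub> p a)"
    if "a \<in> carrier J" "b \<in> carrier J" "z \<in> Z" for a b z
    using that by (simp add: \<phi>_simps p_simps(1) q_simps(1) Z_closed)
  show ?thesis
  proof (intro equalityI subsetI)
    fix y assume "y \<in> datum_core R J E (\<lambda>a. \<phi> (p a)) (\<lambda>a. \<phi> (q a))"
    then obtain a b z where *: "a \<in> carrier J" "b \<in> carrier J" "z \<in> Z" "y = \<phi> (q b) \<oplus>\<^bsub>E\<^esub> \<phi> z \<oplus>\<^bsub>E\<^esub> \<phi> (p a)"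
      unfolding datum_core_def zero by blast
    then show "y \<in> \<phi> ` C" using sum[OF *(1-3)] coreI[OF *(1-3)] by simp
  next
    fix y assume "y \<in> \<phi> ` C"
    then obtain a b z where *: "a \<in> carrier J" "b \<in> carrier J" "z \<in> Z" "y = \<phi> (q b \<oplus>\<^bsub>L\<^esub> z \<oplus>\<^bsub>L\<^esub> p a)"
      by (auto elim: coreE)
    then show "y \<in> datum_core R J E (\<lambda>a. \<phi> (p a)) (\<lambda>a. \<phi> (q a))"
      unfolding datum_core_def zero *(4) sum[OF *(1-3), symmetric] using *(1-3) by blast
  qed
qed

text \<open>The brackets of the two copies of \<open>J\<close> span the remaining part of the core.\<close>

lemma core_map_unique:
  assumes E: "lie_algebra R E" and \<phi>: "algebra_map R (L\<lparr>carrier := C\<rparr>) E \<phi>"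
    and \<psi>: "algebra_map R (L\<lparr>carrier := C\<rparr>) E \<psi>"
    and p: "\<And>a. a \<in> carrier J \<Longrightarrow> \<phi> (p a) = \<psi> (p a)" and q: "\<And>a. a \<in> carrier J \<Longrightarrow> \<phi> (q a) = \<psi> (q a)"
    and x: "x \<in> C"
  shows "\<phi> x = \<psi> x"
proof -
  interpret E: lie_algebra R E by fact
  interpret C: lie_algebra R "L\<lparr>carrier := C\<rparr>" by (rule core_lie_algebra)
  have mult: "f (u \<otimes>\<^bsub>L\<^esub> v) = f u \<otimes>\<^bsub>E\<^esub> f v" if "algebra_map R (L\<lparr>carrier := C\<rparr>) E f" "u \<in> C" "v \<in> C" for f u v
    using algebra_mapD(2)[OF that(1)] that(2,3) by simp
  have add: "f (u \<oplus>\<^bsub>L\<^esub> v) = f u \<oplus>\<^bsub>E\<^esub> f v" if "algebra_map R (L\<lparr>carrier := C\<rparr>) E f" "u \<in> C" "v \<in> C" for f u v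
    using linear_map_simps(2)[OF algebra_mapD(1)[OF that(1)]] that(2,3) by simp
  have Z: "\<phi> z = \<psi> z" if "z \<in> Z" for z
  proof (rule C.linear_map_eq_on_span[OF E.module_axioms algebra_mapD(1)[OF \<phi>] algebra_mapD(1)[OF \<psi>]])
    let ?S = "{q b \<otimes>\<^bsub>L\<^esub> p a | a b. a \<in> carrier J \<and> b \<in> carrier J}"
    have S: "?S \<subseteq> C" by (auto intro: parts_in_core(3) q_p_in_Z)
    then show "?S \<subseteq> carrier (L\<lparr>carrier := C\<rparr>)" by simp
    show "z \<in> lin_span R (L\<lparr>carrier := C\<rparr>) ?S"
      using that unfolding datum_zero_def L.lin_span_restrict[OF core_submodule S] .
    show "\<phi> x = \<psi> x" if "x \<in> ?S" for x using that by (auto simp: mult \<phi> \<psi> parts_in_core p q)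
  qed
  show ?thesis using x by (rule coreE) (simp add: add \<phi> \<psi> parts_in_core core_add p q Z)
qed

end

lemma (in jordan_datum) precompose_datum:
  assumes J': "unital_jordan_algebra R J'" and \<psi>: "algebra_map R J' J \<psi>"
  shows "jordan_datum R J' L (\<lambda>a. p (\<psi> a)) (\<lambda>a. q (\<psi> a))"
proof -
  interpret J': unital_jordan_algebra R J' by fact
  have J'': "jordan_char_not_2_3 R J'"
    by (intro jordan_char_not_2_3.intro field_char_not_2_3_axioms J')
  note lin = algebra_mapD(1)[OF \<psi>]
  note \<psi>_simps = linear_map_simps[OF lin] linear_map_minus[OF J'.module_axioms module_axioms lin] algebra_mapD(2)[OF \<psi>]
  have triple: "\<psi> (jordan_triple2 J' a b c) = jordan_triple2 J (\<psi> a) (\<psi> b) (\<psi> c)"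
    "jordan_triple2 J' a b c \<in> carrier J'"
    if "a \<in> carrier J'" "b \<in> carrier J'" "c \<in> carrier J'" for a b c
    using that by (simp_all add: jordan_triple2_def jordan_triple_def \<psi>_simps J'.mult_closed)
  show ?thesis
    by (rule jordan_datumI[OF J'' L.lie_algebra_axioms linear_map_compose[OF lin p_linear]
          linear_map_compose[OF lin q_linear]])
      (simp_all add: \<psi>_simps(1) p_p q_q p_q_p p_q_q triple)
qed

lemma product_datum:
  assumes J: "jordan_char_not_2_3 R J" and D: "\<And>i. i \<in> I \<Longrightarrow> jordan_datum R J (L i) (p i) (q i)"
  shows "jordan_datum R J (product_algebra I L) (\<lambda>a. \<lambda>i\<in>I. p i a) (\<lambda>a. \<lambda>i\<in>I. q i a)"
proof -
  interpret J: jordan_char_not_2_3 R J by fact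
  have lie: "lie_algebra R (L i)" if "i \<in> I" for i using D[OF that] by (simp add: jordan_datum_def)
  have P: "lie_algebra R (product_algebra I L)" by (rule product_lie_algebra[OF J.is_cring lie])
  interpret P: lie_algebra R "product_algebra I L" by (rule P)
  have mo: "module R (L i)" if "i \<in> I" for i
    using lie[OF that] by (simp add: lie_algebra_def nonassoc_algebra_def)
  note lin = linear_map_simps[OF jordan_datum.p_linear[OF D]] linear_map_simps[OF jordan_datum.q_linear[OF D]]
  have cl: "(\<lambda>i\<in>I. p i a) \<in> carrier (product_algebra I L)" "(\<lambda>i\<in>I. q i a) \<in> carrier (product_algebra I L)"
    if "a \<in> carrier J" for a using that by (simp_all add: product_algebra_def lin)
  have p_lin: "linear_map R J (product_algebra I L) (\<lambda>a. \<lambda>i\<in>I. p i a)"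
    and q_lin: "linear_map R J (product_algebra I L) (\<lambda>a. \<lambda>i\<in>I. q i a)"
    by (auto intro!: linear_mapI product_ext[of _ I L] simp: cl product_apply lin P.M.a_closed P.smult_closed)
  note minus = product_minus_apply[OF J.is_cring mo]
  show ?thesis
    by (rule jordan_datumI[OF J P p_lin q_lin];
        (rule product_ext[of _ I L]; simp add: cl P.mult_closed product_apply minus
          jordan_datum.p_p[OF D] jordan_datum.q_q[OF D] jordan_datum.p_q_p[OF D] jordan_datum.p_q_q[OF D]))
qed

definition tkk_vector :: "('k, 'a, 'y) module_scheme \<Rightarrow> bool \<Rightarrow> 'a \<Rightarrow> bool \<times> 'a option \<Rightarrow> 'a" where
  "tkk_vector J t a = (\<lambda>(s, w)\<in>tkk_index J. if w = None \<and> s = t then a else \<zero>\<^bsub>J\<^esub>)"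

context jordan_char_not_2_3 begin

lemma tkk_vector_apply:
  "tkk_vector J t a (s, None) = (if s = t then a else \<zero>\<^bsub>J\<^esub>)" "x \<in> carrier J \<Longrightarrow> tkk_vector J t a (s, Some x) = \<zero>\<^bsub>J\<^esub>"
  by (simp_all add: tkk_vector_def)

lemma tkk_vector_closed: "a \<in> carrier J \<Longrightarrow> tkk_vector J t a \<in> tkk_carrier R J"
  by (rule tkk_carrierI) (auto simp: tkk_vector_apply V_simps, simp add: tkk_vector_def)

text \<open>
  The bracket of the vectors \<open>a\<close> and \<open>b\<close> of opposite signs is the pair of operators that take \<open>x\<close> to
  \<open>2 {a b x}\<close> and to \<open>- 2 {b a x}\<close>.
\<close>

lemma tkk_datum: "jordan_datum R J (tkk R J) (tkk_vector J True) (tkk_vector J False)"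
proof -
  interpret T: lie_algebra R "tkk R J" by (rule tkk_lie_algebra)
  note cl = tkk_vector_closed tkk_bracket_closed T.M.a_closed[simplified] T.smult_closed[simplified]
    T.M.zero_closed[simplified] T.M.a_inv_closed[simplified]
  have minus: "(\<ominus>\<^bsub>tkk R J\<^esub> u) (s, None) = \<ominus>\<^bsub>J\<^esub> u (s, None)"
    "x \<in> carrier J \<Longrightarrow> (\<ominus>\<^bsub>tkk R J\<^esub> u) (s, Some x) = \<ominus>\<^bsub>J\<^esub> u (s, Some x)" if u: "u \<in> tkk_carrier R J" for u s x
  proof -
    have "\<ominus>\<^bsub>tkk R J\<^esub> u \<oplus>\<^bsub>tkk R J\<^esub> u = \<zero>\<^bsub>tkk R J\<^esub>" using T.M.l_neg u by simp
    then have "(\<ominus>\<^bsub>tkk R J\<^esub> u \<oplus>\<^bsub>tkk R J\<^esub> u) i = \<zero>\<^bsub>tkk R J\<^esub> i" for i by simp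
    from this[of "(s, None)"] this[of "(s, Some x)"]
    show "(\<ominus>\<^bsub>tkk R J\<^esub> u) (s, None) = \<ominus>\<^bsub>J\<^esub> u (s, None)"
      "x \<in> carrier J \<Longrightarrow> (\<ominus>\<^bsub>tkk R J\<^esub> u) (s, Some x) = \<ominus>\<^bsub>J\<^esub> u (s, Some x)"
      using tkk_carrierD(1,2)[OF u] tkk_carrierD(1,2)[OF cl(6)[OF u]]
      by (auto intro!: M.minus_equality[symmetric])
  qed
  have lin: "linear_map R J (tkk R J) (tkk_vector J t)" for t
    by (rule linear_mapI; (rule tkk_ext)?; simp add: cl tkk_vector_apply)
  show ?thesis
    by (rule jordan_datumI[OF jordan_char_not_2_3_axioms tkk_lie_algebra lin lin];
        simp only: tkk_simps; rule tkk_ext;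
        simp add: cl minus tkk_bracket_apply tkk_vector_apply V_simps M.diff_zero M.diff_self
          M.minus_across M.l_neg)
qed

end

section \<open>The universal Lie algebra over a Jordan algebra\<close>

lemma infinite_pairing:
  assumes "infinite (UNIV :: 'u set)" obtains \<pi> :: "'u \<times> 'u \<Rightarrow> 'u" where "inj \<pi>"
proof -
  have "(card_of ((UNIV :: 'u set) \<times> (UNIV :: 'u set)), card_of (UNIV :: 'u set)) \<in> ordLeq"
    using card_of_Times_same_infinite[OF assms] ordIso_imp_ordLeq by blast
  then show thesis using that card_of_ordLeq[of "(UNIV :: 'u set) \<times> (UNIV :: 'u set)" "UNIV :: 'u set"] by auto
qed

text \<open>Iterated pairing is injective only on the lists of a given length, so the length is recorded too.\<close>

lemma infinite_list_encoding:
  assumes "infinite (UNIV :: 'u set)" obtains \<kappa> :: "'u list \<Rightarrow> 'u" where "inj \<kappa>"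
proof -
  obtain \<pi> :: "'u \<times> 'u \<Rightarrow> 'u" where \<pi>: "inj \<pi>" using infinite_pairing[OF assms] .
  obtain \<nu> :: "nat \<Rightarrow> 'u" where \<nu>: "inj \<nu>" using infinite_countable_subset[OF assms] by auto
  define enc where "enc xs = foldr (\<lambda>x y. \<pi> (x, y)) xs (\<nu> 0)" for xs
  have enc: "xs = ys" if "length xs = length ys" "enc xs = enc ys" for xs ys
    using that by (induction xs ys rule: list_induct2) (auto simp: enc_def dest: injD[OF \<pi>])
  have "inj (\<lambda>xs. \<pi> (\<nu> (length xs), enc xs))"
    by (rule injI) (auto dest!: injD[OF \<pi>] injD[OF \<nu>] intro: enc)
  then show thesis by (rule that)
qed

context jordan_datum begin

definition "bracket_sum xs = foldr (\<lambda>(a, b) s. q b \<otimes>\<^bsub>L\<^esub> p a \<oplus>\<^bsub>L\<^esub> s) xs \<zero>\<^bsub>L\<^esub>"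

lemma bracket_sum_simps [simp]:
  "bracket_sum [] = \<zero>\<^bsub>L\<^esub>" "bracket_sum ((a, b) # xs) = q b \<otimes>\<^bsub>L\<^esub> p a \<oplus>\<^bsub>L\<^esub> bracket_sum xs"
  by (simp_all add: bracket_sum_def)

lemma bracket_sum_closed: "\<forall>x\<in>set xs. x \<in> carrier J \<times> carrier J \<Longrightarrow> bracket_sum xs \<in> carrier L"
  by (induction xs) (auto simp: p_simps(1) q_simps(1) L.mult_closed)

text \<open>The scalars of a linear combination of brackets are absorbed into the vectors.\<close>

lemma Z_eq_bracket_sums: "Z = bracket_sum ` lists (carrier J \<times> carrier J)"
proof
  let ?B = "bracket_sum ` lists (carrier J \<times> carrier J)"
  note cl = p_simps(1) q_simps(1) L.mult_closed bracket_sum_closed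
  have map: "\<exists>ys. ys \<in> lists (carrier J \<times> carrier J) \<and> r \<odot>\<^bsub>L\<^esub> bracket_sum xs = bracket_sum ys"
    if "r \<in> carrier R" "\<forall>x\<in>set xs. x \<in> carrier J \<times> carrier J" for r xs
    using that
  proof (induction xs)
    case Nil
    then show ?case by (auto intro!: exI[of _ "[]"])
  next
    case (Cons x xs)
    then obtain ys where ys: "ys \<in> lists (carrier J \<times> carrier J)" "r \<odot>\<^bsub>L\<^esub> bracket_sum xs = bracket_sum ys" by auto
    obtain a b where x: "x = (a, b)" "a \<in> carrier J" "b \<in> carrier J" using Cons.prems by (cases x) auto
    have "r \<odot>\<^bsub>L\<^esub> bracket_sum (x # xs) = bracket_sum ((r \<odot>\<^bsub>J\<^esub> a, b) # ys)"
      using Cons.prems x ys by (simp add: cl L.smult_r_distr L.mult_smult_right p_simps(3))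
    then show ?case using x ys Cons.prems by (intro exI[of _ "(r \<odot>\<^bsub>J\<^esub> a, b) # ys"]) simp
  qed
  have "submodule ?B R L"
  proof (rule L.submoduleI)
    show "?B \<subseteq> carrier L" by (auto simp: cl)
    show "\<zero>\<^bsub>L\<^esub> \<in> ?B" by (rule image_eqI[of _ _ "[]"]) simp_all
    show smult: "r \<odot>\<^bsub>L\<^esub> x \<in> ?B" if "r \<in> carrier R" "x \<in> ?B" for r x
      using that map by fastforce
    show "\<ominus>\<^bsub>L\<^esub> x \<in> ?B" if "x \<in> ?B" for x
    proof -
      have "x \<in> carrier L" using that by (auto simp: cl)
      then have "\<ominus>\<^bsub>L\<^esub> x = (\<ominus> \<one>) \<odot>\<^bsub>L\<^esub> x" using L.smult_l_minus[of \<one> x] by simp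
      then show ?thesis using smult[of "\<ominus> \<one>" x] that by simp
    qed
    show "x \<oplus>\<^bsub>L\<^esub> y \<in> ?B" if xy: "x \<in> ?B" "y \<in> ?B" for x y
    proof -
      obtain xs ys where *: "x = bracket_sum xs" "y = bracket_sum ys" "\<forall>x\<in>set xs. x \<in> carrier J \<times> carrier J"
        "\<forall>x\<in>set ys. x \<in> carrier J \<times> carrier J" using xy by auto
      have "bracket_sum xs \<oplus>\<^bsub>L\<^esub> bracket_sum ys = bracket_sum (xs @ ys)"
        using *(3,4) by (induction xs) (auto simp: cl L.M.a_assoc)
      then show ?thesis using * by (intro image_eqI[of _ _ "xs @ ys"]) auto
    qed
  qed
  moreover have "{q b \<otimes>\<^bsub>L\<^esub> p a | a b. a \<in> carrier J \<and> b \<in> carrier J} \<subseteq> ?B"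
  proof clarify
    fix a b assume "a \<in> carrier J" "b \<in> carrier J"
    then show "q b \<otimes>\<^bsub>L\<^esub> p a \<in> ?B" by (intro image_eqI[of _ _ "[(a, b)]"]) (simp_all add: cl)
  qed
  ultimately show "Z \<subseteq> ?B" unfolding datum_zero_def by (rule L.lin_span_least)
  have "bracket_sum xs \<in> Z" if "\<forall>x\<in>set xs. x \<in> carrier J \<times> carrier J" for xs
    using that by (induction xs) (auto simp: Z_zero q_p_in_Z L.submoduleE(5)[OF Z_submodule])
  then show "?B \<subseteq> Z" by auto
qed

end

text \<open>
  As linear combinations need no separate scalars, the core is parametrized by lists over \<open>J\<close>: however
  large the field is, the core is no larger than the infinite type that carries \<open>J\<close>.
\<close>

lemma datum_core_embeds:
  fixes J :: "('k, 'u) module" and L :: "('k, 'e, 'y) module_scheme"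
  assumes D: "jordan_datum R J L p q" and inf: "infinite (UNIV :: 'u set)"
  obtains \<iota> :: "'e \<Rightarrow> 'u" where "inj_on \<iota> (datum_core R J L p q)"
proof -
  interpret jordan_datum R J L p q by fact
  obtain \<pi> :: "'u \<times> 'u \<Rightarrow> 'u" where \<pi>: "inj \<pi>" using infinite_pairing[OF inf] .
  obtain \<kappa> :: "'u list \<Rightarrow> 'u" where \<kappa>: "inj \<kappa>" using infinite_list_encoding[OF inf] .
  define sum where "sum = (\<lambda>(a, b, xs). q b \<oplus>\<^bsub>L\<^esub> bracket_sum xs \<oplus>\<^bsub>L\<^esub> p a)"
  define code where "code = (\<lambda>(a, b, xs). \<pi> (a, \<pi> (b, \<kappa> (map \<pi> xs))))"
  have code: "inj code"
    by (rule injI) (auto simp: code_def inj_eq[OF \<pi>] inj_eq[OF \<kappa>] inj_eq[OF inj_mapI[OF \<pi>]])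
  have "\<exists>c. x = sum c" if "x \<in> C" for x
    using that
  proof (rule coreE)
    fix a b z assume *: "z \<in> Z" "x = q b \<oplus>\<^bsub>L\<^esub> z \<oplus>\<^bsub>L\<^esub> p a"
    then obtain xs where "z = bracket_sum xs" unfolding Z_eq_bracket_sums by auto
    then show "\<exists>c. x = sum c" using * by (auto simp: sum_def intro: exI[of _ "(a, b, xs)"])
  qed
  then obtain c where c: "\<And>x. x \<in> C \<Longrightarrow> x = sum (c x)" by metis
  have "inj_on (\<lambda>x. code (c x)) C"
  proof (rule inj_onI)
    fix x y assume "x \<in> C" "y \<in> C" "code (c x) = code (c y)"
    then show "x = y" using c[of x] c[of y] injD[OF code] by metis
  qed
  then show thesis by (rule that)
qed

text \<open>
  The quantifier ranges over targets on the type of \<open>J\<close> only, as the definition must fix a type;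
  \<open>universal_datum_extends\<close> removes this restriction.
\<close>

definition universal_datum ::
  "('k, 'z) ring_scheme \<Rightarrow> ('k, 'u) module \<Rightarrow> ('k, 'u) module \<Rightarrow> ('u \<Rightarrow> 'u) \<Rightarrow> ('u \<Rightarrow> 'u) \<Rightarrow> bool" where
  "universal_datum R J U p q \<longleftrightarrow> jordan_datum R J U p q \<and> carrier U = datum_core R J U p q \<and>
     (\<forall>(E :: ('k, 'u) module) p' q'. jordan_datum R J E p' q' \<longrightarrow>
       (\<exists>\<Phi>. algebra_map R U E \<Phi> \<and> (\<forall>a\<in>carrier J. \<Phi> (p a) = p' a \<and> \<Phi> (q a) = q' a)))"

text \<open>
  The universal Lie algebra is the core of the product of all Lie algebras over \<open>J\<close> that live on a
  fixed type.  As it is generated by \<open>J\<close>, it has a copy on that type, so that it is itself an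
  admissible object.
\<close>

lemma universal_datum_exists:
  fixes J :: "('k, 'u) module" and R :: "('k, 'z) ring_scheme"
  assumes J: "jordan_char_not_2_3 R J" and inf: "infinite (UNIV :: 'u set)"
  obtains U p q where "universal_datum R J U p q"
proof -
  define I where "I = {(E :: ('k, 'u) module, p, q). jordan_datum R J E p q}"
  let ?L = "\<lambda>(E, p, q). E" and ?p = "\<lambda>(E, p, q). p" and ?q = "\<lambda>(E, p, q). q"
  define P where "P = product_algebra I ?L"
  define p0 where "p0 = (\<lambda>a. \<lambda>i\<in>I. ?p i a)"
  define q0 where "q0 = (\<lambda>a. \<lambda>i\<in>I. ?q i a)"
  have D0: "jordan_datum R J P p0 q0"
    unfolding P_def p0_def q0_def by (rule product_datum[OF J]) (auto simp: I_def)
  then interpret P: jordan_datum R J P p0 q0 .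
  let ?C = "P\<lparr>carrier := P.C\<rparr>"
  obtain \<iota> :: "_ \<Rightarrow> 'u" where \<iota>: "inj_on \<iota> P.C" using datum_core_embeds[OF D0 inf] .
  then have \<iota>': "inj_on \<iota> (carrier ?C)" by simp
  interpret C: jordan_datum R J ?C p0 q0 by (rule P.core_datum)
  define U where "U = transport_algebra \<iota> ?C"
  have U_lie: "lie_algebra R U" unfolding U_def by (rule transport_lie_algebra[OF P.core_lie_algebra \<iota>'])
  have U_map: "algebra_map R ?C U \<iota>" unfolding U_def by (rule transport_algebra_map[OF \<iota>'])
  have U_carrier: "carrier U = \<iota> ` P.C" unfolding U_def by (simp add: transport_simps[OF \<iota>'])
  have inverse: "algebra_map R U ?C (inv_into (carrier ?C) \<iota>)"
    using inv_into_algebra_map[OF C.L.nonassoc_algebra_axioms U_map \<iota>'] U_carrier by simp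
  have "universal_datum R J U (\<lambda>a. \<iota> (p0 a)) (\<lambda>a. \<iota> (q0 a))"
    unfolding universal_datum_def
  proof (intro conjI allI impI)
    show "jordan_datum R J U (\<lambda>a. \<iota> (p0 a)) (\<lambda>a. \<iota> (q0 a))" by (rule C.map_datum[OF U_lie U_map])
    show "carrier U = datum_core R J U (\<lambda>a. \<iota> (p0 a)) (\<lambda>a. \<iota> (q0 a))"
      by (simp add: C.map_core[OF U_lie U_map] P.core_of_core U_carrier)
    fix E :: "('k, 'u) module" and p' q' assume E: "jordan_datum R J E p' q'"
    then have i: "(E, p', q') \<in> I" by (simp add: I_def)
    have proj: "algebra_map R ?C E (\<lambda>u. u (E, p', q'))"
      using product_projection(2)[OF i, of R ?L] P.core_closed
      unfolding P_def[symmetric] by (auto simp: algebra_map_def linear_map_def)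
    have inv: "inv_into (carrier ?C) \<iota> (\<iota> x) = x" if "x \<in> P.C" for x
      using that by (intro inv_into_f_f[OF \<iota>']) simp
    show "\<exists>\<Phi>. algebra_map R U E \<Phi> \<and> (\<forall>a\<in>carrier J. \<Phi> (\<iota> (p0 a)) = p' a \<and> \<Phi> (\<iota> (q0 a)) = q' a)"
    proof (intro exI conjI ballI)
      show "algebra_map R U E (\<lambda>x. inv_into (carrier ?C) \<iota> x (E, p', q'))"
        by (rule algebra_map_compose[OF inverse proj])
      fix a assume "a \<in> carrier J"
      then show "inv_into (carrier ?C) \<iota> (\<iota> (p0 a)) (E, p', q') = p' a"
        "inv_into (carrier ?C) \<iota> (\<iota> (q0 a)) (E, p', q') = q' a"
        using i by (simp_all only: inv P.parts_in_core) (simp_all add: p0_def q0_def)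
    qed
  qed
  then show thesis by (rule that)
qed

text \<open>The universal property holds for targets of every type, since only the core matters.\<close>

lemma universal_datum_extends:
  fixes J :: "('k, 'u) module" and E :: "('k, 'e, 'y) module_scheme"
  assumes U: "universal_datum R J U p q" and inf: "infinite (UNIV :: 'u set)" and E: "jordan_datum R J E p' q'"
  obtains \<Phi> where "algebra_map R U E \<Phi>" "\<And>a. a \<in> carrier J \<Longrightarrow> \<Phi> (p a) = p' a" "\<And>a. a \<in> carrier J \<Longrightarrow> \<Phi> (q a) = q' a"
proof -
  interpret E: jordan_datum R J E p' q' by (rule E)
  let ?C = "E\<lparr>carrier := E.C\<rparr>"
  obtain \<iota> :: "'e \<Rightarrow> 'u" where \<iota>: "inj_on \<iota> E.C" using datum_core_embeds[OF _ inf] E by blast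
  then have \<iota>': "inj_on \<iota> (carrier ?C)" by simp
  interpret C: jordan_datum R J ?C p' q' by (rule E.core_datum)
  define T where "T = transport_algebra \<iota> ?C"
  have T_lie: "lie_algebra R T" unfolding T_def by (rule transport_lie_algebra[OF E.core_lie_algebra \<iota>'])
  have T_map: "algebra_map R ?C T \<iota>" unfolding T_def by (rule transport_algebra_map[OF \<iota>'])
  have T_carrier: "carrier T = \<iota> ` E.C" unfolding T_def by (simp add: transport_simps[OF \<iota>'])
  have inverse: "algebra_map R T ?C (inv_into (carrier ?C) \<iota>)"
    using inv_into_algebra_map[OF C.L.nonassoc_algebra_axioms T_map \<iota>'] T_carrier by simp
  have incl: "algebra_map R ?C E (\<lambda>x. x)"
    using E.core_closed by (auto simp: algebra_map_def linear_map_def)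
  obtain \<Psi> where \<Psi>: "algebra_map R U T \<Psi>" "\<And>a. a \<in> carrier J \<Longrightarrow> \<Psi> (p a) = \<iota> (p' a) \<and> \<Psi> (q a) = \<iota> (q' a)"
    using U C.map_datum[OF T_lie T_map] unfolding universal_datum_def by blast
  have inv: "inv_into (carrier ?C) \<iota> (\<iota> x) = x" if "x \<in> E.C" for x
    using that by (intro inv_into_f_f[OF \<iota>']) simp
  show thesis
  proof (rule that)
    show "algebra_map R U E (\<lambda>x. inv_into (carrier ?C) \<iota> (\<Psi> x))"
      using algebra_map_compose[OF algebra_map_compose[OF \<Psi>(1) inverse] incl] .
    fix a assume "a \<in> carrier J"
    then show "inv_into (carrier ?C) \<iota> (\<Psi> (p a)) = p' a" "inv_into (carrier ?C) \<iota> (\<Psi> (q a)) = q' a"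
      by (simp_all only: \<Psi>(2) inv E.parts_in_core)
  qed
qed

text \<open>It suffices that \<open>p\<close> is injective in one Lie algebra over \<open>J\<close>, the Tits--Kantor--Koecher algebra.\<close>

lemma universal_datum_inj:
  fixes J :: "('k, 'u) module"
  assumes U: "universal_datum R J U p q" and inf: "infinite (UNIV :: 'u set)"
  shows "inj_on p (carrier J)"
proof -
  interpret U: jordan_datum R J U p q using U by (simp add: universal_datum_def)
  obtain \<Phi> where \<Phi>: "\<And>a. a \<in> carrier J \<Longrightarrow> \<Phi> (p a) = tkk_vector J True a"
    using universal_datum_extends[OF U inf U.tkk_datum] by metis
  show ?thesis
  proof (rule inj_onI)
    fix a b assume ab: "a \<in> carrier J" "b \<in> carrier J" "p a = p b"
    then have "tkk_vector J True a (True, None) = tkk_vector J True b (True, None)" using \<Phi> by metis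
    then show "a = b" by (simp add: U.tkk_vector_apply)
  qed
qed

section \<open>The Jordan algebra of an A1-graded Lie algebra\<close>

text \<open>With the factor \<open>1/2\<close> the element \<open>e\<close> is the unit, because \<open>[[e, f], a] = [h, a] = 2 a\<close>.\<close>

definition jordan_of ::
  "('k, 'z) ring_scheme \<Rightarrow> ('k, 'a, 'y) module_scheme \<Rightarrow> 'a \<times> 'a \<times> 'a \<Rightarrow> ('k, 'a, 'y) module_scheme" where
  "jordan_of R L = (\<lambda>(h, e, f). L\<lparr>carrier := weight_space L h 1,
     mult := (\<lambda>a b. half R \<odot>\<^bsub>L\<^esub> ((a \<otimes>\<^bsub>L\<^esub> f) \<otimes>\<^bsub>L\<^esub> b)), one := e\<rparr>)"

text \<open>
  The copy of \<open>L_1\<close> in \<open>L_{-1}\<close>: up to a scalar the square of \<open>ad f\<close>, normalized to send \<open>e\<close> to \<open>f\<close>.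
\<close>

definition opposite_part :: "('k, 'z) ring_scheme \<Rightarrow> ('k, 'a, 'y) module_scheme \<Rightarrow> 'a \<Rightarrow> 'a \<Rightarrow> 'a" where
  "opposite_part R L f b = \<ominus>\<^bsub>L\<^esub> (half R \<odot>\<^bsub>L\<^esub> (f \<otimes>\<^bsub>L\<^esub> (f \<otimes>\<^bsub>L\<^esub> b)))"

locale A1_graded_lie = field_char_not_2_3 R + lie_algebra R L for R (structure) and L (structure) +
  fixes h e f
  assumes graded: "A1_graded R L (h, e, f)"

sublocale A1_graded_lie \<subseteq> LV: vector_space_char_not_2_3 R L ..

context A1_graded_lie begin

abbreviation "W \<equiv> weight_space L h"
abbreviation "A a \<equiv> a \<otimes>\<^bsub>L\<^esub> f"
abbreviation "F b \<equiv> f \<otimes>\<^bsub>L\<^esub> (f \<otimes>\<^bsub>L\<^esub> b)"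
abbreviation "J \<equiv> jordan_of R L (h, e, f)"
abbreviation "q \<equiv> opposite_part R L f"

lemma triple: "h \<in> carrier L" "e \<in> carrier L" "f \<in> carrier L" "e \<otimes>\<^bsub>L\<^esub> f = h"
  "h \<otimes>\<^bsub>L\<^esub> e = e \<oplus>\<^bsub>L\<^esub> e" "h \<otimes>\<^bsub>L\<^esub> f = \<ominus>\<^bsub>L\<^esub> (f \<oplus>\<^bsub>L\<^esub> f)"
  using graded by (simp_all add: A1_graded_def sl2_triple_def M.int_mult_simps)

lemma weight_iff:
  "x \<in> W 1 \<longleftrightarrow> x \<in> carrier L \<and> h \<otimes>\<^bsub>L\<^esub> x = x \<oplus>\<^bsub>L\<^esub> x"
  "x \<in> W (-1) \<longleftrightarrow> x \<in> carrier L \<and> h \<otimes>\<^bsub>L\<^esub> x = \<ominus>\<^bsub>L\<^esub> (x \<oplus>\<^bsub>L\<^esub> x)"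
  "x \<in> W 0 \<longleftrightarrow> x \<in> carrier L \<and> h \<otimes>\<^bsub>L\<^esub> x = \<zero>\<^bsub>L\<^esub>"
  by (auto simp: weight_space_def M.int_mult_simps)

lemma weight_closed: "x \<in> W i \<Longrightarrow> x \<in> carrier L" by (simp add: weight_space_def)

lemma weight_submodule: "submodule (W 1) R L" "submodule (W (-1)) R L" "submodule (W 0) R L"
proof -
  have lin: "linear_map R L L (\<lambda>x. x \<oplus>\<^bsub>L\<^esub> x)" "linear_map R L L (\<lambda>x. \<ominus>\<^bsub>L\<^esub> (x \<oplus>\<^bsub>L\<^esub> x))" "linear_map R L L (\<lambda>x. \<zero>\<^bsub>L\<^esub>)"
    by (auto intro!: linear_mapI simp: smult_r_distr smult_r_minus M.minus_add M.a_ac)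
  note eq = submodule_equalizer[OF module_axioms mult_linear_map(1)[OF triple(1)]]
  have sets: "W 1 = {x \<in> carrier L. h \<otimes>\<^bsub>L\<^esub> x = x \<oplus>\<^bsub>L\<^esub> x}" "W (-1) = {x \<in> carrier L. h \<otimes>\<^bsub>L\<^esub> x = \<ominus>\<^bsub>L\<^esub> (x \<oplus>\<^bsub>L\<^esub> x)}"
    "W 0 = {x \<in> carrier L. h \<otimes>\<^bsub>L\<^esub> x = \<zero>\<^bsub>L\<^esub>}" by (auto simp: weight_iff)
  show "submodule (W 1) R L" "submodule (W (-1)) R L" "submodule (W 0) R L"
    unfolding sets by (rule eq[OF lin(1)], rule eq[OF lin(2)], rule eq[OF lin(3)])
qed

lemmas W1 = submoduleE(3,4,5)[OF weight_submodule(1)] submodule_diff[OF weight_submodule(1)] submodule_zero[OF weight_submodule(1)]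
lemmas Wm = submoduleE(3,4,5)[OF weight_submodule(2)] submodule_diff[OF weight_submodule(2)] submodule_zero[OF weight_submodule(2)]
lemmas W0 = submoduleE(3,4,5)[OF weight_submodule(3)] submodule_diff[OF weight_submodule(3)] submodule_zero[OF weight_submodule(3)]

lemma graded_bij: "bij_betw (\<lambda>(x, y, z). x \<oplus>\<^bsub>L\<^esub> y \<oplus>\<^bsub>L\<^esub> z) (W (-1) \<times> W 0 \<times> W 1) (carrier L)"
  and graded_zero: "W 0 = lin_span R L {x \<otimes>\<^bsub>L\<^esub> y | x y. x \<in> W (-1) \<and> y \<in> W 1}"
  using graded unfolding A1_graded_def prod.case by blast+

lemma decompose:
  assumes "x \<in> carrier L"
  obtains u v w where "u \<in> W (-1)" "v \<in> W 0" "w \<in> W 1" "x = u \<oplus>\<^bsub>L\<^esub> v \<oplus>\<^bsub>L\<^esub> w"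
proof -
  have "x \<in> (\<lambda>(x, y, z). x \<oplus>\<^bsub>L\<^esub> y \<oplus>\<^bsub>L\<^esub> z) ` (W (-1) \<times> W 0 \<times> W 1)"
    using graded_bij assms by (simp add: bij_betw_def)
  then show thesis using that by auto
qed

lemma decompose_zero:
  assumes "u \<in> W (-1)" "v \<in> W 0" "w \<in> W 1" "u \<oplus>\<^bsub>L\<^esub> v \<oplus>\<^bsub>L\<^esub> w = \<zero>\<^bsub>L\<^esub>"
  shows "u = \<zero>\<^bsub>L\<^esub>" "v = \<zero>\<^bsub>L\<^esub>" "w = \<zero>\<^bsub>L\<^esub>"
proof -
  have inj: "inj_on (\<lambda>(x, y, z). x \<oplus>\<^bsub>L\<^esub> y \<oplus>\<^bsub>L\<^esub> z) (W (-1) \<times> W 0 \<times> W 1)"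
    using graded_bij by (rule bij_betw_imp_inj_on)
  have "(u, v, w) = (\<zero>\<^bsub>L\<^esub>, \<zero>\<^bsub>L\<^esub>, \<zero>\<^bsub>L\<^esub>)"
    by (rule inj_onD[OF inj]) (use assms W1 Wm W0 in simp_all)
  then show "u = \<zero>\<^bsub>L\<^esub>" "v = \<zero>\<^bsub>L\<^esub>" "w = \<zero>\<^bsub>L\<^esub>" by simp_all
qed

lemma e_f_weight: "e \<in> W 1" "f \<in> W (-1)" "h \<in> W 0"
  using triple by (simp_all add: weight_iff bracket_self)

text \<open>Here \<open>6\<close> must be invertible: otherwise the eigenvalue \<open>4\<close> could coincide with \<open>-2\<close>.\<close>

lemma bracket_same_weight:
  "\<lbrakk>x \<in> W 1; y \<in> W 1\<rbrakk> \<Longrightarrow> x \<otimes>\<^bsub>L\<^esub> y = \<zero>\<^bsub>L\<^esub>" "\<lbrakk>x \<in> W (-1); y \<in> W (-1)\<rbrakk> \<Longrightarrow> x \<otimes>\<^bsub>L\<^esub> y = \<zero>\<^bsub>L\<^esub>"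
proof -
  have six: "x = \<zero>\<^bsub>L\<^esub>" if "x \<oplus>\<^bsub>L\<^esub> x \<oplus>\<^bsub>L\<^esub> x \<oplus>\<^bsub>L\<^esub> (x \<oplus>\<^bsub>L\<^esub> x \<oplus>\<^bsub>L\<^esub> x) = \<zero>\<^bsub>L\<^esub>" "x \<in> carrier L" for x
    by (rule LV.triple_eq_zero[OF LV.double_eq_zero[OF that(1)]]) (simp_all add: that(2))
  have four: "x = \<zero>\<^bsub>L\<^esub>" if "x \<oplus>\<^bsub>L\<^esub> x \<oplus>\<^bsub>L\<^esub> (x \<oplus>\<^bsub>L\<^esub> x) = \<zero>\<^bsub>L\<^esub>" "x \<in> carrier L" for x
    by (rule LV.double_eq_zero[OF LV.double_eq_zero[OF that(1)]]) (simp_all add: that(2))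
  show "x \<otimes>\<^bsub>L\<^esub> y = \<zero>\<^bsub>L\<^esub>" if x: "x \<in> W 1" and y: "y \<in> W 1"
  proof -
    have cl: "x \<in> carrier L" "y \<in> carrier L" "x \<otimes>\<^bsub>L\<^esub> y \<in> carrier L" using x y by (simp_all add: weight_iff mult_closed)
    obtain u v w where d: "u \<in> W (-1)" "v \<in> W 0" "w \<in> W 1" "x \<otimes>\<^bsub>L\<^esub> y = u \<oplus>\<^bsub>L\<^esub> v \<oplus>\<^bsub>L\<^esub> w" using decompose[OF cl(3)] .
    have c: "u \<in> carrier L" "v \<in> carrier L" "w \<in> carrier L" using d by (simp_all add: weight_closed)
    have 1: "h \<otimes>\<^bsub>L\<^esub> (x \<otimes>\<^bsub>L\<^esub> y) = x \<otimes>\<^bsub>L\<^esub> y \<oplus>\<^bsub>L\<^esub> x \<otimes>\<^bsub>L\<^esub> y \<oplus>\<^bsub>L\<^esub> (x \<otimes>\<^bsub>L\<^esub> y \<oplus>\<^bsub>L\<^esub> x \<otimes>\<^bsub>L\<^esub> y)"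
      using x y cl triple by (simp add: bracket_derivation[of h x y] weight_iff mult_distribs)
    have 2: "h \<otimes>\<^bsub>L\<^esub> (x \<otimes>\<^bsub>L\<^esub> y) = w \<oplus>\<^bsub>L\<^esub> w \<ominus>\<^bsub>L\<^esub> (u \<oplus>\<^bsub>L\<^esub> u)"
      unfolding d(4) using d(1-3) triple by (simp add: weight_iff mult_distribs mult_closed M.ab_simps)
    have "(u \<oplus>\<^bsub>L\<^esub> u \<oplus>\<^bsub>L\<^esub> u \<oplus>\<^bsub>L\<^esub> (u \<oplus>\<^bsub>L\<^esub> u \<oplus>\<^bsub>L\<^esub> u)) \<oplus>\<^bsub>L\<^esub> (v \<oplus>\<^bsub>L\<^esub> v \<oplus>\<^bsub>L\<^esub> (v \<oplus>\<^bsub>L\<^esub> v)) \<oplus>\<^bsub>L\<^esub> (w \<oplus>\<^bsub>L\<^esub> w) =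
      (x \<otimes>\<^bsub>L\<^esub> y \<oplus>\<^bsub>L\<^esub> x \<otimes>\<^bsub>L\<^esub> y \<oplus>\<^bsub>L\<^esub> (x \<otimes>\<^bsub>L\<^esub> y \<oplus>\<^bsub>L\<^esub> x \<otimes>\<^bsub>L\<^esub> y)) \<ominus>\<^bsub>L\<^esub> (w \<oplus>\<^bsub>L\<^esub> w \<ominus>\<^bsub>L\<^esub> (u \<oplus>\<^bsub>L\<^esub> u))"
      unfolding d(4) using c by (simp add: M.ab_simps)
    also have "\<dots> = \<zero>\<^bsub>L\<^esub>" using 1 2 cl triple by (simp add: M.diff_self mult_closed)
    finally have 0: "(u \<oplus>\<^bsub>L\<^esub> u \<oplus>\<^bsub>L\<^esub> u \<oplus>\<^bsub>L\<^esub> (u \<oplus>\<^bsub>L\<^esub> u \<oplus>\<^bsub>L\<^esub> u)) \<oplus>\<^bsub>L\<^esub> (v \<oplus>\<^bsub>L\<^esub> v \<oplus>\<^bsub>L\<^esub> (v \<oplus>\<^bsub>L\<^esub> v)) \<oplus>\<^bsub>L\<^esub> (w \<oplus>\<^bsub>L\<^esub> w) = \<zero>\<^bsub>L\<^esub>" .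
    have "u \<oplus>\<^bsub>L\<^esub> u \<oplus>\<^bsub>L\<^esub> u \<oplus>\<^bsub>L\<^esub> (u \<oplus>\<^bsub>L\<^esub> u \<oplus>\<^bsub>L\<^esub> u) \<in> W (-1)" "v \<oplus>\<^bsub>L\<^esub> v \<oplus>\<^bsub>L\<^esub> (v \<oplus>\<^bsub>L\<^esub> v) \<in> W 0" "w \<oplus>\<^bsub>L\<^esub> w \<in> W 1"
      using d(1-3) by (simp_all add: W1 Wm W0)
    note decompose_zero[OF this 0]
    then have "u = \<zero>\<^bsub>L\<^esub>" "v = \<zero>\<^bsub>L\<^esub>" "w = \<zero>\<^bsub>L\<^esub>"
      using six[OF _ c(1)] four[OF _ c(2)] LV.double_eq_zero[OF _ c(3)] by blast+
    then show ?thesis using d(4) by simp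
  qed
  show "x \<otimes>\<^bsub>L\<^esub> y = \<zero>\<^bsub>L\<^esub>" if x: "x \<in> W (-1)" and y: "y \<in> W (-1)"
  proof -
    have cl: "x \<in> carrier L" "y \<in> carrier L" "x \<otimes>\<^bsub>L\<^esub> y \<in> carrier L" using x y by (simp_all add: weight_iff mult_closed)
    obtain u v w where d: "u \<in> W (-1)" "v \<in> W 0" "w \<in> W 1" "x \<otimes>\<^bsub>L\<^esub> y = u \<oplus>\<^bsub>L\<^esub> v \<oplus>\<^bsub>L\<^esub> w" using decompose[OF cl(3)] .
    have c: "u \<in> carrier L" "v \<in> carrier L" "w \<in> carrier L" using d by (simp_all add: weight_closed)
    have 1: "h \<otimes>\<^bsub>L\<^esub> (x \<otimes>\<^bsub>L\<^esub> y) = \<ominus>\<^bsub>L\<^esub> (x \<otimes>\<^bsub>L\<^esub> y \<oplus>\<^bsub>L\<^esub> x \<otimes>\<^bsub>L\<^esub> y \<oplus>\<^bsub>L\<^esub> (x \<otimes>\<^bsub>L\<^esub> y \<oplus>\<^bsub>L\<^esub> x \<otimes>\<^bsub>L\<^esub> y))"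
      using x y cl triple by (simp add: bracket_derivation[of h x y] weight_iff mult_distribs M.minus_add M.a_ac)
    have 2: "h \<otimes>\<^bsub>L\<^esub> (x \<otimes>\<^bsub>L\<^esub> y) = w \<oplus>\<^bsub>L\<^esub> w \<ominus>\<^bsub>L\<^esub> (u \<oplus>\<^bsub>L\<^esub> u)"
      unfolding d(4) using d(1-3) triple by (simp add: weight_iff mult_distribs mult_closed M.ab_simps)
    have "(u \<oplus>\<^bsub>L\<^esub> u) \<oplus>\<^bsub>L\<^esub> (v \<oplus>\<^bsub>L\<^esub> v \<oplus>\<^bsub>L\<^esub> (v \<oplus>\<^bsub>L\<^esub> v)) \<oplus>\<^bsub>L\<^esub> (w \<oplus>\<^bsub>L\<^esub> w \<oplus>\<^bsub>L\<^esub> w \<oplus>\<^bsub>L\<^esub> (w \<oplus>\<^bsub>L\<^esub> w \<oplus>\<^bsub>L\<^esub> w)) =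
      (x \<otimes>\<^bsub>L\<^esub> y \<oplus>\<^bsub>L\<^esub> x \<otimes>\<^bsub>L\<^esub> y \<oplus>\<^bsub>L\<^esub> (x \<otimes>\<^bsub>L\<^esub> y \<oplus>\<^bsub>L\<^esub> x \<otimes>\<^bsub>L\<^esub> y)) \<oplus>\<^bsub>L\<^esub> (w \<oplus>\<^bsub>L\<^esub> w \<ominus>\<^bsub>L\<^esub> (u \<oplus>\<^bsub>L\<^esub> u))"
      unfolding d(4) using c by (simp add: M.ab_simps)
    also have "\<dots> = \<zero>\<^bsub>L\<^esub>" using 1 cl unfolding 2 by (simp add: M.r_neg)
    finally have 0: "(u \<oplus>\<^bsub>L\<^esub> u) \<oplus>\<^bsub>L\<^esub> (v \<oplus>\<^bsub>L\<^esub> v \<oplus>\<^bsub>L\<^esub> (v \<oplus>\<^bsub>L\<^esub> v)) \<oplus>\<^bsub>L\<^esub> (w \<oplus>\<^bsub>L\<^esub> w \<oplus>\<^bsub>L\<^esub> w \<oplus>\<^bsub>L\<^esub> (w \<oplus>\<^bsub>L\<^esub> w \<oplus>\<^bsub>L\<^esub> w)) = \<zero>\<^bsub>L\<^esub>" .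
    have "u \<oplus>\<^bsub>L\<^esub> u \<in> W (-1)" "v \<oplus>\<^bsub>L\<^esub> v \<oplus>\<^bsub>L\<^esub> (v \<oplus>\<^bsub>L\<^esub> v) \<in> W 0" "w \<oplus>\<^bsub>L\<^esub> w \<oplus>\<^bsub>L\<^esub> w \<oplus>\<^bsub>L\<^esub> (w \<oplus>\<^bsub>L\<^esub> w \<oplus>\<^bsub>L\<^esub> w) \<in> W 1"
      using d(1-3) by (simp_all add: W1 Wm W0)
    note decompose_zero[OF this 0]
    then have "u = \<zero>\<^bsub>L\<^esub>" "v = \<zero>\<^bsub>L\<^esub>" "w = \<zero>\<^bsub>L\<^esub>"
      using LV.double_eq_zero[OF _ c(1)] four[OF _ c(2)] six[OF _ c(3)] by blast+
    then show ?thesis using d(4) by simp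
  qed
qed

lemma bracket_weights:
  "\<lbrakk>x \<in> W 0; y \<in> W 1\<rbrakk> \<Longrightarrow> x \<otimes>\<^bsub>L\<^esub> y \<in> W 1" "\<lbrakk>x \<in> W 0; y \<in> W (-1)\<rbrakk> \<Longrightarrow> x \<otimes>\<^bsub>L\<^esub> y \<in> W (-1)"
  "\<lbrakk>x \<in> W 0; y \<in> W 0\<rbrakk> \<Longrightarrow> x \<otimes>\<^bsub>L\<^esub> y \<in> W 0"
  "\<lbrakk>x \<in> W 1; y \<in> W (-1)\<rbrakk> \<Longrightarrow> x \<otimes>\<^bsub>L\<^esub> y \<in> W 0" "\<lbrakk>x \<in> W (-1); y \<in> W 1\<rbrakk> \<Longrightarrow> x \<otimes>\<^bsub>L\<^esub> y \<in> W 0"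
  "\<lbrakk>x \<in> W 1; y \<in> W 0\<rbrakk> \<Longrightarrow> x \<otimes>\<^bsub>L\<^esub> y \<in> W 1" "\<lbrakk>x \<in> W (-1); y \<in> W 0\<rbrakk> \<Longrightarrow> x \<otimes>\<^bsub>L\<^esub> y \<in> W (-1)"
  using triple(1)
  by (simp_all add: weight_iff bracket_derivation[of h x y] mult_distribs mult_closed M.r_neg M.l_neg)

lemma A_weight: "a \<in> W 1 \<Longrightarrow> A a \<in> W 0" by (rule bracket_weights(4)[OF _ e_f_weight(2)])

lemma A_sym:
  assumes a: "a \<in> W 1" and b: "b \<in> W 1" shows "A a \<otimes>\<^bsub>L\<^esub> b = A b \<otimes>\<^bsub>L\<^esub> a"
proof -
  note cl = weight_closed[OF a] weight_closed[OF b] triple(3) mult_closed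
  have "A a \<otimes>\<^bsub>L\<^esub> b = a \<otimes>\<^bsub>L\<^esub> (f \<otimes>\<^bsub>L\<^esub> b)"
    using bracket_commutator[of a f b] bracket_same_weight(1)[OF a b] by (simp add: cl mult_zero M.diff_zero)
  also have "\<dots> = A b \<otimes>\<^bsub>L\<^esub> a"
    using bracket_swap[of a "f \<otimes>\<^bsub>L\<^esub> b"] bracket_swap[of f b] by (simp add: cl mult_minus)
  finally show ?thesis .
qed

lemma F_weight: "b \<in> W 1 \<Longrightarrow> f \<otimes>\<^bsub>L\<^esub> b \<in> W 0" "b \<in> W 1 \<Longrightarrow> F b \<in> W (-1)"
  by (simp_all add: bracket_weights e_f_weight)

lemma bracket_F:
  assumes a: "a \<in> W 1" and b: "b \<in> W 1"
  shows "a \<otimes>\<^bsub>L\<^esub> F b = \<ominus>\<^bsub>L\<^esub> (A a \<otimes>\<^bsub>L\<^esub> A b \<oplus>\<^bsub>L\<^esub> A (A a \<otimes>\<^bsub>L\<^esub> b))"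
proof -
  note cl = weight_closed[OF a] weight_closed[OF b] triple(3) mult_closed
  have fb: "f \<otimes>\<^bsub>L\<^esub> b = \<ominus>\<^bsub>L\<^esub> A b" using bracket_swap[of f b] by (simp add: cl)
  have "a \<otimes>\<^bsub>L\<^esub> (f \<otimes>\<^bsub>L\<^esub> b) = A a \<otimes>\<^bsub>L\<^esub> b"
    using bracket_derivation[of a f b] bracket_same_weight(1)[OF a b] by (simp add: cl mult_zero)
  then have "a \<otimes>\<^bsub>L\<^esub> F b = A a \<otimes>\<^bsub>L\<^esub> (f \<otimes>\<^bsub>L\<^esub> b) \<oplus>\<^bsub>L\<^esub> f \<otimes>\<^bsub>L\<^esub> (A a \<otimes>\<^bsub>L\<^esub> b)"
    using bracket_derivation[of a f "f \<otimes>\<^bsub>L\<^esub> b"] by (simp add: cl)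
  also have "f \<otimes>\<^bsub>L\<^esub> (A a \<otimes>\<^bsub>L\<^esub> b) = \<ominus>\<^bsub>L\<^esub> A (A a \<otimes>\<^bsub>L\<^esub> b)" using bracket_swap[of f "A a \<otimes>\<^bsub>L\<^esub> b"] by (simp add: cl)
  also have "A a \<otimes>\<^bsub>L\<^esub> (f \<otimes>\<^bsub>L\<^esub> b) = \<ominus>\<^bsub>L\<^esub> (A a \<otimes>\<^bsub>L\<^esub> A b)" by (simp add: fb cl mult_minus)
  finally show ?thesis by (simp add: cl M.minus_add)
qed

text \<open>
  Expanding \<open>[A a, F b]\<close> by derivations expresses it by \<open>[A b, F a]\<close>, and conversely; eliminating
  one of the two unknowns leaves three times the claim.
\<close>

lemma A_F:
  assumes a: "a \<in> W 1" and b: "b \<in> W 1" shows "A a \<otimes>\<^bsub>L\<^esub> F b = \<ominus>\<^bsub>L\<^esub> F (A a \<otimes>\<^bsub>L\<^esub> b)"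
proof -
  note cl = weight_closed[OF a] weight_closed[OF b] triple(3) mult_closed
  have expand: "A x \<otimes>\<^bsub>L\<^esub> F y = A y \<otimes>\<^bsub>L\<^esub> F x \<oplus>\<^bsub>L\<^esub> A y \<otimes>\<^bsub>L\<^esub> F x \<oplus>\<^bsub>L\<^esub> F (A x \<otimes>\<^bsub>L\<^esub> y)"
    if x: "x \<in> W 1" and y: "y \<in> W 1" for x y
  proof -
    note cl = weight_closed[OF x] weight_closed[OF y] triple(3) mult_closed
    have xf: "A x \<otimes>\<^bsub>L\<^esub> f = F x"
      using bracket_swap[of "A x" f] bracket_swap[of x f] by (simp add: cl mult_minus)
    have g: "F x \<otimes>\<^bsub>L\<^esub> (f \<otimes>\<^bsub>L\<^esub> y) = A y \<otimes>\<^bsub>L\<^esub> F x"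
      using bracket_swap[of "F x" "f \<otimes>\<^bsub>L\<^esub> y"] bracket_swap[of f y] by (simp add: cl mult_minus)
    have g': "f \<otimes>\<^bsub>L\<^esub> (F x \<otimes>\<^bsub>L\<^esub> y) = F x \<otimes>\<^bsub>L\<^esub> (f \<otimes>\<^bsub>L\<^esub> y)"
      using bracket_derivation[of f "F x" y] bracket_same_weight(2)[OF e_f_weight(2) F_weight(2)[OF x]]
      by (simp add: cl mult_zero)
    have "A x \<otimes>\<^bsub>L\<^esub> F y = F x \<otimes>\<^bsub>L\<^esub> (f \<otimes>\<^bsub>L\<^esub> y) \<oplus>\<^bsub>L\<^esub> f \<otimes>\<^bsub>L\<^esub> (F x \<otimes>\<^bsub>L\<^esub> y \<oplus>\<^bsub>L\<^esub> f \<otimes>\<^bsub>L\<^esub> (A x \<otimes>\<^bsub>L\<^esub> y))"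
      using bracket_derivation[of "A x" f "f \<otimes>\<^bsub>L\<^esub> y"] bracket_derivation[of "A x" f y] by (simp add: cl xf)
    then show ?thesis by (simp add: cl mult_add_right g g' M.a_ac)
  qed
  define X Y w where "X = A a \<otimes>\<^bsub>L\<^esub> F b" and "Y = A b \<otimes>\<^bsub>L\<^esub> F a" and "w = F (A a \<otimes>\<^bsub>L\<^esub> b)"
  have c: "X \<in> carrier L" "Y \<in> carrier L" "w \<in> carrier L" by (simp_all add: X_def Y_def w_def cl)
  have X: "X = Y \<oplus>\<^bsub>L\<^esub> Y \<oplus>\<^bsub>L\<^esub> w" and Y: "Y = X \<oplus>\<^bsub>L\<^esub> X \<oplus>\<^bsub>L\<^esub> w"
    using expand[OF a b] expand[OF b a] A_sym[OF a b] by (simp_all add: X_def Y_def w_def)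
  have "(X \<oplus>\<^bsub>L\<^esub> w) \<oplus>\<^bsub>L\<^esub> (X \<oplus>\<^bsub>L\<^esub> w) \<oplus>\<^bsub>L\<^esub> (X \<oplus>\<^bsub>L\<^esub> w) = (X \<oplus>\<^bsub>L\<^esub> X \<oplus>\<^bsub>L\<^esub> w \<ominus>\<^bsub>L\<^esub> Y) \<oplus>\<^bsub>L\<^esub> (X \<oplus>\<^bsub>L\<^esub> X \<oplus>\<^bsub>L\<^esub> w \<ominus>\<^bsub>L\<^esub> Y) \<oplus>\<^bsub>L\<^esub> (Y \<oplus>\<^bsub>L\<^esub> Y \<oplus>\<^bsub>L\<^esub> w \<ominus>\<^bsub>L\<^esub> X)"
    using c by (simp add: M.ab_simps)
  also have "\<dots> = \<zero>\<^bsub>L\<^esub>" using c X[symmetric] Y[symmetric] by (simp add: M.diff_self)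
  finally have "X \<oplus>\<^bsub>L\<^esub> w = \<zero>\<^bsub>L\<^esub>" by (rule LV.triple_eq_zero) (simp add: c)
  then show ?thesis using c unfolding X_def[symmetric] w_def[symmetric] by (simp add: M.minus_across)
qed

text \<open>
  Put \<open>s = [A a, a]\<close> and apply \<open>A a\<close> to \<open>[a, F a] = - A s\<close>.  By \<open>A_F\<close> and \<open>bracket_F\<close> the left-hand side
  becomes twice the commutator of \<open>A a\<close> and \<open>A s\<close>, while the right-hand side becomes its negative;
  hence three times this commutator is zero.
\<close>

lemma commute_square:
  assumes a: "a \<in> W 1" shows "A a \<otimes>\<^bsub>L\<^esub> A (A a \<otimes>\<^bsub>L\<^esub> a) = \<zero>\<^bsub>L\<^esub>"
proof -
  define s where "s = A a \<otimes>\<^bsub>L\<^esub> a"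
  have s: "s \<in> W 1" unfolding s_def by (simp add: bracket_weights A_weight a)
  note cl = weight_closed[OF a] weight_closed[OF s] triple(3) mult_closed
  define X where "X = A a \<otimes>\<^bsub>L\<^esub> A s"
  have X: "X \<in> carrier L" by (simp add: X_def cl)
  have 1: "a \<otimes>\<^bsub>L\<^esub> F s = \<ominus>\<^bsub>L\<^esub> (X \<oplus>\<^bsub>L\<^esub> A (A a \<otimes>\<^bsub>L\<^esub> s))" using bracket_F[OF a s] by (simp add: X_def)
  have 2: "s \<otimes>\<^bsub>L\<^esub> F a = \<ominus>\<^bsub>L\<^esub> (\<ominus>\<^bsub>L\<^esub> X \<oplus>\<^bsub>L\<^esub> A (A a \<otimes>\<^bsub>L\<^esub> s))"
    using bracket_F[OF s a] A_sym[OF s a] bracket_swap[of "A s" "A a"] by (simp add: X_def cl)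
  have 3: "a \<otimes>\<^bsub>L\<^esub> F a = \<ominus>\<^bsub>L\<^esub> A s"
    using bracket_F[OF a a] by (simp add: s_def[symmetric] bracket_self cl)
  have "\<ominus>\<^bsub>L\<^esub> X = s \<otimes>\<^bsub>L\<^esub> F a \<oplus>\<^bsub>L\<^esub> a \<otimes>\<^bsub>L\<^esub> (\<ominus>\<^bsub>L\<^esub> F s)"
    using bracket_derivation[of "A a" a "F a"] A_F[OF a a]
    by (simp add: 3 cl mult_minus s_def[symmetric] X_def)
  also have "\<dots> = X \<oplus>\<^bsub>L\<^esub> X" by (simp add: mult_minus cl 1 2) (simp add: X cl M.ab_simps)
  finally have "X \<oplus>\<^bsub>L\<^esub> X \<oplus>\<^bsub>L\<^esub> X = \<zero>\<^bsub>L\<^esub>" using X by (simp add: M.ab_simps)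
  then have "X = \<zero>\<^bsub>L\<^esub>" by (rule LV.triple_eq_zero[OF _ X])
  then show ?thesis by (simp add: X_def s_def)
qed

lemma jordan_of_simps:
  "carrier J = W 1" "a \<otimes>\<^bsub>J\<^esub> b = half R \<odot>\<^bsub>L\<^esub> (A a \<otimes>\<^bsub>L\<^esub> b)" "\<one>\<^bsub>J\<^esub> = e"
  "a \<oplus>\<^bsub>J\<^esub> b = a \<oplus>\<^bsub>L\<^esub> b" "r \<odot>\<^bsub>J\<^esub> a = r \<odot>\<^bsub>L\<^esub> a" "\<zero>\<^bsub>J\<^esub> = \<zero>\<^bsub>L\<^esub>"
  by (simp_all add: jordan_of_def)

lemma jordan_of_module: "module R J"
  unfolding jordan_of_def prod.case
  using module_update_mult(2)[OF restrict_module[OF weight_submodule(1)]] by simp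

lemma jordan_of_minus:
  assumes "a \<in> W 1" "b \<in> W 1" shows "\<ominus>\<^bsub>J\<^esub> a = \<ominus>\<^bsub>L\<^esub> a" "a \<ominus>\<^bsub>J\<^esub> b = a \<ominus>\<^bsub>L\<^esub> b"
proof -
  have *: "\<ominus>\<^bsub>J\<^esub> x = \<ominus>\<^bsub>L\<^esub> x" if "x \<in> W 1" for x
    using linear_map_minus(2)[OF jordan_of_module module_axioms, of "\<lambda>x. x" x] that
    by (simp add: linear_map_def jordan_of_simps weight_closed)
  then show "\<ominus>\<^bsub>J\<^esub> a = \<ominus>\<^bsub>L\<^esub> a" "a \<ominus>\<^bsub>J\<^esub> b = a \<ominus>\<^bsub>L\<^esub> b" using assms by (simp_all add: a_minus_def jordan_of_simps)
qed

lemma dot_weight: "\<lbrakk>a \<in> W 1; b \<in> W 1\<rbrakk> \<Longrightarrow> A a \<otimes>\<^bsub>L\<^esub> b \<in> W 1"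
  by (simp add: bracket_weights A_weight)

text \<open>
  Multiplication by \<open>a\<close> is half of \<open>A a\<close>, so the Jordan identity, which says that the multiplications
  by \<open>a\<close> and by the square of \<open>a\<close> commute, is \<open>commute_square\<close>.
\<close>

theorem jordan_of_jordan: "jordan_char_not_2_3 R J"
proof -
  interpret J: module R J by (rule jordan_of_module)
  note cl = weight_closed triple(3) mult_closed half_closed
  note sm = mult_smult_left mult_smult_right
  have "nonassoc_algebra R J"
    by (unfold_locales; simp add: jordan_of_simps cl dot_weight W1 mult_distribs smult_r_distr sm)
      (simp_all add: cl smult_assoc1[symmetric] m_comm)
  moreover have "unital_jordan_algebra_axioms J"
  proof (rule unital_jordan_algebra_axioms.intro; simp only: jordan_of_simps)
    show com: "half R \<odot>\<^bsub>L\<^esub> (A a \<otimes>\<^bsub>L\<^esub> b) = half R \<odot>\<^bsub>L\<^esub> (A b \<otimes>\<^bsub>L\<^esub> a)" if "a \<in> W 1" "b \<in> W 1" for a b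
      using A_sym[OF that] by simp
    show "half R \<odot>\<^bsub>L\<^esub> (A (half R \<odot>\<^bsub>L\<^esub> (A (half R \<odot>\<^bsub>L\<^esub> (A a \<otimes>\<^bsub>L\<^esub> a)) \<otimes>\<^bsub>L\<^esub> b)) \<otimes>\<^bsub>L\<^esub> a) =
        half R \<odot>\<^bsub>L\<^esub> (A (half R \<odot>\<^bsub>L\<^esub> (A a \<otimes>\<^bsub>L\<^esub> a)) \<otimes>\<^bsub>L\<^esub> (half R \<odot>\<^bsub>L\<^esub> (A b \<otimes>\<^bsub>L\<^esub> a)))"
      if a: "a \<in> W 1" and b: "b \<in> W 1" for a b
    proof -
      define s where "s = A a \<otimes>\<^bsub>L\<^esub> a"
      have s: "s \<in> W 1" unfolding s_def by (rule dot_weight[OF a a])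
      have "A a \<otimes>\<^bsub>L\<^esub> (A s \<otimes>\<^bsub>L\<^esub> b) \<ominus>\<^bsub>L\<^esub> A s \<otimes>\<^bsub>L\<^esub> (A a \<otimes>\<^bsub>L\<^esub> b) = (A a \<otimes>\<^bsub>L\<^esub> A s) \<otimes>\<^bsub>L\<^esub> b"
        using bracket_commutator[of "A a" "A s" b] a b s by (simp add: cl)
      also have "\<dots> = \<zero>\<^bsub>L\<^esub>" using commute_square[OF a] b by (simp add: s_def[symmetric] cl mult_zero)
      finally have "A a \<otimes>\<^bsub>L\<^esub> (A s \<otimes>\<^bsub>L\<^esub> b) = A s \<otimes>\<^bsub>L\<^esub> (A a \<otimes>\<^bsub>L\<^esub> b)"
        using a b s by (simp add: cl M.diff_eq_zero_iff)
      moreover have "A (A s \<otimes>\<^bsub>L\<^esub> b) \<otimes>\<^bsub>L\<^esub> a = A a \<otimes>\<^bsub>L\<^esub> (A s \<otimes>\<^bsub>L\<^esub> b)"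
        by (rule A_sym[OF dot_weight[OF s b] a])
      ultimately show ?thesis using a b s A_sym[OF a b] by (simp add: s_def[symmetric] cl sm)
    qed
    show "half R \<odot>\<^bsub>L\<^esub> (A e \<otimes>\<^bsub>L\<^esub> a) = a" if "a \<in> W 1" for a
      using that by (simp add: triple(4) weight_iff LV.smult_half_double)
  qed (simp_all add: e_f_weight)
  ultimately show ?thesis
    by (simp add: jordan_char_not_2_3_def unital_jordan_algebra_def field_char_not_2_3_axioms)
qed

lemma jordan_of_triple2:
  assumes "a \<in> W 1" "b \<in> W 1" "c \<in> W 1"
  shows "jordan_triple2 J a b c = half R \<odot>\<^bsub>L\<^esub> (A (A a \<otimes>\<^bsub>L\<^esub> b) \<otimes>\<^bsub>L\<^esub> c \<oplus>\<^bsub>L\<^esub> A a \<otimes>\<^bsub>L\<^esub> (A b \<otimes>\<^bsub>L\<^esub> c) \<ominus>\<^bsub>L\<^esub> A b \<otimes>\<^bsub>L\<^esub> (A a \<otimes>\<^bsub>L\<^esub> c))"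
    (is "_ = half R \<odot>\<^bsub>L\<^esub> ?T")
proof -
  note cl = weight_closed triple(3) mult_closed half_closed dot_weight W1
  have "jordan_triple J a b c = half R \<odot>\<^bsub>L\<^esub> (half R \<odot>\<^bsub>L\<^esub> ?T)"
    using assms by (simp add: jordan_triple_def jordan_of_simps jordan_of_minus cl mult_smult_left mult_smult_right
        smult_r_distr smult_r_diff)
  then show ?thesis
    using assms by (simp add: jordan_triple2_def jordan_of_simps LV.half_add_half cl)
qed

lemma q_weight: "b \<in> W 1 \<Longrightarrow> q b \<in> W (-1)"
  using F_weight(2) Wm by (simp add: opposite_part_def)

text \<open>
  By \<open>bracket_F\<close> the bracket of \<open>a\<close> and \<open>q b\<close> is a combination of \<open>[A a, A b]\<close> and \<open>A [A a, b]\<close>.  On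
  \<open>L_1\<close> these are given by the product of \<open>J\<close>; on \<open>L_{-1}\<close> they act by the same formulas, except that
  every \<open>A a\<close> changes its sign (\<open>A_F\<close>).
\<close>

theorem jordan_of_datum: "jordan_datum R J L (\<lambda>a. a) q"
proof (rule jordan_datumI[OF jordan_of_jordan lie_algebra_axioms])
  note cl = weight_closed triple(3) mult_closed half_closed
  show "linear_map R J L (\<lambda>a. a)" by (simp add: linear_map_def jordan_of_simps weight_closed)
  show "linear_map R J L q"
    by (rule linear_mapI)
      (simp_all add: opposite_part_def jordan_of_simps cl mult_add_right mult_smult_right smult_r_distr M.minus_add
        smult_r_minus smult_assoc1[symmetric] m_comm)
  fix a b assume ab: "a \<in> carrier J" "b \<in> carrier J"
  then have a: "a \<in> W 1" and b: "b \<in> W 1" by (simp_all add: jordan_of_simps)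
  show "a \<otimes>\<^bsub>L\<^esub> b = \<zero>\<^bsub>L\<^esub>" by (rule bracket_same_weight(1)[OF a b])
  show "q a \<otimes>\<^bsub>L\<^esub> q b = \<zero>\<^bsub>L\<^esub>" by (rule bracket_same_weight(2)[OF q_weight[OF a] q_weight[OF b]])
  fix c assume c: "c \<in> carrier J"
  then have c: "c \<in> W 1" by (simp add: jordan_of_simps)
  have aqb: "a \<otimes>\<^bsub>L\<^esub> q b = half R \<odot>\<^bsub>L\<^esub> (A a \<otimes>\<^bsub>L\<^esub> A b \<oplus>\<^bsub>L\<^esub> A (A a \<otimes>\<^bsub>L\<^esub> b))"
    using a b by (simp add: opposite_part_def cl mult_minus mult_smult_right bracket_F smult_r_minus)
  show "(a \<otimes>\<^bsub>L\<^esub> q b) \<otimes>\<^bsub>L\<^esub> c = jordan_triple2 J a b c"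
    unfolding aqb jordan_of_triple2[OF a b c] using a b c bracket_commutator[of "A a" "A b" c]
    by (simp add: cl mult_smult_left mult_add_left) (simp add: cl M.ab_simps)
  let ?T = "A (A b \<otimes>\<^bsub>L\<^esub> a) \<otimes>\<^bsub>L\<^esub> c \<oplus>\<^bsub>L\<^esub> A b \<otimes>\<^bsub>L\<^esub> (A a \<otimes>\<^bsub>L\<^esub> c) \<ominus>\<^bsub>L\<^esub> A a \<otimes>\<^bsub>L\<^esub> (A b \<otimes>\<^bsub>L\<^esub> c)"
  have F_add: "F (x \<oplus>\<^bsub>L\<^esub> y) = F x \<oplus>\<^bsub>L\<^esub> F y" "F (x \<ominus>\<^bsub>L\<^esub> y) = F x \<ominus>\<^bsub>L\<^esub> F y" "F (\<ominus>\<^bsub>L\<^esub> x) = \<ominus>\<^bsub>L\<^esub> F x" "F (r \<odot>\<^bsub>L\<^esub> x) = r \<odot>\<^bsub>L\<^esub> F x"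
    if "x \<in> carrier L" "y \<in> carrier L" "r \<in> carrier R" for x y r
    using that by (simp_all add: cl mult_distribs mult_smult_right)
  have "(A a \<otimes>\<^bsub>L\<^esub> A b \<oplus>\<^bsub>L\<^esub> A (A a \<otimes>\<^bsub>L\<^esub> b)) \<otimes>\<^bsub>L\<^esub> F c = \<ominus>\<^bsub>L\<^esub> F ?T"
  proof -
    have 1: "A a \<otimes>\<^bsub>L\<^esub> (A b \<otimes>\<^bsub>L\<^esub> F c) = F (A a \<otimes>\<^bsub>L\<^esub> (A b \<otimes>\<^bsub>L\<^esub> c))"
      using A_F[OF b c] A_F[OF a dot_weight[OF b c]] a b c by (simp add: cl mult_minus)
    have 2: "A b \<otimes>\<^bsub>L\<^esub> (A a \<otimes>\<^bsub>L\<^esub> F c) = F (A b \<otimes>\<^bsub>L\<^esub> (A a \<otimes>\<^bsub>L\<^esub> c))"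
      using A_F[OF a c] A_F[OF b dot_weight[OF a c]] a b c by (simp add: cl mult_minus)
    have 3: "A (A a \<otimes>\<^bsub>L\<^esub> b) \<otimes>\<^bsub>L\<^esub> F c = \<ominus>\<^bsub>L\<^esub> F (A (A a \<otimes>\<^bsub>L\<^esub> b) \<otimes>\<^bsub>L\<^esub> c)"
      by (rule A_F[OF dot_weight[OF a b] c])
    show ?thesis
      using a b c bracket_commutator[of "A a" "A b" "F c"] A_sym[OF b a]
      by (simp add: cl mult_add_left 1 2 3 F_add[OF _ _ half_closed]) (simp add: cl M.ab_simps)
  qed
  then show "(a \<otimes>\<^bsub>L\<^esub> q b) \<otimes>\<^bsub>L\<^esub> q c = \<ominus>\<^bsub>L\<^esub> q (jordan_triple2 J b a c)"
    unfolding aqb jordan_of_triple2[OF b a c] using a b c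
    by (simp add: opposite_part_def cl mult_minus mult_smult_left mult_smult_right smult_r_minus)
qed

text \<open>The triple \<open>(-h, f, e)\<close> yields the inverse of \<open>q\<close> by the same formula.\<close>

lemma q_surj:
  assumes y: "y \<in> W (-1)" obtains b where "b \<in> W 1" "q b = y"
proof
  note cl = weight_closed triple mult_closed half_closed
  define x where "x = e \<otimes>\<^bsub>L\<^esub> y"
  have x: "x \<in> W 0" unfolding x_def by (simp add: bracket_weights e_f_weight y)
  have ex: "e \<otimes>\<^bsub>L\<^esub> x \<in> W 1" by (simp add: bracket_weights e_f_weight x)
  have fe: "f \<otimes>\<^bsub>L\<^esub> e = \<ominus>\<^bsub>L\<^esub> h" using bracket_swap[of f e] by (simp add: triple)
  have fx: "f \<otimes>\<^bsub>L\<^esub> x = y \<oplus>\<^bsub>L\<^esub> y"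
    using bracket_derivation[of f e y] bracket_same_weight(2)[OF e_f_weight(2) y] y
    by (simp add: x_def fe cl mult_minus mult_zero weight_iff)
  have fex: "f \<otimes>\<^bsub>L\<^esub> (e \<otimes>\<^bsub>L\<^esub> x) = x \<oplus>\<^bsub>L\<^esub> x"
    using bracket_derivation[of f e x] x y fx
    by (simp add: fe cl mult_minus weight_iff mult_add_right) (simp add: x_def)
  have F: "F (e \<otimes>\<^bsub>L\<^esub> x) = (y \<oplus>\<^bsub>L\<^esub> y) \<oplus>\<^bsub>L\<^esub> (y \<oplus>\<^bsub>L\<^esub> y)"
    using x y by (simp add: fex mult_add_right cl fx)
  show "\<ominus>\<^bsub>L\<^esub> (half R \<odot>\<^bsub>L\<^esub> (e \<otimes>\<^bsub>L\<^esub> x)) \<in> W 1" using ex W1 by simp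
  show "q (\<ominus>\<^bsub>L\<^esub> (half R \<odot>\<^bsub>L\<^esub> (e \<otimes>\<^bsub>L\<^esub> x))) = y"
    using x y ex F by (simp add: opposite_part_def cl mult_minus mult_smult_right smult_r_minus LV.smult_half_double)
qed

lemma q_inj:
  assumes a: "a \<in> W 1" and b: "b \<in> W 1" and eq: "q a = q b" shows "a = b"
proof -
  note cl = weight_closed triple mult_closed half_closed
  have eeq: "e \<otimes>\<^bsub>L\<^esub> (e \<otimes>\<^bsub>L\<^esub> q a) = \<ominus>\<^bsub>L\<^esub> (a \<oplus>\<^bsub>L\<^esub> a)" if a: "a \<in> W 1" for a
  proof -
    have "A e \<otimes>\<^bsub>L\<^esub> A a = \<zero>\<^bsub>L\<^esub>" using A_weight[OF a] triple(4) by (simp add: weight_iff)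
    then have "e \<otimes>\<^bsub>L\<^esub> F a = \<ominus>\<^bsub>L\<^esub> (A a \<oplus>\<^bsub>L\<^esub> A a)"
      using bracket_F[OF e_f_weight(1) a] a triple by (simp add: weight_iff mult_distribs cl)
    then have "e \<otimes>\<^bsub>L\<^esub> q a = A a"
      using a by (simp add: opposite_part_def cl mult_minus mult_smult_right smult_r_minus LV.smult_half_double)
    moreover have "e \<otimes>\<^bsub>L\<^esub> A a = \<ominus>\<^bsub>L\<^esub> (a \<oplus>\<^bsub>L\<^esub> a)"
      using bracket_derivation[of e a f] bracket_same_weight(1)[OF e_f_weight(1) a] a bracket_swap[of a h]
      by (simp add: cl mult_zero weight_iff)
    ultimately show ?thesis by simp
  qed
  have c: "a \<in> carrier L" "b \<in> carrier L" using weight_closed[OF a] weight_closed[OF b] .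
  have "\<ominus>\<^bsub>L\<^esub> (a \<oplus>\<^bsub>L\<^esub> a) = \<ominus>\<^bsub>L\<^esub> (b \<oplus>\<^bsub>L\<^esub> b)" using eeq[OF a] eeq[OF b] eq by simp
  then have "\<ominus>\<^bsub>L\<^esub> (\<ominus>\<^bsub>L\<^esub> (a \<oplus>\<^bsub>L\<^esub> a)) = \<ominus>\<^bsub>L\<^esub> (\<ominus>\<^bsub>L\<^esub> (b \<oplus>\<^bsub>L\<^esub> b))" by (rule arg_cong)
  then have "a \<oplus>\<^bsub>L\<^esub> a = b \<oplus>\<^bsub>L\<^esub> b" by (simp add: c)
  then show ?thesis by (rule LV.double_cancel) (simp_all add: c)
qed

text \<open>This is where the condition \<open>L_0 = [L_{-1}, L_1]\<close> enters.\<close>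

lemma jordan_of_core: "datum_core R J L (\<lambda>a. a) q = carrier L"
proof -
  interpret D: jordan_datum R J L "\<lambda>a. a" q by (rule jordan_of_datum)
  have W1: "carrier J = W 1" by (simp add: jordan_of_simps)
  have Wm: "q ` W 1 = W (-1)"
    by (auto intro: q_weight elim: q_surj)
  have "{q b \<otimes>\<^bsub>L\<^esub> a | a b. a \<in> W 1 \<and> b \<in> W 1} = {x \<otimes>\<^bsub>L\<^esub> y | x y. x \<in> W (-1) \<and> y \<in> W 1}"
    unfolding Wm[symmetric] by blast
  then have "datum_zero R J L (\<lambda>a. a) q = W 0"
    unfolding graded_zero by (simp add: datum_zero_def W1)
  then have core: "datum_core R J L (\<lambda>a. a) q = {q b \<oplus>\<^bsub>L\<^esub> z \<oplus>\<^bsub>L\<^esub> a | a b z. a \<in> W 1 \<and> b \<in> W 1 \<and> z \<in> W 0}"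
    by (simp add: datum_core_def W1)
  show ?thesis
  proof
    show "datum_core R J L (\<lambda>a. a) q \<subseteq> carrier L" using D.core_closed by auto
    show "carrier L \<subseteq> datum_core R J L (\<lambda>a. a) q"
    proof
      fix x assume "x \<in> carrier L"
      then obtain u v w where d: "u \<in> W (-1)" "v \<in> W 0" "w \<in> W 1" "x = u \<oplus>\<^bsub>L\<^esub> v \<oplus>\<^bsub>L\<^esub> w" by (rule decompose)
      then obtain b where "b \<in> W 1" "u = q b" using Wm by auto
      with d show "x \<in> datum_core R J L (\<lambda>a. a) q" unfolding core by blast
    qed
  qed
qed

lemma q_e: "q e = f"
  using triple bracket_swap[of f e] bracket_swap[of f h]
  by (simp add: opposite_part_def mult_closed mult_minus LV.smult_half_double smult_r_minus)

end

section \<open>Quotients, free modules and exterior powers\<close>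

text \<open>
  Homology and cohomology are quotients of a structure whose carrier is cut down to the set \<open>K\<close> of
  cycles.  Whether they vanish depends only on the addition, which may be compared with that of any
  ambient group \<open>M\<close>.
\<close>

lemma zero_quot_module_iff:
  assumes M: "abelian_group M" and N: "subgroup N (add_monoid M)" and K: "K \<subseteq> carrier M" "K \<noteq> {}"
    and Q: "add Q = add M"
  shows "zero_module (quot_module (Q\<lparr>carrier := K\<rparr>) N) \<longleftrightarrow> K \<subseteq> N"
proof -
  interpret M: abelian_group M by fact
  have N': "N \<subseteq> carrier M" "\<zero>\<^bsub>M\<^esub> \<in> N" "\<And>x y. \<lbrakk>x \<in> N; y \<in> N\<rbrakk> \<Longrightarrow> x \<oplus>\<^bsub>M\<^esub> y \<in> N" "\<And>x. x \<in> N \<Longrightarrow> \<ominus>\<^bsub>M\<^esub> x \<in> N"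
    using subgroup.subset[OF N] subgroup.one_closed[OF N] subgroup.m_closed[OF N] subgroup.m_inv_closed[OF N]
    by (simp_all add: a_inv_def)
  have coset: "N +>\<^bsub>Q\<lparr>carrier := K\<rparr>\<^esub> x = (\<lambda>n. n \<oplus>\<^bsub>M\<^esub> x) ` N" for x
    by (auto simp: a_r_coset_def' Q)
  have eq: "(\<lambda>n. n \<oplus>\<^bsub>M\<^esub> x) ` N = N \<longleftrightarrow> x \<in> N" if "x \<in> K" for x
  proof
    assume "(\<lambda>n. n \<oplus>\<^bsub>M\<^esub> x) ` N = N"
    then have "\<zero>\<^bsub>M\<^esub> \<oplus>\<^bsub>M\<^esub> x \<in> N" using N'(2) by blast
    then show "x \<in> N" using that K by auto
  next
    assume x: "x \<in> N"
    show "(\<lambda>n. n \<oplus>\<^bsub>M\<^esub> x) ` N = N"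
    proof
      show "(\<lambda>n. n \<oplus>\<^bsub>M\<^esub> x) ` N \<subseteq> N" using x N'(3) by auto
      show "N \<subseteq> (\<lambda>n. n \<oplus>\<^bsub>M\<^esub> x) ` N"
      proof
        fix n assume n: "n \<in> N"
        have "n = (n \<oplus>\<^bsub>M\<^esub> \<ominus>\<^bsub>M\<^esub> x) \<oplus>\<^bsub>M\<^esub> x" using n x N'(1) by (auto simp: M.a_assoc M.l_neg subset_iff)
        then show "n \<in> (\<lambda>n. n \<oplus>\<^bsub>M\<^esub> x) ` N" using n x N'(3,4) by blast
      qed
    qed
  qed
  have singletons: "(\<Union>x\<in>A. {g x}) = {c} \<longleftrightarrow> (\<forall>x\<in>A. g x = c)" if "A \<noteq> {}" for A :: "'x set" and g and c :: 'y
    using that by auto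
  have "zero_module (quot_module (Q\<lparr>carrier := K\<rparr>) N) \<longleftrightarrow> (\<Union>x\<in>K. {(\<lambda>n. n \<oplus>\<^bsub>M\<^esub> x) ` N}) = {N}"
    by (simp add: zero_module_def quot_module_def A_RCOSETS_def' coset)
  also have "\<dots> \<longleftrightarrow> (\<forall>x\<in>K. (\<lambda>n. n \<oplus>\<^bsub>M\<^esub> x) ` N = N)" by (rule singletons[OF K(2)])
  also have "\<dots> \<longleftrightarrow> K \<subseteq> N" unfolding subset_eq by (rule ball_cong[OF refl]) (rule eq)
  finally show ?thesis .
qed

context module begin

lemma coset_eq_iff:
  assumes N: "submodule N R M" and x: "x \<in> carrier M" and y: "y \<in> carrier M"
  shows "N +>\<^bsub>M\<^esub> x = N +>\<^bsub>M\<^esub> y \<longleftrightarrow> x \<ominus>\<^bsub>M\<^esub> y \<in> N"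
proof
  note sub = submoduleE(1)[OF N]
  have coset: "N +>\<^bsub>M\<^esub> x = (\<lambda>n. n \<oplus>\<^bsub>M\<^esub> x) ` N" for x by (auto simp: a_r_coset_def')
  have *: "N +>\<^bsub>M\<^esub> x \<subseteq> N +>\<^bsub>M\<^esub> y" if d: "x \<ominus>\<^bsub>M\<^esub> y \<in> N" and x: "x \<in> carrier M" and y: "y \<in> carrier M" for x y
  proof
    fix u assume "u \<in> N +>\<^bsub>M\<^esub> x"
    then obtain n where n: "n \<in> N" "u = n \<oplus>\<^bsub>M\<^esub> x" by (auto simp: coset)
    then have "u = (n \<oplus>\<^bsub>M\<^esub> (x \<ominus>\<^bsub>M\<^esub> y)) \<oplus>\<^bsub>M\<^esub> y" using sub x y by (auto simp: M.ab_simps)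
    then show "u \<in> N +>\<^bsub>M\<^esub> y" using n d submoduleE(5)[OF N] unfolding coset by blast
  qed
  show "N +>\<^bsub>M\<^esub> x = N +>\<^bsub>M\<^esub> y" if d: "x \<ominus>\<^bsub>M\<^esub> y \<in> N"
  proof -
    have "\<ominus>\<^bsub>M\<^esub> (x \<ominus>\<^bsub>M\<^esub> y) \<in> N" by (rule submoduleE(3)[OF N d])
    then have "y \<ominus>\<^bsub>M\<^esub> x \<in> N" using x y by (simp add: M.minus_outwards)
    then show ?thesis using *[OF d x y] * x y by blast
  qed
  assume "N +>\<^bsub>M\<^esub> x = N +>\<^bsub>M\<^esub> y"
  then have "\<zero>\<^bsub>M\<^esub> \<oplus>\<^bsub>M\<^esub> x \<in> N +>\<^bsub>M\<^esub> y" using submodule_zero[OF N] unfolding coset by blast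
  then obtain n where "n \<in> N" "x = n \<oplus>\<^bsub>M\<^esub> y" using x by (auto simp: coset)
  moreover from this have "x \<ominus>\<^bsub>M\<^esub> y = n" using sub x y by (auto simp: M.minus_across)
  ultimately show "x \<ominus>\<^bsub>M\<^esub> y \<in> N" by simp
qed

end

locale quotient = module R M for R (structure) and M :: "('k, 'a) module" (structure) +
  fixes N assumes N: "submodule N R M"
begin

abbreviation "Q \<equiv> quot_module M N"
abbreviation "\<pi> x \<equiv> N +>\<^bsub>M\<^esub> x"

lemma quot_simps:
  "carrier Q = \<pi> ` carrier M"
  "\<lbrakk>x \<in> carrier M; y \<in> carrier M\<rbrakk> \<Longrightarrow> \<pi> x \<oplus>\<^bsub>Q\<^esub> \<pi> y = \<pi> (x \<oplus>\<^bsub>M\<^esub> y)"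
  "\<lbrakk>a \<in> carrier R; x \<in> carrier M\<rbrakk> \<Longrightarrow> a \<odot>\<^bsub>Q\<^esub> \<pi> x = \<pi> (a \<odot>\<^bsub>M\<^esub> x)"
  "\<zero>\<^bsub>Q\<^esub> = \<pi> \<zero>\<^bsub>M\<^esub>"
proof -
  note sub = submoduleE(1)[OF N]
  interpret N: abelian_subgroup N M
    by (rule abelian_subgroupI3) (use N in \<open>simp_all add: additive_subgroup_def submodule_def M.abelian_group_axioms\<close>)
  have coset: "N +>\<^bsub>M\<^esub> x = (\<lambda>n. n \<oplus>\<^bsub>M\<^esub> x) ` N" for x by (auto simp: a_r_coset_def')
  show "carrier Q = \<pi> ` carrier M" by (auto simp: quot_module_def A_RCOSETS_def')
  show "\<lbrakk>x \<in> carrier M; y \<in> carrier M\<rbrakk> \<Longrightarrow> \<pi> x \<oplus>\<^bsub>Q\<^esub> \<pi> y = \<pi> (x \<oplus>\<^bsub>M\<^esub> y)"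
    by (simp add: quot_module_def N.a_rcos_sum)
  show "\<zero>\<^bsub>Q\<^esub> = \<pi> \<zero>\<^bsub>M\<^esub>" using sub by (auto simp: quot_module_def coset image_iff subset_iff)
  show "a \<odot>\<^bsub>Q\<^esub> \<pi> x = \<pi> (a \<odot>\<^bsub>M\<^esub> x)" if a: "a \<in> carrier R" and x: "x \<in> carrier M"
  proof -
    have "N <+>\<^bsub>M\<^esub> (\<lambda>x. a \<odot>\<^bsub>M\<^esub> x) ` (N +>\<^bsub>M\<^esub> x) = {n \<oplus>\<^bsub>M\<^esub> a \<odot>\<^bsub>M\<^esub> (n' \<oplus>\<^bsub>M\<^esub> x) | n n'. n \<in> N \<and> n' \<in> N}"
      unfolding set_add_def' coset by blast
    also have "\<dots> = (\<lambda>n. n \<oplus>\<^bsub>M\<^esub> a \<odot>\<^bsub>M\<^esub> x) ` N"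
    proof (intro equalityI subsetI)
      fix u assume "u \<in> {n \<oplus>\<^bsub>M\<^esub> a \<odot>\<^bsub>M\<^esub> (n' \<oplus>\<^bsub>M\<^esub> x) | n n'. n \<in> N \<and> n' \<in> N}"
      then obtain n n' where *: "n \<in> N" "n' \<in> N" "u = n \<oplus>\<^bsub>M\<^esub> a \<odot>\<^bsub>M\<^esub> (n' \<oplus>\<^bsub>M\<^esub> x)" by blast
      moreover have "n \<in> carrier M" "n' \<in> carrier M" using * sub by auto
      ultimately have "u = (n \<oplus>\<^bsub>M\<^esub> a \<odot>\<^bsub>M\<^esub> n') \<oplus>\<^bsub>M\<^esub> a \<odot>\<^bsub>M\<^esub> x" using a x by (simp add: smult_r_distr M.a_assoc)
      then show "u \<in> (\<lambda>n. n \<oplus>\<^bsub>M\<^esub> a \<odot>\<^bsub>M\<^esub> x) ` N" using * a submoduleE(4,5)[OF N] by blast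
    next
      fix u assume "u \<in> (\<lambda>n. n \<oplus>\<^bsub>M\<^esub> a \<odot>\<^bsub>M\<^esub> x) ` N"
      then obtain n where n: "n \<in> N" "u = n \<oplus>\<^bsub>M\<^esub> a \<odot>\<^bsub>M\<^esub> x" by blast
      then have "u = n \<oplus>\<^bsub>M\<^esub> a \<odot>\<^bsub>M\<^esub> (\<zero>\<^bsub>M\<^esub> \<oplus>\<^bsub>M\<^esub> x)" using x by simp
      then show "u \<in> {n \<oplus>\<^bsub>M\<^esub> a \<odot>\<^bsub>M\<^esub> (n' \<oplus>\<^bsub>M\<^esub> x) | n n'. n \<in> N \<and> n' \<in> N}" using n submodule_zero[OF N] by blast
    qed
    finally show ?thesis by (simp add: quot_module_def coset)
  qed
qed

lemma quot_module: "module R Q"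
  by (rule module_image[OF module_axioms, of Q \<pi>]) (simp_all add: quot_simps)

lemma quot_map: "linear_map R M Q \<pi>"
  by (rule linear_mapI) (simp_all add: quot_simps)

lemma quot_zero_iff: "x \<in> carrier M \<Longrightarrow> \<pi> x = \<zero>\<^bsub>Q\<^esub> \<longleftrightarrow> x \<in> N"
  using coset_eq_iff[OF N, of x "\<zero>\<^bsub>M\<^esub>"] by (simp add: quot_simps M.diff_zero)

text \<open>A map that vanishes on \<open>N\<close> is constant on cosets.\<close>

lemma quot_factor:
  assumes V: "module R V" and \<phi>: "linear_map R M V \<phi>" and zero: "\<And>n. n \<in> N \<Longrightarrow> \<phi> n = \<zero>\<^bsub>V\<^esub>"
  shows "linear_map R Q V (\<lambda>K. the_elem (\<phi> ` K))" "x \<in> carrier M \<Longrightarrow> the_elem (\<phi> ` (\<pi> x)) = \<phi> x"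
proof -
  interpret V: module R V by fact
  note sub = submoduleE(1)[OF N]
  have eq: "the_elem (\<phi> ` (\<pi> x)) = \<phi> x" if x: "x \<in> carrier M" for x
  proof -
    have "\<phi> (n \<oplus>\<^bsub>M\<^esub> x) = \<phi> x" if "n \<in> N" for n
      using that x sub zero by (auto simp: linear_map_simps[OF \<phi>] subset_iff)
    then have "(\<lambda>n. \<phi> (n \<oplus>\<^bsub>M\<^esub> x)) ` N = (\<lambda>n. \<phi> x) ` N" by (rule image_cong[OF refl])
    moreover have "\<phi> ` (\<pi> x) = (\<lambda>n. \<phi> (n \<oplus>\<^bsub>M\<^esub> x)) ` N" by (auto simp: a_r_coset_def')
    ultimately have "\<phi> ` (\<pi> x) = {\<phi> x}" using submodule_zero[OF N] by auto
    then show ?thesis by simp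
  qed
  show "linear_map R Q V (\<lambda>K. the_elem (\<phi> ` K))"
    by (rule linear_mapI) (auto simp: quot_simps eq linear_map_simps[OF \<phi>])
  show "x \<in> carrier M \<Longrightarrow> the_elem (\<phi> ` (\<pi> x)) = \<phi> x" by (rule eq)
qed

end

text \<open>The linear extension of \<open>g\<close>, in the form in which the boundary operator is defined.\<close>

definition free_lift ::
  "('k, 'z) ring_scheme \<Rightarrow> ('k, 'v, 'y) module_scheme \<Rightarrow> ('x \<Rightarrow> 'v) \<Rightarrow> ('x \<Rightarrow> 'k) \<Rightarrow> 'v" where
  "free_lift R V g c = (\<Oplus>\<^bsub>V\<^esub> x \<in> {x. c x \<noteq> \<zero>\<^bsub>R\<^esub>}. c x \<odot>\<^bsub>V\<^esub> g x)"

context cring begin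

lemma free_module_carrier:
  "c \<in> carrier (free_module R S) \<longleftrightarrow>
    (\<forall>x. c x \<in> carrier R) \<and> (\<forall>x. x \<notin> S \<longrightarrow> c x = \<zero>) \<and> finite {x. c x \<noteq> \<zero>}"
  by (simp add: free_module_def)

lemma free_module_simps:
  "(c \<oplus>\<^bsub>free_module R S\<^esub> d) x = c x \<oplus> d x" "(a \<odot>\<^bsub>free_module R S\<^esub> c) x = a \<otimes> c x" "\<zero>\<^bsub>free_module R S\<^esub> x = \<zero>"
  by (simp_all add: free_module_def)

lemma free_module_module: "module R (free_module R S)"
proof (rule moduleI[OF is_cring])
  have sum: "c \<oplus>\<^bsub>free_module R S\<^esub> d \<in> carrier (free_module R S)"
    if "c \<in> carrier (free_module R S)" "d \<in> carrier (free_module R S)" for c d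
  proof -
    have "{x. c x \<oplus> d x \<noteq> \<zero>} \<subseteq> {x. c x \<noteq> \<zero>} \<union> {x. d x \<noteq> \<zero>}" by auto
    then show ?thesis using that unfolding free_module_carrier free_module_simps
      by (auto intro: finite_subset[where B = "{x. c x \<noteq> \<zero>} \<union> {x. d x \<noteq> \<zero>}"])
  qed
  have scale: "a \<odot>\<^bsub>free_module R S\<^esub> c \<in> carrier (free_module R S)"
    if "a \<in> carrier R" "c \<in> carrier (free_module R S)" for a c
  proof -
    have "{x. a \<otimes> c x \<noteq> \<zero>} \<subseteq> {x. c x \<noteq> \<zero>}" using that(1) by auto
    then show ?thesis using that unfolding free_module_carrier free_module_simps
      by (auto intro: finite_subset[where B = "{x. c x \<noteq> \<zero>}"])
  qed
  show "abelian_group (free_module R S)"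
  proof (rule abelian_groupI)
    fix c assume c: "c \<in> carrier (free_module R S)"
    show "\<exists>d\<in>carrier (free_module R S). d \<oplus>\<^bsub>free_module R S\<^esub> c = \<zero>\<^bsub>free_module R S\<^esub>"
    proof (rule bexI)
      show "(\<ominus> \<one>) \<odot>\<^bsub>free_module R S\<^esub> c \<in> carrier (free_module R S)" by (rule scale[OF _ c]) simp
      show "(\<ominus> \<one>) \<odot>\<^bsub>free_module R S\<^esub> c \<oplus>\<^bsub>free_module R S\<^esub> c = \<zero>\<^bsub>free_module R S\<^esub>"
        using c by (auto simp: fun_eq_iff free_module_simps free_module_carrier l_minus l_neg)
    qed
  qed (simp_all add: sum, simp_all add: free_module_carrier fun_eq_iff free_module_simps a_ac)
qed (simp_all add: free_module_carrier fun_eq_iff free_module_simps l_distr r_distr m_assoc,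
    auto simp: free_module_def elim: rev_finite_subset)

lemma free_gen_closed: "x \<in> S \<Longrightarrow> free_gen R x \<in> carrier (free_module R S)"
  by (auto simp: free_module_carrier free_gen_def)

lemma free_module_induct:
  assumes N: "submodule N R (free_module R S)" and gen: "\<And>x. x \<in> S \<Longrightarrow> free_gen R x \<in> N"
    and c: "c \<in> carrier (free_module R S)"
  shows "c \<in> N"
proof -
  let ?F = "free_module R S"
  interpret F: module R ?F by (rule free_module_module)
  have "c \<in> N" if "finite A" "{x. c x \<noteq> \<zero>} \<subseteq> A" "c \<in> carrier ?F" for A c
    using that
  proof (induction A arbitrary: c rule: finite_induct)
    case empty
    then have "c = \<zero>\<^bsub>?F\<^esub>" by (auto simp: fun_eq_iff free_module_simps)
    then show ?case using F.submodule_zero[OF N] by simp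
  next
    case (insert y A)
    show ?case
    proof (cases "y \<in> S")
      case True
      define c' where "c' = c(y := \<zero>)"
      have "{x. c' x \<noteq> \<zero>} \<subseteq> {x. c x \<noteq> \<zero>}" by (auto simp: c'_def)
      then have "finite {x. c' x \<noteq> \<zero>}"
        using insert.prems(2) unfolding free_module_carrier by (blast intro: finite_subset)
      moreover have "(\<forall>x. c' x \<in> carrier R) \<and> (\<forall>x. x \<notin> S \<longrightarrow> c' x = \<zero>)"
        using insert.prems(2) unfolding free_module_carrier by (simp add: c'_def)
      ultimately have c': "c' \<in> carrier ?F" unfolding free_module_carrier by blast
      have "c' \<in> N" by (rule insert.IH[OF _ c']) (use insert.prems(1) in \<open>auto simp: c'_def split: if_splits\<close>)
      moreover have "c = c' \<oplus>\<^bsub>?F\<^esub> c y \<odot>\<^bsub>?F\<^esub> free_gen R y"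
        using insert.prems(2) by (auto simp: fun_eq_iff free_module_simps c'_def free_gen_def free_module_carrier)
      moreover have "c y \<in> carrier R" using insert.prems(2) by (simp add: free_module_carrier)
      ultimately show ?thesis
        using gen[OF True] F.submoduleE(4,5)[OF N] by metis
    next
      case False
      then have "c y = \<zero>" using insert.prems(2) by (simp add: free_module_carrier)
      then show ?thesis using insert.IH[of c] insert.prems by blast
    qed
  qed
  then show ?thesis using c by (auto simp: free_module_carrier)
qed

lemma free_lift_linear:
  assumes V: "module R V" and g: "\<And>x. x \<in> S \<Longrightarrow> g x \<in> carrier V"
  shows "linear_map R (free_module R S) V (free_lift R V g)"
    and "x \<in> S \<Longrightarrow> free_lift R V g (free_gen R x) = g x"
proof -
  interpret V: module R V by fact
  let ?F = "free_module R S"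
  have term_closed: "c x \<odot>\<^bsub>V\<^esub> g x \<in> carrier V" if "c \<in> carrier ?F" "x \<in> S" for c x
    using that g by (auto simp: free_module_carrier)
  have sum: "free_lift R V g c = (\<Oplus>\<^bsub>V\<^esub> x \<in> A. c x \<odot>\<^bsub>V\<^esub> g x)"
    if c: "c \<in> carrier ?F" and A: "finite A" "{x. c x \<noteq> \<zero>} \<subseteq> A" "A \<subseteq> S" for c A
    unfolding free_lift_def
    by (rule V.M.add.finprod_mono_neutral_cong_left) (use A c g in \<open>auto simp: free_module_carrier subset_iff\<close>)
  have supp: "{x. c x \<noteq> \<zero>} \<subseteq> S" "finite {x. c x \<noteq> \<zero>}" if "c \<in> carrier ?F" for c
    using that by (auto simp: free_module_carrier)
  interpret F: module R ?F by (rule free_module_module)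
  show "linear_map R ?F V (free_lift R V g)"
  proof (rule linear_mapI)
    show "free_lift R V g c \<in> carrier V" if c: "c \<in> carrier ?F" for c
      unfolding free_lift_def using supp(1)[OF c] term_closed[OF c] by (intro V.M.finsum_closed) auto
    fix c assume c: "c \<in> carrier ?F"
    show "free_lift R V g (c \<oplus>\<^bsub>?F\<^esub> d) = free_lift R V g c \<oplus>\<^bsub>V\<^esub> free_lift R V g d" if d: "d \<in> carrier ?F" for d
    proof -
      let ?A = "{x. c x \<noteq> \<zero>} \<union> {x. d x \<noteq> \<zero>}"
      have A: "finite ?A" "?A \<subseteq> S" using supp[OF c] supp[OF d] by auto
      have cl: "c x \<in> carrier R" "d x \<in> carrier R" for x using c d by (auto simp: free_module_carrier)
      have sub: "{x. (c \<oplus>\<^bsub>?F\<^esub> d) x \<noteq> \<zero>} \<subseteq> ?A" by (auto simp: free_module_simps)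
      have "free_lift R V g (c \<oplus>\<^bsub>?F\<^esub> d) = (\<Oplus>\<^bsub>V\<^esub> x \<in> ?A. (c \<oplus>\<^bsub>?F\<^esub> d) x \<odot>\<^bsub>V\<^esub> g x)"
        by (rule sum[OF F.M.a_closed[OF c d] A(1) sub A(2)])
      also have "\<dots> = (\<Oplus>\<^bsub>V\<^esub> x \<in> ?A. c x \<odot>\<^bsub>V\<^esub> g x \<oplus>\<^bsub>V\<^esub> d x \<odot>\<^bsub>V\<^esub> g x)"
        by (rule V.M.finsum_cong') (use A(2) g cl in \<open>auto simp: free_module_simps V.smult_l_distr subset_iff\<close>)
      also have "\<dots> = (\<Oplus>\<^bsub>V\<^esub> x \<in> ?A. c x \<odot>\<^bsub>V\<^esub> g x) \<oplus>\<^bsub>V\<^esub> (\<Oplus>\<^bsub>V\<^esub> x \<in> ?A. d x \<odot>\<^bsub>V\<^esub> g x)"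
        by (rule V.M.finsum_addf) (use A(2) g cl in \<open>auto simp: subset_iff\<close>)
      also have "\<dots> = free_lift R V g c \<oplus>\<^bsub>V\<^esub> free_lift R V g d"
        using sum[OF c A(1) _ A(2)] sum[OF d A(1) _ A(2)] by simp
      finally show ?thesis .
    qed
    show "free_lift R V g (a \<odot>\<^bsub>?F\<^esub> c) = a \<odot>\<^bsub>V\<^esub> free_lift R V g c" if a: "a \<in> carrier R" for a
    proof -
      let ?A = "{x. c x \<noteq> \<zero>}"
      have cl: "c x \<in> carrier R" for x using c by (auto simp: free_module_carrier)
      have sub: "{x. (a \<odot>\<^bsub>?F\<^esub> c) x \<noteq> \<zero>} \<subseteq> ?A" using a by (auto simp: free_module_simps)
      have "free_lift R V g (a \<odot>\<^bsub>?F\<^esub> c) = (\<Oplus>\<^bsub>V\<^esub> x \<in> ?A. (a \<odot>\<^bsub>?F\<^esub> c) x \<odot>\<^bsub>V\<^esub> g x)"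
        by (rule sum[OF F.smult_closed[OF a c] supp(2)[OF c] sub supp(1)[OF c]])
      also have "\<dots> = (\<Oplus>\<^bsub>V\<^esub> x \<in> ?A. a \<odot>\<^bsub>V\<^esub> (c x \<odot>\<^bsub>V\<^esub> g x))"
        by (rule V.M.finsum_cong')
          (use supp(1)[OF c] g cl a in \<open>auto simp: free_module_simps V.smult_assoc1 subset_iff\<close>)
      also have "\<dots> = a \<odot>\<^bsub>V\<^esub> free_lift R V g c"
        unfolding free_lift_def
        by (rule V.finsum_smult_ldistr[symmetric]) (use supp[OF c] a term_closed[OF c] in auto)
      finally show ?thesis .
    qed
  qed
  show "free_lift R V g (free_gen R x) = g x" if x: "x \<in> S"
  proof -
    have "free_lift R V g (free_gen R x) = (\<Oplus>\<^bsub>V\<^esub> y \<in> {x}. free_gen R x y \<odot>\<^bsub>V\<^esub> g y)"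
      by (rule sum[OF free_gen_closed[OF x]]) (use x in \<open>auto simp: free_gen_def\<close>)
    then show ?thesis using g[OF x] by (simp add: free_gen_def)
  qed
qed

end

lemma tuples_update: "\<lbrakk>xs \<in> tuples M n; x \<in> carrier M\<rbrakk> \<Longrightarrow> xs[i := x] \<in> tuples M n"
  using set_update_subset_insert[of xs i x] by (auto simp: tuples_def)

lemma ce_cochainsD:
  assumes "\<omega> \<in> carrier (ce_cochains R L V n)"
  shows "xs \<in> tuples L n \<Longrightarrow> \<omega> xs \<in> carrier V"
    "\<lbrakk>xs \<in> tuples L n; i < n; x \<in> carrier L; y \<in> carrier L\<rbrakk>
      \<Longrightarrow> \<omega> (xs[i := x \<oplus>\<^bsub>L\<^esub> y]) = \<omega> (xs[i := x]) \<oplus>\<^bsub>V\<^esub> \<omega> (xs[i := y])"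
    "\<lbrakk>xs \<in> tuples L n; i < n; a \<in> carrier R; x \<in> carrier L\<rbrakk> \<Longrightarrow> \<omega> (xs[i := a \<odot>\<^bsub>L\<^esub> x]) = a \<odot>\<^bsub>V\<^esub> \<omega> (xs[i := x])"
    "\<lbrakk>xs \<in> tuples L n; \<not> distinct xs\<rbrakk> \<Longrightarrow> \<omega> xs = \<zero>\<^bsub>V\<^esub>"
    "\<omega> \<in> tuples L n \<rightarrow>\<^sub>E carrier V"
  using assms by (auto simp: ce_cochains_def)

lemma ce_cochainsI:
  assumes "\<omega> \<in> tuples L n \<rightarrow>\<^sub>E carrier V"
    and "\<And>xs i x y. \<lbrakk>xs \<in> tuples L n; i < n; x \<in> carrier L; y \<in> carrier L\<rbrakk>
      \<Longrightarrow> \<omega> (xs[i := x \<oplus>\<^bsub>L\<^esub> y]) = \<omega> (xs[i := x]) \<oplus>\<^bsub>V\<^esub> \<omega> (xs[i := y])"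
    and "\<And>xs i a x. \<lbrakk>xs \<in> tuples L n; i < n; a \<in> carrier R; x \<in> carrier L\<rbrakk> \<Longrightarrow> \<omega> (xs[i := a \<odot>\<^bsub>L\<^esub> x]) = a \<odot>\<^bsub>V\<^esub> \<omega> (xs[i := x])"
    and "\<And>xs. \<lbrakk>xs \<in> tuples L n; \<not> distinct xs\<rbrakk> \<Longrightarrow> \<omega> xs = \<zero>\<^bsub>V\<^esub>"
  shows "\<omega> \<in> carrier (ce_cochains R L V n)"
  using assms by (simp add: ce_cochains_def)

text \<open>The map on the exterior power induced by an alternating multilinear map.\<close>

definition ext_lift ::
  "('k, 'z) ring_scheme \<Rightarrow> ('k, 'v, 'y) module_scheme \<Rightarrow> ('a list \<Rightarrow> 'v) \<Rightarrow> ('a list \<Rightarrow> 'k) set \<Rightarrow> 'v" where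
  "ext_lift R V \<omega> = (\<lambda>K. the_elem (free_lift R V \<omega> ` K))"

context module begin

abbreviation "tuple_module n \<equiv> free_module R (tuples M n)"

lemma F_module: "module R (tuple_module n)" by (rule R.free_module_module)

lemma ext_relators_closed: "ext_relators R M n \<subseteq> carrier (tuple_module n)"
proof -
  interpret F: module R "tuple_module n" by (rule F_module)
  have gen: "free_gen R xs \<in> carrier (tuple_module n)" if "xs \<in> tuples M n" for xs
    using that by (rule R.free_gen_closed)
  show ?thesis
    unfolding ext_relators_def Let_def
    by (auto intro!: F.M.minus_closed F.M.a_closed F.smult_closed gen tuples_update)
qed

lemma ext_quotient: "quotient R (tuple_module n) (ext_rel_module R M n)"
proof -
  interpret F: module R "tuple_module n" by (rule F_module)
  show ?thesis
    unfolding quotient_def quotient_axioms_def ext_rel_module_def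
    using F.lin_span_submodule[OF ext_relators_closed] F_module by simp
qed

lemma ext_power_module: "module R (ext_power R M n)"
  unfolding ext_power_def by (rule quotient.quot_module[OF ext_quotient])

lemma wedge_eq: "xs \<in> tuples M n \<Longrightarrow> wedge R M xs = ext_rel_module R M n +>\<^bsub>tuple_module n\<^esub> free_gen R xs"
  by (simp add: wedge_def tuples_def)

lemma wedge_closed: "xs \<in> tuples M n \<Longrightarrow> wedge R M xs \<in> carrier (ext_power R M n)"
  unfolding wedge_eq ext_power_def
  using linear_map_simps(1)[OF quotient.quot_map[OF ext_quotient] R.free_gen_closed] .

text \<open>The relators of the exterior power are the instances of multilinearity and alternation.\<close>

lemma wedge_cochain: "restrict (wedge R M) (tuples M n) \<in> carrier (ce_cochains R M (ext_power R M n) n)"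
proof -
  interpret q: quotient R "tuple_module n" "ext_rel_module R M n" by (rule ext_quotient)
  have gen: "free_gen R xs \<in> carrier (tuple_module n)" if "xs \<in> tuples M n" for xs
    using that by (rule R.free_gen_closed)
  have rel: "q.\<pi> c = q.\<pi> d" if "c \<ominus>\<^bsub>tuple_module n\<^esub> d \<in> ext_relators R M n" "c \<in> carrier (tuple_module n)" "d \<in> carrier (tuple_module n)" for c d
  proof -
    have "c \<ominus>\<^bsub>tuple_module n\<^esub> d \<in> ext_rel_module R M n"
      using that(1) q.lin_span_superset unfolding ext_rel_module_def by auto
    then show ?thesis using q.coset_eq_iff[OF q.N that(2,3)] by simp
  qed
  note maps = linear_map_simps[OF q.quot_map]
  have w: "restrict (wedge R M) (tuples M n) xs = q.\<pi> (free_gen R xs)" if "xs \<in> tuples M n" for xs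
    using that by (simp add: wedge_eq)
  show ?thesis
  proof (rule ce_cochainsI)
    show "restrict (wedge R M) (tuples M n) \<in> tuples M n \<rightarrow>\<^sub>E carrier (ext_power R M n)"
      using wedge_closed by auto
  next
    fix xs i x y assume *: "xs \<in> tuples M n" "i < n" "x \<in> carrier M" "y \<in> carrier M"
    have "q.\<pi> (free_gen R (xs[i := x \<oplus>\<^bsub>M\<^esub> y])) = q.\<pi> (free_gen R (xs[i := x]) \<oplus>\<^bsub>tuple_module n\<^esub> free_gen R (xs[i := y]))"
    proof (rule rel)
      show "free_gen R (xs[i := x \<oplus>\<^bsub>M\<^esub> y]) \<ominus>\<^bsub>tuple_module n\<^esub> (free_gen R (xs[i := x]) \<oplus>\<^bsub>tuple_module n\<^esub> free_gen R (xs[i := y]))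
          \<in> ext_relators R M n"
        unfolding ext_relators_def Let_def using * by blast
    qed (use * in \<open>simp_all add: gen tuples_update\<close>)
    then show "restrict (wedge R M) (tuples M n) (xs[i := x \<oplus>\<^bsub>M\<^esub> y]) =
        restrict (wedge R M) (tuples M n) (xs[i := x]) \<oplus>\<^bsub>ext_power R M n\<^esub> restrict (wedge R M) (tuples M n) (xs[i := y])"
      using * by (simp only: w tuples_update M.a_closed ext_power_def maps(2) gen)
  next
    fix xs i a x assume *: "xs \<in> tuples M n" "i < n" "a \<in> carrier R" "x \<in> carrier M"
    have "q.\<pi> (free_gen R (xs[i := a \<odot>\<^bsub>M\<^esub> x])) = q.\<pi> (a \<odot>\<^bsub>tuple_module n\<^esub> free_gen R (xs[i := x]))"
    proof (rule rel)
      show "free_gen R (xs[i := a \<odot>\<^bsub>M\<^esub> x]) \<ominus>\<^bsub>tuple_module n\<^esub> (a \<odot>\<^bsub>tuple_module n\<^esub> free_gen R (xs[i := x])) \<in> ext_relators R M n"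
        unfolding ext_relators_def Let_def using * by blast
    qed (use * in \<open>simp_all add: gen tuples_update\<close>)
    then show "restrict (wedge R M) (tuples M n) (xs[i := a \<odot>\<^bsub>M\<^esub> x]) =
        a \<odot>\<^bsub>ext_power R M n\<^esub> restrict (wedge R M) (tuples M n) (xs[i := x])"
      using * by (simp only: w tuples_update smult_closed ext_power_def maps(3) gen)
  next
    fix xs assume *: "xs \<in> tuples M n" "\<not> distinct xs"
    then have "free_gen R xs \<in> ext_relators R M n" unfolding ext_relators_def Let_def by blast
    then have "free_gen R xs \<in> ext_rel_module R M n"
      using q.lin_span_superset unfolding ext_rel_module_def by auto
    then have "q.\<pi> (free_gen R xs) = \<zero>\<^bsub>q.Q\<^esub>" using q.quot_zero_iff gen * by simp
    then show "restrict (wedge R M) (tuples M n) xs = \<zero>\<^bsub>ext_power R M n\<^esub>"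
      unfolding w[OF *(1)] ext_power_def .
  qed
qed

lemma ext_power_induct:
  assumes K: "submodule K R (ext_power R M n)" and w: "\<And>xs. xs \<in> tuples M n \<Longrightarrow> wedge R M xs \<in> K"
    and z: "z \<in> carrier (ext_power R M n)"
  shows "z \<in> K"
proof -
  interpret q: quotient R "tuple_module n" "ext_rel_module R M n" by (rule ext_quotient)
  have K': "submodule K R q.Q" using K by (simp add: ext_power_def)
  have sub: "submodule {c \<in> carrier (tuple_module n). q.\<pi> c \<in> K} R (tuple_module n)"
    by (rule q.submodule_preimage[OF q.quot_module q.quot_map K'])
  obtain c where c: "c \<in> carrier (tuple_module n)" "z = q.\<pi> c" using z by (auto simp: ext_power_def q.quot_simps)
  have "c \<in> {c \<in> carrier (tuple_module n). q.\<pi> c \<in> K}"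
  proof (rule R.free_module_induct[OF sub _ c(1)])
    fix xs assume "xs \<in> tuples M n"
    then show "free_gen R xs \<in> {c \<in> carrier (tuple_module n). q.\<pi> c \<in> K}"
      using w[of xs] by (simp add: wedge_eq R.free_gen_closed)
  qed
  then show ?thesis using c(2) by simp
qed

lemma ext_power_map_unique:
  assumes "module R V" "linear_map R (ext_power R M n) V \<phi>" "linear_map R (ext_power R M n) V \<psi>"
    and "\<And>xs. xs \<in> tuples M n \<Longrightarrow> \<phi> (wedge R M xs) = \<psi> (wedge R M xs)" and "z \<in> carrier (ext_power R M n)"
  shows "\<phi> z = \<psi> z"
proof -
  interpret E: module R "ext_power R M n" by (rule ext_power_module)
  have "z \<in> {z \<in> carrier (ext_power R M n). \<phi> z = \<psi> z}"
    by (rule ext_power_induct[OF E.submodule_equalizer[OF assms(1-3)] _ assms(5)])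
      (simp add: wedge_closed assms(4))
  then show ?thesis by simp
qed

lemma ext_lift:
  assumes V: "module R V" and \<omega>: "\<omega> \<in> carrier (ce_cochains R M V n)"
  shows "linear_map R (ext_power R M n) V (ext_lift R V \<omega>)"
    and "xs \<in> tuples M n \<Longrightarrow> ext_lift R V \<omega> (wedge R M xs) = \<omega> xs"
proof -
  interpret q: quotient R "tuple_module n" "ext_rel_module R M n" by (rule ext_quotient)
  interpret V: module R V by fact
  have lin1: "linear_map R (tuple_module n) V (free_lift R V \<omega>)"
    by (rule R.free_lift_linear(1)[OF V ce_cochainsD(1)[OF \<omega>]])
  have lin2: "free_lift R V \<omega> (free_gen R xs) = \<omega> xs" if "xs \<in> tuples M n" for xs
    by (rule R.free_lift_linear(2)[OF V ce_cochainsD(1)[OF \<omega>] that])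
  note lins = linear_map_simps[OF lin1] linear_map_minus[OF F_module V lin1]
  have gen: "free_gen R xs \<in> carrier (tuple_module n)" if "xs \<in> tuples M n" for xs
    using that by (rule R.free_gen_closed)
  have ker: "submodule {c \<in> carrier (tuple_module n). free_lift R V \<omega> c \<in> {\<zero>\<^bsub>V\<^esub>}} R (tuple_module n)"
    by (rule q.submodule_preimage[OF V lin1 V.zero_submodule])
  have "ext_relators R M n \<subseteq> {c \<in> carrier (tuple_module n). free_lift R V \<omega> c \<in> {\<zero>\<^bsub>V\<^esub>}}"
  proof
    fix c assume c: "c \<in> ext_relators R M n"
    then have "c \<in> carrier (tuple_module n)" using ext_relators_closed by auto
    moreover have "free_lift R V \<omega> c = \<zero>\<^bsub>V\<^esub>"
      using c unfolding ext_relators_def Let_def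
      by (auto simp: lins gen tuples_update lin2 ce_cochainsD[OF \<omega>] V.M.diff_self)
    ultimately show "c \<in> {c \<in> carrier (tuple_module n). free_lift R V \<omega> c \<in> {\<zero>\<^bsub>V\<^esub>}}" by simp
  qed
  from q.lin_span_least[OF ker this]
  have zero: "free_lift R V \<omega> c = \<zero>\<^bsub>V\<^esub>" if "c \<in> ext_rel_module R M n" for c
    using that unfolding ext_rel_module_def by auto
  show "linear_map R (ext_power R M n) V (ext_lift R V \<omega>)"
    unfolding ext_power_def ext_lift_def by (rule q.quot_factor(1)[OF V lin1 zero])
  show "ext_lift R V \<omega> (wedge R M xs) = \<omega> xs" if "xs \<in> tuples M n"
    unfolding ext_lift_def wedge_eq[OF that]
    using q.quot_factor(2)[OF V lin1 zero gen[OF that]] lin2[OF that] by simp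
qed

end

section \<open>Chevalley--Eilenberg complexes in low degrees\<close>

lemma tuples_small:
  "xs \<in> tuples L 1 \<longleftrightarrow> (\<exists>x\<in>carrier L. xs = [x])" "xs \<in> tuples L (Suc 0) \<longleftrightarrow> (\<exists>x\<in>carrier L. xs = [x])"
  "xs \<in> tuples L 2 \<longleftrightarrow> (\<exists>x\<in>carrier L. \<exists>y\<in>carrier L. xs = [x, y])"
  "xs \<in> tuples L 3 \<longleftrightarrow> (\<exists>x\<in>carrier L. \<exists>y\<in>carrier L. \<exists>z\<in>carrier L. xs = [x, y, z])"
  by (auto simp: tuples_def numeral_2_eq_2 numeral_3_eq_3 length_Suc_conv)

lemma tuples_mem [simp]:
  "[x] \<in> tuples L (Suc 0) \<longleftrightarrow> x \<in> carrier L" "[x, y] \<in> tuples L 2 \<longleftrightarrow> x \<in> carrier L \<and> y \<in> carrier L"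
  "[x, y, z] \<in> tuples L 3 \<longleftrightarrow> x \<in> carrier L \<and> y \<in> carrier L \<and> z \<in> carrier L"
  by (auto simp: tuples_def)

lemma tuples2E:
  assumes "xs \<in> tuples L 2" obtains x y where "xs = [x, y]" "x \<in> carrier L" "y \<in> carrier L"
  using assms by (auto simp: tuples_small)

lemma tuples3E:
  assumes "xs \<in> tuples L 3" obtains x y z where "xs = [x, y, z]" "x \<in> carrier L" "y \<in> carrier L" "z \<in> carrier L"
  using assms by (auto simp: tuples_small)

context module begin

lemma cochain1I:
  assumes "linear_map R M V \<phi>"
  shows "(\<lambda>xs\<in>tuples M 1. \<phi> (xs ! 0)) \<in> carrier (ce_cochains R M V 1)"
  by (rule ce_cochainsI) (auto simp: tuples_small linear_map_simps[OF assms])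

lemma cochain1D:
  assumes "\<omega> \<in> carrier (ce_cochains R M V 1)" shows "linear_map R M V (\<lambda>x. \<omega> [x])"
proof (rule linear_mapI)
  note D = ce_cochainsD[OF assms]
  show "\<omega> [x] \<in> carrier V" if "x \<in> carrier M" for x using D(1)[of "[x]"] that by (simp add: tuples_small)
  show "\<omega> [x \<oplus>\<^bsub>M\<^esub> y] = \<omega> [x] \<oplus>\<^bsub>V\<^esub> \<omega> [y]" if "x \<in> carrier M" "y \<in> carrier M" for x y
    using D(2)[of "[x]" 0 x y] that by (simp add: tuples_small)
  show "\<omega> [a \<odot>\<^bsub>M\<^esub> x] = a \<odot>\<^bsub>V\<^esub> \<omega> [x]" if "a \<in> carrier R" "x \<in> carrier M" for a x
    using D(3)[of "[x]" 0 a x] that by (simp add: tuples_small)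
qed

lemma cochain2I:
  assumes l: "\<And>y. y \<in> carrier M \<Longrightarrow> linear_map R M V (\<lambda>x. \<beta> x y)" and r: "\<And>x. x \<in> carrier M \<Longrightarrow> linear_map R M V (\<beta> x)"
    and alt: "\<And>x. x \<in> carrier M \<Longrightarrow> \<beta> x x = \<zero>\<^bsub>V\<^esub>"
  shows "(\<lambda>xs\<in>tuples M 2. \<beta> (xs ! 0) (xs ! 1)) \<in> carrier (ce_cochains R M V 2)"
proof (rule ce_cochainsI)
  note lin = linear_map_simps[OF l] linear_map_simps[OF r]
  show "(\<lambda>xs\<in>tuples M 2. \<beta> (xs ! 0) (xs ! 1)) \<in> tuples M 2 \<rightarrow>\<^sub>E carrier V" by (auto simp: tuples_small lin)
  show "(\<lambda>xs\<in>tuples M 2. \<beta> (xs ! 0) (xs ! 1)) (xs[i := x \<oplus>\<^bsub>M\<^esub> y]) =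
      (\<lambda>xs\<in>tuples M 2. \<beta> (xs ! 0) (xs ! 1)) (xs[i := x]) \<oplus>\<^bsub>V\<^esub> (\<lambda>xs\<in>tuples M 2. \<beta> (xs ! 0) (xs ! 1)) (xs[i := y])"
    if "xs \<in> tuples M 2" "i < 2" "x \<in> carrier M" "y \<in> carrier M" for xs i x y
    using that by (auto elim!: tuples2E simp: less_2_cases_iff lin)
  show "(\<lambda>xs\<in>tuples M 2. \<beta> (xs ! 0) (xs ! 1)) (xs[i := a \<odot>\<^bsub>M\<^esub> x]) = a \<odot>\<^bsub>V\<^esub> (\<lambda>xs\<in>tuples M 2. \<beta> (xs ! 0) (xs ! 1)) (xs[i := x])"
    if "xs \<in> tuples M 2" "i < 2" "a \<in> carrier R" "x \<in> carrier M" for xs i a x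
    using that by (auto elim!: tuples2E simp: less_2_cases_iff lin)
  show "(\<lambda>xs\<in>tuples M 2. \<beta> (xs ! 0) (xs ! 1)) xs = \<zero>\<^bsub>V\<^esub>" if "xs \<in> tuples M 2" "\<not> distinct xs" for xs
    using that by (auto simp: tuples_small alt)
qed

lemma cochain2D:
  assumes "\<omega> \<in> carrier (ce_cochains R M V 2)"
  shows "y \<in> carrier M \<Longrightarrow> linear_map R M V (\<lambda>x. \<omega> [x, y])" "x \<in> carrier M \<Longrightarrow> linear_map R M V (\<lambda>y. \<omega> [x, y])"
    "x \<in> carrier M \<Longrightarrow> \<omega> [x, x] = \<zero>\<^bsub>V\<^esub>"
proof -
  note D = ce_cochainsD[OF assms]
  show "linear_map R M V (\<lambda>x. \<omega> [x, y])" if "y \<in> carrier M"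
    using D(1)[of "[_, y]"] D(2)[of "[_, y]" 0] D(3)[of "[_, y]" 0] that
    by (intro linear_mapI) (simp_all add: tuples_small)
  show "linear_map R M V (\<lambda>y. \<omega> [x, y])" if "x \<in> carrier M"
    using D(1)[of "[x, _]"] D(2)[of "[x, _]" 1] D(3)[of "[x, _]" 1] that
    by (intro linear_mapI) (simp_all add: tuples_small)
  show "\<omega> [x, x] = \<zero>\<^bsub>V\<^esub>" if "x \<in> carrier M" using D(4)[of "[x, x]"] that by (simp add: tuples_small)
qed

lemma cochain2_eqI:
  assumes "\<omega> \<in> carrier (ce_cochains R M V 2)" "\<eta> \<in> carrier (ce_cochains R M V 2)"
    and "\<And>x y. \<lbrakk>x \<in> carrier M; y \<in> carrier M\<rbrakk> \<Longrightarrow> \<omega> [x, y] = \<eta> [x, y]"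
  shows "\<omega> = \<eta>"
  by (rule PiE_ext[OF ce_cochainsD(5)[OF assms(1)] ce_cochainsD(5)[OF assms(2)]])
    (auto simp: tuples_small assms(3))

lemma cochain3I:
  assumes 1: "\<And>y z. \<lbrakk>y \<in> carrier M; z \<in> carrier M\<rbrakk> \<Longrightarrow> linear_map R M V (\<lambda>x. \<gamma> x y z)"
    and 2: "\<And>x z. \<lbrakk>x \<in> carrier M; z \<in> carrier M\<rbrakk> \<Longrightarrow> linear_map R M V (\<lambda>y. \<gamma> x y z)"
    and 3: "\<And>x y. \<lbrakk>x \<in> carrier M; y \<in> carrier M\<rbrakk> \<Longrightarrow> linear_map R M V (\<gamma> x y)"
    and alt: "\<And>x y. \<lbrakk>x \<in> carrier M; y \<in> carrier M\<rbrakk> \<Longrightarrow> \<gamma> x x y = \<zero>\<^bsub>V\<^esub>"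
      "\<And>x y. \<lbrakk>x \<in> carrier M; y \<in> carrier M\<rbrakk> \<Longrightarrow> \<gamma> x y x = \<zero>\<^bsub>V\<^esub>" "\<And>x y. \<lbrakk>x \<in> carrier M; y \<in> carrier M\<rbrakk> \<Longrightarrow> \<gamma> x y y = \<zero>\<^bsub>V\<^esub>"
  shows "(\<lambda>xs\<in>tuples M 3. \<gamma> (xs ! 0) (xs ! 1) (xs ! 2)) \<in> carrier (ce_cochains R M V 3)" (is "?\<omega> \<in> _")
proof (rule ce_cochainsI)
  note lin = linear_map_simps[OF 1] linear_map_simps[OF 2] linear_map_simps[OF 3]
  have i3: "i < 3 \<longleftrightarrow> i = 0 \<or> i = Suc 0 \<or> i = Suc (Suc 0)" for i :: nat by auto
  show "?\<omega> \<in> tuples M 3 \<rightarrow>\<^sub>E carrier V" by (auto simp: tuples_small lin)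
  show "?\<omega> (xs[i := x \<oplus>\<^bsub>M\<^esub> y]) = ?\<omega> (xs[i := x]) \<oplus>\<^bsub>V\<^esub> ?\<omega> (xs[i := y])"
    if "xs \<in> tuples M 3" "i < 3" "x \<in> carrier M" "y \<in> carrier M" for xs i x y
    using that by (auto elim!: tuples3E simp: i3 lin)
  show "?\<omega> (xs[i := a \<odot>\<^bsub>M\<^esub> x]) = a \<odot>\<^bsub>V\<^esub> ?\<omega> (xs[i := x])"
    if "xs \<in> tuples M 3" "i < 3" "a \<in> carrier R" "x \<in> carrier M" for xs i a x
    using that by (auto elim!: tuples3E simp: i3 lin)
  show "?\<omega> xs = \<zero>\<^bsub>V\<^esub>" if "xs \<in> tuples M 3" "\<not> distinct xs" for xs
    using that by (auto simp: tuples_small alt)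
qed

lemma ext_lift_restrict:
  assumes V: "module R V" and \<omega>: "\<And>xs. xs \<in> tuples M n \<Longrightarrow> \<omega> xs \<in> carrier V" and K: "K \<in> carrier (ext_power R M n)"
  shows "ext_lift R V (restrict \<omega> (tuples M n)) K = ext_lift R V \<omega> K"
proof -
  interpret V: module R V by fact
  interpret q: quotient R "tuple_module n" "ext_rel_module R M n" by (rule ext_quotient)
  obtain c where c: "c \<in> carrier (tuple_module n)" "K = q.\<pi> c" using K by (auto simp: ext_power_def q.quot_simps)
  have "d \<in> carrier (tuple_module n)" if "d \<in> K" for d
    using that c q.submoduleE(1)[OF q.N] by (auto simp: a_r_coset_def' subset_iff)
  then have "free_lift R V (restrict \<omega> (tuples M n)) d = free_lift R V \<omega> d" if "d \<in> K" for d
    unfolding free_lift_def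
    by (intro V.M.finsum_cong') (use that \<omega> in \<open>fastforce simp: R.free_module_carrier\<close>)+
  then have "free_lift R V (restrict \<omega> (tuples M n)) ` K = free_lift R V \<omega> ` K" by (rule image_cong[OF refl])
  then show ?thesis by (simp add: ext_lift_def)
qed

end

text \<open>
  The value of the coboundary of \<open>\<omega>\<close> at \<open>(x, y, z)\<close>.  It is zero for all arguments if and only
  if the bracket that \<open>\<omega>\<close> defines on the extension of \<open>L\<close> by \<open>V\<close> satisfies the Jacobi identity.
\<close>

definition cocycle_sum ::
  "('k, 'a, 'x) module_scheme \<Rightarrow> ('k, 'm, 'y) module_scheme \<Rightarrow> ('a list \<Rightarrow> 'm) \<Rightarrow> 'a \<Rightarrow> 'a \<Rightarrow> 'a \<Rightarrow> 'm" where
  "cocycle_sum L V \<omega> x y z = \<omega> [x \<otimes>\<^bsub>L\<^esub> z, y] \<ominus>\<^bsub>V\<^esub> \<omega> [x \<otimes>\<^bsub>L\<^esub> y, z] \<ominus>\<^bsub>V\<^esub> \<omega> [y \<otimes>\<^bsub>L\<^esub> z, x]"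

lemma pair_sets:
  "{(i, j). i < j \<and> j < Suc 1} = {(0, 1)}" "{(i, j). i < j \<and> j < Suc 2} = {(0, 1), (0, 2), (1, 2)}"
  by auto

lemma merge_pair_small:
  "merge_pair L [x, y] 0 1 = [x \<otimes>\<^bsub>L\<^esub> y]" "merge_pair L [x, y, z] 0 1 = [x \<otimes>\<^bsub>L\<^esub> y, z]"
  "merge_pair L [x, y, z] 0 2 = [x \<otimes>\<^bsub>L\<^esub> z, y]" "merge_pair L [x, y, z] 1 2 = [y \<otimes>\<^bsub>L\<^esub> z, x]"
  by (simp_all add: merge_pair_def nths_Cons numeral_2_eq_2)

context lie_algebra begin

lemma coboundary1:
  assumes V: "module R V" and xy: "x \<in> carrier L" "y \<in> carrier L" and "\<omega> [x \<otimes>\<^bsub>L\<^esub> y] \<in> carrier V"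
  shows "ce_coboundary L V 1 \<omega> [x, y] = \<ominus>\<^bsub>V\<^esub> \<omega> [x \<otimes>\<^bsub>L\<^esub> y]"
proof -
  interpret V: module R V by fact
  have "[x, y] \<in> tuples L (Suc 1)" using xy by (simp add: tuples_def)
  then show ?thesis
    using assms(4) unfolding ce_coboundary_def pair_sets
    by (simp add: merge_pair_small[unfolded One_nat_def] V.M.int_mult_simps)
qed

lemma coboundary2:
  assumes V: "module R V" and xyz: "x \<in> carrier L" "y \<in> carrier L" "z \<in> carrier L"
    and cl: "\<omega> [x \<otimes>\<^bsub>L\<^esub> y, z] \<in> carrier V" "\<omega> [x \<otimes>\<^bsub>L\<^esub> z, y] \<in> carrier V" "\<omega> [y \<otimes>\<^bsub>L\<^esub> z, x] \<in> carrier V"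
  shows "ce_coboundary L V 2 \<omega> [x, y, z] = cocycle_sum L V \<omega> x y z"
proof -
  interpret V: module R V by fact
  have t: "[x, y, z] \<in> tuples L (Suc 2)" using xyz by (simp add: tuples_def)
  have "ce_coboundary L V 2 \<omega> [x, y, z] =
      (\<Oplus>\<^bsub>V\<^esub> p \<in> {(0, 1), (0, 2), (1, 2)}. [((-1::int) ^ (fst p + snd p))] \<cdot>\<^bsub>V\<^esub> \<omega> (merge_pair L [x, y, z] (fst p) (snd p)))"
    using t unfolding ce_coboundary_def pair_sets by simp
  also have "\<dots> = \<ominus>\<^bsub>V\<^esub> \<omega> [x \<otimes>\<^bsub>L\<^esub> y, z] \<oplus>\<^bsub>V\<^esub> (\<omega> [x \<otimes>\<^bsub>L\<^esub> z, y] \<oplus>\<^bsub>V\<^esub> \<ominus>\<^bsub>V\<^esub> \<omega> [y \<otimes>\<^bsub>L\<^esub> z, x])"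
    using cl merge_pair_small(2-4)[of L x y z] by (simp add: V.M.int_mult_simps)
  also have "\<dots> = cocycle_sum L V \<omega> x y z"
    using cl unfolding cocycle_sum_def by (simp add: V.M.ab_simps)
  finally show ?thesis .
qed

lemma coboundary1_cochain:
  assumes V: "module R V" and \<omega>: "\<omega> \<in> carrier (ce_cochains R L V 1)"
  shows "ce_coboundary L V 1 \<omega> \<in> carrier (ce_cochains R L V 2)"
proof -
  interpret V: module R V by fact
  note lin = linear_map_simps[OF cochain1D[OF \<omega>]]
  have eq: "ce_coboundary L V 1 \<omega> = (\<lambda>xs\<in>tuples L 2. \<ominus>\<^bsub>V\<^esub> \<omega> [xs ! 0 \<otimes>\<^bsub>L\<^esub> xs ! 1])"
  proof
    fix xs
    show "ce_coboundary L V 1 \<omega> xs = (\<lambda>xs\<in>tuples L 2. \<ominus>\<^bsub>V\<^esub> \<omega> [xs ! 0 \<otimes>\<^bsub>L\<^esub> xs ! 1]) xs"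
    proof (cases "xs \<in> tuples L 2")
      case True
      then obtain x y where xs: "xs = [x, y]" "x \<in> carrier L" "y \<in> carrier L" by (auto simp: tuples_small)
      have "ce_coboundary L V 1 \<omega> [x, y] = \<ominus>\<^bsub>V\<^esub> \<omega> [x \<otimes>\<^bsub>L\<^esub> y]"
        by (rule coboundary1[OF V xs(2,3)]) (simp add: lin mult_closed xs)
      then show ?thesis using True by (simp add: xs(1))
    next
      case False
      then show ?thesis by (simp add: ce_coboundary_def numeral_2_eq_2)
    qed
  qed
  show ?thesis unfolding eq
    by (rule cochain2I)
      (auto intro!: linear_mapI simp: lin mult_closed mult_add_left mult_add_right mult_smult_left
        mult_smult_right V.M.minus_add V.smult_r_minus bracket_self linear_map_minus[OF module_axioms V cochain1D[OF \<omega>]])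
qed

lemma coboundary2_cochain:
  assumes V: "module R V" and \<omega>: "\<omega> \<in> carrier (ce_cochains R L V 2)"
  shows "ce_coboundary L V 2 \<omega> \<in> carrier (ce_cochains R L V 3)"
proof -
  interpret V: module R V by fact
  note lin = linear_map_simps[OF cochain2D(1)[OF \<omega>]] linear_map_simps[OF cochain2D(2)[OF \<omega>]]
    linear_map_minus[OF module_axioms V cochain2D(1)[OF \<omega>]]
  have eq: "ce_coboundary L V 2 \<omega> = (\<lambda>xs\<in>tuples L 3. cocycle_sum L V \<omega> (xs ! 0) (xs ! 1) (xs ! 2))"
  proof
    fix xs
    show "ce_coboundary L V 2 \<omega> xs = (\<lambda>xs\<in>tuples L 3. cocycle_sum L V \<omega> (xs ! 0) (xs ! 1) (xs ! 2)) xs"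
    proof (cases "xs \<in> tuples L 3")
      case True
      then obtain x y z where xs: "xs = [x, y, z]" "x \<in> carrier L" "y \<in> carrier L" "z \<in> carrier L"
        by (auto simp: tuples_small)
      have "ce_coboundary L V 2 \<omega> [x, y, z] = cocycle_sum L V \<omega> x y z"
        by (rule coboundary2[OF V xs(2-4)]) (simp_all add: lin mult_closed xs)
      then show ?thesis using True by (simp add: xs(1))
    next
      case False
      then show ?thesis by (simp add: ce_coboundary_def numeral_3_eq_3 numeral_2_eq_2)
    qed
  qed
  note dist = mult_closed mult_add_left mult_add_right mult_smult_left mult_smult_right
  show ?thesis unfolding eq
  proof (rule cochain3I)
    show "linear_map R L V (\<lambda>x. cocycle_sum L V \<omega> x y z)" if "y \<in> carrier L" "z \<in> carrier L" for y z
      by (rule linear_mapI; use that in \<open>simp add: cocycle_sum_def lin dist V.smult_r_distr V.smult_r_diff\<close>;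
          use that in \<open>simp add: lin dist V.M.ab_simps\<close>)
    show "linear_map R L V (\<lambda>y. cocycle_sum L V \<omega> x y z)" if "x \<in> carrier L" "z \<in> carrier L" for x z
      by (rule linear_mapI; use that in \<open>simp add: cocycle_sum_def lin dist V.smult_r_distr V.smult_r_diff\<close>;
          use that in \<open>simp add: lin dist V.M.ab_simps\<close>)
    show "linear_map R L V (cocycle_sum L V \<omega> x y)" if "x \<in> carrier L" "y \<in> carrier L" for x y
      by (rule linear_mapI; use that in \<open>simp add: cocycle_sum_def lin dist V.smult_r_distr V.smult_r_diff\<close>;
          use that in \<open>simp add: lin dist V.M.ab_simps\<close>)
    fix x y assume xy: "x \<in> carrier L" "y \<in> carrier L"
    have "\<omega> [y \<otimes>\<^bsub>L\<^esub> x, x] = \<ominus>\<^bsub>V\<^esub> \<omega> [x \<otimes>\<^bsub>L\<^esub> y, x]"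
      using xy bracket_swap[of y x] by (simp add: lin mult_closed)
    then show "cocycle_sum L V \<omega> x y x = \<zero>\<^bsub>V\<^esub>"
      using xy by (simp add: cocycle_sum_def bracket_self lin mult_closed V.M.ab_simps)
    show "cocycle_sum L V \<omega> x x y = \<zero>\<^bsub>V\<^esub>" "cocycle_sum L V \<omega> x y y = \<zero>\<^bsub>V\<^esub>"
      using xy by (simp_all add: cocycle_sum_def bracket_self lin mult_closed V.M.diff_zero V.M.diff_self)
  qed
qed

text \<open>
  The boundary is the coboundary of the wedge product, regarded as a cochain with values in the
  exterior power, so that homology and cohomology share their computations.
\<close>

lemma boundary_gen_eq:
  "xs \<in> tuples L (Suc n) \<Longrightarrow> ce_boundary_gen R L xs = ce_coboundary L (ext_power R L n) n (wedge R L) xs"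
  by (simp add: ce_boundary_gen_def ce_coboundary_def tuples_def Let_def)

lemma wedge_lin:
  "linear_map R L (ext_power R L 1) (\<lambda>x. wedge R L [x])"
  "y \<in> carrier L \<Longrightarrow> linear_map R L (ext_power R L 2) (\<lambda>x. wedge R L [x, y])"
  "x \<in> carrier L \<Longrightarrow> linear_map R L (ext_power R L 2) (\<lambda>y. wedge R L [x, y])"
proof -
  have cong: "linear_map R L V f \<Longrightarrow> (\<And>x. x \<in> carrier L \<Longrightarrow> f x = g x) \<Longrightarrow> linear_map R L V g" for V f g
    unfolding linear_map_def by (auto simp: Pi_iff)
  show "linear_map R L (ext_power R L 1) (\<lambda>x. wedge R L [x])"
    by (rule cong[OF cochain1D[OF wedge_cochain]]) (simp add: tuples_small)
  show "linear_map R L (ext_power R L 2) (\<lambda>x. wedge R L [x, y])" if "y \<in> carrier L"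
    by (rule cong[OF cochain2D(1)[OF wedge_cochain that]]) (use that in \<open>simp add: tuples_small\<close>)
  show "linear_map R L (ext_power R L 2) (\<lambda>y. wedge R L [x, y])" if "x \<in> carrier L"
    by (rule cong[OF cochain2D(2)[OF wedge_cochain that]]) (use that in \<open>simp add: tuples_small\<close>)
qed

lemma wedge_values:
  "x \<in> carrier L \<Longrightarrow> wedge R L [x] \<in> carrier (ext_power R L (Suc 0))"
  "\<lbrakk>x \<in> carrier L; y \<in> carrier L\<rbrakk> \<Longrightarrow> wedge R L [x, y] \<in> carrier (ext_power R L 2)"
  by (auto intro: wedge_closed simp: tuples_small)

lemma boundary_gen_cochain:
  "restrict (ce_boundary_gen R L) (tuples L 2) \<in> carrier (ce_cochains R L (ext_power R L 1) 2)"
  "restrict (ce_boundary_gen R L) (tuples L 3) \<in> carrier (ce_cochains R L (ext_power R L 2) 3)"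
  "\<lbrakk>x \<in> carrier L; y \<in> carrier L\<rbrakk>
    \<Longrightarrow> ce_boundary_gen R L [x, y] = \<ominus>\<^bsub>ext_power R L 1\<^esub> wedge R L [x \<otimes>\<^bsub>L\<^esub> y]"
  "\<lbrakk>x \<in> carrier L; y \<in> carrier L; z \<in> carrier L\<rbrakk>
    \<Longrightarrow> ce_boundary_gen R L [x, y, z] = cocycle_sum L (ext_power R L 2) (wedge R L) x y z"
proof -
  let ?E = "ext_power R L"
  note E = ext_power_module
  show 2: "ce_boundary_gen R L [x, y] = \<ominus>\<^bsub>?E 1\<^esub> wedge R L [x \<otimes>\<^bsub>L\<^esub> y]" if "x \<in> carrier L" "y \<in> carrier L" for x y
  proof -
    have "[x, y] \<in> tuples L (Suc 1)" using that by (simp add: tuples_def)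
    from boundary_gen_eq[OF this] show ?thesis
      using coboundary1[OF E that, of "wedge R L" 1] that by (simp add: wedge_values mult_closed)
  qed
  show 3: "ce_boundary_gen R L [x, y, z] = cocycle_sum L (?E 2) (wedge R L) x y z"
    if "x \<in> carrier L" "y \<in> carrier L" "z \<in> carrier L" for x y z
  proof -
    have "[x, y, z] \<in> tuples L (Suc 2)" using that by (simp add: tuples_def)
    from boundary_gen_eq[OF this] show ?thesis
      using coboundary2[OF E that, of "wedge R L" 2] that by (simp add: wedge_values mult_closed)
  qed
  have "restrict (ce_boundary_gen R L) (tuples L 2) = ce_coboundary L (?E 1) 1 (restrict (wedge R L) (tuples L 1))"
  proof
    fix xs
    show "restrict (ce_boundary_gen R L) (tuples L 2) xs = ce_coboundary L (?E 1) 1 (restrict (wedge R L) (tuples L 1)) xs"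
    proof (cases "xs \<in> tuples L 2")
      case True
      then obtain x y where xs: "xs = [x, y]" "x \<in> carrier L" "y \<in> carrier L" by (auto simp: tuples_small)
      have t: "[x \<otimes>\<^bsub>L\<^esub> y] \<in> tuples L 1" using xs by (simp add: tuples_small mult_closed)
      show ?thesis
        using coboundary1[OF E xs(2,3), of "restrict (wedge R L) (tuples L 1)" 1] True t xs
        by (simp add: 2 wedge_values mult_closed)
    next
      case False
      then show ?thesis by (simp add: ce_coboundary_def numeral_2_eq_2)
    qed
  qed
  then show "restrict (ce_boundary_gen R L) (tuples L 2) \<in> carrier (ce_cochains R L (?E 1) 2)"
    using coboundary1_cochain[OF E wedge_cochain] by simp
  have "restrict (ce_boundary_gen R L) (tuples L 3) = ce_coboundary L (?E 2) 2 (restrict (wedge R L) (tuples L 2))"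
  proof
    fix xs
    show "restrict (ce_boundary_gen R L) (tuples L 3) xs = ce_coboundary L (?E 2) 2 (restrict (wedge R L) (tuples L 2)) xs"
    proof (cases "xs \<in> tuples L 3")
      case True
      then obtain x y z where xs: "xs = [x, y, z]" "x \<in> carrier L" "y \<in> carrier L" "z \<in> carrier L"
        by (auto simp: tuples_small)
      have t: "[x \<otimes>\<^bsub>L\<^esub> y, z] \<in> tuples L 2" "[x \<otimes>\<^bsub>L\<^esub> z, y] \<in> tuples L 2" "[y \<otimes>\<^bsub>L\<^esub> z, x] \<in> tuples L 2"
        using xs by (simp_all add: tuples_small mult_closed)
      show ?thesis
        using coboundary2[OF E xs(2-4), of "restrict (wedge R L) (tuples L 2)" 2] True t xs
        by (simp add: 3 wedge_values mult_closed cocycle_sum_def)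
    next
      case False
      then show ?thesis by (simp add: ce_coboundary_def numeral_3_eq_3 numeral_2_eq_2)
    qed
  qed
  then show "restrict (ce_boundary_gen R L) (tuples L 3) \<in> carrier (ce_cochains R L (?E 2) 3)"
    using coboundary2_cochain[OF E wedge_cochain] by simp
qed

lemma boundary_linear:
  assumes "restrict (ce_boundary_gen R L) (tuples L n) \<in> carrier (ce_cochains R L (ext_power R L (n - 1)) n)"
  shows "linear_map R (ext_power R L n) (ext_power R L (n - 1)) (ce_boundary R L n)"
    and "xs \<in> tuples L n \<Longrightarrow> ce_boundary R L n (wedge R L xs) = ce_boundary_gen R L xs"
proof -
  note lift = ext_lift[OF ext_power_module assms]
  interpret E: module R "ext_power R L n" by (rule ext_power_module)
  have gen: "ce_boundary_gen R L xs \<in> carrier (ext_power R L (n - 1))" if "xs \<in> tuples L n" for xs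
    using ce_cochainsD(1)[OF assms that] that by simp
  have eq: "ce_boundary R L n K = ext_lift R (ext_power R L (n - 1)) (restrict (ce_boundary_gen R L) (tuples L n)) K"
    if "K \<in> carrier (ext_power R L n)" for K
  proof -
    have "ce_boundary_free R L n = free_lift R (ext_power R L (n - 1)) (ce_boundary_gen R L)"
      by (rule ext) (simp only: ce_boundary_free_def free_lift_def Let_def)
    moreover have "ext_lift R (ext_power R L (n - 1)) (restrict (ce_boundary_gen R L) (tuples L n)) K =
        ext_lift R (ext_power R L (n - 1)) (ce_boundary_gen R L) K"
      by (rule ext_lift_restrict[OF ext_power_module _ that]) (rule gen)
    ultimately show ?thesis
      using that by (simp only: ce_boundary_def ext_lift_def restrict_apply' if_True)
  qed
  show "linear_map R (ext_power R L n) (ext_power R L (n - 1)) (ce_boundary R L n)"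
    using linear_map_simps[OF lift(1)] by (intro linear_mapI) (simp_all add: eq)
  show "ce_boundary R L n (wedge R L xs) = ce_boundary_gen R L xs" if "xs \<in> tuples L n"
    using lift(2)[OF that] that by (simp add: eq wedge_closed)
qed

lemmas boundary2 = boundary_linear[of 2, simplified, OF boundary_gen_cochain(1)[simplified]]
lemmas boundary3 = boundary_linear[of 3, simplified, OF boundary_gen_cochain(2)[simplified]]

text \<open>The bracket as a linear map on the exterior square.\<close>

definition "ext_bracket = ext_lift R L (\<lambda>xs\<in>tuples L 2. xs ! 0 \<otimes>\<^bsub>L\<^esub> xs ! 1)"

lemma ext_bracket:
  "linear_map R (ext_power R L 2) L ext_bracket"
  "\<lbrakk>x \<in> carrier L; y \<in> carrier L\<rbrakk> \<Longrightarrow> ext_bracket (wedge R L [x, y]) = x \<otimes>\<^bsub>L\<^esub> y"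
proof -
  have "(\<lambda>xs\<in>tuples L 2. xs ! 0 \<otimes>\<^bsub>L\<^esub> xs ! 1) \<in> carrier (ce_cochains R L L 2)"
    by (rule cochain2I) (auto intro: mult_linear_map bracket_self)
  note lift = ext_lift[OF module_axioms this]
  show "linear_map R (ext_power R L 2) L ext_bracket" unfolding ext_bracket_def by (rule lift(1))
  show "ext_bracket (wedge R L [x, y]) = x \<otimes>\<^bsub>L\<^esub> y" if "x \<in> carrier L" "y \<in> carrier L"
    unfolding ext_bracket_def using lift(2)[of "[x, y]"] that by (simp add: tuples_small)
qed

text \<open>In degree two the boundary is the bracket up to sign, since the first exterior power of \<open>L\<close> is \<open>L\<close>.\<close>

lemma boundary2_zero_iff:
  assumes z: "z \<in> carrier (ext_power R L 2)"
  shows "ce_boundary R L 2 z = \<zero>\<^bsub>ext_power R L (Suc 0)\<^esub> \<longleftrightarrow> ext_bracket z = \<zero>\<^bsub>L\<^esub>"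
proof -
  let ?E1 = "ext_power R L (Suc 0)" and ?E2 = "ext_power R L 2"
  interpret E1: module R ?E1 by (rule ext_power_module)
  interpret E2: module R ?E2 by (rule ext_power_module)
  note b2 = boundary2
  note br = linear_map_simps[OF ext_bracket(1)]
  note w = linear_map_simps[OF wedge_lin(1)[unfolded One_nat_def]] linear_map_minus[OF module_axioms ext_power_module wedge_lin(1)[unfolded One_nat_def]]
  have "linear_map R ?E2 ?E1 (\<lambda>z. \<ominus>\<^bsub>?E1\<^esub> wedge R L [ext_bracket z])"
    by (rule linear_mapI) (simp_all add: br w E1.M.minus_add E1.smult_r_minus)
  then have eq: "ce_boundary R L 2 z = \<ominus>\<^bsub>?E1\<^esub> wedge R L [ext_bracket z]"
  proof (rule ext_power_map_unique[OF ext_power_module b2(1) _ _ z])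
    fix xs assume "xs \<in> tuples L 2"
    then obtain x y where xs: "xs = [x, y]" "x \<in> carrier L" "y \<in> carrier L" by (rule tuples2E)
    then show "ce_boundary R L 2 (wedge R L xs) = \<ominus>\<^bsub>?E1\<^esub> wedge R L [ext_bracket (wedge R L xs)]"
      using b2(2)[of xs] by (simp add: boundary_gen_cochain(3)[unfolded One_nat_def] ext_bracket(2))
  qed
  have "(\<lambda>xs\<in>tuples L (Suc 0). xs ! 0) \<in> carrier (ce_cochains R L L (Suc 0))"
    using cochain1I[of L "\<lambda>x. x"] by (simp add: linear_map_def)
  note ev = ext_lift[OF module_axioms this]
  have inj: "x = \<zero>\<^bsub>L\<^esub>" if "x \<in> carrier L" "wedge R L [x] = \<zero>\<^bsub>?E1\<^esub>" for x
    using ev(2)[of "[x]"] linear_map_minus(1)[OF ext_power_module module_axioms ev(1)] that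
    by (simp add: tuples_small)
  show ?thesis
  proof
    assume "ce_boundary R L 2 z = \<zero>\<^bsub>?E1\<^esub>"
    then have "wedge R L [ext_bracket z] = \<zero>\<^bsub>?E1\<^esub>"
      using eq br(1)[OF z] w(1) by (simp add: E1.M.minus_across)
    then show "ext_bracket z = \<zero>\<^bsub>L\<^esub>" using inj br(1)[OF z] by blast
  qed (simp add: eq w)
qed

lemma homology2_zero_iff:
  "zero_module (ce_homology R L 2) \<longleftrightarrow>
    (\<forall>z\<in>carrier (ext_power R L 2). ext_bracket z = \<zero>\<^bsub>L\<^esub> \<longrightarrow> z \<in> ce_boundary R L 3 ` carrier (ext_power R L 3))"
proof -
  interpret E2: module R "ext_power R L 2" by (rule ext_power_module)
  interpret E3: module R "ext_power R L 3" by (rule ext_power_module)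
  have sub: "submodule (ce_boundary R L 3 ` carrier (ext_power R L 3)) R (ext_power R L 2)"
    by (rule E3.submodule_image[OF E2.module_axioms boundary3(1) E3.carrier_is_submodule])
  have ker: "a_kernel (ext_power R L 2) (ext_power R L (Suc 0)) (ce_boundary R L 2) =
      {z \<in> carrier (ext_power R L 2). ext_bracket z = \<zero>\<^bsub>L\<^esub>}"
    using boundary2_zero_iff by (auto simp: a_kernel_def')
  have "\<zero>\<^bsub>ext_power R L 2\<^esub> \<in> {z \<in> carrier (ext_power R L 2). ext_bracket z = \<zero>\<^bsub>L\<^esub>}"
    using linear_map_minus(1)[OF E2.module_axioms module_axioms ext_bracket(1)] by simp
  then have "zero_module (quot_module ((ext_power R L 2)\<lparr>carrier := {z \<in> carrier (ext_power R L 2). ext_bracket z = \<zero>\<^bsub>L\<^esub>}\<rparr>)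
      (ce_boundary R L 3 ` carrier (ext_power R L 3))) \<longleftrightarrow>
      {z \<in> carrier (ext_power R L 2). ext_bracket z = \<zero>\<^bsub>L\<^esub>} \<subseteq> ce_boundary R L 3 ` carrier (ext_power R L 3)"
    by (intro zero_quot_module_iff[OF E2.M.abelian_group_axioms])
      (use sub in \<open>auto simp: submodule_def\<close>)
  moreover have "Suc 2 = (3::nat)" by simp
  ultimately show ?thesis unfolding ce_homology_def using ker by auto
qed

text \<open>A relation between brackets is a cycle.  If it is a boundary, every cocycle vanishes on it.\<close>

lemma homology2_zero_cocycle:
  assumes H: "zero_module (ce_homology R L 2)" and V: "module R V"
    and \<omega>: "\<omega> \<in> carrier (ce_cochains R L V 2)"
    and cocycle: "\<And>x y z. \<lbrakk>x \<in> carrier L; y \<in> carrier L; z \<in> carrier L\<rbrakk> \<Longrightarrow> cocycle_sum L V \<omega> x y z = \<zero>\<^bsub>V\<^esub>"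
    and z: "z \<in> carrier (ext_power R L 2)" and "ext_bracket z = \<zero>\<^bsub>L\<^esub>"
  shows "ext_lift R V \<omega> z = \<zero>\<^bsub>V\<^esub>"
proof -
  interpret V: module R V by fact
  interpret E2: module R "ext_power R L 2" by (rule ext_power_module)
  note lift = ext_lift[OF V \<omega>]
  note lin = linear_map_simps[OF lift(1)] linear_map_minus[OF E2.module_axioms V lift(1)]
  obtain w where w: "w \<in> carrier (ext_power R L 3)" "z = ce_boundary R L 3 w"
    using H z assms(6) homology2_zero_iff by blast
  have "linear_map R (ext_power R L 3) V (\<lambda>w. ext_lift R V \<omega> (ce_boundary R L 3 w))"
    by (rule linear_map_compose[OF boundary3(1) lift(1)])
  moreover have "linear_map R (ext_power R L 3) V (\<lambda>w. \<zero>\<^bsub>V\<^esub>)" by (auto intro: linear_mapI)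
  ultimately have "ext_lift R V \<omega> (ce_boundary R L 3 w) = \<zero>\<^bsub>V\<^esub>"
  proof (rule ext_power_map_unique[OF V _ _ _ w(1)])
    fix xs assume "xs \<in> tuples L 3"
    then obtain x y u where xs: "xs = [x, y, u]" "x \<in> carrier L" "y \<in> carrier L" "u \<in> carrier L"
      by (auto simp: tuples_small)
    then have "ce_boundary R L 3 (wedge R L xs) = cocycle_sum L (ext_power R L 2) (wedge R L) x y u"
      using boundary3(2)[of xs] boundary_gen_cochain(4) by (simp add: tuples_small)
    moreover have "ext_lift R V \<omega> (cocycle_sum L (ext_power R L 2) (wedge R L) x y u) = cocycle_sum L V \<omega> x y u"
      using xs by (simp add: cocycle_sum_def lin wedge_values mult_closed lift(2) tuples_small)
    ultimately show "ext_lift R V \<omega> (ce_boundary R L 3 (wedge R L xs)) = \<zero>\<^bsub>V\<^esub>" using cocycle xs by simp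
  qed
  then show ?thesis using w by simp
qed

end

text \<open>
  The sign of the differential is absorbed into \<open>\<phi>\<close>.  The quotient is compared with one of the
  module of all functions on pairs, which contains the cocycles and the coboundaries.
\<close>

lemma cohomology2_zero_iff:
  fixes R :: "('k, 'z) ring_scheme" and L :: "('k, 'a, 'y) module_scheme" and M :: "('k, 'm, 'w) module_scheme"
  assumes L: "lie_algebra R L" and M: "module R M"
  shows "zero_module (ce_cohomology R L M 2) \<longleftrightarrow>
    (\<forall>\<omega>\<in>carrier (ce_cochains R L M 2).
      (\<forall>x\<in>carrier L. \<forall>y\<in>carrier L. \<forall>z\<in>carrier L. cocycle_sum L M \<omega> x y z = \<zero>\<^bsub>M\<^esub>) \<longrightarrow>
      (\<exists>\<phi>. linear_map R L M \<phi> \<and> (\<forall>x\<in>carrier L. \<forall>y\<in>carrier L. \<omega> [x, y] = \<phi> (x \<otimes>\<^bsub>L\<^esub> y))))"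
proof -
  interpret lie_algebra R L by fact
  interpret M: module R M by fact
  let ?P = "product_algebra (tuples L 2) (\<lambda>_. M)" and ?C = "\<lambda>n. carrier (ce_cochains R L M n)"
  interpret P: module R ?P using product_module[of R "tuples L 2" "\<lambda>_. M"] R.is_cring M by simp
  define \<delta> :: "('a \<Rightarrow> 'm) \<Rightarrow> 'a list \<Rightarrow> 'm" where "\<delta> \<phi> = (\<lambda>xs\<in>tuples L 2. \<phi> (xs ! 0 \<otimes>\<^bsub>L\<^esub> xs ! 1))" for \<phi>
  define K where "K = {\<omega> \<in> ?C 2. \<forall>x\<in>carrier L. \<forall>y\<in>carrier L. \<forall>z\<in>carrier L. cocycle_sum L M \<omega> x y z = \<zero>\<^bsub>M\<^esub>}"
  have \<delta>_cochain: "\<delta> \<phi> \<in> ?C 2" if \<phi>: "linear_map R L M \<phi>" for \<phi>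
    unfolding \<delta>_def
    by (rule cochain2I)
      (auto intro!: linear_mapI simp: linear_map_simps[OF \<phi>] linear_map_minus[OF module_axioms M \<phi>] mult_closed
        mult_add_left mult_add_right mult_smult_left mult_smult_right bracket_self)
  have kernel: "a_kernel (ce_cochains R L M 2) (ce_cochains R L M (Suc 2)) (ce_coboundary L M 2) = K"
  proof -
    have "ce_coboundary L M 2 \<omega> = \<zero>\<^bsub>ce_cochains R L M (Suc 2)\<^esub> \<longleftrightarrow>
        (\<forall>x\<in>carrier L. \<forall>y\<in>carrier L. \<forall>z\<in>carrier L. cocycle_sum L M \<omega> x y z = \<zero>\<^bsub>M\<^esub>)" if \<omega>: "\<omega> \<in> ?C 2" for \<omega>
    proof -
      note lin = linear_map_simps[OF cochain2D(1)[OF \<omega>]]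
      have val: "ce_coboundary L M 2 \<omega> [x, y, z] = cocycle_sum L M \<omega> x y z"
        if "x \<in> carrier L" "y \<in> carrier L" "z \<in> carrier L" for x y z
        by (rule coboundary2[OF M that]) (simp_all add: lin mult_closed that)
      have "ce_coboundary L M 2 \<omega> = (\<lambda>xs\<in>tuples L 3. \<zero>\<^bsub>M\<^esub>) \<longleftrightarrow> (\<forall>xs\<in>tuples L 3. ce_coboundary L M 2 \<omega> xs = \<zero>\<^bsub>M\<^esub>)"
      proof
        assume zero: "\<forall>xs\<in>tuples L 3. ce_coboundary L M 2 \<omega> xs = \<zero>\<^bsub>M\<^esub>"
        show "ce_coboundary L M 2 \<omega> = (\<lambda>xs\<in>tuples L 3. \<zero>\<^bsub>M\<^esub>)"
        proof
          fix xs show "ce_coboundary L M 2 \<omega> xs = (\<lambda>xs\<in>tuples L 3. \<zero>\<^bsub>M\<^esub>) xs"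
            using zero by (cases "xs \<in> tuples L 3") (auto simp: ce_coboundary_def numeral_3_eq_3 numeral_2_eq_2)
        qed
      qed simp
      also have "\<dots> \<longleftrightarrow> (\<forall>x\<in>carrier L. \<forall>y\<in>carrier L. \<forall>z\<in>carrier L. cocycle_sum L M \<omega> x y z = \<zero>\<^bsub>M\<^esub>)"
      proof (intro iffI ballI)
        fix x y z assume zero: "\<forall>xs\<in>tuples L 3. ce_coboundary L M 2 \<omega> xs = \<zero>\<^bsub>M\<^esub>"
          and xyz: "x \<in> carrier L" "y \<in> carrier L" "z \<in> carrier L"
        have "[x, y, z] \<in> tuples L 3" using xyz by simp
        then show "cocycle_sum L M \<omega> x y z = \<zero>\<^bsub>M\<^esub>" using zero val[OF xyz] by metis
      next
        fix xs assume zero: "\<forall>x\<in>carrier L. \<forall>y\<in>carrier L. \<forall>z\<in>carrier L. cocycle_sum L M \<omega> x y z = \<zero>\<^bsub>M\<^esub>"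
          and "xs \<in> tuples L 3"
        then obtain x y z where "xs = [x, y, z]" "x \<in> carrier L" "y \<in> carrier L" "z \<in> carrier L"
          by (elim tuples3E)
        then show "ce_coboundary L M 2 \<omega> xs = \<zero>\<^bsub>M\<^esub>" using zero val by simp
      qed
      finally show ?thesis by (simp add: ce_cochains_def numeral_3_eq_3 numeral_2_eq_2)
    qed
    then show ?thesis unfolding a_kernel_def' K_def by blast
  qed
  have coboundaries: "ce_coboundaries R L M 2 = \<delta> ` {\<phi>. linear_map R L M \<phi>}"
  proof -
    have eq: "ce_coboundary L M 1 \<eta> = \<delta> (\<lambda>x. \<ominus>\<^bsub>M\<^esub> \<eta> [x])" if \<eta>: "\<eta> \<in> ?C 1" for \<eta>
    proof (rule cochain2_eqI[OF coboundary1_cochain[OF M \<eta>] \<delta>_cochain])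
      note lin = linear_map_simps[OF cochain1D[OF \<eta>]]
      show "linear_map R L M (\<lambda>x. \<ominus>\<^bsub>M\<^esub> \<eta> [x])"
        by (rule linear_mapI) (simp_all add: lin M.M.minus_add M.smult_r_minus)
      fix x y assume xy: "x \<in> carrier L" "y \<in> carrier L"
      show "ce_coboundary L M 1 \<eta> [x, y] = \<delta> (\<lambda>x. \<ominus>\<^bsub>M\<^esub> \<eta> [x]) [x, y]"
        using coboundary1[OF M xy, of \<eta>] xy by (simp add: \<delta>_def lin mult_closed tuples_small)
    qed
    have "ce_coboundary L M 1 ` ?C 1 = \<delta> ` {\<phi>. linear_map R L M \<phi>}"
    proof (intro equalityI subsetI)
      fix \<omega> assume "\<omega> \<in> ce_coboundary L M 1 ` ?C 1"
      then obtain \<eta> where \<eta>: "\<eta> \<in> ?C 1" "\<omega> = ce_coboundary L M 1 \<eta>" by auto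
      note lin = linear_map_simps[OF cochain1D[OF \<eta>(1)]]
      have "linear_map R L M (\<lambda>x. \<ominus>\<^bsub>M\<^esub> \<eta> [x])"
        by (rule linear_mapI) (simp_all add: lin M.M.minus_add M.smult_r_minus)
      then show "\<omega> \<in> \<delta> ` {\<phi>. linear_map R L M \<phi>}" using \<eta> eq by blast
    next
      fix \<omega> assume "\<omega> \<in> \<delta> ` {\<phi>. linear_map R L M \<phi>}"
      then obtain \<phi> where \<phi>: "linear_map R L M \<phi>" "\<omega> = \<delta> \<phi>" by auto
      note lin = linear_map_simps[OF \<phi>(1)]
      have neg: "linear_map R L M (\<lambda>x. \<ominus>\<^bsub>M\<^esub> \<phi> x)"
        by (rule linear_mapI) (simp_all add: lin M.M.minus_add M.smult_r_minus)
      define \<eta> where "\<eta> = (\<lambda>xs\<in>tuples L 1. \<ominus>\<^bsub>M\<^esub> \<phi> (xs ! 0))"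
      have \<eta>: "\<eta> \<in> ?C 1" unfolding \<eta>_def by (rule cochain1I[OF neg])
      have "ce_coboundary L M 1 \<eta> = \<delta> \<phi>"
      proof (rule cochain2_eqI[OF coboundary1_cochain[OF M \<eta>] \<delta>_cochain[OF \<phi>(1)]])
        fix x y assume xy: "x \<in> carrier L" "y \<in> carrier L"
        have "\<eta> [x \<otimes>\<^bsub>L\<^esub> y] = \<ominus>\<^bsub>M\<^esub> \<phi> (x \<otimes>\<^bsub>L\<^esub> y)" using xy by (simp add: \<eta>_def tuples_small mult_closed)
        then show "ce_coboundary L M 1 \<eta> [x, y] = \<delta> \<phi> [x, y]"
          using coboundary1[OF M xy, of \<eta>] xy by (simp add: \<delta>_def lin mult_closed tuples_small)
      qed
      then have "\<omega> = ce_coboundary L M 1 \<eta>" using \<phi>(2) by simp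
      then show "\<omega> \<in> ce_coboundary L M 1 ` ?C 1" using \<eta> by (rule image_eqI)
    qed
    then show ?thesis by (simp add: ce_coboundaries_def numeral_2_eq_2)
  qed
  have in_P: "\<omega> \<in> carrier ?P" if "\<omega> \<in> ?C 2" for \<omega>
    using ce_cochainsD(5)[OF that] by (simp add: product_algebra_def)
  have sub: "submodule (\<delta> ` {\<phi>. linear_map R L M \<phi>}) R ?P"
  proof (rule P.submoduleI)
    note ext = fun_eq_iff product_algebra_def \<delta>_def restrict_def tuples_small
    show "\<delta> ` {\<phi>. linear_map R L M \<phi>} \<subseteq> carrier ?P" using \<delta>_cochain in_P by auto
    have "linear_map R L M (\<lambda>x. \<zero>\<^bsub>M\<^esub>)" by (auto intro: linear_mapI)
    moreover have "\<zero>\<^bsub>?P\<^esub> = \<delta> (\<lambda>x. \<zero>\<^bsub>M\<^esub>)" by (simp add: ext)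
    ultimately show "\<zero>\<^bsub>?P\<^esub> \<in> \<delta> ` {\<phi>. linear_map R L M \<phi>}" by blast
    show add: "u \<oplus>\<^bsub>?P\<^esub> v \<in> \<delta> ` {\<phi>. linear_map R L M \<phi>}"
      if uv: "u \<in> \<delta> ` {\<phi>. linear_map R L M \<phi>}" "v \<in> \<delta> ` {\<phi>. linear_map R L M \<phi>}" for u v
    proof -
      obtain \<phi> \<psi> where *: "linear_map R L M \<phi>" "linear_map R L M \<psi>" "u = \<delta> \<phi>" "v = \<delta> \<psi>" using uv by blast
      have "linear_map R L M (\<lambda>x. \<phi> x \<oplus>\<^bsub>M\<^esub> \<psi> x)"
        by (rule linear_mapI) (simp_all add: linear_map_simps[OF *(1)] linear_map_simps[OF *(2)] M.smult_r_distr M.M.a_ac)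
      moreover have "u \<oplus>\<^bsub>?P\<^esub> v = \<delta> (\<lambda>x. \<phi> x \<oplus>\<^bsub>M\<^esub> \<psi> x)" unfolding * by (auto simp: fun_eq_iff product_algebra_def \<delta>_def)
      ultimately show ?thesis by blast
    qed
    show smult: "a \<odot>\<^bsub>?P\<^esub> u \<in> \<delta> ` {\<phi>. linear_map R L M \<phi>}"
      if a: "a \<in> carrier R" and u: "u \<in> \<delta> ` {\<phi>. linear_map R L M \<phi>}" for a u
    proof -
      obtain \<phi> where *: "linear_map R L M \<phi>" "u = \<delta> \<phi>" using u by blast
      have "linear_map R L M (\<lambda>x. a \<odot>\<^bsub>M\<^esub> \<phi> x)"
        using a by (intro linear_mapI)
          (simp_all add: linear_map_simps[OF *(1)] M.smult_r_distr M.smult_assoc1[symmetric] R.m_comm)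
      moreover have "a \<odot>\<^bsub>?P\<^esub> u = \<delta> (\<lambda>x. a \<odot>\<^bsub>M\<^esub> \<phi> x)" unfolding * by (auto simp: fun_eq_iff product_algebra_def \<delta>_def)
      ultimately show ?thesis by blast
    qed
    show "\<ominus>\<^bsub>?P\<^esub> u \<in> \<delta> ` {\<phi>. linear_map R L M \<phi>}" if u: "u \<in> \<delta> ` {\<phi>. linear_map R L M \<phi>}" for u
    proof -
      have "u \<in> carrier ?P" using u \<delta>_cochain in_P by auto
      then have "\<ominus>\<^bsub>?P\<^esub> u = (\<ominus>\<^bsub>R\<^esub> \<one>\<^bsub>R\<^esub>) \<odot>\<^bsub>?P\<^esub> u" using P.smult_l_minus[of "\<one>\<^bsub>R\<^esub>" u] by simp
      then show ?thesis using smult[OF _ u, of "\<ominus>\<^bsub>R\<^esub> \<one>\<^bsub>R\<^esub>"] by simp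
    qed
  qed
  have "(\<lambda>xs\<in>tuples L 2. \<zero>\<^bsub>M\<^esub>) \<in> K"
  proof -
    have lin0: "linear_map R L M (\<lambda>x. \<zero>\<^bsub>M\<^esub>)" by (auto intro: linear_mapI)
    have "(\<lambda>xs\<in>tuples L 2. \<zero>\<^bsub>M\<^esub>) \<in> ?C 2" using \<delta>_cochain[OF lin0] by (simp add: \<delta>_def)
    then show ?thesis by (simp add: K_def cocycle_sum_def tuples_small mult_closed M.M.diff_zero)
  qed
  then have "K \<subseteq> carrier ?P" "K \<noteq> {}" using in_P by (auto simp: K_def)
  moreover have "subgroup (\<delta> ` {\<phi>. linear_map R L M \<phi>}) (add_monoid ?P)" using sub by (simp add: submodule_def)
  moreover have "add (ce_cochains R L M 2) = add ?P" by (simp add: ce_cochains_def product_algebra_def)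
  ultimately have "zero_module (ce_cohomology R L M 2) \<longleftrightarrow> K \<subseteq> \<delta> ` {\<phi>. linear_map R L M \<phi>}"
    unfolding ce_cohomology_def kernel coboundaries
    using zero_quot_module_iff[OF P.M.abelian_group_axioms] by blast
  also have "\<dots> \<longleftrightarrow> (\<forall>\<omega>\<in>K. \<exists>\<phi>. linear_map R L M \<phi> \<and> (\<forall>x\<in>carrier L. \<forall>y\<in>carrier L. \<omega> [x, y] = \<phi> (x \<otimes>\<^bsub>L\<^esub> y)))"
  proof -
    have "\<omega> \<in> \<delta> ` {\<phi>. linear_map R L M \<phi>} \<longleftrightarrow>
        (\<exists>\<phi>. linear_map R L M \<phi> \<and> (\<forall>x\<in>carrier L. \<forall>y\<in>carrier L. \<omega> [x, y] = \<phi> (x \<otimes>\<^bsub>L\<^esub> y)))" if "\<omega> \<in> K" for \<omega>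
    proof -
      have \<omega>: "\<omega> \<in> ?C 2" using that by (simp add: K_def)
      have "\<omega> = \<delta> \<phi> \<longleftrightarrow> (\<forall>x\<in>carrier L. \<forall>y\<in>carrier L. \<omega> [x, y] = \<phi> (x \<otimes>\<^bsub>L\<^esub> y))" if \<phi>: "linear_map R L M \<phi>" for \<phi>
      proof
        assume "\<omega> = \<delta> \<phi>"
        then show "\<forall>x\<in>carrier L. \<forall>y\<in>carrier L. \<omega> [x, y] = \<phi> (x \<otimes>\<^bsub>L\<^esub> y)" by (simp add: \<delta>_def tuples_small)
      next
        assume "\<forall>x\<in>carrier L. \<forall>y\<in>carrier L. \<omega> [x, y] = \<phi> (x \<otimes>\<^bsub>L\<^esub> y)"
        then show "\<omega> = \<delta> \<phi>"
          by (intro cochain2_eqI[OF \<omega> \<delta>_cochain[OF \<phi>]]) (simp add: \<delta>_def tuples_small)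
      qed
      then show ?thesis by blast
    qed
    then show ?thesis by blast
  qed
  finally show ?thesis unfolding K_def by blast
qed

text \<open>
  Apply the hypothesis to the universal cocycle, the wedge product with values in \<open>\<Lambda>\<^sup>2 L\<close> modulo
  boundaries.  It factors through the bracket, so every relation between brackets is a boundary.
\<close>

lemma homology2_zeroI:
  fixes R :: "('k, 'z) ring_scheme" and L :: "('k, 'a, 'y) module_scheme"
  assumes L: "lie_algebra R L"
    and split: "\<And>(V :: ('k, ('a list \<Rightarrow> 'k) set set) module) \<omega>. \<lbrakk>module R V; \<omega> \<in> carrier (ce_cochains R L V 2);
      \<And>x y z. \<lbrakk>x \<in> carrier L; y \<in> carrier L; z \<in> carrier L\<rbrakk> \<Longrightarrow> cocycle_sum L V \<omega> x y z = \<zero>\<^bsub>V\<^esub>\<rbrakk>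
    \<Longrightarrow> \<exists>\<mu>. linear_map R L V \<mu> \<and> (\<forall>x\<in>carrier L. \<forall>y\<in>carrier L. \<omega> [x, y] = \<mu> (x \<otimes>\<^bsub>L\<^esub> y))"
  shows "zero_module (ce_homology R L 2)"
proof -
  interpret lie_algebra R L by fact
  interpret E3: module R "ext_power R L 3" by (rule ext_power_module)
  define B where "B = ce_boundary R L 3 ` carrier (ext_power R L 3)"
  have B: "submodule B R (ext_power R L 2)" unfolding B_def
    by (rule E3.submodule_image[OF ext_power_module boundary3(1) E3.carrier_is_submodule])
  interpret q: quotient R "ext_power R L 2" B
    unfolding quotient_def quotient_axioms_def using B ext_power_module by simp
  define \<omega> where "\<omega> = (\<lambda>xs\<in>tuples L 2. q.\<pi> (wedge R L [xs ! 0, xs ! 1]))"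
  have val: "\<omega> [x, y] = q.\<pi> (wedge R L [x, y])" if "x \<in> carrier L" "y \<in> carrier L" for x y
    using that by (simp add: \<omega>_def tuples_small)
  have \<omega>: "\<omega> \<in> carrier (ce_cochains R L q.Q 2)"
    unfolding \<omega>_def
  proof (rule cochain2I)
    show "linear_map R L q.Q (\<lambda>x. q.\<pi> (wedge R L [x, y]))" if "y \<in> carrier L" for y
      by (rule linear_map_compose[OF wedge_lin(2)[OF that] q.quot_map])
    show "linear_map R L q.Q (\<lambda>y. q.\<pi> (wedge R L [x, y]))" if "x \<in> carrier L" for x
      by (rule linear_map_compose[OF wedge_lin(3)[OF that] q.quot_map])
    show "q.\<pi> (wedge R L [x, x]) = \<zero>\<^bsub>q.Q\<^esub>" if "x \<in> carrier L" for x
      using cochain2D(3)[OF wedge_cochain that] that by (simp add: tuples_small q.quot_simps)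
  qed
  have "cocycle_sum L q.Q \<omega> x y z = \<zero>\<^bsub>q.Q\<^esub>" if xyz: "x \<in> carrier L" "y \<in> carrier L" "z \<in> carrier L" for x y z
  proof -
    have t: "[x, y, z] \<in> tuples L 3" using xyz by (simp add: tuples_small)
    have "cocycle_sum L q.Q \<omega> x y z = q.\<pi> (cocycle_sum L (ext_power R L 2) (wedge R L) x y z)"
      using xyz by (simp add: cocycle_sum_def val mult_closed wedge_values
          linear_map_minus[OF q.module_axioms q.quot_module q.quot_map])
    also have "cocycle_sum L (ext_power R L 2) (wedge R L) x y z = ce_boundary R L 3 (wedge R L [x, y, z])"
      using boundary3(2)[OF t] boundary_gen_cochain(4)[OF xyz] by simp
    also have "q.\<pi> (ce_boundary R L 3 (wedge R L [x, y, z])) = \<zero>\<^bsub>q.Q\<^esub>"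
      using wedge_closed[OF t] linear_map_simps(1)[OF boundary3(1)] q.quot_zero_iff by (simp add: B_def)
    finally show ?thesis .
  qed
  from split[OF q.quot_module \<omega> this]
  obtain \<mu> where \<mu>: "linear_map R L q.Q \<mu>" "\<And>x y. \<lbrakk>x \<in> carrier L; y \<in> carrier L\<rbrakk> \<Longrightarrow> \<omega> [x, y] = \<mu> (x \<otimes>\<^bsub>L\<^esub> y)"
    by blast
  have eq: "\<mu> (ext_bracket z) = q.\<pi> z" if "z \<in> carrier (ext_power R L 2)" for z
    by (rule ext_power_map_unique[OF q.quot_module linear_map_compose[OF ext_bracket(1) \<mu>(1)] q.quot_map _ that])
      (auto simp: tuples_small ext_bracket(2) \<mu>(2)[symmetric] val)
  show ?thesis unfolding homology2_zero_iff B_def[symmetric]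
  proof (intro ballI impI)
    fix z assume z: "z \<in> carrier (ext_power R L 2)" "ext_bracket z = \<zero>\<^bsub>L\<^esub>"
    then have "q.\<pi> z = \<zero>\<^bsub>q.Q\<^esub>"
      using eq[OF z(1)] linear_map_minus(1)[OF module_axioms q.quot_module \<mu>(1)] by simp
    then show "z \<in> B" using q.quot_zero_iff[OF z(1)] by simp
  qed
qed

section \<open>Vanishing of second homology and of second cohomology\<close>

definition self_module :: "('k, 'z) ring_scheme \<Rightarrow> ('k, 'k) module" where
  "self_module R = \<lparr>carrier = carrier R, mult = mult R, one = \<one>\<^bsub>R\<^esub>, zero = \<zero>\<^bsub>R\<^esub>, add = add R, smult = mult R\<rparr>"

lemma (in cring) self_module: "module R (self_module R)"
  by (rule moduleI[OF is_cring])
    (auto simp: self_module_def l_distr r_distr m_assoc a_ac intro!: abelian_groupI intro: l_neg)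

text \<open>A subspace that is maximal among those containing \<open>N\<close> but not \<open>z\<close> is a hyperplane.\<close>

lemma separating_functional:
  assumes R: "field R" and V: "module R V" and N: "submodule N R V" and z: "z \<in> carrier V" "z \<notin> N"
  obtains g where "linear_map R V (self_module R) g" "\<And>n. n \<in> N \<Longrightarrow> g n = \<zero>\<^bsub>R\<^esub>" "g z = \<one>\<^bsub>R\<^esub>"
proof -
  interpret R: field R by fact
  interpret V: module R V by fact
  define \<A> where "\<A> = {K. submodule K R V \<and> N \<subseteq> K \<and> z \<notin> K}"
  have "\<exists>K\<in>\<A>. \<forall>X\<in>\<A>. K \<subseteq> X \<longrightarrow> X = K"
  proof (rule subset_Zorn_nonempty)
    show "\<A> \<noteq> {}" using N z by (auto simp: \<A>_def)
    fix C assume C: "C \<noteq> {}" "subset.chain \<A> C"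
    then have mem: "submodule K R V" "N \<subseteq> K" "z \<notin> K" if "K \<in> C" for K
      using that by (auto simp: \<A>_def subset_chain_def)
    have "submodule (\<Union>C) R V"
    proof (rule V.submoduleI)
      show "\<Union>C \<subseteq> carrier V" using V.submoduleE(1)[OF mem(1)] by blast
      show "\<zero>\<^bsub>V\<^esub> \<in> \<Union>C" using C(1) V.submodule_zero[OF mem(1)] by blast
      show "\<ominus>\<^bsub>V\<^esub> x \<in> \<Union>C" if "x \<in> \<Union>C" for x using that V.submoduleE(3)[OF mem(1)] by blast
      show "a \<odot>\<^bsub>V\<^esub> x \<in> \<Union>C" if "a \<in> carrier R" "x \<in> \<Union>C" for a x using that V.submoduleE(4)[OF mem(1)] by blast
      show "x \<oplus>\<^bsub>V\<^esub> y \<in> \<Union>C" if xy: "x \<in> \<Union>C" "y \<in> \<Union>C" for x y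
      proof -
        obtain K K' where K: "K \<in> C" "x \<in> K" "K' \<in> C" "y \<in> K'" using xy by blast
        then have "K \<subseteq> K' \<or> K' \<subseteq> K" using C(2) by (auto simp: subset_chain_def)
        then show ?thesis using K V.submoduleE(5)[OF mem(1)] by blast
      qed
    qed
    then show "\<Union>C \<in> \<A>" using C(1) mem(2,3) by (auto simp: \<A>_def)
  qed
  then obtain K where K: "submodule K R V" "N \<subseteq> K" "z \<notin> K"
    and max: "\<And>X. \<lbrakk>submodule X R V; N \<subseteq> X; z \<notin> X; K \<subseteq> X\<rbrakk> \<Longrightarrow> X = K" by (auto simp: \<A>_def)
  note KE = V.submoduleE[OF K(1)] V.submodule_zero[OF K(1)]
  have Kc: "k \<in> carrier V" if "k \<in> K" for k using that KE(1) by auto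
  \<comment> \<open>modulo the maximal subspace \<open>K\<close> every vector is a unique multiple of \<open>z\<close>\<close>
  have ex: "\<exists>a\<in>carrier R. v \<ominus>\<^bsub>V\<^esub> a \<odot>\<^bsub>V\<^esub> z \<in> K" if v: "v \<in> carrier V" for v
  proof (cases "v \<in> K")
    case True
    then show ?thesis using z v by (intro bexI[of _ "\<zero>\<^bsub>R\<^esub>"]) (simp_all add: V.M.diff_zero)
  next
    case False
    define X where "X = {k \<oplus>\<^bsub>V\<^esub> b \<odot>\<^bsub>V\<^esub> v | k b. k \<in> K \<and> b \<in> carrier R}"
    have X: "submodule X R V"
    proof (rule V.submoduleI)
      show "X \<subseteq> carrier V" using v Kc by (auto simp: X_def)
      have "\<zero>\<^bsub>V\<^esub> = \<zero>\<^bsub>V\<^esub> \<oplus>\<^bsub>V\<^esub> \<zero>\<^bsub>R\<^esub> \<odot>\<^bsub>V\<^esub> v" using v by simp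
      then show "\<zero>\<^bsub>V\<^esub> \<in> X" unfolding X_def using KE(7) R.zero_closed by blast
      show "x \<oplus>\<^bsub>V\<^esub> y \<in> X" if xy: "x \<in> X" "y \<in> X" for x y
      proof -
        obtain k b k' b' where *: "k \<in> K" "b \<in> carrier R" "k' \<in> K" "b' \<in> carrier R"
          "x = k \<oplus>\<^bsub>V\<^esub> b \<odot>\<^bsub>V\<^esub> v" "y = k' \<oplus>\<^bsub>V\<^esub> b' \<odot>\<^bsub>V\<^esub> v" using xy by (auto simp: X_def)
        then have "x \<oplus>\<^bsub>V\<^esub> y = (k \<oplus>\<^bsub>V\<^esub> k') \<oplus>\<^bsub>V\<^esub> (b \<oplus>\<^bsub>R\<^esub> b') \<odot>\<^bsub>V\<^esub> v" using v by (simp add: Kc V.smult_l_distr V.M.a_ac)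
        then show ?thesis unfolding X_def using * KE(5) R.a_closed by blast
      qed
      show smult: "a \<odot>\<^bsub>V\<^esub> x \<in> X" if a: "a \<in> carrier R" and x: "x \<in> X" for a x
      proof -
        obtain k b where *: "k \<in> K" "b \<in> carrier R" "x = k \<oplus>\<^bsub>V\<^esub> b \<odot>\<^bsub>V\<^esub> v" using x by (auto simp: X_def)
        then have "a \<odot>\<^bsub>V\<^esub> x = a \<odot>\<^bsub>V\<^esub> k \<oplus>\<^bsub>V\<^esub> (a \<otimes>\<^bsub>R\<^esub> b) \<odot>\<^bsub>V\<^esub> v" using v a by (simp add: Kc V.smult_r_distr V.smult_assoc1)
        then show ?thesis unfolding X_def using * a KE(4) R.m_closed by blast
      qed
      show "\<ominus>\<^bsub>V\<^esub> x \<in> X" if x: "x \<in> X" for x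
      proof -
        have "x \<in> carrier V" using x v Kc by (auto simp: X_def)
        then have "\<ominus>\<^bsub>V\<^esub> x = (\<ominus>\<^bsub>R\<^esub> \<one>\<^bsub>R\<^esub>) \<odot>\<^bsub>V\<^esub> x" using V.smult_l_minus[of "\<one>\<^bsub>R\<^esub>" x] by simp
        then show ?thesis using smult[OF _ x, of "\<ominus>\<^bsub>R\<^esub> \<one>\<^bsub>R\<^esub>"] by simp
      qed
    qed
    have KX: "K \<subseteq> X"
    proof
      fix k assume k: "k \<in> K"
      then have "k = k \<oplus>\<^bsub>V\<^esub> \<zero>\<^bsub>R\<^esub> \<odot>\<^bsub>V\<^esub> v" using v Kc by simp
      then show "k \<in> X" unfolding X_def using k R.zero_closed by blast
    qed
    have "v = \<zero>\<^bsub>V\<^esub> \<oplus>\<^bsub>V\<^esub> \<one>\<^bsub>R\<^esub> \<odot>\<^bsub>V\<^esub> v" using v by simp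
    then have "v \<in> X" unfolding X_def using KE(7) R.one_closed by blast
    then have "z \<in> X" using max[OF X _ _ KX] K(2) KX False by blast
    then obtain k b where *: "k \<in> K" "b \<in> carrier R" "z = k \<oplus>\<^bsub>V\<^esub> b \<odot>\<^bsub>V\<^esub> v" by (auto simp: X_def)
    have "b \<noteq> \<zero>\<^bsub>R\<^esub>"
    proof
      assume "b = \<zero>\<^bsub>R\<^esub>"
      then show False using * K(3) v Kc by simp
    qed
    then have b: "b \<in> Units R" using *(2) R.field_Units by auto
    have "inv\<^bsub>R\<^esub> b \<odot>\<^bsub>V\<^esub> (b \<odot>\<^bsub>V\<^esub> v) = v" using b v *(2) by (simp add: V.smult_assoc1[symmetric])
    then have "inv\<^bsub>R\<^esub> b \<odot>\<^bsub>V\<^esub> z = inv\<^bsub>R\<^esub> b \<odot>\<^bsub>V\<^esub> k \<oplus>\<^bsub>V\<^esub> v" using * b v Kc by (simp add: V.smult_r_distr)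
    then have "v \<ominus>\<^bsub>V\<^esub> inv\<^bsub>R\<^esub> b \<odot>\<^bsub>V\<^esub> z = \<ominus>\<^bsub>V\<^esub> (inv\<^bsub>R\<^esub> b \<odot>\<^bsub>V\<^esub> k)" using * b v Kc by (simp add: V.M.ab_simps)
    then show ?thesis using KE(3,4) *(1) b by (intro bexI[of _ "inv\<^bsub>R\<^esub> b"]) simp_all
  qed
  have unique: "a = b" if "a \<in> carrier R" "b \<in> carrier R" "v \<in> carrier V" "v \<ominus>\<^bsub>V\<^esub> a \<odot>\<^bsub>V\<^esub> z \<in> K" "v \<ominus>\<^bsub>V\<^esub> b \<odot>\<^bsub>V\<^esub> z \<in> K" for a b v
  proof (rule ccontr)
    assume "a \<noteq> b"
    then have "a \<ominus>\<^bsub>R\<^esub> b \<noteq> \<zero>\<^bsub>R\<^esub>" using that(1,2) by (simp add: R.diff_eq_zero_iff)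
    then have u: "a \<ominus>\<^bsub>R\<^esub> b \<in> Units R" using that(1,2) R.field_Units by auto
    have "(v \<ominus>\<^bsub>V\<^esub> b \<odot>\<^bsub>V\<^esub> z) \<ominus>\<^bsub>V\<^esub> (v \<ominus>\<^bsub>V\<^esub> a \<odot>\<^bsub>V\<^esub> z) = (a \<ominus>\<^bsub>R\<^esub> b) \<odot>\<^bsub>V\<^esub> z"
      using that(1-3) z(1) by (simp add: a_minus_def[of R] V.smult_l_distr V.smult_l_minus) (simp add: V.M.ab_simps)
    then have "(a \<ominus>\<^bsub>R\<^esub> b) \<odot>\<^bsub>V\<^esub> z \<in> K" using V.submodule_diff[OF K(1) that(5,4)] by simp
    then have "inv\<^bsub>R\<^esub> (a \<ominus>\<^bsub>R\<^esub> b) \<odot>\<^bsub>V\<^esub> ((a \<ominus>\<^bsub>R\<^esub> b) \<odot>\<^bsub>V\<^esub> z) \<in> K" using KE(4) u by simp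
    moreover have "inv\<^bsub>R\<^esub> (a \<ominus>\<^bsub>R\<^esub> b) \<odot>\<^bsub>V\<^esub> ((a \<ominus>\<^bsub>R\<^esub> b) \<odot>\<^bsub>V\<^esub> z) = z"
      using u z(1) that(1,2) V.smult_assoc1[of "inv\<^bsub>R\<^esub> (a \<ominus>\<^bsub>R\<^esub> b)" "a \<ominus>\<^bsub>R\<^esub> b" z] by simp
    ultimately show False using K(3) by simp
  qed
  define g where "g v = (THE a. a \<in> carrier R \<and> v \<ominus>\<^bsub>V\<^esub> a \<odot>\<^bsub>V\<^esub> z \<in> K)" for v
  have g_eq: "g v = a" if "v \<in> carrier V" "a \<in> carrier R" "v \<ominus>\<^bsub>V\<^esub> a \<odot>\<^bsub>V\<^esub> z \<in> K" for v a
    unfolding g_def by (rule the_equality) (use that unique in blast)+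
  have g: "g v \<in> carrier R" "v \<ominus>\<^bsub>V\<^esub> g v \<odot>\<^bsub>V\<^esub> z \<in> K" if "v \<in> carrier V" for v
    using ex[OF that] g_eq[OF that] by auto
  have "linear_map R V (self_module R) g"
  proof (rule linear_mapI; simp add: self_module_def)
    show "g v \<in> carrier R" if "v \<in> carrier V" for v by (rule g(1)[OF that])
    show "g (v \<oplus>\<^bsub>V\<^esub> w) = g v \<oplus>\<^bsub>R\<^esub> g w" if v: "v \<in> carrier V" and w: "w \<in> carrier V" for v w
    proof (rule g_eq)
      have "(v \<oplus>\<^bsub>V\<^esub> w) \<ominus>\<^bsub>V\<^esub> (g v \<oplus>\<^bsub>R\<^esub> g w) \<odot>\<^bsub>V\<^esub> z = (v \<ominus>\<^bsub>V\<^esub> g v \<odot>\<^bsub>V\<^esub> z) \<oplus>\<^bsub>V\<^esub> (w \<ominus>\<^bsub>V\<^esub> g w \<odot>\<^bsub>V\<^esub> z)"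
        using v w z(1) g(1) by (simp add: V.smult_l_distr) (simp add: V.M.ab_simps g(1))
      then show "(v \<oplus>\<^bsub>V\<^esub> w) \<ominus>\<^bsub>V\<^esub> (g v \<oplus>\<^bsub>R\<^esub> g w) \<odot>\<^bsub>V\<^esub> z \<in> K" using KE(5) g(2) v w by simp
    qed (use v w g(1) in simp_all)
    show "g (a \<odot>\<^bsub>V\<^esub> v) = a \<otimes>\<^bsub>R\<^esub> g v" if a: "a \<in> carrier R" and v: "v \<in> carrier V" for a v
    proof (rule g_eq)
      have "a \<odot>\<^bsub>V\<^esub> v \<ominus>\<^bsub>V\<^esub> (a \<otimes>\<^bsub>R\<^esub> g v) \<odot>\<^bsub>V\<^esub> z = a \<odot>\<^bsub>V\<^esub> (v \<ominus>\<^bsub>V\<^esub> g v \<odot>\<^bsub>V\<^esub> z)"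
        using a v z(1) g(1) by (simp add: V.smult_r_diff V.smult_assoc1)
      then show "a \<odot>\<^bsub>V\<^esub> v \<ominus>\<^bsub>V\<^esub> (a \<otimes>\<^bsub>R\<^esub> g v) \<odot>\<^bsub>V\<^esub> z \<in> K" using KE(4) g(2) a v by simp
    qed (use a v g(1) in simp_all)
  qed
  then show thesis
  proof (rule that)
    show "g n = \<zero>\<^bsub>R\<^esub>" if "n \<in> N" for n
      by (rule g_eq) (use that K(2) Kc z(1) in \<open>auto simp: V.M.diff_zero subset_iff\<close>)
    show "g z = \<one>\<^bsub>R\<^esub>" by (rule g_eq) (use z(1) KE(7) in \<open>simp_all add: V.M.diff_self\<close>)
  qed
qed

lemma A1_graded_lieI: "\<lbrakk>field_char_not_2_3 R; A1_graded R L (h, e, f)\<rbrakk> \<Longrightarrow> A1_graded_lie R L h e f"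
  unfolding A1_graded_lie_def A1_graded_lie_axioms_def by (unfold A1_graded_def prod.case) blast

text \<open>
  An A1-graded Lie algebra is perfect: \<open>h\<close> acts invertibly on \<open>L_1\<close> and \<open>L_{-1}\<close>, and \<open>L_0\<close> consists of
  brackets.
\<close>

lemma (in A1_graded_lie) ext_bracket_surj:
  assumes "x \<in> carrier L" shows "\<exists>z\<in>carrier (ext_power R L 2). ext_bracket z = x"
proof -
  interpret E2: module R "ext_power R L 2" by (rule ext_power_module)
  let ?I = "ext_bracket ` carrier (ext_power R L 2)"
  have I: "submodule ?I R L"
    by (rule E2.submodule_image[OF module_axioms ext_bracket(1) E2.carrier_is_submodule])
  have br: "x \<otimes>\<^bsub>L\<^esub> y \<in> ?I" if "x \<in> carrier L" "y \<in> carrier L" for x y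
    using ext_bracket(2)[OF that] wedge_values(2)[OF that] by (metis imageI)
  obtain u v w where d: "u \<in> W (-1)" "v \<in> W 0" "w \<in> W 1" "x = u \<oplus>\<^bsub>L\<^esub> v \<oplus>\<^bsub>L\<^esub> w" using decompose[OF assms] .
  have "h \<otimes>\<^bsub>L\<^esub> (half R \<odot>\<^bsub>L\<^esub> (\<ominus>\<^bsub>L\<^esub> u)) = u" "h \<otimes>\<^bsub>L\<^esub> (half R \<odot>\<^bsub>L\<^esub> w) = w"
    using d triple by (simp_all add: weight_iff mult_smult_right mult_minus LV.smult_half_double)
  then have "u \<in> ?I" "w \<in> ?I"
    using br[of h "half R \<odot>\<^bsub>L\<^esub> (\<ominus>\<^bsub>L\<^esub> u)"] br[of h "half R \<odot>\<^bsub>L\<^esub> w"] d triple by (simp_all add: weight_closed)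
  moreover have "W 0 \<subseteq> ?I" unfolding graded_zero
    by (rule lin_span_least[OF I]) (use br weight_closed in blast)
  ultimately have "x \<in> ?I" using d submoduleE(5)[OF I] by auto
  then show ?thesis by auto
qed

text \<open>
  For a perfect Lie algebra \<open>H^2(L, M)\<close> consists of the linear maps from \<open>H_2(L)\<close> to \<open>M\<close>.  If \<open>H_2(L)\<close>
  vanishes, a cocycle factors through the bracket, on all of \<open>L\<close> because \<open>L\<close> is perfect.  Conversely, a
  class that is not zero is separated from zero by a linear functional, and the cocycle defined by this
  functional does not factor through the bracket.
\<close>

theorem homology2_zero_iff_cohomology2_zero:
  fixes R :: "('k, 'z) ring_scheme" and L :: "('k, 'u) module" and \<kappa> :: "'k \<Rightarrow> 'm"
  assumes R: "field_char_not_2_3 R" and A1: "A1_graded R L s" and \<kappa>: "inj_on \<kappa> (carrier R)"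
  shows "zero_module (ce_homology R L 2) \<longleftrightarrow>
    (\<forall>M :: ('k, 'm) module. module R M \<longrightarrow> zero_module (ce_cohomology R L M 2))"
proof -
  obtain h e f where s: "s = (h, e, f)" by (cases s)
  interpret A1_graded_lie R L h e f by (rule A1_graded_lieI[OF R A1[unfolded s]])
  interpret E2: module R "ext_power R L 2" by (rule ext_power_module)
  interpret E3: module R "ext_power R L 3" by (rule ext_power_module)
  show ?thesis
  proof (intro iffI allI impI)
    fix M :: "('k, 'm) module"
    assume H: "zero_module (ce_homology R L 2)" and M: "module R M"
    interpret T: module R M by fact
    show "zero_module (ce_cohomology R L M 2)"
      unfolding cohomology2_zero_iff[OF lie_algebra_axioms M]
    proof (intro ballI impI)
      fix \<omega> assume \<omega>: "\<omega> \<in> carrier (ce_cochains R L M 2)"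
        and "\<forall>x\<in>carrier L. \<forall>y\<in>carrier L. \<forall>z\<in>carrier L. cocycle_sum L M \<omega> x y z = \<zero>\<^bsub>M\<^esub>"
      then have zero: "ext_lift R M \<omega> z = \<zero>\<^bsub>M\<^esub>" if "z \<in> carrier (ext_power R L 2)" "ext_bracket z = \<zero>\<^bsub>L\<^esub>" for z
        using homology2_zero_cocycle[OF H M \<omega> _ that] by blast
      note lift = ext_lift[OF M \<omega>]
      define pre where "pre x = (SOME z. z \<in> carrier (ext_power R L 2) \<and> ext_bracket z = x)" for x
      have pre: "pre x \<in> carrier (ext_power R L 2)" "ext_bracket (pre x) = x" if "x \<in> carrier L" for x
        using someI_ex[of "\<lambda>z. z \<in> carrier (ext_power R L 2) \<and> ext_bracket z = x"] ext_bracket_surj[OF that]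
        unfolding pre_def by blast+
      define \<phi> where "\<phi> x = ext_lift R M \<omega> (pre x)" for x
      have \<phi>_eq: "\<phi> (ext_bracket z) = ext_lift R M \<omega> z" if z: "z \<in> carrier (ext_power R L 2)" for z
      proof -
        have b: "ext_bracket z \<in> carrier L" using z by (simp add: linear_map_simps[OF ext_bracket(1)])
        have "ext_lift R M \<omega> (pre (ext_bracket z) \<ominus>\<^bsub>ext_power R L 2\<^esub> z) = \<zero>\<^bsub>M\<^esub>"
          by (rule zero) (use z b pre in \<open>simp_all add: M.diff_self
              linear_map_minus[OF E2.module_axioms module_axioms ext_bracket(1)]\<close>)
        then show ?thesis
          using z b pre by (simp add: \<phi>_def T.M.diff_eq_zero_iff linear_map_simps[OF lift(1)]
              linear_map_minus[OF E2.module_axioms M lift(1)])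
      qed
      have "linear_map R L M \<phi>"
      proof (rule linear_mapI)
        show "\<phi> x \<in> carrier M" if "x \<in> carrier L" for x
          using that pre by (simp add: \<phi>_def linear_map_simps[OF lift(1)])
        show "\<phi> (x \<oplus>\<^bsub>L\<^esub> y) = \<phi> x \<oplus>\<^bsub>M\<^esub> \<phi> y" if "x \<in> carrier L" "y \<in> carrier L" for x y
          using \<phi>_eq[of "pre x \<oplus>\<^bsub>ext_power R L 2\<^esub> pre y"] that pre
          by (simp add: linear_map_simps[OF lift(1)] linear_map_simps[OF ext_bracket(1)] \<phi>_def)
        show "\<phi> (a \<odot>\<^bsub>L\<^esub> x) = a \<odot>\<^bsub>M\<^esub> \<phi> x" if "a \<in> carrier R" "x \<in> carrier L" for a x
          using \<phi>_eq[of "a \<odot>\<^bsub>ext_power R L 2\<^esub> pre x"] that pre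
          by (simp add: linear_map_simps[OF lift(1)] linear_map_simps[OF ext_bracket(1)] \<phi>_def)
      qed
      moreover have "\<omega> [x, y] = \<phi> (x \<otimes>\<^bsub>L\<^esub> y)" if "x \<in> carrier L" "y \<in> carrier L" for x y
        using \<phi>_eq[OF wedge_values(2)[OF that]] ext_bracket(2)[OF that] lift(2)[of "[x, y]"] that
        by (simp add: tuples_small)
      ultimately show "\<exists>\<phi>. linear_map R L M \<phi> \<and> (\<forall>x\<in>carrier L. \<forall>y\<in>carrier L. \<omega> [x, y] = \<phi> (x \<otimes>\<^bsub>L\<^esub> y))" by blast
    qed
  next
    assume H: "\<forall>M :: ('k, 'm) module. module R M \<longrightarrow> zero_module (ce_cohomology R L M 2)"
    define B where "B = ce_boundary R L 3 ` carrier (ext_power R L 3)"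
    have B: "submodule B R (ext_power R L 2)" unfolding B_def
      by (rule E3.submodule_image[OF ext_power_module boundary3(1) E3.carrier_is_submodule])
    show "zero_module (ce_homology R L 2)"
    proof (rule ccontr)
      assume "\<not> zero_module (ce_homology R L 2)"
      then obtain z where z: "z \<in> carrier (ext_power R L 2)" "ext_bracket z = \<zero>\<^bsub>L\<^esub>" "z \<notin> B"
        unfolding homology2_zero_iff B_def by blast
      obtain g where gS: "linear_map R (ext_power R L 2) (self_module R) g" and g: "\<And>n. n \<in> B \<Longrightarrow> g n = \<zero>\<^bsub>R\<^esub>" "g z = \<one>\<^bsub>R\<^esub>"
        by (rule separating_functional[OF field_axioms E2.module_axioms B z(1,3)]) blast
      note S = self_module
      have \<kappa>S: "inj_on \<kappa> (carrier (self_module R))" using \<kappa> by (simp add: self_module_def)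
      \<comment> \<open>a copy of the field on the type that carries the coefficient modules\<close>
      define M where "M = transport_algebra \<kappa> (self_module R)"
      have M: "module R M" unfolding M_def by (rule transport_module[OF S \<kappa>S])
      interpret T: module R M by fact
      have \<kappa>M: "linear_map R (self_module R) M \<kappa>"
        unfolding M_def by (rule algebra_mapD(1)[OF transport_algebra_map[OF \<kappa>S]])
      note G = linear_map_compose[OF gS \<kappa>M]
      note Gs = linear_map_simps[OF G] linear_map_minus[OF E2.module_axioms M G]
      define \<omega> where "\<omega> = (\<lambda>xs\<in>tuples L 2. \<kappa> (g (wedge R L [xs ! 0, xs ! 1])))"
      have val: "\<omega> [x, y] = \<kappa> (g (wedge R L [x, y]))" if "x \<in> carrier L" "y \<in> carrier L" for x y
        using that by (simp add: \<omega>_def tuples_small)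
      have \<omega>: "\<omega> \<in> carrier (ce_cochains R L M 2)"
        unfolding \<omega>_def
      proof (rule cochain2I)
        show "linear_map R L M (\<lambda>x. \<kappa> (g (wedge R L [x, y])))" if "y \<in> carrier L" for y
          by (rule linear_map_compose[OF wedge_lin(2)[OF that] G])
        show "linear_map R L M (\<lambda>y. \<kappa> (g (wedge R L [x, y])))" if "x \<in> carrier L" for x
          by (rule linear_map_compose[OF wedge_lin(3)[OF that] G])
        show "\<kappa> (g (wedge R L [x, x])) = \<zero>\<^bsub>M\<^esub>" if "x \<in> carrier L" for x
          using cochain2D(3)[OF wedge_cochain that] that Gs(4) by (simp add: tuples_small)
      qed
      have "cocycle_sum L M \<omega> x y u = \<zero>\<^bsub>M\<^esub>" if xyu: "x \<in> carrier L" "y \<in> carrier L" "u \<in> carrier L" for x y u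
      proof -
        have t: "[x, y, u] \<in> tuples L 3" using xyu by (simp add: tuples_small)
        have "cocycle_sum L M \<omega> x y u = \<kappa> (g (cocycle_sum L (ext_power R L 2) (wedge R L) x y u))"
          using xyu by (simp add: cocycle_sum_def val mult_closed wedge_values Gs)
        also have "cocycle_sum L (ext_power R L 2) (wedge R L) x y u = ce_boundary R L 3 (wedge R L [x, y, u])"
          using boundary3(2)[OF t] boundary_gen_cochain(4)[OF xyu] by simp
        also have "g (ce_boundary R L 3 (wedge R L [x, y, u])) = \<zero>\<^bsub>R\<^esub>"
          by (rule g(1)) (use wedge_closed[OF t] in \<open>simp add: B_def\<close>)
        also have "\<kappa> \<zero>\<^bsub>R\<^esub> = \<zero>\<^bsub>M\<^esub>" using linear_map_minus(1)[OF S M \<kappa>M] by (simp add: self_module_def)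
        finally show ?thesis .
      qed
      then have cocycle: "\<forall>x\<in>carrier L. \<forall>y\<in>carrier L. \<forall>u\<in>carrier L. cocycle_sum L M \<omega> x y u = \<zero>\<^bsub>M\<^esub>" by blast
      have "zero_module (ce_cohomology R L M 2)" using H M by blast
      then obtain \<phi> where \<phi>: "linear_map R L M \<phi>" "\<And>x y. \<lbrakk>x \<in> carrier L; y \<in> carrier L\<rbrakk> \<Longrightarrow> \<omega> [x, y] = \<phi> (x \<otimes>\<^bsub>L\<^esub> y)"
        unfolding cohomology2_zero_iff[OF lie_algebra_axioms M] using \<omega> cocycle by blast
      have "\<phi> (ext_bracket z) = \<kappa> (g z)"
        by (rule ext_power_map_unique[OF M linear_map_compose[OF ext_bracket(1) \<phi>(1)] G _ z(1)])
          (auto simp: tuples_small ext_bracket(2) \<phi>(2)[symmetric] val)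
      then have "\<kappa> \<one>\<^bsub>R\<^esub> = \<kappa> \<zero>\<^bsub>R\<^esub>"
        using z(2) g(2) linear_map_minus(1)[OF module_axioms M \<phi>(1)] linear_map_minus(1)[OF S M \<kappa>M]
        by (simp add: self_module_def)
      then show False using inj_onD[OF \<kappa>] by fastforce
    qed
  qed
qed

section \<open>The universal Lie algebra is centrally closed\<close>

definition central_extension ::
  "('k, 'a, 'x) module_scheme \<Rightarrow> ('k, 'v, 'y) module_scheme \<Rightarrow> ('a list \<Rightarrow> 'v) \<Rightarrow> ('k, 'a \<times> 'v) module" where
  "central_extension L V \<omega> =
     \<lparr>carrier = carrier L \<times> carrier V, mult = (\<lambda>(x, v) (y, w). (x \<otimes>\<^bsub>L\<^esub> y, \<omega> [x, y])), one = (\<one>\<^bsub>L\<^esub>, \<zero>\<^bsub>V\<^esub>),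
      zero = (\<zero>\<^bsub>L\<^esub>, \<zero>\<^bsub>V\<^esub>), add = (\<lambda>(x, v) (y, w). (x \<oplus>\<^bsub>L\<^esub> y, v \<oplus>\<^bsub>V\<^esub> w)), smult = (\<lambda>a (x, v). (a \<odot>\<^bsub>L\<^esub> x, a \<odot>\<^bsub>V\<^esub> v))\<rparr>"

lemma (in lie_algebra) cochain2_swap:
  assumes V: "module R V" and \<omega>: "\<omega> \<in> carrier (ce_cochains R L V 2)" and xy: "x \<in> carrier L" "y \<in> carrier L"
  shows "\<omega> [x, y] = \<ominus>\<^bsub>V\<^esub> \<omega> [y, x]"
proof -
  interpret V: module R V by fact
  note lin = linear_map_simps[OF cochain2D(1)[OF \<omega>]] linear_map_simps[OF cochain2D(2)[OF \<omega>]]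
  have "\<omega> [x \<oplus>\<^bsub>L\<^esub> y, x \<oplus>\<^bsub>L\<^esub> y] = (\<omega> [x, x] \<oplus>\<^bsub>V\<^esub> \<omega> [y, y]) \<oplus>\<^bsub>V\<^esub> (\<omega> [x, y] \<oplus>\<^bsub>V\<^esub> \<omega> [y, x])"
    using xy by (simp add: lin V.M.a_ac)
  then have "\<omega> [x, y] \<oplus>\<^bsub>V\<^esub> \<omega> [y, x] = \<zero>\<^bsub>V\<^esub>" using xy cochain2D(3)[OF \<omega>] by (simp add: lin)
  then show ?thesis using xy by (simp add: lin V.M.minus_across)
qed

lemma (in lie_algebra) central_extension_lie_algebra:
  assumes V: "module R V" and \<omega>: "\<omega> \<in> carrier (ce_cochains R L V 2)"
    and cocycle: "\<And>x y z. \<lbrakk>x \<in> carrier L; y \<in> carrier L; z \<in> carrier L\<rbrakk> \<Longrightarrow> cocycle_sum L V \<omega> x y z = \<zero>\<^bsub>V\<^esub>"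
  shows "lie_algebra R (central_extension L V \<omega>)"
proof -
  interpret V: module R V by fact
  note lin = linear_map_simps[OF cochain2D(1)[OF \<omega>]] linear_map_simps[OF cochain2D(2)[OF \<omega>]]
    linear_map_minus[OF module_axioms V cochain2D(1)[OF \<omega>]] linear_map_minus[OF module_axioms V cochain2D(2)[OF \<omega>]]
  have mod: "module R (central_extension L V \<omega>)"
  proof (rule moduleI[OF R.is_cring])
    show "abelian_group (central_extension L V \<omega>)"
    proof (rule abelian_groupI)
      fix u assume "u \<in> carrier (central_extension L V \<omega>)"
      then show "\<exists>v\<in>carrier (central_extension L V \<omega>). v \<oplus>\<^bsub>central_extension L V \<omega>\<^esub> u = \<zero>\<^bsub>central_extension L V \<omega>\<^esub>"
        by (intro bexI[of _ "(\<ominus>\<^bsub>L\<^esub> fst u, \<ominus>\<^bsub>V\<^esub> snd u)"]) (auto simp: central_extension_def M.l_neg V.M.l_neg)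
    qed (auto simp: central_extension_def M.a_ac V.M.a_ac)
  qed (auto simp: central_extension_def smult_l_distr smult_r_distr smult_assoc1 V.smult_l_distr
      V.smult_r_distr V.smult_assoc1)
  show ?thesis
  proof (rule lie_algebraI[OF mod])
    fix u v w
    assume "u \<in> carrier (central_extension L V \<omega>)" "v \<in> carrier (central_extension L V \<omega>)"
      "w \<in> carrier (central_extension L V \<omega>)"
    then obtain x y z a b c where uvw: "u = (x, a)" "v = (y, b)" "w = (z, c)"
      and cl: "x \<in> carrier L" "y \<in> carrier L" "z \<in> carrier L" "a \<in> carrier V" "b \<in> carrier V" "c \<in> carrier V"
      by (auto simp: central_extension_def)
    have "\<omega> [x, y \<otimes>\<^bsub>L\<^esub> z] \<oplus>\<^bsub>V\<^esub> \<omega> [y, z \<otimes>\<^bsub>L\<^esub> x] \<oplus>\<^bsub>V\<^esub> \<omega> [z, x \<otimes>\<^bsub>L\<^esub> y] = cocycle_sum L V \<omega> x y z"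
    proof -
      have 1: "\<omega> [x, y \<otimes>\<^bsub>L\<^esub> z] = \<ominus>\<^bsub>V\<^esub> \<omega> [y \<otimes>\<^bsub>L\<^esub> z, x]" "\<omega> [z, x \<otimes>\<^bsub>L\<^esub> y] = \<ominus>\<^bsub>V\<^esub> \<omega> [x \<otimes>\<^bsub>L\<^esub> y, z]"
        by (rule cochain2_swap[OF V \<omega>]; simp add: cl mult_closed)+
      have 2: "\<omega> [y, z \<otimes>\<^bsub>L\<^esub> x] = \<omega> [x \<otimes>\<^bsub>L\<^esub> z, y]"
        using cochain2_swap[OF V \<omega>, of "x \<otimes>\<^bsub>L\<^esub> z" y] bracket_swap[of z x] cl by (simp add: lin mult_closed)
      show ?thesis unfolding 1 2 cocycle_sum_def using cl by (simp add: lin mult_closed V.M.ab_simps)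
    qed
    then have "\<omega> [x, y \<otimes>\<^bsub>L\<^esub> z] \<oplus>\<^bsub>V\<^esub> \<omega> [y, z \<otimes>\<^bsub>L\<^esub> x] \<oplus>\<^bsub>V\<^esub> \<omega> [z, x \<otimes>\<^bsub>L\<^esub> y] = \<zero>\<^bsub>V\<^esub>" using cocycle cl by simp
    then show "u \<otimes>\<^bsub>central_extension L V \<omega>\<^esub> (v \<otimes>\<^bsub>central_extension L V \<omega>\<^esub> w) \<oplus>\<^bsub>central_extension L V \<omega>\<^esub>
        v \<otimes>\<^bsub>central_extension L V \<omega>\<^esub> (w \<otimes>\<^bsub>central_extension L V \<omega>\<^esub> u) \<oplus>\<^bsub>central_extension L V \<omega>\<^esub>
        w \<otimes>\<^bsub>central_extension L V \<omega>\<^esub> (u \<otimes>\<^bsub>central_extension L V \<omega>\<^esub> v) = \<zero>\<^bsub>central_extension L V \<omega>\<^esub>"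
      using cl jacobi[of x y z] by (simp add: central_extension_def uvw)
  qed (auto simp: central_extension_def lin mult_closed mult_add_left mult_add_right mult_smult_left
      mult_smult_right bracket_self cochain2D(3)[OF \<omega>])
qed

text \<open>
  In a central extension of the universal Lie algebra the generators lift canonically, namely to
  eigenvectors of a lift of \<open>h\<close>.  The lifts satisfy the defining relations, so the extension splits.
\<close>

theorem universal_datum_homology:
  fixes J :: "('k, 'u) module" and R :: "('k, 'z) ring_scheme"
  assumes U: "universal_datum R J U p q" and inf: "infinite (UNIV :: 'u set)"
  shows "zero_module (ce_homology R U 2)"
proof -
  interpret U: jordan_datum R J U p q using U by (simp add: universal_datum_def)
  have core: "U.C = carrier U" using U by (simp add: universal_datum_def)
  show ?thesis
  proof (rule homology2_zeroI[OF U.L.lie_algebra_axioms])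
    fix V :: "('k, ('u list \<Rightarrow> 'k) set set) module" and \<omega>
    assume V: "module R V" and \<omega>: "\<omega> \<in> carrier (ce_cochains R U V 2)"
      and cocycle: "\<And>x y z. \<lbrakk>x \<in> carrier U; y \<in> carrier U; z \<in> carrier U\<rbrakk> \<Longrightarrow> cocycle_sum U V \<omega> x y z = \<zero>\<^bsub>V\<^esub>"
    interpret V: vector_space_char_not_2_3 R V
      unfolding vector_space_char_not_2_3_def using V U.field_char_not_2_3_axioms by simp
    let ?E = "central_extension U V \<omega>"
    have E: "lie_algebra R ?E" by (rule U.L.central_extension_lie_algebra[OF V \<omega> cocycle])
    interpret E: lie_algebra R ?E by (rule E)
    note lin = linear_map_simps[OF U.L.cochain2D(1)[OF \<omega>]] linear_map_simps[OF U.L.cochain2D(2)[OF \<omega>]]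
      linear_map_minus[OF U.L.module_axioms V U.L.cochain2D(1)[OF \<omega>]]
      linear_map_minus[OF U.L.module_axioms V U.L.cochain2D(2)[OF \<omega>]]
    note swap = U.L.cochain2_swap[OF V \<omega>]
    note cl = U.p_simps(1) U.q_simps(1) U.h_closed U.L.mult_closed U.half_closed
    let ?h = "U.h"
    \<comment> \<open>the lifts on which \<open>(h, 0)\<close> acts by \<open>2\<close> and by \<open>- 2\<close>\<close>
    define P where "P a = (p a, half R \<odot>\<^bsub>V\<^esub> \<omega> [?h, p a])" for a
    define Q where "Q a = (q a, \<ominus>\<^bsub>V\<^esub> (half R \<odot>\<^bsub>V\<^esub> \<omega> [?h, q a]))" for a
    have E_minus: "\<ominus>\<^bsub>?E\<^esub> (x, v) = (\<ominus>\<^bsub>U\<^esub> x, \<ominus>\<^bsub>V\<^esub> v)" if "x \<in> carrier U" "v \<in> carrier V" for x v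
      by (rule E.M.minus_equality) (use that in \<open>simp_all add: central_extension_def U.L.M.l_neg V.M.l_neg\<close>)
    have D: "jordan_datum R J ?E P Q"
    proof (rule jordan_datumI[OF U.jordan_char_not_2_3_axioms E])
      show "linear_map R J ?E P"
        by (rule linear_mapI) (simp_all add: P_def central_extension_def U.p_simps lin cl V.smult_r_distr
            V.smult_assoc1[symmetric] U.m_comm)
      show "linear_map R J ?E Q"
        by (rule linear_mapI) (simp_all add: Q_def central_extension_def U.q_simps lin cl V.smult_r_distr
            V.smult_assoc1[symmetric] U.m_comm V.M.minus_add V.smult_r_minus)
      fix a b assume ab: "a \<in> carrier J" "b \<in> carrier J"
      have four: "x = \<zero>\<^bsub>V\<^esub>" if "x \<oplus>\<^bsub>V\<^esub> x \<oplus>\<^bsub>V\<^esub> (x \<oplus>\<^bsub>V\<^esub> x) = \<zero>\<^bsub>V\<^esub>" "x \<in> carrier V" for x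
        by (rule V.double_eq_zero[OF V.double_eq_zero[OF that(1)]]) (simp_all add: that(2))
      have "\<omega> [p a, p b] = \<zero>\<^bsub>V\<^esub>"
      proof (rule four)
        have "cocycle_sum U V \<omega> ?h (p a) (p b) = \<ominus>\<^bsub>V\<^esub> (\<omega> [p a, p b] \<oplus>\<^bsub>V\<^esub> \<omega> [p a, p b] \<oplus>\<^bsub>V\<^esub> (\<omega> [p a, p b] \<oplus>\<^bsub>V\<^esub> \<omega> [p a, p b]))"
          using ab swap[of "p b" "p a"]
          by (simp add: cocycle_sum_def U.h_p U.p_p lin cl V.M.diff_zero) (simp add: lin cl V.M.ab_simps)
        then show "\<omega> [p a, p b] \<oplus>\<^bsub>V\<^esub> \<omega> [p a, p b] \<oplus>\<^bsub>V\<^esub> (\<omega> [p a, p b] \<oplus>\<^bsub>V\<^esub> \<omega> [p a, p b]) = \<zero>\<^bsub>V\<^esub>"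
          using cocycle[of ?h "p a" "p b"] ab by (simp add: lin cl V.M.minus_across)
      qed (simp add: lin cl ab)
      then show "P a \<otimes>\<^bsub>?E\<^esub> P b = \<zero>\<^bsub>?E\<^esub>" using ab by (simp add: P_def central_extension_def U.p_p)
      have "\<omega> [q a, q b] = \<zero>\<^bsub>V\<^esub>"
      proof (rule four)
        have "cocycle_sum U V \<omega> ?h (q a) (q b) = \<omega> [q a, q b] \<oplus>\<^bsub>V\<^esub> \<omega> [q a, q b] \<oplus>\<^bsub>V\<^esub> (\<omega> [q a, q b] \<oplus>\<^bsub>V\<^esub> \<omega> [q a, q b])"
          using ab swap[of "q b" "q a"]
          by (simp add: cocycle_sum_def U.h_q U.q_q lin cl V.M.diff_zero) (simp add: lin cl V.M.ab_simps)
        then show "\<omega> [q a, q b] \<oplus>\<^bsub>V\<^esub> \<omega> [q a, q b] \<oplus>\<^bsub>V\<^esub> (\<omega> [q a, q b] \<oplus>\<^bsub>V\<^esub> \<omega> [q a, q b]) = \<zero>\<^bsub>V\<^esub>"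
          using cocycle[of ?h "q a" "q b"] ab by (simp add: cl)
      qed (simp add: lin cl ab)
      then show "Q a \<otimes>\<^bsub>?E\<^esub> Q b = \<zero>\<^bsub>?E\<^esub>" using ab by (simp add: Q_def central_extension_def U.q_q)
      fix c assume c: "c \<in> carrier J"
      let ?X = "p a \<otimes>\<^bsub>U\<^esub> q b"
      have X: "?X \<in> carrier U" "?h \<otimes>\<^bsub>U\<^esub> ?X = \<zero>\<^bsub>U\<^esub>" using ab U.h_Z[OF U.p_q_in_Z] by (simp_all add: cl)
      have bracket: "P a \<otimes>\<^bsub>?E\<^esub> Q b = (?X, \<omega> [p a, q b])" by (simp add: P_def Q_def central_extension_def)
      have "\<omega> [?X, p c] = half R \<odot>\<^bsub>V\<^esub> \<omega> [?h, ?X \<otimes>\<^bsub>U\<^esub> p c]"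
      proof -
        have "cocycle_sum U V \<omega> ?h ?X (p c) = \<omega> [?h, ?X \<otimes>\<^bsub>U\<^esub> p c] \<ominus>\<^bsub>V\<^esub> (\<omega> [?X, p c] \<oplus>\<^bsub>V\<^esub> \<omega> [?X, p c])"
          using ab c X swap[of "p c" ?X] swap[of "?X \<otimes>\<^bsub>U\<^esub> p c" ?h]
          by (simp add: cocycle_sum_def U.h_p lin cl) (simp add: lin cl V.M.ab_simps)
        then have "\<omega> [?h, ?X \<otimes>\<^bsub>U\<^esub> p c] = \<omega> [?X, p c] \<oplus>\<^bsub>V\<^esub> \<omega> [?X, p c]"
          using cocycle[of ?h ?X "p c"] ab c X by (simp add: lin cl V.M.minus_across)
        then show ?thesis using c X by (simp add: lin cl V.smult_half_double)
      qed
      then show "(P a \<otimes>\<^bsub>?E\<^esub> Q b) \<otimes>\<^bsub>?E\<^esub> P c = P (jordan_triple2 J a b c)"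
        unfolding bracket using ab c by (simp add: P_def central_extension_def U.p_q_p)
      have "\<omega> [?X, q c] = \<ominus>\<^bsub>V\<^esub> (half R \<odot>\<^bsub>V\<^esub> \<omega> [?h, ?X \<otimes>\<^bsub>U\<^esub> q c])"
      proof -
        have "cocycle_sum U V \<omega> ?h ?X (q c) = \<omega> [?h, ?X \<otimes>\<^bsub>U\<^esub> q c] \<oplus>\<^bsub>V\<^esub> (\<omega> [?X, q c] \<oplus>\<^bsub>V\<^esub> \<omega> [?X, q c])"
          using ab c X swap[of "q c" ?X] swap[of "?X \<otimes>\<^bsub>U\<^esub> q c" ?h]
          by (simp add: cocycle_sum_def U.h_q lin cl) (simp add: lin cl V.M.ab_simps)
        then have "\<omega> [?h, ?X \<otimes>\<^bsub>U\<^esub> q c] = \<ominus>\<^bsub>V\<^esub> (\<omega> [?X, q c] \<oplus>\<^bsub>V\<^esub> \<omega> [?X, q c])"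
          using cocycle[of ?h ?X "q c"] ab c X by (simp add: lin cl V.M.minus_across)
        then show ?thesis using c X by (simp add: lin cl V.smult_half_double V.smult_r_minus)
      qed
      then show "(P a \<otimes>\<^bsub>?E\<^esub> Q b) \<otimes>\<^bsub>?E\<^esub> Q c = \<ominus>\<^bsub>?E\<^esub> Q (jordan_triple2 J b a c)"
        unfolding bracket using ab c
        by (simp add: Q_def E_minus lin cl) (simp add: central_extension_def U.p_q_q lin cl V.smult_r_minus)
    qed
    obtain \<Phi> where \<Phi>: "algebra_map R U ?E \<Phi>" "\<And>a. a \<in> carrier J \<Longrightarrow> \<Phi> (p a) = P a" "\<And>a. a \<in> carrier J \<Longrightarrow> \<Phi> (q a) = Q a"
      by (rule universal_datum_extends[OF U inf D]) blast
    have fst: "algebra_map R ?E U fst" by (auto simp: algebra_map_def linear_map_def central_extension_def)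
    have "algebra_map R U U (\<lambda>x. x)" by (simp add: algebra_map_def linear_map_def)
    then have fst_\<Phi>: "fst (\<Phi> x) = x" if "x \<in> carrier U" for x
      using U.core_map_unique[OF U.L.lie_algebra_axioms, of "\<lambda>x. fst (\<Phi> x)" "\<lambda>x. x"] algebra_map_compose[OF \<Phi>(1) fst]
        that by (simp add: core \<Phi> P_def Q_def)
    have "linear_map R ?E V snd" by (auto simp: linear_map_def central_extension_def)
    then have "linear_map R U V (\<lambda>x. snd (\<Phi> x))" by (rule linear_map_compose[OF algebra_mapD(1)[OF \<Phi>(1)]])
    moreover have "\<omega> [x, y] = snd (\<Phi> (x \<otimes>\<^bsub>U\<^esub> y))" if "x \<in> carrier U" "y \<in> carrier U" for x y
      using algebra_mapD(2)[OF \<Phi>(1) that] fst_\<Phi>[OF that(1)] fst_\<Phi>[OF that(2)]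
      by (simp add: central_extension_def split_beta)
    ultimately show "\<exists>\<mu>. linear_map R U V \<mu> \<and> (\<forall>x\<in>carrier U. \<forall>y\<in>carrier U. \<omega> [x, y] = \<mu> (x \<otimes>\<^bsub>U\<^esub> y))" by blast
  qed
qed

text \<open>
  The kernel of a map that is injective on the two copies of \<open>J\<close> meets neither of them, so it lies in
  weight zero, is central and consists of sums of brackets.  Brackets of preimages therefore form a cocycle on the
  image, and if the second homology of the image vanishes, so does this cocycle on relations: the
  kernel is zero.
\<close>

theorem core_map_injective:
  fixes R :: "('k, 'z) ring_scheme" and U :: "('k, 'a, 'y) module_scheme" and L :: "('k, 'b, 'w) module_scheme"
  assumes D: "jordan_datum R J U p q" and core: "datum_core R J U p q = carrier U"
    and L: "lie_algebra R L" and H: "zero_module (ce_homology R L 2)"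
    and \<pi>: "algebra_map R U L \<pi>" and surj: "\<pi> ` carrier U = carrier L"
    and inj: "inj_on (\<lambda>a. \<pi> (p a)) (carrier J)" "inj_on (\<lambda>a. \<pi> (q a)) (carrier J)"
  shows "inj_on \<pi> (carrier U)"
proof -
  interpret U: jordan_datum R J U p q by fact
  interpret L: lie_algebra R L by fact
  interpret A: A1_graded_lie R U U.h "p \<one>\<^bsub>J\<^esub>" "q \<one>\<^bsub>J\<^esub>"
    using U.core_A1_graded by (intro A1_graded_lieI U.field_char_not_2_3_axioms) (simp add: core)
  interpret \<pi>D: jordan_datum R J L "\<lambda>a. \<pi> (p a)" "\<lambda>a. \<pi> (q a)" by (rule U.map_datum[OF L \<pi>])
  note lin = linear_map_simps[OF algebra_mapD(1)[OF \<pi>]] linear_map_minus[OF U.L.module_axioms L.module_axioms algebra_mapD(1)[OF \<pi>]]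
  note mult = algebra_mapD(2)[OF \<pi>]
  note cl = U.p_simps(1) U.q_simps(1) U.Z_closed U.L.mult_closed
  have central: "x \<otimes>\<^bsub>U\<^esub> y = \<zero>\<^bsub>U\<^esub>" if x: "x \<in> carrier U" "\<pi> x = \<zero>\<^bsub>L\<^esub>" and y: "y \<in> carrier U" for x y
  proof -
    obtain a b z where *: "a \<in> carrier J" "b \<in> carrier J" "z \<in> U.Z" "x = q b \<oplus>\<^bsub>U\<^esub> z \<oplus>\<^bsub>U\<^esub> p a"
      using x(1) unfolding core[symmetric] by (rule U.coreE)
    have \<pi>z: "\<pi> z \<in> \<pi>D.Z"
    proof -
      have "{\<pi> (q b) \<otimes>\<^bsub>L\<^esub> \<pi> (p a) | a b. a \<in> carrier J \<and> b \<in> carrier J} =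
          \<pi> ` {q b \<otimes>\<^bsub>U\<^esub> p a | a b. a \<in> carrier J \<and> b \<in> carrier J}"
      proof (intro equalityI subsetI)
        have eq: "\<pi> (q b) \<otimes>\<^bsub>L\<^esub> \<pi> (p a) = \<pi> (q b \<otimes>\<^bsub>U\<^esub> p a)" if "a \<in> carrier J" "b \<in> carrier J" for a b
          using that by (simp add: mult cl)
        show "y \<in> \<pi> ` {q b \<otimes>\<^bsub>U\<^esub> p a | a b. a \<in> carrier J \<and> b \<in> carrier J}"
          if "y \<in> {\<pi> (q b) \<otimes>\<^bsub>L\<^esub> \<pi> (p a) | a b. a \<in> carrier J \<and> b \<in> carrier J}" for y
          using that eq by blast
        show "y \<in> {\<pi> (q b) \<otimes>\<^bsub>L\<^esub> \<pi> (p a) | a b. a \<in> carrier J \<and> b \<in> carrier J}"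
          if "y \<in> \<pi> ` {q b \<otimes>\<^bsub>U\<^esub> p a | a b. a \<in> carrier J \<and> b \<in> carrier J}" for y
          using that eq[symmetric] by blast
      qed
      then show ?thesis
        using *(3) U.L.lin_span_image[OF L.module_axioms algebra_mapD(1)[OF \<pi>] U.generators_closed]
        unfolding datum_zero_def by auto
    qed
    have "\<pi> (q b) \<oplus>\<^bsub>L\<^esub> \<pi> z \<oplus>\<^bsub>L\<^esub> \<pi> (p a) = \<zero>\<^bsub>L\<^esub>" using x(2) *(1-3) unfolding *(4) by (simp add: lin cl)
    from \<pi>D.core_direct[OF *(1,2) \<pi>z this] have "\<pi> (p a) = \<zero>\<^bsub>L\<^esub>" "\<pi> (q b) = \<zero>\<^bsub>L\<^esub>" by simp_all
    then have "a = \<zero>\<^bsub>J\<^esub>" "b = \<zero>\<^bsub>J\<^esub>"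
      using inj_onD[OF inj(1), of a "\<zero>\<^bsub>J\<^esub>"] inj_onD[OF inj(2), of b "\<zero>\<^bsub>J\<^esub>"] *(1,2)
      by (simp_all add: U.p_simps U.q_simps lin)
    then have xz: "x = z" using * by (simp add: U.p_simps U.q_simps U.Z_closed)
    have zp: "z \<otimes>\<^bsub>U\<^esub> p c = \<zero>\<^bsub>U\<^esub>" if c: "c \<in> carrier J" for c
    proof -
      obtain d where d: "d \<in> carrier J" "z \<otimes>\<^bsub>U\<^esub> p c = p d" using U.Z_p[OF *(3) c] by auto
      have "\<pi> (p d) = \<zero>\<^bsub>L\<^esub>"
        using x(2) xz *(3) c d(2)[symmetric] by (simp add: mult cl lin L.mult_zero)
      then have "d = \<zero>\<^bsub>J\<^esub>" using inj_onD[OF inj(1), of d "\<zero>\<^bsub>J\<^esub>"] d(1) by (simp add: U.p_simps lin)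
      then show ?thesis using d by (simp add: U.p_simps)
    qed
    have zq: "z \<otimes>\<^bsub>U\<^esub> q c = \<zero>\<^bsub>U\<^esub>" if c: "c \<in> carrier J" for c
    proof -
      obtain d where d: "d \<in> carrier J" "z \<otimes>\<^bsub>U\<^esub> q c = q d" using U.Z_q[OF *(3) c] by auto
      have "\<pi> (q d) = \<zero>\<^bsub>L\<^esub>"
        using x(2) xz *(3) c d(2)[symmetric] by (simp add: mult cl lin L.mult_zero)
      then have "d = \<zero>\<^bsub>J\<^esub>" using inj_onD[OF inj(2), of d "\<zero>\<^bsub>J\<^esub>"] d(1) by (simp add: U.q_simps lin)
      then show ?thesis using d by (simp add: U.q_simps)
    qed
    have zz: "z \<otimes>\<^bsub>U\<^esub> w = \<zero>\<^bsub>U\<^esub>" if w: "w \<in> U.Z" for w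
    proof -
      have sub: "submodule {w \<in> carrier U. z \<otimes>\<^bsub>U\<^esub> w \<in> {\<zero>\<^bsub>U\<^esub>}} R U"
        using *(3) by (intro U.L.submodule_preimage[OF U.L.module_axioms U.L.mult_linear_map(1) U.L.zero_submodule])
          (simp add: cl)
      have "w \<in> {w \<in> carrier U. z \<otimes>\<^bsub>U\<^esub> w \<in> {\<zero>\<^bsub>U\<^esub>}}"
      proof (rule U.Z_least[OF sub _ w])
        fix a b assume ab: "a \<in> carrier J" "b \<in> carrier J"
        then show "q b \<otimes>\<^bsub>U\<^esub> p a \<in> {w \<in> carrier U. z \<otimes>\<^bsub>U\<^esub> w \<in> {\<zero>\<^bsub>U\<^esub>}}"
          using U.L.bracket_derivation[of z "q b" "p a"] *(3) by (simp add: cl zp zq U.L.mult_zero)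
      qed
      then show ?thesis by simp
    qed
    obtain a' b' z' where "a' \<in> carrier J" "b' \<in> carrier J" "z' \<in> U.Z" "y = q b' \<oplus>\<^bsub>U\<^esub> z' \<oplus>\<^bsub>U\<^esub> p a'"
      using y unfolding core[symmetric] by (rule U.coreE)
    then show ?thesis unfolding xz using *(3) by (simp add: U.L.mult_add_right cl zp zq zz)
  qed
  have indep: "x \<otimes>\<^bsub>U\<^esub> y = x' \<otimes>\<^bsub>U\<^esub> y'"
    if "x \<in> carrier U" "x' \<in> carrier U" "y \<in> carrier U" "y' \<in> carrier U" "\<pi> x = \<pi> x'" "\<pi> y = \<pi> y'" for x x' y y'
  proof -
    have 1: "(x \<ominus>\<^bsub>U\<^esub> x') \<otimes>\<^bsub>U\<^esub> y = \<zero>\<^bsub>U\<^esub>"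
      by (rule central) (use that in \<open>simp_all add: lin L.M.diff_self\<close>)
    have "(y \<ominus>\<^bsub>U\<^esub> y') \<otimes>\<^bsub>U\<^esub> x' = \<zero>\<^bsub>U\<^esub>"
      by (rule central) (use that in \<open>simp_all add: lin L.M.diff_self\<close>)
    then have 2: "x' \<otimes>\<^bsub>U\<^esub> (y \<ominus>\<^bsub>U\<^esub> y') = \<zero>\<^bsub>U\<^esub>" using U.L.bracket_swap[of x' "y \<ominus>\<^bsub>U\<^esub> y'"] that by simp
    show ?thesis using 1 2 that by (simp add: U.L.mult_diff cl U.L.M.diff_eq_zero_iff)
  qed
  define l where "l u = inv_into (carrier U) \<pi> u" for u
  have l: "l u \<in> carrier U" "\<pi> (l u) = u" if "u \<in> carrier L" for u
    using that surj unfolding l_def by (auto intro: inv_into_into f_inv_into_f)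
  \<comment> \<open>the bracket of preimages, which does not depend on their choice because the kernel is central\<close>
  define \<omega> where "\<omega> = (\<lambda>xs\<in>tuples L 2. l (xs ! 0) \<otimes>\<^bsub>U\<^esub> l (xs ! 1))"
  have val: "\<omega> [u, v] = l u \<otimes>\<^bsub>U\<^esub> l v" if "u \<in> carrier L" "v \<in> carrier L" for u v using that by (simp add: \<omega>_def)
  have \<omega>_eq: "l (\<pi> x) \<otimes>\<^bsub>U\<^esub> l (\<pi> y) = x \<otimes>\<^bsub>U\<^esub> y" if "x \<in> carrier U" "y \<in> carrier U" for x y
    by (rule indep) (use that l in \<open>simp_all add: lin\<close>)
  have \<omega>: "\<omega> \<in> carrier (ce_cochains R L U 2)"
    unfolding \<omega>_def
  proof (rule L.cochain2I)
    fix u assume u: "u \<in> carrier L"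
    show "linear_map R L U (\<lambda>x. l x \<otimes>\<^bsub>U\<^esub> l u)"
    proof (rule linear_mapI)
      show "l x \<otimes>\<^bsub>U\<^esub> l u \<in> carrier U" if "x \<in> carrier L" for x using that u l by (simp add: cl)
      show "l (x \<oplus>\<^bsub>L\<^esub> y) \<otimes>\<^bsub>U\<^esub> l u = l x \<otimes>\<^bsub>U\<^esub> l u \<oplus>\<^bsub>U\<^esub> l y \<otimes>\<^bsub>U\<^esub> l u" if "x \<in> carrier L" "y \<in> carrier L" for x y
        using \<omega>_eq[of "l x \<oplus>\<^bsub>U\<^esub> l y" "l u"] that u l by (simp add: lin U.L.mult_add_left)
      show "l (a \<odot>\<^bsub>L\<^esub> x) \<otimes>\<^bsub>U\<^esub> l u = a \<odot>\<^bsub>U\<^esub> (l x \<otimes>\<^bsub>U\<^esub> l u)" if "a \<in> carrier R" "x \<in> carrier L" for a x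
        using \<omega>_eq[of "a \<odot>\<^bsub>U\<^esub> l x" "l u"] that u l by (simp add: lin U.L.mult_smult_left)
    qed
    show "linear_map R L U (\<lambda>x. l u \<otimes>\<^bsub>U\<^esub> l x)"
    proof (rule linear_mapI)
      show "l u \<otimes>\<^bsub>U\<^esub> l x \<in> carrier U" if "x \<in> carrier L" for x using that u l by (simp add: cl)
      show "l u \<otimes>\<^bsub>U\<^esub> l (x \<oplus>\<^bsub>L\<^esub> y) = l u \<otimes>\<^bsub>U\<^esub> l x \<oplus>\<^bsub>U\<^esub> l u \<otimes>\<^bsub>U\<^esub> l y" if "x \<in> carrier L" "y \<in> carrier L" for x y
        using \<omega>_eq[of "l u" "l x \<oplus>\<^bsub>U\<^esub> l y"] that u l by (simp add: lin U.L.mult_add_right)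
      show "l u \<otimes>\<^bsub>U\<^esub> l (a \<odot>\<^bsub>L\<^esub> x) = a \<odot>\<^bsub>U\<^esub> (l u \<otimes>\<^bsub>U\<^esub> l x)" if "a \<in> carrier R" "x \<in> carrier L" for a x
        using \<omega>_eq[of "l u" "a \<odot>\<^bsub>U\<^esub> l x"] that u l by (simp add: lin U.L.mult_smult_right)
    qed
    show "l u \<otimes>\<^bsub>U\<^esub> l u = \<zero>\<^bsub>U\<^esub>" using u l by (simp add: U.L.bracket_self)
  qed
  have cocycle: "cocycle_sum L U \<omega> x y z = \<zero>\<^bsub>U\<^esub>" if xyz: "x \<in> carrier L" "y \<in> carrier L" "z \<in> carrier L" for x y z
  proof -
    have eq: "\<omega> [u \<otimes>\<^bsub>L\<^esub> v, w] = (l u \<otimes>\<^bsub>U\<^esub> l v) \<otimes>\<^bsub>U\<^esub> l w" if "u \<in> carrier L" "v \<in> carrier L" "w \<in> carrier L" for u v w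
      using \<omega>_eq[of "l u \<otimes>\<^bsub>U\<^esub> l v" "l w"] that l by (simp add: val L.mult_closed mult cl)
    have sw: "(l x \<otimes>\<^bsub>U\<^esub> l z) \<otimes>\<^bsub>U\<^esub> l y = \<ominus>\<^bsub>U\<^esub> (l y \<otimes>\<^bsub>U\<^esub> (l x \<otimes>\<^bsub>U\<^esub> l z))" "(l y \<otimes>\<^bsub>U\<^esub> l z) \<otimes>\<^bsub>U\<^esub> l x = \<ominus>\<^bsub>U\<^esub> (l x \<otimes>\<^bsub>U\<^esub> (l y \<otimes>\<^bsub>U\<^esub> l z))"
      by (rule U.L.bracket_swap; use xyz l in \<open>simp add: cl\<close>)+
    show ?thesis
      using U.L.bracket_derivation[of "l x" "l y" "l z"] xyz l
      unfolding cocycle_sum_def eq[OF xyz(1,3,2)] eq[OF xyz] eq[OF xyz(2,3,1)] sw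
      by (simp add: cl) (simp add: cl U.L.M.ab_simps)
  qed
  have pi_cochain: "(\<lambda>xs\<in>tuples U 2. wedge R L [\<pi> (xs ! 0), \<pi> (xs ! 1)]) \<in> carrier (ce_cochains R U (ext_power R L 2) 2)"
  proof (rule U.L.cochain2I)
    fix u assume u: "u \<in> carrier U"
    show "linear_map R U (ext_power R L 2) (\<lambda>x. wedge R L [\<pi> x, \<pi> u])"
      using linear_map_compose[OF algebra_mapD(1)[OF \<pi>] L.wedge_lin(2)] u lin(1) by blast
    show "linear_map R U (ext_power R L 2) (\<lambda>y. wedge R L [\<pi> u, \<pi> y])"
      using linear_map_compose[OF algebra_mapD(1)[OF \<pi>] L.wedge_lin(3)] u lin(1) by blast
    show "wedge R L [\<pi> u, \<pi> u] = \<zero>\<^bsub>ext_power R L 2\<^esub>"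
      using L.cochain2D(3)[OF L.wedge_cochain] u lin(1) by simp
  qed
  \<comment> \<open>the map of exterior squares induced by \<open>\<pi>\<close>\<close>
  define T where "T = ext_lift R (ext_power R L 2) (\<lambda>xs\<in>tuples U 2. wedge R L [\<pi> (xs ! 0), \<pi> (xs ! 1)])"
  note T = U.L.ext_lift[OF L.ext_power_module pi_cochain, folded T_def]
  note lift = L.ext_lift[OF U.L.module_axioms \<omega>]
  have eq1: "ext_lift R U \<omega> (T w) = U.L.ext_bracket w" if "w \<in> carrier (ext_power R U 2)" for w
  proof (rule U.L.ext_power_map_unique[OF U.L.module_axioms linear_map_compose[OF T(1) lift(1)] U.L.ext_bracket(1) _ that])
    fix xs assume "xs \<in> tuples U 2"
    then obtain x y where xs: "xs = [x, y]" "x \<in> carrier U" "y \<in> carrier U" by (rule tuples2E)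
    then show "ext_lift R U \<omega> (T (wedge R U xs)) = U.L.ext_bracket (wedge R U xs)"
      using T(2)[of xs] lift(2)[of "[\<pi> x, \<pi> y]"] by (simp add: U.L.ext_bracket(2) lin val \<omega>_eq)
  qed
  have eq2: "L.ext_bracket (T w) = \<pi> (U.L.ext_bracket w)" if "w \<in> carrier (ext_power R U 2)" for w
  proof (rule U.L.ext_power_map_unique[OF L.module_axioms linear_map_compose[OF T(1) L.ext_bracket(1)]
        linear_map_compose[OF U.L.ext_bracket(1) algebra_mapD(1)[OF \<pi>]] _ that])
    fix xs assume "xs \<in> tuples U 2"
    then obtain x y where xs: "xs = [x, y]" "x \<in> carrier U" "y \<in> carrier U" by (rule tuples2E)
    then show "L.ext_bracket (T (wedge R U xs)) = \<pi> (U.L.ext_bracket (wedge R U xs))"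
      using T(2)[of xs] by (simp add: U.L.ext_bracket(2) L.ext_bracket(2) lin mult)
  qed
  have ker: "k = \<zero>\<^bsub>U\<^esub>" if k: "k \<in> carrier U" "\<pi> k = \<zero>\<^bsub>L\<^esub>" for k
  proof -
    obtain w where w: "w \<in> carrier (ext_power R U 2)" "U.L.ext_bracket w = k"
      using A.ext_bracket_surj[OF k(1)] by blast
    have "ext_lift R U \<omega> (T w) = \<zero>\<^bsub>U\<^esub>"
      by (rule L.homology2_zero_cocycle[OF H U.L.module_axioms \<omega> cocycle])
        (use w k in \<open>simp_all add: eq2 linear_map_simps[OF T(1)]\<close>)
    then show ?thesis using eq1[OF w(1)] w(2) by simp
  qed
  show ?thesis
  proof (rule inj_onI)
    fix x y assume xy: "x \<in> carrier U" "y \<in> carrier U" "\<pi> x = \<pi> y"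
    then have "x \<ominus>\<^bsub>U\<^esub> y = \<zero>\<^bsub>U\<^esub>" by (intro ker) (simp_all add: lin L.M.diff_self)
    then show "x = y" using xy by (simp add: U.L.M.diff_eq_zero_iff)
  qed
qed

section \<open>The equivalence of categories\<close>

text \<open>
  A fully faithful and essentially surjective functor \<open>G\<close> is an equivalence: a quasi-inverse picks
  for every object \<open>a\<close> an isomorphism \<open>\<epsilon> a\<close> from some \<open>G (F a)\<close> and lifts conjugated morphisms.
\<close>

lemma equivalent_categoriesI:
  assumes C: "is_category C" and D: "is_category D" and G: "is_functor D C G G'"
    and full: "\<And>x y f. \<lbrakk>x \<in> Ob D; y \<in> Ob D; f \<in> Hom C (G x) (G y)\<rbrakk> \<Longrightarrow> \<exists>g\<in>Hom D x y. G' x y g = f"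
    and faithful: "\<And>x y g g'. \<lbrakk>x \<in> Ob D; y \<in> Ob D; g \<in> Hom D x y; g' \<in> Hom D x y; G' x y g = G' x y g'\<rbrakk> \<Longrightarrow> g = g'"
    and surj: "\<And>a. a \<in> Ob C \<Longrightarrow> \<exists>x\<in>Ob D. \<exists>i. is_iso C (G x) a i"
  shows "equivalent_categories C D"
proof -
  have idC: "\<And>a. a \<in> Ob C \<Longrightarrow> Ident C a \<in> Hom C a a"
    and compC: "\<And>a b c f g. \<lbrakk>a \<in> Ob C; b \<in> Ob C; c \<in> Ob C; f \<in> Hom C a b; g \<in> Hom C b c\<rbrakk> \<Longrightarrow> Comp C a b c g f \<in> Hom C a c"
    and unitC: "\<And>a b f. \<lbrakk>a \<in> Ob C; b \<in> Ob C; f \<in> Hom C a b\<rbrakk> \<Longrightarrow> Comp C a a b f (Ident C a) = f"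
      "\<And>a b f. \<lbrakk>a \<in> Ob C; b \<in> Ob C; f \<in> Hom C a b\<rbrakk> \<Longrightarrow> Comp C a b b (Ident C b) f = f"
    and assocC: "\<And>a b c d f g h. \<lbrakk>a \<in> Ob C; b \<in> Ob C; c \<in> Ob C; d \<in> Ob C; f \<in> Hom C a b; g \<in> Hom C b c; h \<in> Hom C c d\<rbrakk>
      \<Longrightarrow> Comp C a b d (Comp C b c d h g) f = Comp C a c d h (Comp C a b c g f)"
    using C unfolding is_category_def by blast+
  have idD: "\<And>a. a \<in> Ob D \<Longrightarrow> Ident D a \<in> Hom D a a"
    and compD: "\<And>a b c f g. \<lbrakk>a \<in> Ob D; b \<in> Ob D; c \<in> Ob D; f \<in> Hom D a b; g \<in> Hom D b c\<rbrakk> \<Longrightarrow> Comp D a b c g f \<in> Hom D a c"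
    using D unfolding is_category_def by blast+
  have Gob: "\<And>a. a \<in> Ob D \<Longrightarrow> G a \<in> Ob C"
    and Ghom: "\<And>a b f. \<lbrakk>a \<in> Ob D; b \<in> Ob D; f \<in> Hom D a b\<rbrakk> \<Longrightarrow> G' a b f \<in> Hom C (G a) (G b)"
    and Gid: "\<And>a. a \<in> Ob D \<Longrightarrow> G' a a (Ident D a) = Ident C (G a)"
    and Gcomp: "\<And>a b c f g. \<lbrakk>a \<in> Ob D; b \<in> Ob D; c \<in> Ob D; f \<in> Hom D a b; g \<in> Hom D b c\<rbrakk>
      \<Longrightarrow> G' a c (Comp D a b c g f) = Comp C (G a) (G b) (G c) (G' b c g) (G' a b f)"
    using G unfolding is_functor_def by blast+
  have "\<forall>a\<in>Ob C. \<exists>t. fst t \<in> Ob D \<and> fst (snd t) \<in> Hom C (G (fst t)) a \<and> snd (snd t) \<in> Hom C a (G (fst t)) \<and>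
      Comp C (G (fst t)) a (G (fst t)) (snd (snd t)) (fst (snd t)) = Ident C (G (fst t)) \<and>
      Comp C a (G (fst t)) a (fst (snd t)) (snd (snd t)) = Ident C a"
    using surj unfolding is_iso_def by fastforce
  from bchoice[OF this] obtain t where t: "\<forall>a\<in>Ob C. fst (t a) \<in> Ob D \<and> fst (snd (t a)) \<in> Hom C (G (fst (t a))) a \<and>
      snd (snd (t a)) \<in> Hom C a (G (fst (t a))) \<and>
      Comp C (G (fst (t a))) a (G (fst (t a))) (snd (snd (t a))) (fst (snd (t a))) = Ident C (G (fst (t a))) \<and>
      Comp C a (G (fst (t a))) a (fst (snd (t a))) (snd (snd (t a))) = Ident C a" ..
  define F where "F a = fst (t a)" for a
  define \<epsilon> where "\<epsilon> a = fst (snd (t a))" for a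
  define \<epsilon>' where "\<epsilon>' a = snd (snd (t a))" for a
  have F: "F a \<in> Ob D" "G (F a) \<in> Ob C" "\<epsilon> a \<in> Hom C (G (F a)) a" "\<epsilon>' a \<in> Hom C a (G (F a))"
    and inv: "Comp C (G (F a)) a (G (F a)) (\<epsilon>' a) (\<epsilon> a) = Ident C (G (F a))" "Comp C a (G (F a)) a (\<epsilon> a) (\<epsilon>' a) = Ident C a"
    if "a \<in> Ob C" for a
    using t that Gob by (simp_all add: F_def \<epsilon>_def \<epsilon>'_def)
  have cancel: "Comp C x (G (F b)) b (\<epsilon> b) (Comp C x b (G (F b)) (\<epsilon>' b) k) = k"
    if "x \<in> Ob C" "b \<in> Ob C" "k \<in> Hom C x b" for x b k
    using assocC[of x b "G (F b)" b k "\<epsilon>' b" "\<epsilon> b"] that F inv(2) unitC(2) by simp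
  define lift where "lift x y f = (SOME g. g \<in> Hom D x y \<and> G' x y g = f)" for x y f
  have lift: "lift x y f \<in> Hom D x y" "G' x y (lift x y f) = f" if "x \<in> Ob D" "y \<in> Ob D" "f \<in> Hom C (G x) (G y)" for x y f
    using someI_ex[of "\<lambda>g. g \<in> Hom D x y \<and> G' x y g = f"] full[OF that] unfolding lift_def by blast+
  define conj where "conj a b f = Comp C (G (F a)) b (G (F b)) (\<epsilon>' b) (Comp C (G (F a)) a b f (\<epsilon> a))" for a b f
  have conj: "conj a b f \<in> Hom C (G (F a)) (G (F b))" if "a \<in> Ob C" "b \<in> Ob C" "f \<in> Hom C a b" for a b f
    unfolding conj_def using that F by (simp add: compC)
  define F' where "F' a b f = lift (F a) (F b) (conj a b f)" for a b f
  have F': "F' a b f \<in> Hom D (F a) (F b)" "G' (F a) (F b) (F' a b f) = conj a b f"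
    if "a \<in> Ob C" "b \<in> Ob C" "f \<in> Hom C a b" for a b f
    unfolding F'_def using lift[OF F(1)[OF that(1)] F(1)[OF that(2)] conj[OF that]] by blast+
  have quasi_inverse: "is_functor C D F F'"
    unfolding is_functor_def
  proof (intro conjI ballI)
    show "F a \<in> Ob D" if "a \<in> Ob C" for a by (rule F(1)[OF that])
    show "F' a b f \<in> Hom D (F a) (F b)" if "a \<in> Ob C" "b \<in> Ob C" "f \<in> Hom C a b" for a b f by (rule F'(1)[OF that])
    fix a assume a: "a \<in> Ob C"
    show "F' a a (Ident C a) = Ident D (F a)"
    proof (rule faithful[OF F(1)[OF a] F(1)[OF a]])
      show "G' (F a) (F a) (F' a a (Ident C a)) = G' (F a) (F a) (Ident D (F a))"
        using a F inv by (simp add: F'(2) idC conj_def unitC Gid)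
    qed (use a F' idC idD F in simp_all)
    fix b c f g assume *: "b \<in> Ob C" "c \<in> Ob C" "f \<in> Hom C a b" "g \<in> Hom C b c"
    show "F' a c (Comp C a b c g f) = Comp D (F a) (F b) (F c) (F' b c g) (F' a b f)"
    proof (rule faithful[OF F(1)[OF a] F(1)[OF *(2)]])
      have "conj a c (Comp C a b c g f) = Comp C (G (F a)) (G (F b)) (G (F c)) (conj b c g) (conj a b f)"
        unfolding conj_def using a * F by (simp add: assocC compC cancel)
      then show "G' (F a) (F c) (F' a c (Comp C a b c g f)) = G' (F a) (F c) (Comp D (F a) (F b) (F c) (F' b c g) (F' a b f))"
        using a * F F' by (simp add: compC Gcomp)
    qed (use a * F F' compC compD in simp_all)
  qed
  have nat1: "nat_isomorphic C C (\<lambda>a. G (F a)) (\<lambda>a b f. G' (F a) (F b) (F' a b f)) (\<lambda>a. a) (\<lambda>a b f. f)"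
    unfolding nat_isomorphic_def
  proof (rule exI[of _ \<epsilon>], intro conjI ballI)
    show "is_iso C (G (F a)) a (\<epsilon> a)" if "a \<in> Ob C" for a
      unfolding is_iso_def using F(3,4)[OF that] inv[OF that] by blast
    show "Comp C (G (F a)) (G (F b)) b (\<epsilon> b) (G' (F a) (F b) (F' a b f)) = Comp C (G (F a)) a b f (\<epsilon> a)"
      if "a \<in> Ob C" "b \<in> Ob C" "f \<in> Hom C a b" for a b f
      using that F F' compC by (simp add: conj_def cancel)
  qed
  define \<eta> where "\<eta> x = lift (F (G x)) x (\<epsilon> (G x))" for x
  define \<eta>' where "\<eta>' x = lift x (F (G x)) (\<epsilon>' (G x))" for x
  have \<eta>: "\<eta> x \<in> Hom D (F (G x)) x" "G' (F (G x)) x (\<eta> x) = \<epsilon> (G x)"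
    "\<eta>' x \<in> Hom D x (F (G x))" "G' x (F (G x)) (\<eta>' x) = \<epsilon>' (G x)" if "x \<in> Ob D" for x
    unfolding \<eta>_def \<eta>'_def using lift F[OF Gob[OF that]] that by blast+
  have nat2: "nat_isomorphic D D (\<lambda>x. F (G x)) (\<lambda>x y g. F' (G x) (G y) (G' x y g)) (\<lambda>x. x) (\<lambda>x y g. g)"
    unfolding nat_isomorphic_def
  proof (rule exI[of _ \<eta>], intro conjI ballI)
    fix x assume x: "x \<in> Ob D"
    note Fx = F[OF Gob[OF x]]
    have "Comp D (F (G x)) x (F (G x)) (\<eta>' x) (\<eta> x) = Ident D (F (G x))"
      by (rule faithful[OF Fx(1) Fx(1)])
        (use x Fx \<eta>[OF x] inv[OF Gob[OF x]] in \<open>simp_all add: compD idD Gcomp Gid\<close>)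
    moreover have "Comp D x (F (G x)) x (\<eta> x) (\<eta>' x) = Ident D x"
      by (rule faithful[OF x x])
        (use x Fx \<eta>[OF x] inv[OF Gob[OF x]] in \<open>simp_all add: compD idD Gcomp Gid\<close>)
    ultimately show "is_iso D (F (G x)) x (\<eta> x)" unfolding is_iso_def using \<eta>[OF x] by blast
    fix y g assume y: "y \<in> Ob D" and g: "g \<in> Hom D x y"
    note Fy = F[OF Gob[OF y]] and Gg = Ghom[OF x y g]
    show "Comp D (F (G x)) (F (G y)) y (\<eta> y) (F' (G x) (G y) (G' x y g)) = Comp D (F (G x)) x y g (\<eta> x)"
    proof (rule faithful[OF Fx(1) y])
      show "G' (F (G x)) y (Comp D (F (G x)) (F (G y)) y (\<eta> y) (F' (G x) (G y) (G' x y g))) =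
          G' (F (G x)) y (Comp D (F (G x)) x y g (\<eta> x))"
        using x y g Fx Fy Gg \<eta>[OF x] \<eta>[OF y] Gob F'[OF Gob[OF x] Gob[OF y] Gg]
        by (simp add: Gcomp conj_def cancel compC)
    qed (use x y g Fx Fy Gg \<eta>[OF x] \<eta>[OF y] F'[OF Gob[OF x] Gob[OF y] Gg] compD in simp_all)
  qed
  show ?thesis unfolding equivalent_categories_def using C D quasi_inverse G nat1 nat2 by blast
qed

lemma algebra_map_restrict:
  assumes "nonassoc_algebra R A" "algebra_map R A B \<phi>"
  shows "algebra_map R A B (restrict \<phi> (carrier A))"
proof -
  interpret nonassoc_algebra R A by fact
  show ?thesis using assms(2) by (auto simp: algebra_map_def linear_map_def mult_closed Pi_iff)
qed

lemma compose_algebra_homs: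
  assumes A: "nonassoc_algebra R A" and "\<phi> \<in> algebra_homs R A B" "\<psi> \<in> algebra_homs R B C"
  shows "compose (carrier A) \<psi> \<phi> \<in> algebra_homs R A C"
  using algebra_map_restrict[OF A algebra_map_compose[of R A B \<phi> C \<psi>]] assms(2,3)
  by (simp add: algebra_homs_iff compose_def)

lemma identity_algebra_homs:
  "nonassoc_algebra R A \<Longrightarrow> (\<lambda>x\<in>carrier A. x) \<in> algebra_homs R A A"
  using algebra_map_restrict[of R A A "\<lambda>x. x"] by (simp add: algebra_homs_iff algebra_map_def linear_map_def)

lemma algebra_homs_ext:
  "\<lbrakk>\<phi> \<in> algebra_homs R A B; \<psi> \<in> algebra_homs R A B; \<And>x. x \<in> carrier A \<Longrightarrow> \<phi> x = \<psi> x\<rbrakk> \<Longrightarrow> \<phi> = \<psi>"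
  by (auto simp: algebra_homs_iff intro: extensionalityI)

lemma concrete_categoryI:
  assumes "\<And>x y f. \<lbrakk>x \<in> Ob C; y \<in> Ob C; f \<in> Hom C x y\<rbrakk> \<Longrightarrow> f \<in> U x \<rightarrow>\<^sub>E U y"
    and "\<And>x. x \<in> Ob C \<Longrightarrow> Ident C x = (\<lambda>a\<in>U x. a)" "\<And>x. x \<in> Ob C \<Longrightarrow> (\<lambda>a\<in>U x. a) \<in> Hom C x x"
    and "\<And>x y z f g. \<lbrakk>x \<in> Ob C; y \<in> Ob C; z \<in> Ob C\<rbrakk> \<Longrightarrow> Comp C x y z g f = compose (U x) g f"
    and "\<And>x y z f g. \<lbrakk>x \<in> Ob C; y \<in> Ob C; z \<in> Ob C; f \<in> Hom C x y; g \<in> Hom C y z\<rbrakk> \<Longrightarrow> compose (U x) g f \<in> Hom C x z"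
  shows "is_category C"
  unfolding is_category_def
proof (intro conjI ballI)
  fix a assume a: "a \<in> Ob C"
  show "Ident C a \<in> Hom C a a" using a assms(2,3) by simp
  fix b assume b: "b \<in> Ob C"
  show "Comp C a a b f (Ident C a) = f" if "f \<in> Hom C a b" for f
    using assms(1)[OF a b that] a b by (auto simp: assms(2,4) PiE_iff intro!: compose_Id)
  show "Comp C a b b (Ident C b) f = f" if "f \<in> Hom C a b" for f
    using assms(1)[OF a b that] a b by (auto simp: assms(2,4) PiE_iff intro!: Id_compose)
  fix c f g assume c: "c \<in> Ob C" "f \<in> Hom C a b" "g \<in> Hom C b c"
  show "Comp C a b c g f \<in> Hom C a c" using a b c assms(4,5) by simp
  fix d h assume d: "d \<in> Ob C" "h \<in> Hom C c d"
  have "f \<in> U a \<rightarrow> U b" using assms(1)[OF a b c(2)] by auto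
  then show "Comp C a b d (Comp C b c d h g) f = Comp C a c d h (Comp C a b c g f)"
    using a b c d by (simp add: assms(4) compose_assoc)
qed

lemma jordan_category:
  fixes R :: "('k, 'z) ring_scheme"
  shows "is_category (jordan_category R :: (('k, 'u) module, 'u \<Rightarrow> 'u) cat)" (is "is_category ?C")
proof (rule concrete_categoryI[where U = carrier])
  have na: "nonassoc_algebra R J" "\<one>\<^bsub>J\<^esub> \<in> carrier J" if "unital_jordan_algebra R J" for J :: "('k, 'u) module"
    using that unital_jordan_algebra.unit_closed[OF that] by (simp_all add: unital_jordan_algebra_def)
  show "(\<lambda>a\<in>carrier J. a) \<in> Hom ?C J J" if "J \<in> Ob ?C" for J
  proof -
    have "unital_jordan_algebra R J" using that by (simp add: jordan_category_def)
    from na[OF this] show ?thesis by (simp add: jordan_category_def identity_algebra_homs)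
  qed
  show "compose (carrier J) \<psi> \<phi> \<in> Hom ?C J L" if J: "J \<in> Ob ?C" and "\<phi> \<in> Hom ?C J K" "\<psi> \<in> Hom ?C K L" for J K L \<phi> \<psi>
  proof -
    have "unital_jordan_algebra R J" using J by (simp add: jordan_category_def)
    from na[OF this] that(2,3) show ?thesis
      by (simp add: jordan_category_def compose_algebra_homs[of R J \<phi> K \<psi> L] compose_eq)
  qed
qed (auto simp: jordan_category_def algebra_homs_def module_homs_def)

lemma A1_gradedD:
  assumes "A1_graded R L (h, e, f)"
  shows "nonassoc_algebra R L" "h \<in> carrier L" "e \<in> carrier L" "f \<in> carrier L"
  using assms unfolding A1_graded_def sl2_triple_def prod.case lie_algebra_def by blast+

lemma A1_category: "is_category (A1_category R P)"
proof (rule concrete_categoryI[where U = "\<lambda>(L, s). carrier L"])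
  show "(\<lambda>a\<in>(case x of (L, s) \<Rightarrow> carrier L). a) \<in> Hom (A1_category R P) x x" if "x \<in> Ob (A1_category R P)" for x
    using that by (auto simp: A1_category_def identity_algebra_homs A1_gradedD)
  show "compose (case x of (L, s) \<Rightarrow> carrier L) \<psi> \<phi> \<in> Hom (A1_category R P) x z"
    if "x \<in> Ob (A1_category R P)" "\<phi> \<in> Hom (A1_category R P) x y" "\<psi> \<in> Hom (A1_category R P) y z" for x y z \<phi> \<psi>
    using that by (auto simp: A1_category_def compose_algebra_homs compose_eq A1_gradedD)
qed (auto simp: A1_category_def algebra_homs_def module_homs_def)

text \<open>\<open>L_1\<close> and \<open>f\<close> generate \<open>L\<close>, because \<open>q\<close> is a double bracket with \<open>f\<close>.\<close>

lemma (in A1_graded_lie) hom_unique: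
  assumes L': "lie_algebra R L'" and \<phi>: "algebra_map R L L' \<phi>" and \<psi>: "algebra_map R L L' \<psi>"
    and eq: "\<And>a. a \<in> W 1 \<Longrightarrow> \<phi> a = \<psi> a" "\<phi> f = \<psi> f" and x: "x \<in> carrier L"
  shows "\<phi> x = \<psi> x"
proof -
  interpret L': lie_algebra R L' by fact
  interpret D: jordan_datum R J L "\<lambda>a. a" q by (rule jordan_of_datum)
  have val: "\<chi> (q a) = \<ominus>\<^bsub>L'\<^esub> (half R \<odot>\<^bsub>L'\<^esub> (\<chi> f \<otimes>\<^bsub>L'\<^esub> (\<chi> f \<otimes>\<^bsub>L'\<^esub> \<chi> a)))" if \<chi>: "algebra_map R L L' \<chi>" and a: "a \<in> W 1" for \<chi> a
    using weight_closed[OF a] triple(3)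
    by (simp add: opposite_part_def linear_map_simps[OF algebra_mapD(1)[OF \<chi>]] algebra_mapD(2)[OF \<chi>] mult_closed
        linear_map_minus[OF module_axioms L'.module_axioms algebra_mapD(1)[OF \<chi>]])
  show ?thesis
  proof (rule D.core_map_unique[OF L'])
    show "algebra_map R (L\<lparr>carrier := D.C\<rparr>) L' \<phi>" "algebra_map R (L\<lparr>carrier := D.C\<rparr>) L' \<psi>"
      using \<phi> \<psi> by (simp_all add: jordan_of_core algebra_map_def linear_map_def)
    show "\<phi> a = \<psi> a" if "a \<in> carrier J" for a using that eq(1) by (simp add: jordan_of_simps)
    show "\<phi> (q a) = \<psi> (q a)" if "a \<in> carrier J" for a
      using that eq by (simp add: jordan_of_simps val \<phi> \<psi>)
  qed (simp add: jordan_of_core x)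
qed

lemma datum_core_cong:
  assumes "\<And>a. a \<in> carrier J \<Longrightarrow> p a = p' a" "\<And>a. a \<in> carrier J \<Longrightarrow> q a = q' a"
  shows "datum_core R J L p q = datum_core R J L p' q'"
proof -
  have "{q b \<otimes>\<^bsub>L\<^esub> p a | a b. a \<in> carrier J \<and> b \<in> carrier J} = {q' b \<otimes>\<^bsub>L\<^esub> p' a | a b. a \<in> carrier J \<and> b \<in> carrier J}"
    using assms by (intro Collect_cong) metis
  then have "datum_zero R J L p q = datum_zero R J L p' q'" by (simp add: datum_zero_def)
  then show ?thesis unfolding datum_core_def using assms by (intro Collect_cong) metis
qed

text \<open>
  The universal Lie algebra of \<open>L_1\<close> maps to \<open>L\<close> and, along \<open>\<phi>\<close>, to \<open>L'\<close>.  As \<open>H_2(L) = 0\<close> the first map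
  is an isomorphism.
\<close>

lemma A1_hom_extends:
  fixes R :: "('k, 'z) ring_scheme" and L L' :: "('k, 'u) module"
  assumes R: "field_char_not_2_3 R" and inf: "infinite (UNIV :: 'u set)"
    and L: "A1_graded R L (h, e, f)" and H: "zero_module (ce_homology R L 2)" and L': "A1_graded R L' (h', e', f')"
    and \<phi>: "algebra_map R (jordan_of R L (h, e, f)) (jordan_of R L' (h', e', f')) \<phi>" and \<phi>e: "\<phi> e = e'"
  obtains \<Phi> where "algebra_map R L L' \<Phi>" "\<Phi> h = h'" "\<Phi> e = e'" "\<Phi> f = f'" "\<And>a. a \<in> weight_space L h 1 \<Longrightarrow> \<Phi> a = \<phi> a"
proof -
  interpret L: A1_graded_lie R L h e f by (rule A1_graded_lieI[OF R L])
  interpret L': A1_graded_lie R L' h' e' f' by (rule A1_graded_lieI[OF R L'])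
  interpret D: jordan_datum R L.J L "\<lambda>a. a" L.q by (rule L.jordan_of_datum)
  interpret D': jordan_datum R L'.J L' "\<lambda>a. a" L'.q by (rule L'.jordan_of_datum)
  obtain U p q where U: "universal_datum R L.J U p q" using universal_datum_exists[OF L.jordan_of_jordan inf] .
  interpret U: jordan_datum R L.J U p q using U by (simp add: universal_datum_def)
  have core: "U.C = carrier U" using U by (simp add: universal_datum_def)
  obtain \<pi> where \<pi>: "algebra_map R U L \<pi>" and \<pi>p: "\<And>a. a \<in> carrier L.J \<Longrightarrow> \<pi> (p a) = a"
    and \<pi>q: "\<And>a. a \<in> carrier L.J \<Longrightarrow> \<pi> (q a) = L.q a"
    by (rule universal_datum_extends[OF U inf L.jordan_of_datum]) blast
  have DL': "jordan_datum R L.J L' (\<lambda>a. \<phi> a) (\<lambda>a. L'.q (\<phi> a))"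
    by (rule D'.precompose_datum[OF D.unital_jordan_algebra_axioms \<phi>])
  obtain \<psi> where \<psi>: "algebra_map R U L' \<psi>" and \<psi>p: "\<And>a. a \<in> carrier L.J \<Longrightarrow> \<psi> (p a) = \<phi> a"
    and \<psi>q: "\<And>a. a \<in> carrier L.J \<Longrightarrow> \<psi> (q a) = L'.q (\<phi> a)"
    by (rule universal_datum_extends[OF U inf DL']) blast
  have surj: "\<pi> ` carrier U = carrier L"
    using U.map_core[OF L.lie_algebra_axioms \<pi>] datum_core_cong[of L.J "\<lambda>a. \<pi> (p a)" "\<lambda>a. a" "\<lambda>a. \<pi> (q a)" L.q R L]
    by (simp add: core \<pi>p \<pi>q L.jordan_of_core)
  have q_inj: "inj_on L.q (carrier L.J)"
  proof (rule inj_onI)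
    fix a b assume "a \<in> carrier L.J" "b \<in> carrier L.J" "L.q a = L.q b"
    then show "a = b" using L.q_inj[of a b] by (simp add: L.jordan_of_simps)
  qed
  have inj: "inj_on \<pi> (carrier U)"
  proof (rule core_map_injective[OF U.jordan_datum_axioms core L.lie_algebra_axioms H \<pi> surj])
    show "inj_on (\<lambda>a. \<pi> (p a)) (carrier L.J)" by (rule inj_onI) (simp add: \<pi>p)
    show "inj_on (\<lambda>a. \<pi> (q a)) (carrier L.J)" using q_inj by (simp add: inj_on_def \<pi>q)
  qed
  define \<Phi> where "\<Phi> x = \<psi> (inv_into (carrier U) \<pi> x)" for x
  have \<Phi>: "algebra_map R L L' \<Phi>"
    unfolding \<Phi>_def
    by (rule algebra_map_compose[OF inv_into_algebra_map[OF U.L.nonassoc_algebra_axioms \<pi> inj surj] \<psi>])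
  have \<Phi>\<pi>: "\<Phi> (\<pi> u) = \<psi> u" if "u \<in> carrier U" for u using that inj by (simp add: \<Phi>_def)
  have \<Phi>p: "\<Phi> a = \<phi> a" if "a \<in> carrier L.J" for a
    using \<Phi>\<pi>[of "p a"] that by (simp add: \<pi>p \<psi>p U.p_simps)
  have e: "e \<in> carrier L.J" using L.e_f_weight by (simp add: L.jordan_of_simps)
  have \<Phi>e: "\<Phi> e = e'" using \<Phi>p[OF e] \<phi>e by simp
  have \<Phi>f: "\<Phi> f = f'"
    using \<Phi>\<pi>[of "q e"] e by (simp add: \<pi>q \<psi>q U.q_simps L.q_e L'.q_e \<phi>e)
  have "\<Phi> h = h'" using algebra_mapD(2)[OF \<Phi> L.triple(2,3)] \<Phi>e \<Phi>f by (simp add: L.triple L'.triple)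
  then show thesis using that \<Phi> \<Phi>e \<Phi>f \<Phi>p by (simp add: L.jordan_of_simps)
qed

lemma (in A1_graded_lie) hom_weight:
  assumes L': "A1_graded_lie R L' h' e' f'" and \<Phi>: "algebra_map R L L' \<Phi>" "\<Phi> h = h'" "\<Phi> e = e'" "\<Phi> f = f'"
  shows "algebra_map R J (jordan_of R L' (h', e', f')) (restrict \<Phi> (W 1))"
proof -
  interpret L': A1_graded_lie R L' h' e' f' by fact
  interpret JJ: jordan_char_not_2_3 R J by (rule jordan_of_jordan)
  note lin = linear_map_simps[OF algebra_mapD(1)[OF \<Phi>(1)]]
  note mult = algebra_mapD(2)[OF \<Phi>(1)]
  have W: "\<Phi> x \<in> L'.W 1" if "x \<in> W 1" for x
    using that mult[of h x] triple(1) by (simp add: weight_iff L'.weight_iff lin \<Phi>(2))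
  have "algebra_map R J L'.J \<Phi>"
    using W by (auto simp: algebra_map_def linear_map_def jordan_of_simps L'.jordan_of_simps lin mult \<Phi>(4)
        weight_closed triple(3) mult_closed)
  then show ?thesis
    using algebra_map_restrict[OF JJ.nonassoc_algebra_axioms] by (simp add: jordan_of_simps)
qed

definition weight_one_functor ::
  "('k, 'z) ring_scheme \<Rightarrow> ('k, 'u) module \<times> ('u \<times> 'u \<times> 'u) \<Rightarrow> ('k, 'u) module" where
  "weight_one_functor R = (\<lambda>(L, s). jordan_of R L s)"

text \<open>
  A quasi-inverse of the functor that takes \<open>L\<close> to \<open>L_1\<close> is the construction of the universal Lie
  algebra over \<open>J\<close>.
\<close>

theorem jordan_equivalent_A1:
  fixes R :: "('k, 'z) ring_scheme"
  assumes R: "field_char_not_2_3 R" and inf: "infinite (UNIV :: 'u set)"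
  shows "equivalent_categories (jordan_category R :: (('k, 'u) module, 'u \<Rightarrow> 'u) cat)
    (A1_category R (\<lambda>L :: ('k, 'u) module. zero_module (ce_homology R L 2)))"
    (is "equivalent_categories ?C ?D")
proof (rule equivalent_categoriesI[OF jordan_category A1_category])
  let ?G = "weight_one_functor R :: _ \<Rightarrow> ('k, 'u) module"
  let ?G' = "\<lambda>x y :: ('k, 'u) module \<times> ('u \<times> 'u \<times> 'u). \<lambda>\<Phi> :: 'u \<Rightarrow> 'u. restrict \<Phi> (carrier (?G x))"
  have obj: "A1_graded_lie R L h e f" if "(L, h, e, f) \<in> Ob ?D" for L h e f
    by (rule A1_graded_lieI[OF R]) (use that in \<open>simp add: A1_category_def\<close>)
  have hom: "\<Phi> \<in> algebra_homs R L L' \<and> \<Phi> h = h' \<and> \<Phi> e = e' \<and> \<Phi> f = f'" if "\<Phi> \<in> Hom ?D (L, h, e, f) (L', h', e', f')"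
    for \<Phi> L h e f L' h' e' f' using that by (simp add: A1_category_def)
  have G_ob: "?G x \<in> Ob ?C" if "x \<in> Ob ?D" for x
  proof -
    obtain L h e f where x: "x = (L, h, e, f)" by (metis prod_cases4)
    interpret A1_graded_lie R L h e f using obj that x by simp
    interpret JJ: jordan_char_not_2_3 R J by (rule jordan_of_jordan)
    show ?thesis using JJ.unital_jordan_algebra_axioms by (simp add: x weight_one_functor_def jordan_category_def)
  qed
  have G_hom: "?G' x y \<Phi> \<in> Hom ?C (?G x) (?G y) \<and> (\<forall>a\<in>carrier (?G x). \<Phi> a \<in> carrier (?G y))"
    if "x \<in> Ob ?D" "y \<in> Ob ?D" "\<Phi> \<in> Hom ?D x y" for x y \<Phi>
  proof -
    obtain L h e f where x: "x = (L, h, e, f)" by (metis prod_cases4)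
    obtain L' h' e' f' where y: "y = (L', h', e', f')" by (metis prod_cases4)
    interpret L: A1_graded_lie R L h e f using obj that x by simp
    interpret L': A1_graded_lie R L' h' e' f' using obj that y by simp
    have \<Phi>: "algebra_map R L L' \<Phi>" "\<Phi> h = h'" "\<Phi> e = e'" "\<Phi> f = f'"
      using that(3) unfolding x y by (simp_all add: A1_category_def algebra_homs_iff)
    have map: "algebra_map R L.J L'.J (restrict \<Phi> (L.W 1))"
      by (rule L.hom_weight[OF L'.A1_graded_lie_axioms \<Phi>])
    have G: "?G x = L.J" "?G y = L'.J" by (simp_all add: x y weight_one_functor_def)
    have "restrict \<Phi> (carrier (?G x)) \<in> Hom ?C (?G x) (?G y)"
      unfolding G using map L.e_f_weight(1) \<Phi>(3)
      by (simp add: jordan_category_def algebra_homs_iff L.jordan_of_simps L'.jordan_of_simps)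
    moreover have "\<Phi> a \<in> carrier L'.J" if "a \<in> carrier L.J" for a
      using linear_map_simps(1)[OF algebra_mapD(1)[OF map] that] that by (simp add: L.jordan_of_simps)
    ultimately show ?thesis unfolding G by blast
  qed
  show "is_functor ?D ?C ?G ?G'"
    unfolding is_functor_def
  proof (intro conjI ballI)
    show "?G x \<in> Ob ?C" if "x \<in> Ob ?D" for x by (rule G_ob[OF that])
    show "?G' x y \<Phi> \<in> Hom ?C (?G x) (?G y)" if "x \<in> Ob ?D" "y \<in> Ob ?D" "\<Phi> \<in> Hom ?D x y" for x y \<Phi>
      using G_hom[OF that] by blast
    have sub: "carrier (?G x) \<subseteq> carrier (fst x)" if "x \<in> Ob ?D" for x :: "('k, 'u) module \<times> ('u \<times> 'u \<times> 'u)"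
      by (cases x) (auto simp: weight_one_functor_def jordan_of_def weight_space_def split: prod.splits)
    show "?G' x x (Ident ?D x) = Ident ?C (?G x)" if "x \<in> Ob ?D" for x
      using sub[OF that] by (cases x) (auto simp: A1_category_def jordan_category_def fun_eq_iff)
    fix x y z \<Phi> \<Psi> assume *: "x \<in> Ob ?D" "y \<in> Ob ?D" "z \<in> Ob ?D" "\<Phi> \<in> Hom ?D x y" "\<Psi> \<in> Hom ?D y z"
    show "?G' x z (Comp ?D x y z \<Psi> \<Phi>) = Comp ?C (?G x) (?G y) (?G z) (?G' y z \<Psi>) (?G' x y \<Phi>)"
      using sub[OF *(1)] G_hom[OF *(1,2,4)]
      by (cases x) (auto simp: A1_category_def jordan_category_def fun_eq_iff compose_def)
  qed
  fix x y assume xy: "x \<in> Ob ?D" "y \<in> Ob ?D"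
  obtain L h e f where x: "x = (L, h, e, f)" by (metis prod_cases4)
  obtain L' h' e' f' where y: "y = (L', h', e', f')" by (metis prod_cases4)
  interpret L: A1_graded_lie R L h e f using obj xy x by simp
  interpret L': A1_graded_lie R L' h' e' f' using obj xy y by simp
  have Gx: "?G x = L.J" "?G y = L'.J" by (simp_all add: x y weight_one_functor_def)
  show "\<exists>\<Phi>\<in>Hom ?D x y. ?G' x y \<Phi> = \<phi>" if \<phi>: "\<phi> \<in> Hom ?C (?G x) (?G y)" for \<phi>
  proof -
    have \<phi>': "algebra_map R L.J L'.J \<phi>" "\<phi> e = e'" "\<phi> \<in> extensional (L.W 1)"
      using \<phi> unfolding Gx by (simp_all add: jordan_category_def algebra_homs_iff L.jordan_of_simps L'.jordan_of_simps)
    have A1: "A1_graded R L (h, e, f)" "zero_module (ce_homology R L 2)" "A1_graded R L' (h', e', f')"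
      using xy by (simp_all add: x y A1_category_def)
    obtain \<Phi> where \<Phi>: "algebra_map R L L' \<Phi>" "\<Phi> h = h'" "\<Phi> e = e'" "\<Phi> f = f'" "\<And>a. a \<in> L.W 1 \<Longrightarrow> \<Phi> a = \<phi> a"
      using A1_hom_extends[OF R inf A1 \<phi>'(1,2)] by blast
    have "restrict \<Phi> (carrier L) \<in> Hom ?D x y"
      using algebra_map_restrict[OF L.nonassoc_algebra_axioms \<Phi>(1)] \<Phi>(2-4) L.triple(1-3)
      by (simp add: x y A1_category_def algebra_homs_iff)
    moreover have "?G' x y (restrict \<Phi> (carrier L)) = \<phi>"
    proof
      fix a show "?G' x y (restrict \<Phi> (carrier L)) a = \<phi> a"
        unfolding Gx using \<phi>'(3) \<Phi>(5)[of a] L.weight_closed[of a 1]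
        by (cases "a \<in> L.W 1") (auto simp: L.jordan_of_simps extensional_def)
    qed
    ultimately show ?thesis by blast
  qed
  show "\<Phi> = \<Psi>" if *: "\<Phi> \<in> Hom ?D x y" "\<Psi> \<in> Hom ?D x y" "?G' x y \<Phi> = ?G' x y \<Psi>" for \<Phi> \<Psi>
  proof -
    have \<Phi>: "\<Phi> \<in> algebra_homs R L L'" "\<Phi> f = f'" and \<Psi>: "\<Psi> \<in> algebra_homs R L L'" "\<Psi> f = f'"
      using *(1,2) by (simp_all add: x y A1_category_def)
    have eq: "\<Phi> a = \<Psi> a" if "a \<in> L.W 1" for a
      using fun_cong[OF *(3), of a] that unfolding Gx by (simp add: L.jordan_of_simps)
    show ?thesis
    proof (rule algebra_homs_ext[OF \<Phi>(1) \<Psi>(1)])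
      show "\<Phi> u = \<Psi> u" if "u \<in> carrier L" for u
        by (rule L.hom_unique[OF L'.lie_algebra_axioms, of \<Phi> \<Psi>]) (use \<Phi> \<Psi> eq that in \<open>simp_all add: algebra_homs_iff\<close>)
    qed
  qed
next
  let ?G = "weight_one_functor R :: _ \<Rightarrow> ('k, 'u) module"
  fix J :: "('k, 'u) module" assume "J \<in> Ob ?C"
  then have J: "unital_jordan_algebra R J" by (simp add: jordan_category_def)
  then have J': "jordan_char_not_2_3 R J" using R by (simp add: jordan_char_not_2_3_def)
  interpret J: jordan_char_not_2_3 R J by (rule J')
  obtain U p q where U: "universal_datum R J U p q" using universal_datum_exists[OF J' inf] .
  interpret U: jordan_datum R J U p q using U by (simp add: universal_datum_def)
  have core: "U.C = carrier U" using U by (simp add: universal_datum_def)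
  let ?s = "(U.h, p \<one>\<^bsub>J\<^esub>, q \<one>\<^bsub>J\<^esub>)"
  have A1: "A1_graded R U ?s" using U.core_A1_graded by (simp add: core)
  interpret A: A1_graded_lie R U U.h "p \<one>\<^bsub>J\<^esub>" "q \<one>\<^bsub>J\<^esub>" by (rule A1_graded_lieI[OF R A1])
  have ob: "(U, ?s) \<in> Ob ?D" using A1 universal_datum_homology[OF U inf] by (simp add: A1_category_def)
  have carrier: "carrier A.J = p ` carrier J"
    using U.core_weight_spaces(1) by (simp add: core A.jordan_of_simps)
  have "algebra_map R J A.J p"
    unfolding algebra_map_def
  proof (intro conjI ballI)
    show "linear_map R J A.J p"
      by (rule linear_mapI) (simp_all add: carrier A.jordan_of_simps U.p_simps)
    fix a b assume ab: "a \<in> carrier J" "b \<in> carrier J"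
    have "(p a \<otimes>\<^bsub>U\<^esub> q \<one>\<^bsub>J\<^esub>) \<otimes>\<^bsub>U\<^esub> p b = p (a \<otimes>\<^bsub>J\<^esub> b) \<oplus>\<^bsub>U\<^esub> p (a \<otimes>\<^bsub>J\<^esub> b)"
      using ab by (simp add: U.p_q_p J.unit_closed J.jordan_triple2_one U.p_simps J.mult_closed)
    then show "p (a \<otimes>\<^bsub>J\<^esub> b) = p a \<otimes>\<^bsub>A.J\<^esub> p b"
      using ab by (simp add: A.jordan_of_simps U.p_simps J.mult_closed U.LV.smult_half_double)
  qed
  note p_map = this
  have inj: "inj_on p (carrier J)" by (rule universal_datum_inj[OF U inf])
  have inv: "algebra_map R A.J J (inv_into (carrier J) p)"
    by (rule inv_into_algebra_map[OF J.nonassoc_algebra_axioms p_map inj carrier[symmetric]])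
  interpret AJ: jordan_char_not_2_3 R A.J by (rule A.jordan_of_jordan)
  let ?i = "restrict (inv_into (carrier J) p) (carrier A.J)" and ?j = "restrict p (carrier J)"
  have one: "\<one>\<^bsub>A.J\<^esub> = p \<one>\<^bsub>J\<^esub>" by (simp add: A.jordan_of_simps)
  have "?i \<in> Hom ?C A.J J"
    using algebra_map_restrict[OF AJ.nonassoc_algebra_axioms inv] inj
    by (simp add: jordan_category_def algebra_homs_iff one carrier J.unit_closed)
  moreover have "?j \<in> Hom ?C J A.J"
    using algebra_map_restrict[OF J.nonassoc_algebra_axioms p_map]
    by (simp add: jordan_category_def algebra_homs_iff one J.unit_closed)
  moreover have "Comp ?C A.J J A.J ?j ?i = Ident ?C A.J" "Comp ?C J A.J J ?i ?j = Ident ?C J"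
    using inj by (auto simp: jordan_category_def compose_def fun_eq_iff carrier)
  ultimately have "is_iso ?C A.J J ?i" unfolding is_iso_def by blast
  then show "\<exists>x\<in>Ob ?D. \<exists>i. is_iso ?C (?G x) J i"
    using ob by (intro bexI[of _ "(U, ?s)"] exI[of _ ?i]) (simp_all add: weight_one_functor_def)
qed

theorem theoremC:
  fixes R :: "('k, 'z) ring_scheme"
  assumes "field R" and "ring_char R \<noteq> 2" and "ring_char R \<noteq> 3"
    and "infinite (UNIV :: 'u set)"
    and "\<exists>\<iota> :: 'k \<Rightarrow> 'm. inj_on \<iota> (carrier R)"
  shows "(\<forall>(L :: ('k, 'u) module) s. A1_graded R L s \<longrightarrow>
            (zero_module (ce_homology R L 2) \<longleftrightarrow>
             (\<forall>M :: ('k, 'm) module. module R M \<longrightarrow> zero_module (ce_cohomology R L M 2)))) \<and>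
         equivalent_categories
           (jordan_category R :: (('k, 'u) module, 'u \<Rightarrow> 'u) cat)
           (A1_category R (\<lambda>L :: ('k, 'u) module. zero_module (ce_homology R L 2))) \<and>
         equivalent_categories
           (jordan_category R :: (('k, 'u) module, 'u \<Rightarrow> 'u) cat)
           (A1_category R (\<lambda>L :: ('k, 'u) module.
              \<forall>M :: ('k, 'm) module. module R M \<longrightarrow> zero_module (ce_cohomology R L M 2)))"
proof -
  have R: "field_char_not_2_3 R" by (rule field_char_not_2_3I[OF assms(1-3)])
  obtain \<kappa> :: "'k \<Rightarrow> 'm" where \<kappa>: "inj_on \<kappa> (carrier R)" using assms(5) by blast
  have iff: "zero_module (ce_homology R L 2) \<longleftrightarrow>
      (\<forall>M :: ('k, 'm) module. module R M \<longrightarrow> zero_module (ce_cohomology R L M 2))"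
    if "A1_graded R L s" for L :: "('k, 'u) module" and s
    by (rule homology2_zero_iff_cohomology2_zero[OF R that \<kappa>])
  \<comment> \<open>the two categories of Lie algebras are equal, because they have the same objects\<close>
  have "A1_category R (\<lambda>L :: ('k, 'u) module. zero_module (ce_homology R L 2)) =
      A1_category R (\<lambda>L. \<forall>M :: ('k, 'm) module. module R M \<longrightarrow> zero_module (ce_cohomology R L M 2))"
    unfolding A1_category_def using iff by auto
  then show ?thesis using iff jordan_equivalent_A1[OF R assms(4)] by metis
qed

end
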